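(* There exist constants $c,c',c'',C,C'\in(0,\infty)$ depending only on $d$ such that the following holds. For all $u\in(0,\infty)$, integers $K\ge0$ and $L,L'\ge1$ such that $L'$ divides $L/2$ and $L'\ge L^{1-c}$, and any two functions $f_1,f_2:\mathbb{Z}^d\to\mathbb{R}_+$ such that $f=f_1+f_2$ satisfies $u\ge f\ge CL^{-c'}$ on $B_{K+L}$, there exists a coupling $\mathbb{Q}$ of $(\mathcal{I}_1,\mathcal{I}_2)$ such that $$\mathcal{I}_1\stackrel{\text{law}}{=}\mathcal{I}^{\frac12(1+P_{L/2})f_1,\frac L2}\cup\mathcal{I}^{f_2,L},\qquad\mathcal{I}_2\stackrel{\text{law}}{=}\mathcal{I}^{(1-C'(L/L')^{-1/2})P_L^{L'}(f1_{B_K}),\,L'},$$ and $$\mathbb{Q}[\mathcal{I}_1\supset\mathcal{I}_2]\ \ge\ 1-C(u\vee1)(K+L)^de^{-c''(L/L')^{1/4}},$$ where $\mathcal{I}^{\frac12(1+P_{L/2})f_1,\frac L2}$ and $\mathcal{I}^{f_2,L}$ are sampled independently in the law defining $\mathcal{I}_1$.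
   Context: Fix $d\ge 3$. $|\cdot|$ is the $\ell^\infty$-norm on $\mathbb{Z}^d$, $B(x,r)=\{y\in\mathbb{Z}^d:|y-x|\le r\}$, $B_r=B(0,r)$. $P_x$ (expectation $E_x$) is the law of the discrete-time lazy simple random walk $X=(X_n)_{n\ge0}$ on $\mathbb{Z}^d$ started at $x$: at each step it stays put with probability $1/2$ and jumps to each of the $2d$ nearest neighbors with probability $1/(4d)$. $P_nf(x)=E_x[f(X_n)]$; $(1+P_n)f=f+P_nf$. Finite range interlacements: let $W_+$ be the space of $\mathbb{Z}^d$-valued trajectories $(w(n))_{n\ge0}$ and let $\eta=\sum_i\delta_{(w_i,u_i)}$ be a Poisson point process on $W_+\times\mathbb{R}_+$ with intensity $\nu(A\times[0,v])=v\sum_{x\in\mathbb{Z}^d}P_x[X\in A]$. For a density $f$ on $\mathbb{Z}^d$ and an integer $L\ge1$, $\mathcal{I}^{f,L}=\bigcup_{i:\,u_i\le\frac{4d}{L}f(w_i(0))}\{w_i(0),\dots,w_i(L-1)\}$; by this formula, points where the density is negative contribute no trajectories. $P_L^{L'}(f)=\frac{L'}{L}\sum_{k=1}^{L/L'}P_{(k-1)L'}(f)$. $a\vee b=\max(a,b)$. *)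

theory Defs
  imports "HOL-Probability.Probability"
begin

text \<open>
  The lattice \<open>\<int>\<^sup>d\<close> is the type \<open>int ^ 'd\<close>, with \<open>d = CARD('d)\<close>.
\<close>

definition linf :: "int ^ 'd::finite \<Rightarrow> int" where
  "linf x = Max (range (\<lambda>i. \<bar>x $ i\<bar>))"

definition lattice_ball :: "int ^ 'd::finite \<Rightarrow> nat \<Rightarrow> (int ^ 'd) set" where
  "lattice_ball x r = {y. linf (y - x) \<le> int r}"


subsection \<open>Lazy simple random walk\<close>

definition lazy_step :: "(int ^ 'd::finite) pmf" where
  "lazy_step = bernoulli_pmf (1/2) \<bind>
     (\<lambda>stay. if stay then return_pmf 0 else pmf_of_set {e. (\<Sum>i\<in>UNIV. \<bar>e $ i\<bar>) = 1})"

type_synonym 'd trajectory = "nat \<Rightarrow> int ^ 'd"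

definition trajectories :: "('d::finite) trajectory measure" where
  "trajectories = PiM UNIV (\<lambda>_. count_space UNIV)"

definition lazy_walk :: "int ^ 'd::finite \<Rightarrow> 'd trajectory measure" where
  "lazy_walk x = distr (PiM UNIV (\<lambda>_::nat. measure_pmf lazy_step)) trajectories
     (\<lambda>\<xi> n. x + (\<Sum>k<n. \<xi> k))"

definition walk_op :: "nat \<Rightarrow> (int ^ 'd::finite \<Rightarrow> real) \<Rightarrow> int ^ 'd \<Rightarrow> real" where
  "walk_op n f x = (\<integral>w. f (w n) \<partial>lazy_walk x)"

text \<open>\<open>P\<^sub>L\<^sup>L\<^sup>'\<close>; used only when \<open>L'\<close> divides \<open>L\<close>, so that \<open>L div L'\<close> is exact.\<close>

definition walk_avg :: "nat \<Rightarrow> nat \<Rightarrow> (int ^ 'd::finite \<Rightarrow> real) \<Rightarrow> int ^ 'd \<Rightarrow> real" where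
  "walk_avg L L' f x = real L' / real L * (\<Sum>k=1..L div L'. walk_op ((k - 1) * L') f x)"


subsection \<open>Poisson point processes\<close>

text \<open>
  A random point measure \<open>\<Sum>\<^sub>i \<delta>\<^bsub>X i\<^esub>\<close> is given by a sequence \<open>X\<close> of random points. Indexing the
  points by \<^typ>\<open>nat\<close> confines the definition to intensities of infinite total mass, for which
  there are almost surely infinitely many points.
\<close>

definition point_count :: "(nat \<Rightarrow> 'w \<Rightarrow> 'a) \<Rightarrow> 'a set \<Rightarrow> 'w \<Rightarrow> ennreal" where
  "point_count X A \<omega> = (\<Sum>i. indicator A (X i \<omega>))"

definition poisson_point_process :: "'w measure \<Rightarrow> 'a measure \<Rightarrow> (nat \<Rightarrow> 'w \<Rightarrow> 'a) \<Rightarrow> bool" where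
  "poisson_point_process M \<nu> X \<longleftrightarrow>
     prob_space M \<and>
     (\<forall>i. X i \<in> M \<rightarrow>\<^sub>M \<nu>) \<and>
     (\<forall>A\<in>sets \<nu>. emeasure \<nu> A < \<infinity> \<longrightarrow>
        (\<forall>k::nat. measure M {\<omega>\<in>space M. point_count X A \<omega> = of_nat k}
           = measure \<nu> A ^ k / fact k * exp (- measure \<nu> A))) \<and>
     (\<forall>A\<in>sets \<nu>. emeasure \<nu> A = \<infinity> \<longrightarrow> (AE \<omega> in M. point_count X A \<omega> = \<infinity>)) \<and>
     (\<forall>A::nat \<Rightarrow> 'a set. range A \<subseteq> sets \<nu> \<longrightarrow> disjoint_family A \<longrightarrow>
        prob_space.indep_vars M (\<lambda>_. borel) (\<lambda>j. point_count X (A j)) UNIV)"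


subsection \<open>Finite range interlacements\<close>

definition intensity :: "(('d::finite) trajectory \<times> real) measure" where
  "intensity = (count_space UNIV \<bind> lazy_walk) \<Otimes>\<^sub>M restrict_space lborel {0..}"

definition interlacement_set ::
    "(int ^ 'd::finite \<Rightarrow> real) \<Rightarrow> nat \<Rightarrow> (nat \<Rightarrow> 'd trajectory \<times> real) \<Rightarrow> (int ^ 'd) set" where
  "interlacement_set f L p =
     (\<Union>i\<in>{i. snd (p i) \<le> 4 * real CARD('d) / real L * f (fst (p i) 0)}. fst (p i) ` {0..<L})"

definition random_sets :: "'a set measure" where
  "random_sets = sigma UNIV (range (\<lambda>x. {A. x \<in> A}))"

text \<open>
  \<open>interlacement_law f L \<mu>\<close> says that \<open>\<mu>\<close> is the law of the interlacement set with density \<open>f\<close> and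
  range \<open>L\<close>. Since the law of a Poisson point process is determined by its intensity, there is exactly
  one such \<open>\<mu>\<close>; since the law of a sequence of points can be carried by the sequence space
  itself, fixing the type of the underlying probability space loses no generality.
\<close>

definition interlacement_law ::
    "(int ^ 'd::finite \<Rightarrow> real) \<Rightarrow> nat \<Rightarrow> (int ^ 'd) set measure \<Rightarrow> bool" where
  "interlacement_law f L \<mu> \<longleftrightarrow>
     (\<exists>(M :: (nat \<Rightarrow> 'd trajectory \<times> real) measure) X.
        poisson_point_process M intensity X \<and>
        \<mu> = distr M random_sets (\<lambda>\<omega>. interlacement_set f L (\<lambda>i. X i \<omega>)))"

definition independent_union :: "'a set measure \<Rightarrow> 'a set measure \<Rightarrow> 'a set measure" where
  "independent_union \<mu> \<mu>' = distr (\<mu> \<Otimes>\<^sub>M \<mu>') random_sets (\<lambda>(A, B). A \<union> B)"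

definition coupling :: "('a \<times> 'b) measure \<Rightarrow> 'a measure \<Rightarrow> 'b measure \<Rightarrow> bool" where
  "coupling Q \<mu> \<mu>' \<longleftrightarrow>
     prob_space Q \<and> sets Q = sets (\<mu> \<Otimes>\<^sub>M \<mu>') \<and> distr Q \<mu> fst = \<mu> \<and> distr Q \<mu>' snd = \<mu>'"


subsection \<open>The defining property of the intensity\<close>

lemma prob_space_lazy_walk: "prob_space (lazy_walk (x :: int ^ 'd::finite))"
  and sets_lazy_walk: "sets (lazy_walk x) = sets trajectories"
proof -
  have 1: "(\<lambda>\<xi> n. x + (\<Sum>k<n. \<xi> k)) \<in> PiM UNIV (\<lambda>_::nat. measure_pmf lazy_step) \<rightarrow>\<^sub>M trajectories"
    unfolding trajectories_def
  proof (rule measurable_PiM_single')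
    fix n :: nat
    have "(\<lambda>\<xi>. (\<Sum>k<m. \<xi> k) :: int ^ 'd) \<in> PiM UNIV (\<lambda>_::nat. measure_pmf lazy_step) \<rightarrow>\<^sub>M count_space UNIV" for m
    proof (induction m)
      case (Suc m)
      have "(\<lambda>\<xi>. \<xi> m) \<in> PiM UNIV (\<lambda>_::nat. measure_pmf (lazy_step :: (int ^ 'd) pmf)) \<rightarrow>\<^sub>M count_space UNIV"
        using measurable_component_singleton[of m UNIV "\<lambda>_. measure_pmf (lazy_step :: (int ^ 'd) pmf)"]
        by (simp cong: measurable_cong_sets)
      then show ?case
        using measurable_compose_countable[OF _ Suc.IH, of "\<lambda>a \<xi>. a + \<xi> m"] by simp
    qed simp
    from measurable_compose[OF this, of "\<lambda>y. x + y"]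
    show "(\<lambda>\<xi>. x + (\<Sum>k<n. \<xi> k)) \<in> PiM UNIV (\<lambda>_::nat. measure_pmf lazy_step) \<rightarrow>\<^sub>M count_space UNIV"
      by simp
  qed auto
  interpret product_prob_space "\<lambda>_::nat. measure_pmf (lazy_step :: (int ^ 'd) pmf)" UNIV
    by unfold_locales
  show "prob_space (lazy_walk x)"
    unfolding lazy_walk_def by (rule prob_space_distr[OF 1])
  show "sets (lazy_walk x) = sets trajectories"
    by (simp add: lazy_walk_def)
qed

lemma emeasure_intensity:
  assumes "A \<in> sets (trajectories :: ('d::finite) trajectory measure)" and "v \<ge> 0"
  shows "emeasure intensity (A \<times> {0..v}) =
    ennreal v * (\<integral>\<^sup>+ x. emeasure (lazy_walk x) A \<partial>count_space UNIV)"
proof -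
  have k: "lazy_walk \<in> count_space UNIV \<rightarrow>\<^sub>M subprob_algebra (trajectories :: 'd trajectory measure)"
    by (auto simp: space_subprob_algebra sets_lazy_walk prob_space_imp_subprob_space prob_space_lazy_walk)
  have s: "sets (count_space UNIV \<bind> lazy_walk) = sets (trajectories :: 'd trajectory measure)"
    by (rule sets_bind) (auto simp: sets_lazy_walk)
  interpret sigma_finite_measure "restrict_space lborel {0::real..}"
    by (rule sigma_finite_measure_restrict_space) (auto intro: lborel.sigma_finite_measure_axioms)
  have B: "{0..v} \<in> sets (restrict_space lborel {0..})"
    by (auto simp: sets_restrict_space_iff)
  have "emeasure (restrict_space lborel {0..}) {0..v} = ennreal v"
    using assms(2) by (subst emeasure_restrict_space) auto
  then show ?thesis
    unfolding intensity_def
    using assms(1) B emeasure_bind[OF _ k assms(1)]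
    by (subst emeasure_pair_measure_Times) (auto simp: s mult.commute)
qed

end

theory Submission
  imports Defs
begin

text \<open>
  Put \<open>N = L / L'\<close>. The trajectories behind the first set are walkers released from a Poisson
  configuration: those of \<open>f\<^sub>2\<close> run for time \<open>L\<close>, those of \<open>f\<^sub>1\<close> for time \<open>L/2\<close>, and those of
  \<open>P\<^bsub>L/2\<^esub> f\<^sub>1\<close> are regarded as running during \<open>[L/2, L)\<close>. At every time \<open>s\<close> the walkers alive
  are then Poisson with density \<open>P\<^sub>s f\<close>.

  Time is cut into about \<open>N\<close> stages, each slightly longer than \<open>L'\<close>, and space into cells that a
  walker traverses in much less than the surplus time \<open>g\<close>. Whatever its position in the cell, a
  walker is after \<open>g\<close> steps distributed like a sample of a law that depends on the cell only, up to a
  coin that fails rarely. The number of walkers in a cell is Poisson with a large mean, so a slightly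
  smaller Poisson number of samples of that law, drawn independently in every cell and stage, can be
  matched with walkers outside an event that Chernoff's bound makes exponentially unlikely; the next
  \<open>L'\<close> steps of the matched walkers are independent trajectories of range \<open>L'\<close>.

  Comparing heat kernels at nearby times, up to exponentially small remainders, shows that the
  density of these trajectories exceeds the target density. No stage may straddle \<open>L/2\<close> or \<open>L\<close>, which
  costs two of the \<open>N\<close> terms of the target; they are compensated by the surplus of about
  \<open>N\<^sup>1\<^sup>/\<^sup>2\<close> other terms. Thinning then produces the target density exactly, the
  remainder being an independent set that is empty with high probability. If \<open>N\<close> is bounded, the target
  density is not positive and the second set is empty. Laws of random sets are identified
  through their void probabilities.
\<close>

section \<open>Poissonian particle systems\<close>

text \<open>The obstacle is that the failure probability must be exponentially small, while the
  mixture coin of a single walker fails with a probability that is only bounded by a power of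
  \<open>N\<close>. So every power loss is moved into the density, where the factor
  \<open>1 - C' * N powr (-1/2)\<close> pays for it, and only Chernoff, Gaussian and multinomial
  tails remain as probabilities. The law of the second set is exact because it never depends on
  success: requests are answered by fresh samples even when no walker is left, so a failure destroys
  the inclusion but not the independence. The losses of order \<open>N powr (-1/2)\<close> are the
  reduction \<open>eta\<close> of the requests, the change of the kernel across a cell, and the two
  leftover terms spread over a window of about \<open>sqrt N\<close> terms. For the window the heat
  kernel is compared with earlier times, which works up to distances of order
  \<open>sqrt (L * sqrt N)\<close>; their Gaussian tail, exponential in \<open>sqrt N\<close>, is
  the largest error and is still better than the required one in \<open>N powr (1/4)\<close>. The
  interacting walkers have finite total intensity and are handled as \<open>pmf\<close>; those
  released outside the ball of radius \<open>K + L\<close> are added independently at the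
  end.\<close>

lemma nn_integral_poisson_pmf:
  assumes "0 < r" "0 \<le> s"
  shows "(\<integral>\<^sup>+n. ennreal s ^ n \<partial>poisson_pmf r) = ennreal (exp (r * (s - 1)))"
proof -
  have sm: "(\<lambda>n. (r * s) ^ n / fact n * exp (-r)) sums (exp (r * s) * exp (-r))"
    using exp_converges[of "r * s"] by (intro sums_mult2) (simp add: field_simps scaleR_conv_of_real)
  have "(\<integral>\<^sup>+n. ennreal s ^ n \<partial>poisson_pmf r) = (\<integral>\<^sup>+n. ennreal ((r * s) ^ n / fact n * exp (-r)) \<partial>count_space UNIV)"
    using assms by (subst nn_integral_measure_pmf)
      (auto intro!: nn_integral_cong simp: ennreal_power ennreal_mult[symmetric] power_mult_distrib mult_ac)
  also have "\<dots> = (\<Sum>n. ennreal ((r * s) ^ n / fact n * exp (-r)))"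
    by (simp add: nn_integral_count_space_nat)
  also have "\<dots> = ennreal (exp (r * s) * exp (-r))"
    using assms by (intro suminf_ennreal_eq sm) auto
  finally show ?thesis
    by (simp add: exp_add[symmetric] algebra_simps)
qed

lemma nn_integral_replicate_pmf:
  "(\<integral>\<^sup>+xs. (\<Prod>x\<leftarrow>xs. \<phi> x) \<partial>replicate_pmf n p) = (\<integral>\<^sup>+x. \<phi> x \<partial>p) ^ n"
  for \<phi> :: "'a \<Rightarrow> ennreal"
  by (induction n) (simp_all add: nn_integral_cmult nn_integral_multc)

definition poisson_list :: "real \<Rightarrow> 'a pmf \<Rightarrow> 'a list pmf" where
  "poisson_list r p = bind_pmf (poisson_pmf r) (\<lambda>n. replicate_pmf n p)"

lemma nn_integral_poisson_list:
  fixes p :: "'a pmf"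
  assumes "0 < r" "(\<integral>\<^sup>+x. \<phi> x \<partial>p) = ennreal s" "0 \<le> s"
  shows "(\<integral>\<^sup>+xs. (\<Prod>x\<leftarrow>xs. \<phi> x) \<partial>poisson_list r p) = ennreal (exp (r * (s - 1)))"
  using assms by (simp add: poisson_list_def nn_integral_replicate_pmf nn_integral_poisson_pmf)

primrec move_all :: "('s \<Rightarrow> 't pmf) \<Rightarrow> 's list \<Rightarrow> 't list pmf" where
  "move_all K [] = return_pmf []"
| "move_all K (x # xs) = bind_pmf (K x) (\<lambda>y. map_pmf ((#) y) (move_all K xs))"

lemma nn_integral_move_all:
  "(\<integral>\<^sup>+ys. (\<Prod>y\<leftarrow>ys. \<phi> y) \<partial>move_all K xs) = (\<Prod>x\<leftarrow>xs. \<integral>\<^sup>+y. \<phi> y \<partial>K x)"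
  for \<phi> :: "'a \<Rightarrow> ennreal"
  by (induction xs) (simp_all add: nn_integral_cmult nn_integral_multc)

text \<open>Its expectation is a void probability. With values in \<open>ennreal\<close> it turns
  unions into products, and no integrability has to be checked.\<close>

definition avoid :: "'b set \<Rightarrow> 'b set \<Rightarrow> ennreal" where
  "avoid F B = indicator {B. B \<inter> F = {}} B"

lemma avoid_Un: "avoid F (A \<union> B) = avoid F A * avoid F B"
  by (auto simp: avoid_def indicator_def)

lemma avoid_Union_list: "avoid F (\<Union>(set xs)) = (\<Prod>B\<leftarrow>xs. avoid F B)"
  by (induction xs) (simp_all add: avoid_Un, simp add: avoid_def)

lemma avoid_UN: "finite D \<Longrightarrow> avoid F (\<Union>c\<in>D. g c) = (\<Prod>c\<in>D. avoid F (g c))"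
  by (induction rule: finite_induct) (simp_all add: avoid_Un, simp add: avoid_def)

text \<open>A particle in cell \<open>c\<close> uses up one of the \<open>M c\<close> requested samples of \<open>Q c\<close> whenever its
  mixture coin shows \<open>Q c\<close>; requests left over at the end are sampled without particles.\<close>

locale particle_stage =
  fixes K :: "'s \<Rightarrow> 's pmf" and acc :: "'s \<Rightarrow> 'b set" and C :: "'c set" and cell :: "'s \<Rightarrow> 'c option"
    and a :: "'c \<Rightarrow> real" and Q :: "'c \<Rightarrow> ('b set \<times> 'v) pmf" and H :: "'s \<Rightarrow> 'v \<Rightarrow> 's pmf"
    and R :: "'s \<Rightarrow> 's pmf"
  assumes fin: "finite C"
    and a: "\<And>c. c \<in> C \<Longrightarrow> 0 \<le> a c \<and> a c \<le> 1"
    and mix: "\<And>x c. c \<in> C \<Longrightarrow> cell x = Some c \<Longrightarrow>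
       K x = bind_pmf (bernoulli_pmf (a c)) (\<lambda>b. if b then bind_pmf (Q c) (\<lambda>z. H x (snd z)) else R x)"
    and covered: "\<And>x c z y. c \<in> C \<Longrightarrow> cell x = Some c \<Longrightarrow> z \<in> set_pmf (Q c) \<Longrightarrow> y \<in> set_pmf (H x (snd z)) \<Longrightarrow> fst z \<subseteq> acc y"
begin

definition leftover :: "('c \<Rightarrow> nat) \<Rightarrow> 'b set pmf" where
  "leftover M = map_pmf (\<lambda>g. \<Union>c\<in>C. \<Union>(set (g c))) (Pi_pmf C [] (\<lambda>c. replicate_pmf (M c) (map_pmf fst (Q c))))"

primrec feed :: "'s list \<Rightarrow> ('c \<Rightarrow> nat) \<Rightarrow> ('s list \<times> 'b set) pmf" where
  "feed [] M = map_pmf (Pair []) (leftover M)"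
| "feed (x # xs) M =
    (if \<exists>c\<in>C. cell x = Some c \<and> M c > 0
     then let c = the (cell x) in
       bind_pmf (bernoulli_pmf (a c)) (\<lambda>b. if b
         then bind_pmf (Q c) (\<lambda>z. bind_pmf (H x (snd z)) (\<lambda>y.
           map_pmf (\<lambda>w. (y # fst w, fst z \<union> snd w)) (feed xs (M(c := M c - 1)))))
         else bind_pmf (R x) (\<lambda>y. map_pmf (\<lambda>w. (y # fst w, snd w)) (feed xs M)))
     else bind_pmf (K x) (\<lambda>y. map_pmf (\<lambda>w. (y # fst w, snd w)) (feed xs M)))"

definition avoid_prob :: "'b set \<Rightarrow> 'c \<Rightarrow> ennreal" where
  "avoid_prob F c = (\<integral>\<^sup>+z. avoid F (fst z) \<partial>Q c)"

text \<open>Forgetting which requests were served undoes the mixture, by \<open>mix\<close>. Hence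
  the walkers move independently according to \<open>K\<close>, whatever \<open>M\<close>
  is.\<close>

lemma map_fst_feed: "map_pmf fst (feed xs M) = move_all K xs"
proof (induction xs arbitrary: M)
  case (Cons x xs)
  have *: "map_pmf (\<lambda>z. y # fst z) (feed xs M) = map_pmf ((#) y) (move_all K xs)" for y M
    using Cons.IH[of M] by (simp flip: Cons.IH[of M] add: pmf.map_comp o_def)
  show ?case
    by (auto simp: map_bind_pmf pmf.map_comp o_def * Let_def mix bind_assoc_pmf if_distrib[of "map_pmf _"]
        if_distrib[of "\<lambda>p. bind_pmf p _"] cong: if_cong)
qed (simp add: pmf.map_comp o_def leftover_def)

text \<open>Each request receives exactly one sample of its \<open>Q c\<close>, from a walker or
  from \<open>leftover\<close>. The right-hand side does not mention \<open>xs\<close>: this makes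
  the second set independent of the positions of the walkers.\<close>

lemma avoid_feed: "(\<integral>\<^sup>+z. avoid F (snd z) \<partial>feed xs M) = (\<Prod>c\<in>C. avoid_prob F c ^ M c)"
proof (induction xs arbitrary: M)
  case Nil
  have "(\<integral>\<^sup>+z. avoid F (snd z) \<partial>feed [] M) = (\<integral>\<^sup>+g. (\<Prod>c\<in>C. \<Prod>B\<leftarrow>g c. avoid F B) \<partial>Pi_pmf C [] (\<lambda>c. replicate_pmf (M c) (map_pmf fst (Q c))))"
    by (simp add: leftover_def avoid_UN fin avoid_Union_list)
  also have "\<dots> = (\<Prod>c\<in>C. avoid_prob F c ^ M c)"
    by (subst nn_integral_prod_Pi_pmf[OF fin, where f = "\<lambda>c bs. \<Prod>B\<leftarrow>bs. avoid F B"]) (simp add: nn_integral_replicate_pmf avoid_prob_def)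
  finally show ?case .
next
  case (Cons x xs)
  show ?case
  proof (cases "\<exists>c\<in>C. cell x = Some c \<and> M c > 0")
    case False
    show ?thesis unfolding feed.simps(2) if_not_P[OF False] by (simp add: Cons.IH)
  next
    case True
    then obtain c where c: "c \<in> C" "cell x = Some c" "M c > 0" by auto
    let ?P = "\<Prod>c\<in>C. avoid_prob F c ^ M c"
    have P: "avoid_prob F c * (\<Prod>c'\<in>C. avoid_prob F c' ^ (M(c := M c - 1)) c') = ?P"
    proof -
      have "(\<Prod>c'\<in>C - {c}. avoid_prob F c' ^ (M(c := M c - 1)) c') = (\<Prod>c'\<in>C - {c}. avoid_prob F c' ^ M c')"
        by (intro prod.cong) auto
      then show ?thesis
        using c fin by (simp add: prod.remove[OF fin c(1)] mult.assoc[symmetric] power_Suc[symmetric] del: power_Suc)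
    qed
    have "(\<integral>\<^sup>+z. avoid F (snd z) \<partial>feed (x # xs) M) =
        (\<integral>\<^sup>+b. (if b then avoid_prob F c * (\<Prod>c'\<in>C. avoid_prob F c' ^ (M(c := M c - 1)) c') else ?P) \<partial>bernoulli_pmf (a c))"
      using c True Cons.IH
      by (auto simp: Let_def avoid_Un nn_integral_cmult nn_integral_multc avoid_prob_def intro!: nn_integral_cong)
    also have "\<dots> = ?P" unfolding P by simp
    finally show ?thesis .
  qed
qed

definition miss :: "'s list \<times> 'b set \<Rightarrow> ennreal" where
  "miss z = indicator {z. \<not> snd z \<subseteq> (\<Union>x\<in>set (fst z). acc x)} z"

text \<open>The Laplace transform at \<open>t\<close> of the mixture coin of a walker at
  \<open>x\<close>, counted only if the walker is in cell \<open>c\<close>.\<close>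

definition tilt :: "real \<Rightarrow> 'c \<Rightarrow> 's \<Rightarrow> real" where
  "tilt t c x = (if cell x = Some c then 1 - a c * (1 - exp (- t)) else 1)"

lemma tilt_bounds: "c \<in> C \<Longrightarrow> 0 < t \<Longrightarrow> 0 \<le> tilt t c x \<and> tilt t c x \<le> 1"
  using a[of c] mult_le_one[of "a c" "1 - exp (-t)"] by (auto simp: tilt_def)

text \<open>Exponential Markov bound for having fewer successful coins than requests in some cell.
  Once the requests of a cell are exhausted, further walkers there no longer lower the failure
  probability; setting the term to 0 in that case keeps the induction over the walkers
  valid.\<close>

definition miss_bound :: "real \<Rightarrow> 's list \<Rightarrow> ('c \<Rightarrow> nat) \<Rightarrow> real" where
  "miss_bound t xs M = (\<Sum>c\<in>C. if M c = 0 then 0 else exp (t * M c) * (\<Prod>x\<leftarrow>xs. tilt t c x))"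

lemma miss_bound_nonneg: "0 < t \<Longrightarrow> 0 \<le> miss_bound t xs M"
  using tilt_bounds by (auto simp: miss_bound_def intro!: sum_nonneg mult_nonneg_nonneg prod_list_nonneg)

lemma miss_Cons:
  assumes "B \<subseteq> acc y"
  shows "miss (y # fst w, B \<union> snd w) \<le> miss w"
  using assms by (auto simp: miss_def indicator_def)

text \<open>The bound is a supermartingale along the list: a success lowers \<open>M c\<close> and
  contributes \<open>exp (- t)\<close>, a failure leaves \<open>M\<close> unchanged, and the average
  over the coin is at most the factor \<open>tilt\<close>.\<close>

lemma miss_feed:
  assumes t: "0 < t"
  shows "(\<integral>\<^sup>+z. miss z \<partial>feed xs M) \<le> ennreal (miss_bound t xs M)"
proof (induction xs arbitrary: M)
  case Nil
  show ?case
  proof (cases "\<exists>c\<in>C. M c > 0")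
    case False
    then have "leftover M = map_pmf (\<lambda>g. \<Union>c\<in>C. \<Union>(set (g c))) (Pi_pmf C [] (\<lambda>c. return_pmf []))"
      unfolding leftover_def by (intro arg_cong[where f = "map_pmf _"] Pi_pmf_cong) auto
    then have "leftover M = return_pmf {}" by (simp add: fin)
    then show ?thesis by (simp add: miss_def)
  next
    case True
    then obtain c where c: "c \<in> C" "M c > 0" by auto
    have "(\<integral>\<^sup>+z. miss z \<partial>feed [] M) \<le> (\<integral>\<^sup>+z. 1 \<partial>feed [] M)"
      by (intro nn_integral_mono) (auto simp: miss_def indicator_def)
    also have "\<dots> = ennreal 1" by simp
    also have "\<dots> \<le> ennreal (miss_bound t [] M)"
    proof (intro ennreal_leI)
      have "1 \<le> exp (t * M c)" using t by simp
      also have "\<dots> = (\<Sum>c\<in>{c}. if M c = 0 then 0 else exp (t * M c) * (\<Prod>x\<leftarrow>[]. tilt t c x))" using c by simp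
      also have "\<dots> \<le> miss_bound t [] M"
        unfolding miss_bound_def using c fin by (intro sum_mono2) auto
      finally show "1 \<le> miss_bound t [] M" .
    qed
    finally show ?thesis .
  qed
next
  case (Cons x xs)
  have plain: "(\<integral>\<^sup>+w. miss (y # fst w, snd w) \<partial>feed xs M) \<le> ennreal (miss_bound t xs M)" for y M
    by (rule order_trans[OF _ Cons.IH]) (use miss_Cons[of "{}"] in \<open>auto intro!: nn_integral_mono\<close>)
  show ?case
  proof (cases "\<exists>c\<in>C. cell x = Some c \<and> M c > 0")
    case False
    have "(\<integral>\<^sup>+z. miss z \<partial>feed (x # xs) M) = (\<integral>\<^sup>+y. \<integral>\<^sup>+w. miss (y # fst w, snd w) \<partial>feed xs M \<partial>K x)"
      unfolding feed.simps(2) if_not_P[OF False] by simp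
    also have "\<dots> \<le> (\<integral>\<^sup>+y. ennreal (miss_bound t xs M) \<partial>K x)"
      by (intro nn_integral_mono plain)
    also have "\<dots> = ennreal (miss_bound t xs M)" by simp
    also have "miss_bound t xs M = miss_bound t (x # xs) M"
      unfolding miss_bound_def using False by (intro sum.cong) (auto simp: tilt_def)
    finally show ?thesis .
  next
    case True
    then obtain c where c: "c \<in> C" "cell x = Some c" "M c > 0" by auto
    let ?M = "M(c := M c - 1)"
    have "(\<integral>\<^sup>+z. miss z \<partial>feed (x # xs) M) =
       (\<integral>\<^sup>+b. (if b then (\<integral>\<^sup>+z. \<integral>\<^sup>+y. \<integral>\<^sup>+w. miss (y # fst w, fst z \<union> snd w) \<partial>feed xs ?M \<partial>H x (snd z) \<partial>Q c)
          else (\<integral>\<^sup>+y. \<integral>\<^sup>+w. miss (y # fst w, snd w) \<partial>feed xs M \<partial>R x)) \<partial>bernoulli_pmf (a c))"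
      using c True by (auto simp: Let_def intro!: nn_integral_cong)
    also have "\<dots> \<le> (\<integral>\<^sup>+b. (if b then ennreal (miss_bound t xs ?M) else ennreal (miss_bound t xs M)) \<partial>bernoulli_pmf (a c))"
    proof -
      have "(\<integral>\<^sup>+z. \<integral>\<^sup>+y. \<integral>\<^sup>+w. miss (y # fst w, fst z \<union> snd w) \<partial>feed xs ?M \<partial>H x (snd z) \<partial>Q c)
          \<le> (\<integral>\<^sup>+z. \<integral>\<^sup>+y. ennreal (miss_bound t xs ?M) \<partial>H x (snd z) \<partial>Q c)"
      proof (intro nn_integral_mono_AE AE_pmfI)
        fix z y assume "z \<in> set_pmf (Q c)" "y \<in> set_pmf (H x (snd z))"
        then have "fst z \<subseteq> acc y" using covered c by blast
        then show "(\<integral>\<^sup>+w. miss (y # fst w, fst z \<union> snd w) \<partial>feed xs ?M) \<le> ennreal (miss_bound t xs ?M)"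
          by (intro order_trans[OF _ Cons.IH] nn_integral_mono miss_Cons)
      qed
      moreover have "(\<integral>\<^sup>+y. \<integral>\<^sup>+w. miss (y # fst w, snd w) \<partial>feed xs M \<partial>R x) \<le> (\<integral>\<^sup>+y. ennreal (miss_bound t xs M) \<partial>R x)"
        by (intro nn_integral_mono plain)
      ultimately show ?thesis by (intro nn_integral_mono) auto
    qed
    also have "\<dots> = ennreal (miss_bound t xs ?M) * ennreal (a c) + ennreal (miss_bound t xs M) * ennreal (1 - a c)"
      using a[OF c(1)] by (subst nn_integral_bernoulli_pmf) auto
    also have "\<dots> = ennreal (miss_bound t xs ?M * a c + miss_bound t xs M * (1 - a c))"
      using a[OF c(1)] miss_bound_nonneg[OF t] by (simp add: ennreal_mult ennreal_plus)
    also have "\<dots> \<le> ennreal (miss_bound t (x # xs) M)"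
    proof (intro ennreal_leI)
      let ?f = "\<lambda>xs M c. if M c = 0 then 0 else exp (t * real (M c)) * (\<Prod>x\<leftarrow>xs. tilt t c x)"
      have "miss_bound t xs ?M * a c + miss_bound t xs M * (1 - a c) = (\<Sum>c'\<in>C. ?f xs ?M c' * a c + ?f xs M c' * (1 - a c))"
        unfolding miss_bound_def by (simp only: sum_distrib_right sum.distrib)
      also have "\<dots> \<le> (\<Sum>c'\<in>C. ?f (x # xs) M c')"
      proof (intro sum_mono)
        fix c' assume c': "c' \<in> C"
        show "?f xs ?M c' * a c + ?f xs M c' * (1 - a c) \<le> ?f (x # xs) M c'"
        proof (cases "c' = c")
          case False
          then show ?thesis using c by (auto simp: tilt_def algebra_simps)
        next
          case True
          let ?P = "\<Prod>x\<leftarrow>xs. tilt t c x"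
          have P: "0 \<le> ?P" using tilt_bounds[OF c(1) t] by (auto intro!: prod_list_nonneg)
          have e: "exp (t * real (M c - 1)) = exp (t * M c) * exp (- t)"
            using c(3) by (simp add: exp_add[symmetric] of_nat_diff algebra_simps)
          have tx: "tilt t c x = 1 - a c * (1 - exp (- t))" by (simp add: tilt_def c(2))
          define E G P where EGP: "E = exp (t * real (M c))" "G = exp (- t)" "P = ?P"
          \<comment> \<open>Only an inequality, because the left side is 0 when the last request of
            the cell has just been served.\<close>
          have "?f xs ?M c \<le> E * G * P" using P by (auto simp: EGP e[symmetric])
          then have "?f xs ?M c * a c \<le> E * G * P * a c"
            using a[OF c(1)] by (intro mult_right_mono) auto
          moreover have "?f xs M c = E * P" using c(3) by (simp add: EGP)
          moreover have "?f (x # xs) M c = E * ((1 - a c * (1 - G)) * P)"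
            using c(3) tx by (simp add: EGP)
          ultimately show ?thesis unfolding True by (simp add: algebra_simps)
        qed
      qed
      finally show "miss_bound t xs ?M * a c + miss_bound t xs M * (1 - a c) \<le> miss_bound t (x # xs) M"
        by (simp add: miss_bound_def)
    qed
    finally show ?thesis .
  qed
qed

definition stage :: "('c \<Rightarrow> real) \<Rightarrow> 's list \<Rightarrow> ('s list \<times> 'b set) pmf" where
  "stage lam xs = bind_pmf (Pi_pmf C 0 (\<lambda>c. poisson_pmf (lam c))) (feed xs)"

lemma map_fst_stage: "map_pmf fst (stage lam xs) = move_all K xs"
  by (simp add: stage_def map_bind_pmf map_fst_feed)

lemma avoid_prob_le_1: "avoid_prob F c \<le> 1"
proof -
  have "avoid_prob F c \<le> (\<integral>\<^sup>+z. 1 \<partial>Q c)"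
    unfolding avoid_prob_def by (intro nn_integral_mono) (auto simp: avoid_def indicator_def)
  then show ?thesis by simp
qed

lemma avoid_stage:
  assumes lam: "\<And>c. c \<in> C \<Longrightarrow> 0 < lam c"
  shows "(\<integral>\<^sup>+z. avoid F (snd z) \<partial>stage lam xs) = (\<Prod>c\<in>C. ennreal (exp (lam c * (enn2real (avoid_prob F c) - 1))))"
proof -
  have e: "avoid_prob F c = ennreal (enn2real (avoid_prob F c))" for c
    using avoid_prob_le_1[of F c] by (subst ennreal_enn2real) (auto simp: less_top[symmetric] top_unique)
  have "(\<integral>\<^sup>+z. avoid F (snd z) \<partial>stage lam xs) = (\<Prod>c\<in>C. \<integral>\<^sup>+n. avoid_prob F c ^ n \<partial>poisson_pmf (lam c))"
    unfolding stage_def by (simp add: avoid_feed nn_integral_prod_Pi_pmf[OF fin, where f = "\<lambda>c n. avoid_prob F c ^ n"])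
  also have "\<dots> = (\<Prod>c\<in>C. ennreal (exp (lam c * (enn2real (avoid_prob F c) - 1))))"
    by (intro prod.cong refl, subst e) (simp add: nn_integral_poisson_pmf lam)
  finally show ?thesis .
qed

text \<open>The Poisson requests are averaged out, which replaces \<open>exp (t * M c)\<close> by
  their exponential moment; what is left depends on the walkers only through a product, to which
  their Poisson law can be applied.\<close>

lemma miss_stage:
  assumes t: "0 < t" and lam: "\<And>c. c \<in> C \<Longrightarrow> 0 < lam c"
  shows "(\<integral>\<^sup>+z. miss z \<partial>stage lam xs) \<le>
    (\<Sum>c\<in>C. ennreal (exp (lam c * (exp t - 1))) * (\<Prod>x\<leftarrow>xs. ennreal (tilt t c x)))"
proof -
  have pl: "ennreal (\<Prod>x\<leftarrow>xs. tilt t c x) = (\<Prod>x\<leftarrow>xs. ennreal (tilt t c x)) \<and> 0 \<le> (\<Prod>x\<leftarrow>xs. tilt t c x)" if "c \<in> C" for c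
    using tilt_bounds[OF that t] by (induction xs) (auto simp: ennreal_mult)
  have "(\<integral>\<^sup>+z. miss z \<partial>stage lam xs) \<le> (\<integral>\<^sup>+M. ennreal (miss_bound t xs M) \<partial>Pi_pmf C 0 (\<lambda>c. poisson_pmf (lam c)))"
    unfolding stage_def by (auto intro!: nn_integral_mono miss_feed t)
  also have "\<dots> \<le> (\<integral>\<^sup>+M. (\<Sum>c\<in>C. ennreal (exp t) ^ M c * (\<Prod>x\<leftarrow>xs. ennreal (tilt t c x))) \<partial>Pi_pmf C 0 (\<lambda>c. poisson_pmf (lam c)))"
  proof (intro nn_integral_mono)
    fix M :: "'c \<Rightarrow> nat"
    have "ennreal (miss_bound t xs M) \<le> ennreal (\<Sum>c\<in>C. exp t ^ M c * (\<Prod>x\<leftarrow>xs. tilt t c x))"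
      unfolding miss_bound_def using pl by (intro ennreal_leI sum_mono) (auto simp: exp_of_nat_mult[symmetric] mult.commute)
    also have "\<dots> = (\<Sum>c\<in>C. ennreal (exp t ^ M c * (\<Prod>x\<leftarrow>xs. tilt t c x)))"
      using pl by (intro sum_ennreal[symmetric]) auto
    also have "\<dots> = (\<Sum>c\<in>C. ennreal (exp t) ^ M c * (\<Prod>x\<leftarrow>xs. ennreal (tilt t c x)))"
      using pl by (intro sum.cong) (auto simp: ennreal_mult ennreal_power)
    finally show "ennreal (miss_bound t xs M) \<le> \<dots>" .
  qed
  also have "\<dots> = (\<Sum>c\<in>C. (\<integral>\<^sup>+M. ennreal (exp t) ^ M c \<partial>Pi_pmf C 0 (\<lambda>c. poisson_pmf (lam c))) * (\<Prod>x\<leftarrow>xs. ennreal (tilt t c x)))"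
    by (subst nn_integral_sum) (auto simp: nn_integral_multc)
  also have "\<dots> = (\<Sum>c\<in>C. ennreal (exp (lam c * (exp t - 1))) * (\<Prod>x\<leftarrow>xs. ennreal (tilt t c x)))"
  proof (intro sum.cong refl)
    fix c assume c: "c \<in> C"
    have "(\<integral>\<^sup>+M. ennreal (exp t) ^ M c \<partial>Pi_pmf C 0 (\<lambda>c. poisson_pmf (lam c)))
      = (\<integral>\<^sup>+n. ennreal (exp t) ^ n \<partial>map_pmf (\<lambda>M. M c) (Pi_pmf C 0 (\<lambda>c. poisson_pmf (lam c))))" by simp
    also have "\<dots> = ennreal (exp (lam c * (exp t - 1)))"
      using c fin lam by (subst Pi_pmf_component) (auto simp: nn_integral_poisson_pmf)
    finally show "(\<integral>\<^sup>+M. ennreal (exp t) ^ M c \<partial>Pi_pmf C 0 (\<lambda>c. poisson_pmf (lam c))) * (\<Prod>x\<leftarrow>xs. ennreal (tilt t c x))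
      = ennreal (exp (lam c * (exp t - 1))) * (\<Prod>x\<leftarrow>xs. ennreal (tilt t c x))" by simp
  qed
  finally show ?thesis .
qed

end

section \<open>Composition of the stages in time\<close>

lemma subset_acc_move_all:
  assumes "\<And>x y. y \<in> set_pmf (K x) \<Longrightarrow> acc x \<subseteq> acc y" "ys \<in> set_pmf (move_all K xs)"
  shows "(\<Union>x\<in>set xs. acc x) \<subseteq> (\<Union>y\<in>set ys. acc y)"
  using assms(2)
proof (induction xs arbitrary: ys)
  case (Cons x xs)
  then obtain y zs where "ys = y # zs" "y \<in> set_pmf (K x)" "zs \<in> set_pmf (move_all K xs)" by auto
  then show ?case using Cons.IH[of zs] assms(1)[of y x] by auto
qed simp

text \<open>\<open>acc\<close> is the set a walker has visited so far. The initial law already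
  returns a covered set, because at time 0 the first steps of the walkers can serve directly as
  trajectories of the target: nothing has to be forgotten before them.\<close>

locale particle_system =
  fixes K :: "nat \<Rightarrow> 's \<Rightarrow> 's pmf" and acc :: "'s \<Rightarrow> 'b set" and C :: "nat \<Rightarrow> 'c set"
    and cell :: "nat \<Rightarrow> 's \<Rightarrow> 'c option" and a :: "nat \<Rightarrow> 'c \<Rightarrow> real"
    and Q :: "nat \<Rightarrow> 'c \<Rightarrow> ('b set \<times> 'v) pmf" and H :: "nat \<Rightarrow> 's \<Rightarrow> 'v \<Rightarrow> 's pmf"
    and R :: "nat \<Rightarrow> 's \<Rightarrow> 's pmf" and lam :: "nat \<Rightarrow> 'c \<Rightarrow> real" and init :: "('s list \<times> 'b set) pmf"
  assumes stages: "\<And>k. particle_stage (K k) acc (C k) (cell k) (a k) (Q k) (H k) (R k)"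
    and mono: "\<And>k x y. y \<in> set_pmf (K k x) \<Longrightarrow> acc x \<subseteq> acc y"
    and lam: "\<And>k c. c \<in> C k \<Longrightarrow> 0 < lam k c"
    and init: "\<And>z. z \<in> set_pmf init \<Longrightarrow> snd z \<subseteq> (\<Union>x\<in>set (fst z). acc x)"
begin

sublocale st: particle_stage "K k" acc "C k" "cell k" "a k" "Q k" "H k" "R k" for k
  by (rule stages)

primrec system :: "nat \<Rightarrow> ('s list \<times> 'b set) pmf" where
  "system 0 = init"
| "system (Suc k) = bind_pmf (system k) (\<lambda>w. map_pmf (\<lambda>z. (fst z, snd w \<union> snd z)) (st.stage k (lam k) (fst w)))"

primrec run :: "nat \<Rightarrow> 's \<Rightarrow> 's pmf" where
  "run 0 x = return_pmf x"
| "run (Suc k) x = bind_pmf (run k x) (K k)"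

lemma particles_system:
  "(\<integral>\<^sup>+z. (\<Prod>x\<leftarrow>fst z. \<phi> x) \<partial>system k) = (\<integral>\<^sup>+z. (\<Prod>x\<leftarrow>fst z. \<integral>\<^sup>+y. \<phi> y \<partial>run k x) \<partial>init)"
  for \<phi> :: "'s \<Rightarrow> ennreal"
proof (induction k arbitrary: \<phi>)
  case (Suc k)
  have *: "(\<integral>\<^sup>+z. (\<Prod>x\<leftarrow>fst z. \<phi> x) \<partial>st.stage k (lam k) xs) = (\<Prod>x\<leftarrow>xs. \<integral>\<^sup>+y. \<phi> y \<partial>K k x)" for xs
    using arg_cong[OF st.map_fst_stage[of k "lam k" xs], of "\<lambda>p. \<integral>\<^sup>+ys. (\<Prod>y\<leftarrow>ys. \<phi> y) \<partial>p"]
    by (simp add: nn_integral_move_all)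
  show ?case by (simp add: * Suc.IH)
qed simp

text \<open>The samples of a stage do not depend on where its walkers are, so the void probabilities
  of the stages simply multiply.\<close>

lemma avoid_system:
  "(\<integral>\<^sup>+z. avoid F (snd z) \<partial>system n) = (\<integral>\<^sup>+z. avoid F (snd z) \<partial>init) *
     (\<Prod>k<n. \<Prod>c\<in>C k. ennreal (exp (lam k c * (enn2real (st.avoid_prob k F c) - 1))))"
  by (induction n)
    (simp_all add: avoid_Un nn_integral_cmult st.avoid_stage lam nn_integral_multc mult.assoc)

text \<open>A union bound over the stages. What has been covered once stays covered, since
  \<open>acc\<close> only grows along the moves.\<close>

lemma miss_system:
  assumes t: "0 < t"
  shows "(\<integral>\<^sup>+z. st.miss z \<partial>system n) \<le>
    (\<Sum>k<n. \<Sum>c\<in>C k. ennreal (exp (lam k c * (exp t - 1))) *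
       (\<integral>\<^sup>+z. (\<Prod>x\<leftarrow>fst z. \<integral>\<^sup>+y. ennreal (st.tilt k t c y) \<partial>run k x) \<partial>init))"
proof (induction n)
  case 0
  have "(\<integral>\<^sup>+z. st.miss z \<partial>system 0) = (\<integral>\<^sup>+z. 0 \<partial>init)"
    unfolding system.simps by (intro nn_integral_cong_AE AE_pmfI) (use init in \<open>auto simp: st.miss_def\<close>)
  then show ?case by simp
next
  case (Suc n)
  have *: "st.miss (fst z, snd w \<union> snd z) \<le> st.miss w + st.miss z" if "z \<in> set_pmf (st.stage n (lam n) (fst w))" for w z
  proof -
    have "fst z \<in> set_pmf (move_all (K n) (fst w))"
      using that by (simp flip: st.map_fst_stage[of n "lam n"])
    from subset_acc_move_all[OF mono this] have "(\<Union>x\<in>set (fst w). acc x) \<subseteq> (\<Union>x\<in>set (fst z). acc x)" .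
    then have "snd w \<subseteq> (\<Union>x\<in>set (fst w). acc x) \<Longrightarrow> snd w \<subseteq> (\<Union>x\<in>set (fst z). acc x)" by (rule order_trans[rotated])
    then show ?thesis by (auto simp: st.miss_def indicator_def)
  qed
  have "(\<integral>\<^sup>+z. st.miss z \<partial>system (Suc n)) = (\<integral>\<^sup>+w. \<integral>\<^sup>+z. st.miss (fst z, snd w \<union> snd z) \<partial>st.stage n (lam n) (fst w) \<partial>system n)"
    by simp
  also have "\<dots> \<le> (\<integral>\<^sup>+w. \<integral>\<^sup>+z. st.miss w + st.miss z \<partial>st.stage n (lam n) (fst w) \<partial>system n)"
    by (intro nn_integral_mono_AE AE_pmfI nn_integral_mono_AE *)
  also have "\<dots> = (\<integral>\<^sup>+w. st.miss w \<partial>system n) + (\<integral>\<^sup>+w. \<integral>\<^sup>+z. st.miss z \<partial>st.stage n (lam n) (fst w) \<partial>system n)"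
    by (simp add: nn_integral_add)
  also have "\<dots> \<le> (\<integral>\<^sup>+w. st.miss w \<partial>system n) + (\<integral>\<^sup>+w. (\<Sum>c\<in>C n. ennreal (exp (lam n c * (exp t - 1))) *
      (\<Prod>x\<leftarrow>fst w. ennreal (st.tilt n t c x))) \<partial>system n)"
    by (intro add_left_mono nn_integral_mono st.miss_stage t lam)
  also have "(\<integral>\<^sup>+w. (\<Sum>c\<in>C n. ennreal (exp (lam n c * (exp t - 1))) * (\<Prod>x\<leftarrow>fst w. ennreal (st.tilt n t c x))) \<partial>system n)
     = (\<Sum>c\<in>C n. ennreal (exp (lam n c * (exp t - 1))) *
       (\<integral>\<^sup>+z. (\<Prod>x\<leftarrow>fst z. \<integral>\<^sup>+y. ennreal (st.tilt n t c y) \<partial>run n x) \<partial>init))"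
    by (subst nn_integral_sum) (simp_all add: nn_integral_cmult particles_system)
  finally show ?case using Suc.IH by (simp add: add_right_mono order_trans)
qed

end

section \<open>The heat kernel of the lazy walk\<close>

text \<open>The lazy walk on the integers after \<open>m\<close> steps: one lazy step is the sum of
  two fair coins minus 1. So the kernel is a single binomial coefficient, and explicit ratios can
  replace a local limit theorem.\<close>

definition lazy_bin :: "nat \<Rightarrow> int pmf" where
  "lazy_bin m = map_pmf (\<lambda>k. int k - int m) (binomial_pmf (2 * m) (1/2))"

lemma pmf_lazy_bin:
  "pmf (lazy_bin m) x = (if - int m \<le> x then real ((2 * m) choose nat (int m + x)) / 4 ^ m else 0)"
proof (cases "- int m \<le> x")
  case True
  have "pmf (lazy_bin m) x = pmf (lazy_bin m) (int (nat (int m + x)) - int m)" using True by simp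
  also have "\<dots> = pmf (binomial_pmf (2 * m) (1/2)) (nat (int m + x))"
    unfolding lazy_bin_def by (rule pmf_map_inj') (auto simp: inj_on_def)
  also have "\<dots> = real ((2 * m) choose nat (int m + x)) / 4 ^ m"
  proof (cases "nat (int m + x) \<le> 2 * m")
    case True
    have "(1/2::real) ^ nat (int m + x) * (1/2) ^ (2 * m - nat (int m + x)) = (1/2) ^ (2 * m)"
      using True by (simp add: power_add[symmetric])
    also have "\<dots> = 1 / 4 ^ m" by (simp add: power_mult power_one_over)
    finally show ?thesis by (simp add: mult.assoc)
  next
    case False
    then show ?thesis by (simp add: binomial_eq_0)
  qed
  finally show ?thesis using True by simp
next
  case False
  then have "x \<notin> set_pmf (lazy_bin m)" by (auto simp: lazy_bin_def)
  then show ?thesis using False by (simp add: pmf_eq_0_set_pmf)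
qed

lemma lazy_bin_ratio_space: "(real m + x + 1) * pmf (lazy_bin m) (x + 1) = (real m - x) * pmf (lazy_bin m) x" for x :: int
proof (cases "- int m \<le> x")
  case True
  define k where "k = nat (int m + x)"
  have x: "x = int k - int m" using True by (simp add: k_def)
  have "Suc k * (2 * m choose Suc k) = (2 * m - k) * (2 * m choose k)"
    by (simp only: binomial_absorption binomial_absorb_comp)
  then have "real (Suc k) * real (2 * m choose Suc k) = real (2 * m - k) * real (2 * m choose k)"
    by (simp only: of_nat_mult[symmetric])
  also have "\<dots> = (2 * real m - k) * real (2 * m choose k)"
    by (cases "k \<le> 2 * m") (auto simp: of_nat_diff)
  finally show ?thesis
    by (auto simp: pmf_lazy_bin x nat_add_distrib field_simps)
next
  case False
  then consider "x = - int m - 1" | "x < - int m - 1" by linarith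
  then show ?thesis by cases (auto simp: pmf_lazy_bin)
qed

lemma lazy_bin_ratio_time:
  "(real m + 1) * (2 * real m + 1) * pmf (lazy_bin m) x = 2 * ((real m + 1)\<^sup>2 - (real_of_int x)\<^sup>2) * pmf (lazy_bin (Suc m)) x"
proof (cases "- int m \<le> x")
  case True
  define k where "k = nat (int m + x)"
  have x: "x = int k - int m" using True by (simp add: k_def)
  let ?b = "real (2 * m choose k)" and ?b' = "real (2 * m + 2 choose Suc k)"
  have 1: "Suc k * (2 * m + 2 choose Suc k) = (2 * m + 2) * (2 * m + 1 choose k)"
    using Suc_times_binomial[of k "2 * m + 1"] by simp
  have 2: "(2 * m + 1 - k) * (2 * m + 1 choose k) = (2 * m + 1) * (2 * m choose k)"
    using binomial_absorb_comp[of "2 * m + 1" k] by simp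
  have 1: "real (Suc k) * ?b' = real (2 * m + 2) * real (2 * m + 1 choose k)"
    using 1 by (metis of_nat_mult)
  have 2: "real (2 * m + 1 - k) * real (2 * m + 1 choose k) = real (2 * m + 1) * ?b"
    using 2 by (metis of_nat_mult)
  have "real (2 * m + 1 - k) * real (2 * m + 1 choose k) = (2 * real m + 1 - real k) * real (2 * m + 1 choose k)"
    by (cases "k \<le> 2 * m + 1") (auto simp: of_nat_diff)
  with 2 have 2: "(2 * real m + 1 - real k) * real (2 * m + 1 choose k) = real (2 * m + 1) * ?b" by simp
  define B B' where B: "B = ?b" "B' = ?b'"
  have X: "real (2 * m + 2) * (real (2 * m + 1) * ?b) = (2 * real m + 1 - real k) * (real (Suc k) * ?b')"
    unfolding 1 2[symmetric] by simp
  have Y: "(2 * real m + 1 - real k) * real (Suc k) = (real m + 1)\<^sup>2 - (real_of_int x)\<^sup>2"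
    by (simp add: x power2_eq_square algebra_simps)
  have Z: "2 * ((real m + 1) * (2 * real m + 1) * B) = ((real m + 1)\<^sup>2 - (real_of_int x)\<^sup>2) * B'"
    using X unfolding Y[symmetric] B[symmetric] by (simp add: algebra_simps)
  have pm: "pmf (lazy_bin m) x = B / 4 ^ m" "pmf (lazy_bin (Suc m)) x = B' / (4 * 4 ^ m)"
    by (auto simp: B pmf_lazy_bin x nat_add_distrib Suc_nat_eq_nat_zadd1 simp flip: k_def)
  define S where "S = (real m + 1)\<^sup>2 - (real_of_int x)\<^sup>2"
  have "2 * S * (B' / (4 * 4 ^ m)) = (S * B') / (2 * 4 ^ m)" by (simp add: field_simps)
  also have "\<dots> = (2 * ((real m + 1) * (2 * real m + 1) * B)) / (2 * 4 ^ m)" unfolding Z S_def ..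
  also have "\<dots> = (real m + 1) * (2 * real m + 1) * (B / 4 ^ m)" by simp
  finally show ?thesis unfolding pm S_def ..
next
  case False
  then consider "x = - int (Suc m)" | "x < - int (Suc m)" by linarith
  then show ?thesis
  proof cases
    case 1
    then have "real_of_int x = - (real m + 1)" by simp
    then have "(real_of_int x)\<^sup>2 = (real m + 1)\<^sup>2" by (simp only: power2_minus)
    then show ?thesis using False by (simp add: pmf_lazy_bin)
  next
    case 2
    then show ?thesis by (auto simp: pmf_lazy_bin)
  qed
qed

text \<open>By \<open>lazy_bin_ratio_time\<close> one further step costs at most the factor
  \<open>(m + 1) / m\<close>, uniformly in \<open>x\<close>, and these factors telescope.\<close>

lemma lazy_bin_later:
  assumes "0 < m"
  shows "pmf (lazy_bin m) x \<le> (real (m + k) / real m) * pmf (lazy_bin (m + k)) x"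
proof (induction k)
  case 0
  then show ?case using assms by simp
next
  case (Suc k)
  let ?m = "m + k"
  have "(real ?m + 1) * (2 * real ?m + 1) * pmf (lazy_bin ?m) x
      \<le> (real ?m + 1) * (2 * (real ?m + 1)) * pmf (lazy_bin (Suc ?m)) x"
    unfolding lazy_bin_ratio_time by (intro mult_right_mono) (auto simp: power2_eq_square algebra_simps)
  then have "(2 * real ?m + 1) * pmf (lazy_bin ?m) x \<le> (2 * (real ?m + 1)) * pmf (lazy_bin (Suc ?m)) x"
    by (simp only: mult.assoc, subst (asm) mult_le_cancel_left_pos) auto
  moreover have "2 * real ?m * pmf (lazy_bin ?m) x \<le> (2 * real ?m + 1) * pmf (lazy_bin ?m) x"
    by (intro mult_right_mono) auto
  ultimately have "real ?m * pmf (lazy_bin ?m) x \<le> (real ?m + 1) * pmf (lazy_bin (Suc ?m)) x" by linarith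
  then have "(real ?m * pmf (lazy_bin ?m) x) / real m \<le> ((real ?m + 1) * pmf (lazy_bin (Suc ?m)) x) / real m"
    by (rule divide_right_mono) simp
  then show ?case using Suc by (simp add: algebra_simps)
qed

text \<open>In this direction the ratio of consecutive kernels contains
  \<open>1 - (x / (m + 1))^2\<close>, which is bad for large \<open>x\<close>; hence the restriction
  to distance \<open>R\<close>. Bernoulli's inequality then makes the loss linear in
  \<open>k\<close>.\<close>

lemma lazy_bin_earlier:
  assumes "0 < m" "\<bar>real_of_int x\<bar> \<le> R" "R \<le> real m"
  shows "(1 - real k * R\<^sup>2 / (real m)\<^sup>2) * pmf (lazy_bin (m + k)) x \<le> pmf (lazy_bin m) x"
proof -
  define q where "q = R\<^sup>2 / (real m)\<^sup>2"
  have R: "0 \<le> R" using assms by linarith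
  have q: "0 \<le> q" "q \<le> 1" using assms R by (auto simp: q_def divide_simps power_mono)
  have "(1 - q) ^ k * pmf (lazy_bin (m + k)) x \<le> pmf (lazy_bin m) x" for k
  proof (induction k)
    case (Suc k)
    let ?n = "real (m + k) + 1"
    have n: "0 < ?n" by simp
    have x2: "(real_of_int x)\<^sup>2 \<le> R\<^sup>2" using assms power_mono[of "\<bar>real_of_int x\<bar>" R 2] by simp
    have "(real_of_int x)\<^sup>2 / ?n\<^sup>2 \<le> R\<^sup>2 / (real m)\<^sup>2"
      using assms R x2 by (intro frac_le) (auto intro: power_mono)
    then have "(1 - q) * ?n\<^sup>2 \<le> ?n\<^sup>2 - (real_of_int x)\<^sup>2"
      using n by (simp add: q_def field_simps)
    then have "2 * ((1 - q) * ?n\<^sup>2) * pmf (lazy_bin (Suc (m + k))) x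
       \<le> 2 * (?n\<^sup>2 - (real_of_int x)\<^sup>2) * pmf (lazy_bin (Suc (m + k))) x"
      by (intro mult_right_mono mult_left_mono) auto
    also have "\<dots> = ?n * (2 * real (m + k) + 1) * pmf (lazy_bin (m + k)) x"
      by (simp only: lazy_bin_ratio_time)
    also have "\<dots> \<le> ?n * (2 * ?n) * pmf (lazy_bin (m + k)) x"
      by (intro mult_right_mono mult_left_mono) auto
    finally have le: "2 * ((1 - q) * ?n\<^sup>2) * pmf (lazy_bin (Suc (m + k))) x \<le> ?n * (2 * ?n) * pmf (lazy_bin (m + k)) x" .
    have cancel: "c * P \<le> P'" if "2 * (c * n\<^sup>2) * P \<le> n * (2 * n) * P'" "0 < n" for c P P' n :: real
    proof (rule mult_left_le_imp_le)
      show "2 * n\<^sup>2 * (c * P) \<le> 2 * n\<^sup>2 * P'" using that(1) by (simp add: power2_eq_square mult_ac)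
      show "0 < 2 * n\<^sup>2" using that(2) by simp
    qed
    have s: "(1 - q) * pmf (lazy_bin (Suc (m + k))) x \<le> pmf (lazy_bin (m + k)) x"
      by (rule cancel[OF le n])
    have "(1 - q) ^ Suc k * pmf (lazy_bin (m + Suc k)) x = (1 - q) ^ k * ((1 - q) * pmf (lazy_bin (Suc (m + k))) x)"
      by simp
    also have "\<dots> \<le> (1 - q) ^ k * pmf (lazy_bin (m + k)) x"
      using q by (intro mult_left_mono[OF s]) auto
    finally show ?case using Suc by linarith
  qed simp
  moreover have "1 - real k * q \<le> (1 - q) ^ k"
    using Bernoulli_inequality[of "- q" k] q by simp
  ultimately show ?thesis
    by (smt (verit) mult_right_mono pmf_nonneg q_def times_divide_eq_right)
qed

lemma lazy_bin_minus: "pmf (lazy_bin m) (- x) = pmf (lazy_bin m) x"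
proof -
  have *: "pmf (lazy_bin m) (- x) = pmf (lazy_bin m) x" if "0 \<le> x" "x \<le> int m" for x
  proof -
    have "(2 * m choose nat (int m - x)) = (2 * m choose nat (int m + x))"
      using that by (subst binomial_symmetric) (auto intro!: arg_cong[where f = "binomial _"])
    then show ?thesis using that by (simp add: pmf_lazy_bin)
  qed
  have big: "pmf (lazy_bin m) x = 0" if "int m < \<bar>x\<bar>" for x
    using that by (auto simp: pmf_lazy_bin)
  show ?thesis
  proof (cases "\<bar>x\<bar> \<le> int m")
    case True
    then show ?thesis using *[of x] *[of "- x"] by (cases "0 \<le> x") auto
  next
    case False
    then show ?thesis by (simp add: big)
  qed
qed

text \<open>For \<open>0 \<le> y\<close> a step from \<open>y\<close> to \<open>y + 1\<close> costs
  the factor \<open>(m - y) / (m + y + 1)\<close>, and for negative \<open>y\<close> it gains.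
  Shifts to the left follow by symmetry. The hypothesis on \<open>m\<close> keeps the loss per step
  below 1.\<close>

lemma lazy_bin_shift:
  assumes "\<bar>x\<bar> \<le> R" "\<bar>h\<bar> \<le> int l" "2 * (R + l) + 1 \<le> int m" "0 \<le> R"
  shows "(1 - real l * (2 * (real_of_int R + l) + 1) / real m) * pmf (lazy_bin m) x \<le> pmf (lazy_bin m) (x + h)"
proof -
  define q where "q = (2 * (real_of_int R + l) + 1) / real m"
  have m: "0 < real m" "real_of_int (2 * (R + l) + 1) \<le> real m" using assms by (auto intro: of_int_le_iff[THEN iffD2])
  have q: "0 \<le> q" "q \<le> 1" using assms m by (auto simp: q_def divide_simps)
  have up: "(1 - q) ^ j * pmf (lazy_bin m) x \<le> pmf (lazy_bin m) (x + int j)" if "\<bar>x\<bar> \<le> R" "j \<le> l" for x j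
    using that(2)
  proof (induction j)
    case (Suc j)
    define y where "y = x + int j"
    have y: "\<bar>y\<bar> \<le> R + l" using Suc.prems that by (auto simp: y_def)
    have "0 < int m + y + 1" using y assms(3,4) of_nat_0_le_iff[of l] by (simp add: abs_le_iff)
    then have "0 < real_of_int (int m + y + 1)" by (simp only: of_int_0_less_iff)
    then have d: "0 < real m + y + 1" by simp
    have s: "(1 - q) * pmf (lazy_bin m) y \<le> pmf (lazy_bin m) (y + 1)"
    proof -
      have "(1 - q) * (real m + y + 1) \<le> real m - y"
      proof (cases "0 \<le> y")
        case True
        have "2 * real_of_int y + 1 \<le> q * real m"
          using y m True by (simp add: q_def)
        also have "\<dots> \<le> q * (real m + y + 1)" using q True by (intro mult_left_mono) auto
        finally show ?thesis by (simp add: algebra_simps)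
      next
        case False
        have "(1 - q) * (real m + y + 1) \<le> 1 * (real m + y + 1)" using q d by (intro mult_right_mono) auto
        moreover have "real_of_int y \<le> real_of_int (- 1)" using False by (simp only: of_int_le_iff)
        ultimately show ?thesis by simp
      qed
      then have "(1 - q) * (real m + y + 1) * pmf (lazy_bin m) y \<le> (real m + y + 1) * pmf (lazy_bin m) (y + 1)"
        unfolding lazy_bin_ratio_space by (intro mult_right_mono) auto
      then have "(real m + y + 1) * ((1 - q) * pmf (lazy_bin m) y) \<le> (real m + y + 1) * pmf (lazy_bin m) (y + 1)"
        by (simp add: mult_ac)
      then show ?thesis using d by (subst (asm) mult_le_cancel_left_pos) auto
    qed
    have "(1 - q) ^ Suc j * pmf (lazy_bin m) x = (1 - q) * ((1 - q) ^ j * pmf (lazy_bin m) x)" by simp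
    also have "\<dots> \<le> (1 - q) * pmf (lazy_bin m) y"
      using Suc q unfolding y_def by (intro mult_left_mono) auto
    finally show ?case using s by (simp add: y_def algebra_simps)
  qed simp
  have "(1 - q) ^ nat \<bar>h\<bar> * pmf (lazy_bin m) x \<le> pmf (lazy_bin m) (x + h)"
  proof (cases "0 \<le> h")
    case True
    then show ?thesis using up[of x "nat h"] assms by simp
  next
    case False
    then have "(1 - q) ^ nat \<bar>h\<bar> * pmf (lazy_bin m) (- x) \<le> pmf (lazy_bin m) (- (x + h))"
      using up[of "- x" "nat (- h)"] assms by simp
    then show ?thesis by (simp only: lazy_bin_minus)
  qed
  moreover have "1 - real l * q \<le> (1 - q) ^ nat \<bar>h\<bar>"
  proof -
    have "1 - real l * q \<le> (1 - q) ^ l"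
      using Bernoulli_inequality[of "- q" l] q by simp
    also have "\<dots> \<le> (1 - q) ^ nat \<bar>h\<bar>" using q assms by (intro power_decreasing) auto
    finally show ?thesis .
  qed
  ultimately have "(1 - real l * q) * pmf (lazy_bin m) x \<le> pmf (lazy_bin m) (x + h)"
    by (smt (verit) mult_right_mono pmf_nonneg)
  then show ?thesis by (simp add: q_def)
qed

section \<open>The walk in several dimensions as a mixture of products of one-dimensional
  walks\<close>

definition coord_step :: "int pmf" where
  "coord_step = bind_pmf (bernoulli_pmf (1/2)) (\<lambda>a. bind_pmf (bernoulli_pmf (1/2)) (\<lambda>b.
     return_pmf (of_bool a + of_bool b - 1)))"

lemma lazy_bin_Suc: "lazy_bin (Suc m) = bind_pmf coord_step (\<lambda>s. map_pmf ((+) s) (lazy_bin m))"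
  by (simp add: lazy_bin_def coord_step_def binomial_pmf_Suc map_bind_pmf bind_assoc_pmf
      bind_return_pmf map_pmf_def algebra_simps)
    (intro bind_pmf_cong refl arg_cong[where f = return_pmf], auto)

lemma unit_vectors: "{e :: int ^ 'd::finite. (\<Sum>i\<in>UNIV. \<bar>e $ i\<bar>) = 1} = (\<lambda>(i, s). axis i s) ` (UNIV \<times> {1, -1})"
proof (intro set_eqI iffI)
  fix e :: "int ^ 'd" assume "e \<in> {e. (\<Sum>i\<in>UNIV. \<bar>e $ i\<bar>) = 1}"
  then have s: "(\<Sum>i\<in>UNIV. \<bar>e $ i\<bar>) = 1" by simp
  then obtain i where i: "e $ i \<noteq> 0" by (force intro: ccontr)
  have "(\<Sum>i\<in>UNIV. \<bar>e $ i\<bar>) = \<bar>e $ i\<bar> + (\<Sum>j\<in>UNIV - {i}. \<bar>e $ j\<bar>)"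
    by (subst sum.remove[of _ i]) auto
  moreover have "0 \<le> (\<Sum>j\<in>UNIV - {i}. \<bar>e $ j\<bar>)" by (intro sum_nonneg) auto
  ultimately have 1: "\<bar>e $ i\<bar> = 1" and "(\<Sum>j\<in>UNIV - {i}. \<bar>e $ j\<bar>) = 0" using s i by linarith+
  then have "\<forall>j\<in>UNIV - {i}. \<bar>e $ j\<bar> = 0" by (subst (asm) sum_nonneg_eq_0_iff) auto
  then have "e = axis i (e $ i)" by (auto simp: vec_eq_iff axis_def)
  moreover have "e $ i = 1 \<or> e $ i = -1" using 1 by linarith
  ultimately show "e \<in> (\<lambda>(i, s). axis i s) ` (UNIV \<times> {1, -1})" by force
next
  fix e :: "int ^ 'd" assume "e \<in> (\<lambda>(i, s). axis i s) ` (UNIV \<times> {1, -1})"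
  then obtain i s where e: "e = axis i s" "s = 1 \<or> s = -1" by auto
  have "(\<Sum>j\<in>UNIV. \<bar>e $ j\<bar>) = (\<Sum>j\<in>UNIV. if j = i then 1 else 0)"
    using e by (intro sum.cong) (auto simp: axis_def)
  then show "e \<in> {e. (\<Sum>i\<in>UNIV. \<bar>e $ i\<bar>) = 1}" by simp
qed

lemma inj_axis: "inj_on (\<lambda>(i, s). axis i s :: int ^ 'd::finite) (UNIV \<times> {1, -1})"
  by (auto simp: inj_on_def axis_eq_axis)

text \<open>Holding with probability 1/2 is exactly what makes this work: after choosing a
  coordinate uniformly, the step is a one-dimensional lazy step with probabilities 1/4, 1/2,
  1/4.\<close>

lemma lazy_step_coord: "(lazy_step :: (int ^ 'd::finite) pmf) = bind_pmf (pmf_of_set UNIV) (\<lambda>i. map_pmf (axis i) coord_step)"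
proof (rule pmf_eqI)
  fix x :: "int ^ 'd"
  let ?U = "{e :: int ^ 'd. (\<Sum>i\<in>UNIV. \<bar>e $ i\<bar>) = 1}" and ?d = "real CARD('d)"
  have U: "finite ?U" "?U \<noteq> {}" "card ?U = 2 * CARD('d)"
    unfolding unit_vectors using inj_axis[where 'd = 'd] by (auto simp: card_image card_cartesian_product)
  have ind: "(\<Sum>i\<in>UNIV. indicator {axis i 1} x + indicator {axis i (-1)} x) = (indicator ?U x :: real)"
  proof -
    have "(indicator ?U x :: real) = (\<Sum>e\<in>?U. indicator {e} x)"
      using U(1) by (simp add: indicator_def sum.delta)
    also have "\<dots> = (\<Sum>(i, s)\<in>UNIV \<times> {1, -1}. indicator {axis i s} x)"
      unfolding unit_vectors by (subst sum.reindex[OF inj_axis]) (simp add: o_def case_prod_unfold)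
    also have "\<dots> = (\<Sum>i\<in>UNIV. \<Sum>s\<in>{1, -1}. indicator {axis i s} x)"
      by (rule sum.cartesian_product[symmetric])
    also have "\<dots> = (\<Sum>i\<in>UNIV. indicator {axis i 1} x + indicator {axis i (-1)} x)"
      by (intro sum.cong) auto
    finally show ?thesis ..
  qed
  have ax0: "axis i (0::int) = 0" for i :: 'd by (simp add: axis_def vec_eq_iff)
  have c: "pmf (map_pmf (axis i) coord_step) x = 1/2 * indicator {0} x + 1/4 * (indicator {axis i 1} x + indicator {axis i (-1)} x)" for i
    by (simp add: coord_step_def map_bind_pmf pmf_bind ax0 indicator_def)
  have "pmf (lazy_step :: (int ^ 'd) pmf) x = 1/2 * indicator {0} x + 1/2 * (indicator ?U x / (2 * ?d))"
    using U by (simp add: lazy_step_def pmf_bind indicator_def)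
  moreover have "pmf (bind_pmf (pmf_of_set UNIV) (\<lambda>i. map_pmf (axis i) coord_step)) x =
     (\<Sum>i\<in>UNIV. 1/2 * indicator {0} x + 1/4 * (indicator {axis i 1} x + indicator {axis i (-1)} x)) / ?d"
    by (simp add: pmf_bind_pmf_of_set c)
  moreover have "\<dots> = 1/2 * indicator {0} x + 1/4 * (indicator ?U x / ?d)"
    unfolding sum.distrib[of "\<lambda>_. 1/2 * indicator {0} x"] sum_distrib_left[symmetric] ind by (simp add: field_simps)
  ultimately show "pmf lazy_step x = pmf (bind_pmf (pmf_of_set UNIV) (\<lambda>i. map_pmf (axis i) coord_step)) x"
    by simp
qed

primrec walk_pos :: "nat \<Rightarrow> (int ^ 'd::finite) pmf" where
  "walk_pos 0 = return_pmf 0"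
| "walk_pos (Suc n) = bind_pmf lazy_step (\<lambda>e. map_pmf ((+) e) (walk_pos n))"

lemma walk_pos_add: "walk_pos (m + n) = bind_pmf (walk_pos m) (\<lambda>x :: int ^ 'd::finite. map_pmf ((+) x) (walk_pos n))"
proof -
  have [simp]: "(+) (0 :: int ^ 'd) = id" and eq: "(\<lambda>y. e + (x + y)) = (+) (e + x)" for e x :: "int ^ 'd"
    by (auto simp: add.assoc)
  show ?thesis
    by (induction m) (simp_all add: map_bind_pmf bind_assoc_pmf bind_map_pmf pmf.map_comp o_def bind_return_pmf eq)
qed

definition coord_walk :: "('d \<Rightarrow> nat) \<Rightarrow> (int ^ 'd::finite) pmf" where
  "coord_walk \<nu> = map_pmf vec_lambda (Pi_pmf UNIV 0 (\<lambda>i. lazy_bin (\<nu> i)))"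

lemma pmf_coord_walk: "pmf (coord_walk \<nu>) x = (\<Prod>i\<in>UNIV. pmf (lazy_bin (\<nu> i)) (x $ i))"
proof -
  have "pmf (coord_walk \<nu>) (vec_lambda (\<lambda>i. x $ i)) = pmf (Pi_pmf UNIV 0 (\<lambda>i. lazy_bin (\<nu> i))) (\<lambda>i. x $ i)"
    unfolding coord_walk_def by (rule pmf_map_inj') (auto simp: inj_on_def vec_lambda_inject)
  then show ?thesis by (simp add: pmf_Pi)
qed

lemma coord_walk_Suc: "coord_walk (\<nu>(i := Suc (\<nu> i))) = bind_pmf coord_step (\<lambda>s. map_pmf ((+) (axis i s)) (coord_walk \<nu>))"
  for \<nu> :: "'d::finite \<Rightarrow> nat"
proof (rule pmf_eqI)
  fix x :: "int ^ 'd"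
  have tr: "pmf (map_pmf ((+) a) p) y = pmf p (y - a)" for a y :: "'b::ab_group_add" and p
    using pmf_map_inj'[of "(+) a" p "y - a"] by (simp add: inj_on_def)
  have "pmf (coord_walk (\<nu>(i := Suc (\<nu> i)))) x = pmf (lazy_bin (Suc (\<nu> i))) (x $ i) * (\<Prod>j\<in>UNIV - {i}. pmf (lazy_bin (\<nu> j)) (x $ j))"
    unfolding pmf_coord_walk by (subst prod.remove[of _ i]) (auto intro!: prod.cong)
  also have "\<dots> = (\<integral>s. pmf (lazy_bin (\<nu> i)) (x $ i - s) * (\<Prod>j\<in>UNIV - {i}. pmf (lazy_bin (\<nu> j)) (x $ j)) \<partial>coord_step)"
    by (simp add: lazy_bin_Suc pmf_bind tr)
  also have "\<dots> = (\<integral>s. pmf (coord_walk \<nu>) (x - axis i s) \<partial>coord_step)"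
  proof (intro Bochner_Integration.integral_cong refl)
    fix s
    show "pmf (lazy_bin (\<nu> i)) (x $ i - s) * (\<Prod>j\<in>UNIV - {i}. pmf (lazy_bin (\<nu> j)) (x $ j)) = pmf (coord_walk \<nu>) (x - axis i s)"
      unfolding pmf_coord_walk by (subst (2) prod.remove[of _ i]) (auto intro!: prod.cong simp: axis_def)
  qed
  also have "\<dots> = pmf (bind_pmf coord_step (\<lambda>s. map_pmf ((+) (axis i s)) (coord_walk \<nu>))) x"
    by (simp add: pmf_bind tr)
  finally show "pmf (coord_walk (\<nu>(i := Suc (\<nu> i)))) x = \<dots>" .
qed

primrec counts :: "nat \<Rightarrow> ('d::finite \<Rightarrow> nat) pmf" where
  "counts 0 = return_pmf (\<lambda>_. 0)"
| "counts (Suc n) = bind_pmf (counts n) (\<lambda>\<nu>. map_pmf (\<lambda>i. \<nu>(i := Suc (\<nu> i))) (pmf_of_set UNIV))"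

text \<open>Given how often each coordinate was chosen, the coordinates are independent
  one-dimensional lazy walks. All comparisons of kernels are made inside this mixture.\<close>

lemma walk_pos_counts: "(walk_pos n :: (int ^ 'd::finite) pmf) = bind_pmf (counts n) coord_walk"
proof (induction n)
  case 0
  have "coord_walk (\<lambda>_. 0) = return_pmf (0 :: int ^ 'd)"
    by (simp add: coord_walk_def lazy_bin_def zero_vec_def binomial_pmf_0[of "1/2"])
  then show ?case by (simp add: bind_return_pmf)
next
  case (Suc n)
  have "(walk_pos (Suc n) :: (int ^ 'd) pmf) = bind_pmf (pmf_of_set UNIV) (\<lambda>i. bind_pmf coord_step (\<lambda>s. bind_pmf (counts n) (\<lambda>\<nu>. map_pmf ((+) (axis i s)) (coord_walk \<nu>))))"
    by (simp only: walk_pos.simps Suc.IH) (simp add: lazy_step_coord bind_assoc_pmf bind_map_pmf map_bind_pmf)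
  also have "\<dots> = bind_pmf (pmf_of_set UNIV) (\<lambda>i. bind_pmf (counts n) (\<lambda>\<nu>. coord_walk (\<nu>(i := Suc (\<nu> i)))))"
    by (subst bind_commute_pmf) (simp add: coord_walk_Suc)
  also have "\<dots> = bind_pmf (counts n) (\<lambda>\<nu>. bind_pmf (pmf_of_set UNIV) (\<lambda>i. coord_walk (\<nu>(i := Suc (\<nu> i)))))"
    by (rule bind_commute_pmf)
  finally show ?case by (simp add: bind_assoc_pmf bind_map_pmf)
qed

lemma counts_add: "counts (m + n) = bind_pmf (counts m) (\<lambda>\<nu>. map_pmf (\<lambda>\<mu> i. \<nu> i + \<mu> i) (counts n))"
proof (induction n)
  case (Suc n)
  have *: "(\<lambda>j. \<nu> j + (\<mu>(i := Suc (\<mu> i))) j) = (\<lambda>j. \<nu> j + \<mu> j)(i := Suc (\<nu> i + \<mu> i))" for \<nu> \<mu> :: "'a \<Rightarrow> nat" and i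
    by auto
  show ?case
    by (simp add: Suc bind_assoc_pmf bind_map_pmf map_bind_pmf pmf.map_comp o_def * del: fun_upd_apply)
qed (simp add: map_pmf_def bind_return_pmf bind_return_pmf')

lemma counts_le: "\<nu> \<in> set_pmf (counts n) \<Longrightarrow> \<nu> i \<le> n"
proof (induction n arbitrary: \<nu>)
  case (Suc n)
  then obtain \<nu>' j where "\<nu>' \<in> set_pmf (counts n)" "\<nu> = \<nu>'(j := Suc (\<nu>' j))" by auto
  then show ?case using Suc.IH[of \<nu>'] by (auto simp: le_Suc_eq)
qed simp

lemma counts_half_power: "(\<integral>\<^sup>+\<nu>. ennreal ((1/2) ^ \<nu> i) \<partial>counts n) = ennreal ((1 - 1 / (2 * real CARD('d))) ^ n)"
  for i :: "'d::finite"
proof (induction n)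
  case (Suc n)
  let ?d = "real CARD('d)"
  have d: "1 \<le> ?d" by (simp add: Suc_leI)
  have "1 / (2 * ?d) \<le> 1" using d by (subst divide_le_eq_1_pos) linarith+
  then have q: "0 \<le> 1 - 1 / (2 * ?d)" by simp
  have *: "(\<integral>\<^sup>+j. ennreal ((1/2) ^ (\<nu>(j := Suc (\<nu> j))) i) \<partial>pmf_of_set UNIV) = ennreal (1 - 1 / (2 * ?d)) * ennreal ((1/2) ^ \<nu> i)"
    for \<nu> :: "'d \<Rightarrow> nat"
  proof -
    have d': "0 \<le> ?d - 1/2" using d by linarith
    have "(\<Sum>j\<in>UNIV. (1/2::real) ^ (\<nu>(j := Suc (\<nu> j))) i) = (1/2) * (1/2) ^ \<nu> i + (\<Sum>j\<in>UNIV - {i}. (1/2) ^ \<nu> i)"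
      by (subst sum.remove[of _ i]) auto
    also have "\<dots> = (?d - 1/2) * (1/2) ^ \<nu> i"
      using d by (simp add: card_Diff_singleton of_nat_diff algebra_simps)
    finally have s: "(\<Sum>j\<in>UNIV. (1/2::real) ^ (\<nu>(j := Suc (\<nu> j))) i) = (?d - 1/2) * (1/2) ^ \<nu> i" .
    have "(\<integral>\<^sup>+j. ennreal ((1/2) ^ (\<nu>(j := Suc (\<nu> j))) i) \<partial>pmf_of_set UNIV) = ennreal (\<Sum>j\<in>UNIV. (1/2) ^ (\<nu>(j := Suc (\<nu> j))) i) / CARD('d)"
      by (subst nn_integral_pmf_of_set) (auto simp: sum_ennreal)
    also have "\<dots> = ennreal ((?d - 1/2) * (1/2) ^ \<nu> i / ?d)"
      unfolding s using d by (subst ennreal_of_nat_eq_real_of_nat, subst divide_ennreal) (simp_all add: mult_nonneg_nonneg[OF d'])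
    also have "(?d - 1/2) * (1/2) ^ \<nu> i / ?d = (1 - 1 / (2 * ?d)) * (1/2) ^ \<nu> i" using d by (simp add: field_simps)
    finally show ?thesis using d by (simp add: ennreal_mult)
  qed
  show ?case
    using q by (simp add: * nn_integral_cmult Suc ennreal_mult del: fun_upd_apply)
qed simp

text \<open>Chernoff's bound with base 1/2: a coordinate chosen fewer than
  \<open>n / (4 * d)\<close> times has \<open>(1/2) ^ \<nu> i\<close> at least
  \<open>exp (- n / (4 * d))\<close>, because 2 is below e, whereas the mean of this power is at
  most \<open>exp (- n / (2 * d))\<close>.\<close>

lemma counts_small:
  fixes n :: nat
  defines "th \<equiv> nat \<lceil>real n / (4 * real CARD('d))\<rceil>"
  shows "emeasure (counts n) {\<nu> :: 'd::finite \<Rightarrow> nat. \<exists>i. \<nu> i < th}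
    \<le> ennreal (real CARD('d) * exp (- real n / (4 * real CARD('d))))"
proof -
  let ?d = "real CARD('d)" and ?y = "real n / (4 * real CARD('d))"
  have d: "1 \<le> ?d" by (simp add: Suc_leI)
  have "1 / (2 * ?d) \<le> 1" using d by (subst divide_le_eq_1_pos) linarith+
  then have q: "0 \<le> 1 - 1 / (2 * ?d)" by simp
  have one: "emeasure (counts n) {\<nu> :: 'd \<Rightarrow> nat. \<nu> i < th} \<le> ennreal (exp (- ?y))" for i
  proof -
    have lt: "real k < ?y" if "k < th" for k using that unfolding th_def by linarith
    have "emeasure (counts n) {\<nu> :: 'd \<Rightarrow> nat. \<nu> i < th} = (\<integral>\<^sup>+\<nu>. indicator {\<nu> :: 'd \<Rightarrow> nat. \<nu> i < th} \<nu> \<partial>counts n)"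
      by simp
    also have "\<dots> \<le> (\<integral>\<^sup>+\<nu>. ennreal (exp ?y) * ennreal ((1/2) ^ \<nu> i) \<partial>counts n)"
    proof (intro nn_integral_mono)
      fix \<nu> :: "'d \<Rightarrow> nat"
      have "1 \<le> exp ?y * (1/2) ^ \<nu> i" if "\<nu> i < th"
      proof -
        have "(2::real) ^ \<nu> i \<le> exp 1 ^ \<nu> i" using exp_ge_add_one_self[of 1] by (intro power_mono) auto
        also have "\<dots> = exp (real (\<nu> i))" by (simp add: exp_of_nat_mult[symmetric])
        also have "\<dots> \<le> exp ?y" using lt[OF that] by simp
        finally show ?thesis by (simp add: power_one_over field_simps)
      qed
      then show "indicator {\<nu> :: 'd \<Rightarrow> nat. \<nu> i < th} \<nu> \<le> ennreal (exp ?y) * ennreal ((1/2) ^ \<nu> i)"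
        by (auto simp: indicator_def ennreal_mult[symmetric])
    qed
    also have "\<dots> = ennreal (exp ?y * (1 - 1 / (2 * ?d)) ^ n)"
      using d by (subst nn_integral_cmult, simp, subst counts_half_power) (simp add: ennreal_mult zero_le_power[OF q])
    also have "\<dots> \<le> ennreal (exp (- ?y))"
    proof (intro ennreal_leI)
      have "(1 - 1 / (2 * ?d)) ^ n \<le> exp (- (1 / (2 * ?d))) ^ n"
        using exp_ge_add_one_self[of "- (1 / (2 * ?d))"] q by (intro power_mono) simp_all
      also have "\<dots> = exp (- 2 * ?y)" by (simp add: exp_of_nat_mult[symmetric])
      finally have "exp ?y * (1 - 1 / (2 * ?d)) ^ n \<le> exp ?y * exp (- 2 * ?y)" by (intro mult_left_mono) auto
      also have "\<dots> = exp (- ?y)" by (simp add: exp_add[symmetric])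
      finally show "exp ?y * (1 - 1 / (2 * ?d)) ^ n \<le> exp (- ?y)" .
    qed
    finally show ?thesis .
  qed
  have "{\<nu> :: 'd \<Rightarrow> nat. \<exists>i. \<nu> i < th} = (\<Union>i\<in>UNIV. {\<nu>. \<nu> i < th})" by auto
  then have "emeasure (counts n) {\<nu> :: 'd \<Rightarrow> nat. \<exists>i. \<nu> i < th} \<le> (\<Sum>i\<in>UNIV. emeasure (counts n) {\<nu> :: 'd \<Rightarrow> nat. \<nu> i < th})"
    by (simp only:) (intro emeasure_subadditive_finite, auto)
  also have "\<dots> \<le> (\<Sum>i\<in>(UNIV :: 'd set). ennreal (exp (- ?y)))" by (intro sum_mono one)
  also have "\<dots> = ennreal (?d * exp (- ?y))"
    by (simp add: ennreal_mult ennreal_of_nat_eq_real_of_nat)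
  finally show ?thesis by simp
qed

section \<open>Exponential moments and Gaussian tails of the walk\<close>

lemma exp_sym_le:
  fixes t :: real assumes "0 \<le> t" "t \<le> 1"
  shows "exp t + exp (- t) \<le> 2 + 2 * t\<^sup>2"
proof -
  have 1: "exp t \<le> 1 + t + t\<^sup>2" using exp_bound[OF assms] .
  have "1 \<le> (1 + t) * (1 - t + t\<^sup>2)" using assms by (simp add: algebra_simps power2_eq_square)
  also have "\<dots> \<le> exp t * (1 - t + t\<^sup>2)"
    using exp_ge_add_one_self[of t] assms by (intro mult_right_mono) (auto simp: power2_eq_square)
  finally have "exp (- t) \<le> 1 - t + t\<^sup>2" by (simp add: exp_minus field_simps)
  with 1 show ?thesis by simp
qed

lemma lazy_step_exp:
  fixes t s :: real and i :: "'d::finite"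
  assumes t: "0 \<le> t" "t \<le> 1" and s: "s = 1 \<or> s = -1"
  shows "(\<integral>\<^sup>+e. ennreal (exp (s * t * real_of_int (e $ i))) \<partial>(lazy_step :: (int ^ 'd) pmf)) \<le> ennreal (exp (t\<^sup>2 / 2))"
proof -
  have c: "(\<integral>\<^sup>+\<sigma>. ennreal (exp (s * t * real_of_int \<sigma>)) \<partial>coord_step) = ennreal (1/2 + 1/4 * (exp t + exp (-t)))"
  proof -
    have i2: "inverse 2 = ennreal (1/2)" using inverse_ennreal[of 2] by simp
    have comb: "(ennreal a * inverse 2 + inverse 2) * inverse 2 + (inverse 2 + ennreal b * inverse 2) * inverse 2
        = ennreal (1/2 + 1/4 * (a + b))" if "0 \<le> a" "0 \<le> b" for a b
    proof -
      have "(ennreal a * inverse 2 + inverse 2) * inverse 2 + (inverse 2 + ennreal b * inverse 2) * inverse 2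
         = ennreal ((a * (1/2) + 1/2) * (1/2) + (1/2 + b * (1/2)) * (1/2))"
        unfolding i2 using that
        by (simp only: ennreal_mult[symmetric] ennreal_plus[symmetric] add_nonneg_nonneg mult_nonneg_nonneg zero_le_divide_1_iff zero_le_numeral)
      also have "(a * (1/2) + 1/2) * (1/2) + (1/2 + b * (1/2)) * (1/2) = 1/2 + 1/4 * (a + b)" by (simp add: field_simps)
      finally show ?thesis .
    qed
    show ?thesis
      using s comb[of "exp t" "exp (-t)"] comb[of "exp (-t)" "exp t"] by (auto simp: coord_step_def add.commute)
  qed
  have "1/2 + 1/4 * (exp t + exp (-t)) \<le> 1 + t\<^sup>2 / 2" using exp_sym_le[OF t] by (simp add: field_simps)
  also have "\<dots> \<le> exp (t\<^sup>2 / 2)" by (rule exp_ge_add_one_self)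
  finally have c': "(\<integral>\<^sup>+\<sigma>. ennreal (exp (s * t * real_of_int \<sigma>)) \<partial>coord_step) \<le> ennreal (exp (t\<^sup>2 / 2))"
    unfolding c by (rule ennreal_leI)
  have "(\<integral>\<^sup>+e. ennreal (exp (s * t * real_of_int (e $ i))) \<partial>(lazy_step :: (int ^ 'd) pmf))
     = (\<integral>\<^sup>+j. \<integral>\<^sup>+\<sigma>. ennreal (exp (s * t * real_of_int (axis j \<sigma> $ i))) \<partial>coord_step \<partial>pmf_of_set UNIV)"
    by (simp add: lazy_step_coord)
  also have "\<dots> \<le> (\<integral>\<^sup>+j. ennreal (exp (t\<^sup>2 / 2)) \<partial>pmf_of_set (UNIV :: 'd set))"
  proof (intro nn_integral_mono)
    fix j :: 'd
    show "(\<integral>\<^sup>+\<sigma>. ennreal (exp (s * t * real_of_int (axis j \<sigma> $ i))) \<partial>coord_step) \<le> ennreal (exp (t\<^sup>2 / 2))"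
    proof (cases "j = i")
      case True then show ?thesis using c' by (simp add: axis_def)
    next
      case False
      then have "(\<integral>\<^sup>+\<sigma>. ennreal (exp (s * t * real_of_int (axis j \<sigma> $ i))) \<partial>coord_step) = ennreal 1"
        by (simp add: axis_def)
      then show ?thesis by (simp only:) (intro ennreal_leI, simp)
    qed
  qed
  finally show ?thesis by simp
qed

lemma walk_pos_exp:
  fixes t s :: real and i :: "'d::finite"
  assumes t: "0 \<le> t" "t \<le> 1" and s: "s = 1 \<or> s = -1"
  shows "(\<integral>\<^sup>+e. ennreal (exp (s * t * real_of_int (e $ i))) \<partial>(walk_pos n :: (int ^ 'd) pmf)) \<le> ennreal (exp (real n * (t\<^sup>2 / 2)))"
proof (induction n)
  case (Suc n)
  have "(\<integral>\<^sup>+e. ennreal (exp (s * t * real_of_int (e $ i))) \<partial>(walk_pos (Suc n) :: (int ^ 'd) pmf))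
    = (\<integral>\<^sup>+e. ennreal (exp (s * t * real_of_int (e $ i))) * (\<integral>\<^sup>+y. ennreal (exp (s * t * real_of_int (y $ i))) \<partial>(walk_pos n :: (int ^ 'd) pmf)) \<partial>lazy_step)"
    by (simp add: ring_distribs exp_add ennreal_mult nn_integral_cmult)
  also have "\<dots> \<le> ennreal (exp (t\<^sup>2 / 2)) * ennreal (exp (real n * (t\<^sup>2 / 2)))"
    using Suc lazy_step_exp[OF assms, of i] by (subst nn_integral_multc) (auto intro!: mult_mono)
  also have "\<dots> = ennreal (exp (real (Suc n) * (t\<^sup>2 / 2)))"
    by (simp add: ennreal_mult[symmetric] exp_add[symmetric] ring_distribs)
  finally show ?case .
qed simp

text \<open>Exponential Markov inequality with \<open>t = R / n\<close>; \<open>R \<le> n\<close>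
  keeps \<open>t\<close> in the range where the quadratic bound on the exponential moment holds. The
  bound refers to \<open>n\<close> and not to \<open>m\<close>, so that one estimate serves all
  times up to \<open>n\<close>.\<close>

lemma walk_pos_tail:
  fixes R :: real
  assumes R: "0 \<le> R" "R \<le> real n" and mn: "m \<le> n" "0 < n"
  shows "emeasure (walk_pos m) {x :: int ^ 'd::finite. \<exists>i. R < \<bar>real_of_int (x $ i)\<bar>}
    \<le> ennreal (2 * real CARD('d) * exp (- (R\<^sup>2 / (2 * real n))))"
proof -
  define t where "t = R / real n"
  have t: "0 \<le> t" "t \<le> 1" using R mn by (auto simp: t_def)
  have one: "emeasure (walk_pos m) {x :: int ^ 'd. R < s * real_of_int (x $ i)} \<le> ennreal (exp (- (R\<^sup>2 / (2 * real n))))"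
    if s: "s = 1 \<or> s = -1" for s i
  proof -
    have "emeasure (walk_pos m) {x :: int ^ 'd. R < s * real_of_int (x $ i)}
       = (\<integral>\<^sup>+x. indicator {x :: int ^ 'd. R < s * real_of_int (x $ i)} x \<partial>walk_pos m)" by simp
    also have "\<dots> \<le> (\<integral>\<^sup>+x. ennreal (exp (- t * R)) * ennreal (exp (s * t * real_of_int (x $ i))) \<partial>walk_pos m)"
    proof (intro nn_integral_mono)
      fix x :: "int ^ 'd"
      have "1 \<le> exp (- t * R) * exp (s * t * real_of_int (x $ i))" if "R < s * real_of_int (x $ i)"
      proof -
        have "t * R \<le> t * (s * real_of_int (x $ i))" using t that by (intro mult_left_mono) auto
        then show ?thesis by (simp add: exp_add[symmetric] algebra_simps)
      qed
      then show "indicator {x :: int ^ 'd. R < s * real_of_int (x $ i)} x \<le> ennreal (exp (- t * R)) * ennreal (exp (s * t * real_of_int (x $ i)))"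
        by (auto simp: indicator_def ennreal_mult[symmetric])
    qed
    also have "\<dots> \<le> ennreal (exp (- t * R)) * ennreal (exp (real m * (t\<^sup>2 / 2)))"
      using walk_pos_exp[OF t s, where i = i and n = m] by (subst nn_integral_cmult) (auto intro!: mult_left_mono)
    also have "\<dots> = ennreal (exp (- t * R + real m * (t\<^sup>2 / 2)))" by (simp only: exp_add ennreal_mult exp_ge_zero)
    also have "\<dots> \<le> ennreal (exp (- (R\<^sup>2 / (2 * real n))))"
    proof (intro ennreal_leI, simp only: exp_le_cancel_iff)
      have "real m * (t\<^sup>2 / 2) \<le> real n * (t\<^sup>2 / 2)" using mn by (intro mult_right_mono) auto
      also have "- t * R + real n * (t\<^sup>2 / 2) = - (R\<^sup>2 / (2 * real n))"
        using mn by (simp add: t_def power2_eq_square field_simps)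
      finally show "- t * R + real m * (t\<^sup>2 / 2) \<le> - (R\<^sup>2 / (2 * real n))" by simp
    qed
    finally show ?thesis .
  qed
  let ?A = "\<lambda>(i, s). {x :: int ^ 'd. R < s * real_of_int (x $ i)}"
  have "{x :: int ^ 'd. \<exists>i. R < \<bar>real_of_int (x $ i)\<bar>} \<subseteq> (\<Union>p\<in>UNIV \<times> {1, -1}. ?A p)"
    by (auto simp: abs_if split: if_splits)
  then have "emeasure (walk_pos m) {x :: int ^ 'd. \<exists>i. R < \<bar>real_of_int (x $ i)\<bar>}
     \<le> emeasure (walk_pos m) (\<Union>p\<in>UNIV \<times> {1, -1}. ?A p)" by (intro emeasure_mono) auto
  also have "\<dots> \<le> (\<Sum>p\<in>UNIV \<times> {1, -1}. emeasure (walk_pos m) (?A p))"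
    by (intro emeasure_subadditive_finite) auto
  also have "\<dots> \<le> (\<Sum>p\<in>(UNIV :: 'd set) \<times> {1, -1 :: real}. ennreal (exp (- (R\<^sup>2 / (2 * real n)))))"
    using one by (intro sum_mono) auto
  also have "\<dots> = ennreal (2 * real CARD('d) * exp (- (R\<^sup>2 / (2 * real n))))"
    by (simp add: card_cartesian_product ennreal_of_nat_eq_real_of_nat ennreal_mult ennreal_numeral mult_ac flip: of_nat_mult ennreal_numeral)
  finally show ?thesis .
qed

text \<open>The part of the kernel at time \<open>n + J\<close> that comes from paths in which some
  coordinate was chosen fewer than \<open>th\<close> times during the first \<open>n\<close> steps.
  There the one-dimensional estimates are too weak, so it is kept as an additive error of small
  total mass.\<close>

definition low :: "nat \<Rightarrow> nat \<Rightarrow> nat \<Rightarrow> int ^ 'd::finite \<Rightarrow> ennreal" where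
  "low n J th x = (\<integral>\<^sup>+\<nu>. indicator {\<nu>. \<exists>i. \<nu> i < th} \<nu> *
     (\<integral>\<^sup>+\<mu>. ennreal (pmf (coord_walk (\<lambda>i. \<nu> i + \<mu> i)) x) \<partial>counts J) \<partial>counts n)"

lemma nn_integral_low: "(\<integral>\<^sup>+x. low n J th (x :: int ^ 'd::finite) \<partial>count_space UNIV) = emeasure (counts n) {\<nu> :: 'd::finite \<Rightarrow> nat. \<exists>i. \<nu> i < th}"
proof -
  have sw: "(\<integral>\<^sup>+x. \<integral>\<^sup>+\<nu>. f x \<nu> \<partial>measure_pmf p \<partial>count_space UNIV) = (\<integral>\<^sup>+\<nu>. \<integral>\<^sup>+x. f x \<nu> \<partial>count_space UNIV \<partial>measure_pmf p)"
    for f :: "int ^ 'd \<Rightarrow> ('d \<Rightarrow> nat) \<Rightarrow> ennreal" and p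
    by (subst nn_integral_count_space_nn_integral) auto
  show ?thesis
    unfolding low_def by (subst sw) (simp add: nn_integral_cmult sw nn_integral_pmf)
qed

lemma pmf_walk_pos_add: "ennreal (pmf (walk_pos (n + J)) x) =
    (\<integral>\<^sup>+\<nu>. \<integral>\<^sup>+\<mu>. ennreal (pmf (coord_walk (\<lambda>i. \<nu> i + \<mu> i)) x) \<partial>counts J \<partial>counts n)"
  for x :: "int ^ 'd::finite"
proof -
  have "walk_pos (n + J) = bind_pmf (counts n) (\<lambda>\<nu>. bind_pmf (counts J) (\<lambda>\<mu>. coord_walk (\<lambda>i. \<nu> i + \<mu> i :: nat) :: (int ^ 'd) pmf))"
    by (simp add: walk_pos_counts counts_add bind_assoc_pmf bind_map_pmf)
  then show ?thesis by (simp add: ennreal_pmf_bind)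
qed

lemma pmf_walk_pos: "ennreal (pmf (walk_pos n) x) = (\<integral>\<^sup>+\<nu>. ennreal (pmf (coord_walk \<nu>) x) \<partial>counts n)"
  for x :: "int ^ 'd::finite"
  by (simp add: walk_pos_counts ennreal_pmf_bind)

lemma low_0: "low n 0 th x = (\<integral>\<^sup>+\<nu>. indicator {\<nu>. \<exists>i. \<nu> i < th} \<nu> * ennreal (pmf (coord_walk \<nu>) x) \<partial>counts n)"
  by (simp add: low_def)

text \<open>If all coordinates have at least \<open>th\<close> steps, multiplying the
  one-dimensional comparison over the coordinates gives the power of \<open>K\<close>; the remaining
  count vectors are estimated by themselves and form the error.\<close>

lemma walk_pos_compare_up:
  fixes x h :: "int ^ 'd::finite"
  assumes K: "0 \<le> K" "K \<le> 1" and le: "\<And>i m k. th \<le> m \<Longrightarrow> k \<le> J \<Longrightarrow> K * pmf (lazy_bin m) (x $ i) \<le> pmf (lazy_bin (m + k)) ((x + h) $ i)"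
  shows "ennreal (K ^ CARD('d)) * ennreal (pmf (walk_pos n) x) \<le> ennreal (pmf (walk_pos (n + J)) (x + h)) + low n 0 th x"
proof -
  let ?K = "ennreal (K ^ CARD('d))"
  have K1: "?K \<le> 1" using K by (intro ennreal_le_1[THEN iffD2] power_le_one)
  have "?K * ennreal (pmf (walk_pos n) x) = (\<integral>\<^sup>+\<nu>. ?K * ennreal (pmf (coord_walk \<nu>) x) \<partial>counts n)"
    by (simp add: pmf_walk_pos nn_integral_cmult)
  also have "\<dots> \<le> (\<integral>\<^sup>+\<nu>. (\<integral>\<^sup>+\<mu>. ennreal (pmf (coord_walk (\<lambda>i. \<nu> i + \<mu> i)) (x + h)) \<partial>counts J) +
      indicator {\<nu>. \<exists>i. \<nu> i < th} \<nu> * ennreal (pmf (coord_walk \<nu>) x) \<partial>counts n)"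
  proof (intro nn_integral_mono)
    fix \<nu> :: "'d \<Rightarrow> nat"
    show "?K * ennreal (pmf (coord_walk \<nu>) x) \<le> (\<integral>\<^sup>+\<mu>. ennreal (pmf (coord_walk (\<lambda>i. \<nu> i + \<mu> i)) (x + h)) \<partial>counts J) +
      indicator {\<nu>. \<exists>i. \<nu> i < th} \<nu> * ennreal (pmf (coord_walk \<nu>) x)"
    proof (cases "\<exists>i. \<nu> i < th")
      case True
      have "?K * ennreal (pmf (coord_walk \<nu>) x) \<le> 1 * ennreal (pmf (coord_walk \<nu>) x)" by (intro mult_right_mono K1) auto
      then show ?thesis using True by (simp add: add_increasing)
    next
      case False
      have "?K * ennreal (pmf (coord_walk \<nu>) x) = (\<integral>\<^sup>+\<mu>. ?K * ennreal (pmf (coord_walk \<nu>) x) \<partial>(counts J :: ('d \<Rightarrow> nat) pmf))" by simp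
      also have "\<dots> \<le> (\<integral>\<^sup>+\<mu>. ennreal (pmf (coord_walk (\<lambda>i. \<nu> i + \<mu> i)) (x + h)) \<partial>counts J)"
      proof (intro nn_integral_mono_AE AE_pmfI)
        fix \<mu> :: "'d \<Rightarrow> nat" assume \<mu>: "\<mu> \<in> set_pmf (counts J)"
        have "K ^ CARD('d) * pmf (coord_walk \<nu>) x = (\<Prod>i\<in>UNIV. K * pmf (lazy_bin (\<nu> i)) (x $ i))"
          by (simp add: pmf_coord_walk prod.distrib)
        also have "\<dots> \<le> pmf (coord_walk (\<lambda>i. \<nu> i + \<mu> i)) (x + h)"
          unfolding pmf_coord_walk using False counts_le[OF \<mu>] K
          by (intro prod_mono conjI le mult_nonneg_nonneg) (auto simp: not_less)
        finally show "?K * ennreal (pmf (coord_walk \<nu>) x) \<le> ennreal (pmf (coord_walk (\<lambda>i. \<nu> i + \<mu> i)) (x + h))"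
          using K by (subst ennreal_mult[symmetric]) (auto intro!: ennreal_leI)
      qed
      finally show ?thesis by (simp add: add_increasing2)
    qed
  qed
  also have "\<dots> = ennreal (pmf (walk_pos (n + J)) (x + h)) + low n 0 th x"
    by (simp add: nn_integral_add pmf_walk_pos_add low_0)
  finally show ?thesis .
qed

lemma walk_pos_compare_down:
  fixes x :: "int ^ 'd::finite"
  assumes K: "0 \<le> K" "K \<le> 1" and le: "\<And>i m k. th \<le> m \<Longrightarrow> k \<le> J \<Longrightarrow> K * pmf (lazy_bin (m + k)) (x $ i) \<le> pmf (lazy_bin m) (x $ i)"
  shows "ennreal (K ^ CARD('d)) * ennreal (pmf (walk_pos (n + J)) x) \<le> ennreal (pmf (walk_pos n) x) + low n J th x"
proof -
  let ?K = "ennreal (K ^ CARD('d))" and ?I = "\<lambda>\<nu>. (\<integral>\<^sup>+\<mu>. ennreal (pmf (coord_walk (\<lambda>i. \<nu> i + \<mu> i)) x) \<partial>counts J)"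
  have K1: "?K \<le> 1" using K by (intro ennreal_le_1[THEN iffD2] power_le_one)
  have "?K * ennreal (pmf (walk_pos (n + J)) x) = (\<integral>\<^sup>+\<nu>. ?K * ?I \<nu> \<partial>counts n)"
    by (simp add: pmf_walk_pos_add nn_integral_cmult)
  also have "\<dots> \<le> (\<integral>\<^sup>+\<nu>. ennreal (pmf (coord_walk \<nu>) x) + indicator {\<nu>. \<exists>i. \<nu> i < th} \<nu> * ?I \<nu> \<partial>counts n)"
  proof (intro nn_integral_mono)
    fix \<nu> :: "'d \<Rightarrow> nat"
    show "?K * ?I \<nu> \<le> ennreal (pmf (coord_walk \<nu>) x) + indicator {\<nu>. \<exists>i. \<nu> i < th} \<nu> * ?I \<nu>"
    proof (cases "\<exists>i. \<nu> i < th")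
      case True
      have "?K * ?I \<nu> \<le> 1 * ?I \<nu>" by (intro mult_right_mono K1) auto
      then show ?thesis using True by (simp add: add_increasing)
    next
      case False
      have "?K * ?I \<nu> = (\<integral>\<^sup>+\<mu>. ?K * ennreal (pmf (coord_walk (\<lambda>i. \<nu> i + \<mu> i)) x) \<partial>counts J)" by (simp add: nn_integral_cmult)
      also have "\<dots> \<le> (\<integral>\<^sup>+\<mu>. ennreal (pmf (coord_walk \<nu>) x) \<partial>(counts J :: ('d \<Rightarrow> nat) pmf))"
      proof (intro nn_integral_mono_AE AE_pmfI)
        fix \<mu> :: "'d \<Rightarrow> nat" assume \<mu>: "\<mu> \<in> set_pmf (counts J)"
        have "K ^ CARD('d) * pmf (coord_walk (\<lambda>i. \<nu> i + \<mu> i)) x = (\<Prod>i\<in>UNIV. K * pmf (lazy_bin (\<nu> i + \<mu> i)) (x $ i))"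
          by (simp add: pmf_coord_walk prod.distrib)
        also have "\<dots> \<le> pmf (coord_walk \<nu>) x"
          unfolding pmf_coord_walk using False counts_le[OF \<mu>] K
          by (intro prod_mono conjI le mult_nonneg_nonneg) (auto simp: not_less)
        finally show "?K * ennreal (pmf (coord_walk (\<lambda>i. \<nu> i + \<mu> i)) x) \<le> ennreal (pmf (coord_walk \<nu>) x)"
          using K by (subst ennreal_mult[symmetric]) (auto intro!: ennreal_leI)
      qed
      finally show ?thesis by (simp add: add_increasing2)
    qed
  qed
  also have "\<dots> = ennreal (pmf (walk_pos n) x) + low n J th x"
    by (simp add: nn_integral_add pmf_walk_pos low_def)
  finally show ?thesis .
qed

section \<open>Comparison of heat kernels\<close>

abbreviation hk :: "nat \<Rightarrow> int ^ 'd::finite \<Rightarrow> real" where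
  "hk n x \<equiv> pmf (walk_pos n) x"

lemma hk_minus: "hk n (- x) = hk n x"
proof -
  have "ennreal (hk n (- x)) = ennreal (hk n x)"
    unfolding pmf_walk_pos pmf_coord_walk by (simp add: lazy_bin_minus)
  then show ?thesis by simp
qed

definition hk_low_mass :: "'d::finite itself \<Rightarrow> nat \<Rightarrow> real" where
  "hk_low_mass _ n = real CARD('d) * exp (- real n / (4 * real CARD('d)))"

definition hk_far_mass :: "'d::finite itself \<Rightarrow> real \<Rightarrow> nat \<Rightarrow> real" where
  "hk_far_mass _ R n = 2 * real CARD('d) * exp (- (R\<^sup>2 / (2 * real n)))"

definition hk_far :: "nat \<Rightarrow> real \<Rightarrow> int ^ 'd::finite \<Rightarrow> ennreal" where
  "hk_far n R x = ennreal (hk n x) * indicator {x. \<exists>i. R < \<bar>real_of_int (x $ i)\<bar>} x"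

lemma nn_integral_hk_far:
  assumes "0 \<le> R" "R \<le> real n" "0 < n"
  shows "(\<integral>\<^sup>+x. hk_far n R x \<partial>count_space (UNIV :: (int ^ 'd::finite) set)) \<le> ennreal (hk_far_mass TYPE('d) R n)"
proof -
  have "(\<integral>\<^sup>+x. hk_far n R x \<partial>count_space (UNIV :: (int ^ 'd::finite) set))
     = (\<integral>\<^sup>+x. indicator {x :: int ^ 'd. \<exists>i. R < \<bar>real_of_int (x $ i)\<bar>} x \<partial>walk_pos n)"
    unfolding hk_far_def by (subst nn_integral_measure_pmf) (rule refl)
  also have "\<dots> \<le> ennreal (hk_far_mass TYPE('d) R n)"
    using walk_pos_tail[OF assms(1,2) order_refl assms(3), where 'd = 'd] by (simp add: hk_far_mass_def)
  finally show ?thesis .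
qed

abbreviation hk_th :: "'d::finite itself \<Rightarrow> nat \<Rightarrow> nat" where
  "hk_th _ n \<equiv> nat \<lceil>real n / (4 * real CARD('d))\<rceil>"

lemma nn_integral_low_le:
  "(\<integral>\<^sup>+x. low n J (hk_th TYPE('d) n) x \<partial>count_space (UNIV :: (int ^ 'd::finite) set)) \<le> ennreal (hk_low_mass TYPE('d) n)"
  unfolding nn_integral_low hk_low_mass_def by (rule counts_small)

lemma hk_th_le: "real n / (4 * real CARD('d)) \<le> real m" if "hk_th TYPE('d::finite) n \<le> m"
  using that by linarith

text \<open>Outside the exceptional event a coordinate has at least \<open>n / (4 * d)\<close> steps
  and receives at most \<open>J\<close> more; this turns the one-dimensional factor
  \<open>(m + k) / m\<close> into \<open>1 + 4 * d * J / n\<close>. No bound on \<open>x\<close> is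
  needed for later times.\<close>

lemma hk_later:
  fixes x :: "int ^ 'd::finite"
  assumes "0 < n"
  shows "ennreal ((1 / (1 + 4 * real CARD('d) * real J / real n)) ^ CARD('d)) * ennreal (hk n x)
    \<le> ennreal (hk (n + J) x) + low n 0 (hk_th TYPE('d) n) x"
proof -
  let ?d = "real CARD('d)" let ?K = "1 / (1 + 4 * ?d * real J / real n)"
  have d: "0 < ?d" by simp
  have "?K * pmf (lazy_bin m) y \<le> pmf (lazy_bin (m + k)) y" if m: "hk_th TYPE('d) n \<le> m" and k: "k \<le> J" for m k y
  proof -
    have y: "real n / (4 * ?d) \<le> real m" by (rule hk_th_le[OF m])
    have "0 < real n / (4 * ?d)" using assms d by simp
    then have m0: "0 < m" using y by (cases m) auto
    have "real k / real m \<le> real J / (real n / (4 * ?d))"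
      using k y assms d by (intro frac_le) auto
    then have q: "1 + real k / real m \<le> 1 + 4 * ?d * real J / real n" by (simp add: mult_ac)
    have "?K \<le> 1 / (1 + real k / real m)" using q by (intro divide_left_mono) (auto intro!: mult_pos_pos add_pos_nonneg)
    also have "\<dots> = real m / real (m + k)" using m0 by (simp add: field_simps)
    finally have K: "?K \<le> real m / real (m + k)" .
    have "?K * pmf (lazy_bin m) y \<le> (real m / real (m + k)) * pmf (lazy_bin m) y" by (intro mult_right_mono K) auto
    also have "\<dots> \<le> (real m / real (m + k)) * ((real (m + k) / real m) * pmf (lazy_bin (m + k)) y)"
      using lazy_bin_later[OF m0] by (intro mult_left_mono) auto
    also have "\<dots> = pmf (lazy_bin (m + k)) y" using m0 by simp
    finally show ?thesis .
  qed
  moreover have "?K \<le> 1" by (subst divide_le_eq_1_pos) (auto intro: add_pos_nonneg)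
  ultimately show ?thesis
    using walk_pos_compare_up[where K = ?K and th = "hk_th TYPE('d) n" and J = J and n = n and x = x and h = 0]
    by simp
qed

text \<open>Beyond distance \<open>R\<close> the kernel is estimated by itself, which is the term
  \<open>hk_far\<close>; within it \<open>lazy_bin_shift\<close> applies with at least
  \<open>n / (4 * d)\<close> steps per coordinate.\<close>

lemma hk_shift:
  fixes x h :: "int ^ 'd::finite" and n l :: nat and R :: real
  defines "q \<equiv> 4 * real CARD('d) * (real l * (2 * (R + real l) + 1)) / real n"
  assumes n: "0 < n" and R: "0 \<le> R" and l: "2 * (R + real l) + 1 \<le> real n / (4 * real CARD('d))" "q \<le> 1"
    and h: "\<And>i. \<bar>h $ i\<bar> \<le> int l"
  shows "ennreal ((1 - q) ^ CARD('d)) * ennreal (hk n x)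
    \<le> ennreal (hk n (x + h)) + (low n 0 (hk_th TYPE('d) n) x + hk_far n R x)"
proof (cases "\<exists>i. R < \<bar>real_of_int (x $ i)\<bar>")
  case True
  have q0: "0 \<le> q" using R by (simp add: q_def)
  have "ennreal ((1 - q) ^ CARD('d)) * ennreal (hk n x) \<le> 1 * ennreal (hk n x)"
    using l q0 by (intro mult_right_mono ennreal_le_1[THEN iffD2] power_le_one) auto
  then show ?thesis using True by (simp add: hk_far_def add_increasing)
next
  case False
  let ?d = "real CARD('d)"
  have d: "0 < ?d" by simp
  have q0: "0 \<le> q" using R by (simp add: q_def)
  have "(1 - q) * pmf (lazy_bin m) (x $ i) \<le> pmf (lazy_bin (m + k)) ((x + h) $ i)"
    if m: "hk_th TYPE('d) n \<le> m" and k: "k \<le> 0" for m k i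
  proof -
    have y: "real n / (4 * ?d) \<le> real m" by (rule hk_th_le[OF m])
    have n0: "0 < real n / (4 * ?d)" using n d by simp
    have Rf: "real_of_int \<lfloor>R\<rfloor> \<le> R" by simp
    have x: "\<bar>x $ i\<bar> \<le> \<lfloor>R\<rfloor>" using False by (subst le_floor_iff) (auto simp: not_less)
    have "2 * (real_of_int \<lfloor>R\<rfloor> + real l) + 1 \<le> 2 * (R + real l) + 1" using Rf by simp
    also note l(1)
    also note y
    finally have "2 * (real_of_int \<lfloor>R\<rfloor> + real l) + 1 \<le> real m" .
    then have "real_of_int (2 * (\<lfloor>R\<rfloor> + int l) + 1) \<le> real m" by simp
    then have c: "2 * (\<lfloor>R\<rfloor> + int l) + 1 \<le> int m" by linarith
    have "real l * (2 * (real_of_int \<lfloor>R\<rfloor> + real l) + 1) / real m \<le> real l * (2 * (R + real l) + 1) / (real n / (4 * ?d))"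
      using y n0 Rf R by (intro frac_le mult_left_mono) auto
    also have "\<dots> = q" by (simp add: q_def mult_ac)
    finally have "(1 - q) * pmf (lazy_bin m) (x $ i) \<le> (1 - real l * (2 * (real_of_int \<lfloor>R\<rfloor> + real l) + 1) / real m) * pmf (lazy_bin m) (x $ i)"
      by (intro mult_right_mono) auto
    also have "\<dots> \<le> pmf (lazy_bin m) (x $ i + h $ i)"
      by (rule lazy_bin_shift[OF x h c]) (use R in simp)
    finally show ?thesis using k by simp
  qed
  then have "ennreal ((1 - q) ^ CARD('d)) * ennreal (hk n x) \<le> ennreal (hk n (x + h)) + low n 0 (hk_th TYPE('d) n) x"
    using walk_pos_compare_up[where K = "1 - q" and th = "hk_th TYPE('d) n" and J = 0 and n = n and x = x and h = h] l q0
    by simp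
  then show ?thesis by (simp add: add.assoc[symmetric] add_increasing2)
qed

text \<open>Going back in time is controlled only up to distance \<open>R\<close>, so the later
  kernel beyond \<open>R\<close> appears as an error. The admissible \<open>R\<close> shrinks as
  \<open>J\<close> grows, and this trade-off decides the exponent of the whole estimate.\<close>

lemma hk_earlier:
  fixes x :: "int ^ 'd::finite" and n J :: nat and R :: real
  defines "q \<equiv> (4 * real CARD('d))\<^sup>2 * (real J * R\<^sup>2) / (real n)\<^sup>2"
  assumes n: "0 < n" and R: "0 \<le> R" "R \<le> real n / (4 * real CARD('d))" "q \<le> 1"
  shows "ennreal ((1 - q) ^ CARD('d)) * ennreal (hk (n + J) x)
    \<le> ennreal (hk n x) + (low n J (hk_th TYPE('d) n) x + hk_far (n + J) R x)"
proof (cases "\<exists>i. R < \<bar>real_of_int (x $ i)\<bar>")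
  case True
  have q0: "0 \<le> q" using R by (simp add: q_def)
  have "ennreal ((1 - q) ^ CARD('d)) * ennreal (hk (n + J) x) \<le> 1 * ennreal (hk (n + J) x)"
    using R q0 by (intro mult_right_mono ennreal_le_1[THEN iffD2] power_le_one) auto
  then show ?thesis using True by (simp add: hk_far_def add_increasing)
next
  case False
  let ?d = "real CARD('d)"
  have d: "0 < ?d" by simp
  have q0: "0 \<le> q" using R by (simp add: q_def)
  have "(1 - q) * pmf (lazy_bin (m + k)) (x $ i) \<le> pmf (lazy_bin m) (x $ i)"
    if m: "hk_th TYPE('d) n \<le> m" and k: "k \<le> J" for m k i
  proof -
    have y: "real n / (4 * ?d) \<le> real m" by (rule hk_th_le[OF m])
    have n0: "0 < real n / (4 * ?d)" using n d by simp
    then have m0: "0 < m" using y by (cases m) auto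
    have "real k * R\<^sup>2 / (real m)\<^sup>2 \<le> real J * R\<^sup>2 / (real n / (4 * ?d))\<^sup>2"
      using y n0 k n by (intro frac_le mult_right_mono power_mono) auto
    also have "\<dots> = q" by (simp add: q_def power_divide power_mult_distrib mult_ac)
    finally have "(1 - q) * pmf (lazy_bin (m + k)) (x $ i) \<le> (1 - real k * R\<^sup>2 / (real m)\<^sup>2) * pmf (lazy_bin (m + k)) (x $ i)"
      by (intro mult_right_mono) auto
    also have "\<dots> \<le> pmf (lazy_bin m) (x $ i)"
      by (rule lazy_bin_earlier[OF m0]) (use False R y in \<open>auto simp: not_less\<close>)
    finally show ?thesis .
  qed
  then have "ennreal ((1 - q) ^ CARD('d)) * ennreal (hk (n + J) x) \<le> ennreal (hk n x) + low n J (hk_th TYPE('d) n) x"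
    using walk_pos_compare_down[where K = "1 - q" and th = "hk_th TYPE('d) n" and J = J and n = n and x = x] R q0
    by simp
  then show ?thesis by (simp add: add.assoc[symmetric] add_increasing2)
qed

lemma hk_chapman: "(\<integral>\<^sup>+z. ennreal (hk s (z - x)) * ennreal (hk g (y - z)) \<partial>count_space UNIV) = ennreal (hk (s + g) (y - x))"
  for x y :: "int ^ 'd::finite"
proof -
  have tr: "pmf (map_pmf ((+) a) p) y = pmf p (y - a)" for a y :: "int ^ 'd" and p
    using pmf_map_inj'[of "(+) a" p "y - a"] by (simp add: inj_on_def)
  have "ennreal (hk (s + g) (y - x)) = (\<integral>\<^sup>+z. ennreal (hk g (y - x - z)) \<partial>walk_pos s)"
    by (simp add: walk_pos_add ennreal_pmf_bind tr)
  also have "\<dots> = (\<integral>\<^sup>+z. ennreal (hk s z) * ennreal (hk g (y - x - z)) \<partial>count_space UNIV)"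
    by (rule nn_integral_measure_pmf)
  also have "\<dots> = (\<integral>\<^sup>+z. ennreal (hk s (z - x)) * ennreal (hk g (y - z)) \<partial>count_space UNIV)"
    by (subst nn_integral_bij_count_space[of "\<lambda>z. z - x" UNIV UNIV, symmetric])
      (auto intro!: bij_betwI[where g = "\<lambda>z. z + x"])
  finally show ?thesis ..
qed

section \<open>Traces of the walk\<close>

text \<open>The set of the first \<open>n\<close> positions together with position number
  \<open>n\<close>, which is not in the set by default. So the traces of consecutive periods
  concatenate, and period \<open>L\<close> matches the \<open>L\<close> points of a trajectory of
  range \<open>L\<close>.\<close>

primrec walk_trace :: "nat \<Rightarrow> int ^ 'd::finite \<Rightarrow> ((int ^ 'd) set \<times> (int ^ 'd)) pmf" where
  "walk_trace 0 x = return_pmf ({}, x)"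
| "walk_trace (Suc n) x = bind_pmf lazy_step (\<lambda>e. map_pmf (\<lambda>w. (insert x (fst w), snd w)) (walk_trace n (x + e)))"

lemma map_snd_walk_trace: "map_pmf snd (walk_trace n x) = map_pmf ((+) x) (walk_pos n)"
proof -
  have eq: "(\<lambda>y. x + (e + y)) = (+) (x + e)" for x e :: "int ^ 'd" by (auto simp: add.assoc)
  show ?thesis
    by (induction n arbitrary: x) (simp_all add: map_bind_pmf pmf.map_comp o_def eq)
qed

lemma walk_trace_add:
  "walk_trace (m + n) x = bind_pmf (walk_trace m x) (\<lambda>w. map_pmf (\<lambda>v. (fst w \<union> fst v, snd v)) (walk_trace n (snd w)))"
  by (induction m arbitrary: x)
    (simp_all add: map_bind_pmf bind_assoc_pmf bind_map_pmf pmf.map_comp o_def bind_return_pmf)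

lemma finite_set_walk_pos: "finite (set_pmf (walk_pos n :: (int ^ 'd::finite) pmf))"
proof -
  have "finite (set_pmf (lazy_step :: (int ^ 'd) pmf))"
    by (simp add: lazy_step_coord coord_step_def)
  then show ?thesis by (induction n) auto
qed

lemma measurable_path: "(\<lambda>\<xi> n. x + (\<Sum>k<n. \<xi> k)) \<in> PiM UNIV (\<lambda>_::nat. measure_pmf (lazy_step :: (int ^ 'd::finite) pmf)) \<rightarrow>\<^sub>M trajectories"
  unfolding trajectories_def
proof (rule measurable_PiM_single')
  fix n :: nat
  have "(\<lambda>\<xi>. \<xi> m) \<in> PiM UNIV (\<lambda>_::nat. measure_pmf (lazy_step :: (int ^ 'd) pmf)) \<rightarrow>\<^sub>M count_space UNIV" for m
    using measurable_component_singleton[of m UNIV "\<lambda>_. measure_pmf (lazy_step :: (int ^ 'd) pmf)"]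
    by (simp cong: measurable_cong_sets)
  then have "(\<lambda>\<xi>. (\<Sum>k<m. \<xi> k)) \<in> PiM UNIV (\<lambda>_::nat. measure_pmf (lazy_step :: (int ^ 'd) pmf)) \<rightarrow>\<^sub>M count_space UNIV" for m
  proof (induction m)
    case (Suc m)
    then show ?case
      using measurable_compose_countable[OF _ Suc.IH, of "\<lambda>a \<xi>. a + \<xi> m"] by simp
  qed simp
  from measurable_compose[OF this, of "\<lambda>y. x + y"]
  show "(\<lambda>\<xi>. x + (\<Sum>k<n. \<xi> k)) \<in> PiM UNIV (\<lambda>_::nat. measure_pmf lazy_step) \<rightarrow>\<^sub>M count_space UNIV"
    by simp
qed auto

lemma measurable_trajectory_prefix:
  "(\<lambda>w :: 'd::finite trajectory. \<phi> (w ` {0..<n}) (w n)) \<in> trajectories \<rightarrow>\<^sub>M count_space UNIV"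
proof -
  have [measurable]: "(\<lambda>w :: 'd trajectory. w k) \<in> trajectories \<rightarrow>\<^sub>M count_space UNIV" for k
    unfolding trajectories_def by simp
  have "(\<lambda>w :: 'd trajectory. map w [0..<n]) \<in> trajectories \<rightarrow>\<^sub>M count_space UNIV" for n
  proof (induction n)
    case (Suc n)
    have "(\<lambda>w :: 'd trajectory. map w [0..<n] @ [w n]) \<in> trajectories \<rightarrow>\<^sub>M count_space UNIV"
      using measurable_compose_countable[OF _ Suc.IH, of "\<lambda>a w. a @ [w n]"] by simp
    then show ?case by simp
  qed simp
  from measurable_compose[OF this[of "Suc n"], of "\<lambda>l. \<phi> (set (butlast l)) (last l)"]
  show ?thesis by simp
qed

text \<open>The bridge from path space to discrete laws: the first step is split off the i.i.d.
  sequence by \<open>PiM_iter\<close>, exactly as in the recursion of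
  \<open>walk_trace\<close>.\<close>

lemma nn_integral_lazy_walk:
  "(\<integral>\<^sup>+w. \<phi> (w ` {0..<n}, w n) \<partial>lazy_walk x) = (\<integral>\<^sup>+z. \<phi> z \<partial>walk_trace n x)"
  for \<phi> :: "_ \<Rightarrow> ennreal" and x :: "int ^ 'd::finite"
proof (induction n arbitrary: x \<phi>)
  case 0
  interpret prob_space "lazy_walk x" by (rule prob_space_lazy_walk)
  interpret S: product_prob_space "\<lambda>_::nat. measure_pmf (lazy_step :: (int ^ 'd) pmf)" UNIV by unfold_locales
  have "(\<integral>\<^sup>+w. \<phi> (w ` {0..<0}, w 0) \<partial>lazy_walk x) = (\<integral>\<^sup>+\<xi>. \<phi> ({}, x) \<partial>PiM UNIV (\<lambda>_::nat. measure_pmf (lazy_step :: (int ^ 'd) pmf)))"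
    unfolding lazy_walk_def
    by (subst nn_integral_distr[OF measurable_path])
      (use measurable_compose[OF measurable_trajectory_prefix[of Pair 0], of \<phi>] in auto)
  also have "\<dots> = \<phi> ({}, x)" by (simp add: S.emeasure_space_1)
  finally show ?case by simp
next
  case (Suc n)
  let ?M = "measure_pmf (lazy_step :: (int ^ 'd) pmf)"
  interpret sequence_space ?M by unfold_locales
  let ?f = "\<lambda>x \<xi> n. x + (\<Sum>k<n. \<xi> k) :: int ^ 'd"
  have m: "(\<lambda>w :: 'd trajectory. \<psi> (w ` {0..<k}, w k)) \<in> borel_measurable trajectories" for \<psi> :: "_ \<Rightarrow> ennreal" and k
    using measurable_compose[OF measurable_trajectory_prefix[of Pair k], of \<psi>] by auto
  have mf: "(\<lambda>\<xi>. \<psi> (?f y \<xi> ` {0..<k}, ?f y \<xi> k)) \<in> borel_measurable S" for \<psi> :: "_ \<Rightarrow> ennreal" and k y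
    by (rule measurable_compose[OF measurable_path m[of \<psi> k], of y])
  have walk: "(\<integral>\<^sup>+w. \<psi> (w ` {0..<k}, w k) \<partial>lazy_walk y) = (\<integral>\<^sup>+\<xi>. \<psi> (?f y \<xi> ` {0..<k}, ?f y \<xi> k) \<partial>S)" for \<psi> :: "_ \<Rightarrow> ennreal" and k y
    unfolding lazy_walk_def by (subst nn_integral_distr[OF measurable_path]) (simp_all add: m)
  have fs: "?f x (case_nat e \<xi>) (Suc k) = ?f (x + e) \<xi> k" for e \<xi> k
    by (simp only: sum.lessThan_Suc_shift) (simp add: add.assoc)
  have im: "?f x (case_nat e \<xi>) ` {0..<Suc n} = insert x (?f (x + e) \<xi> ` {0..<n})" for e \<xi>
  proof -
    have "{0..<Suc n} = insert 0 (Suc ` {0..<n})" by (auto simp: image_iff less_Suc_eq_0_disj)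
    then show ?thesis by (simp only: image_insert image_image fs) simp
  qed
  have meas: "(\<lambda>(e, \<xi>). case_nat e \<xi>) \<in> ?M \<Otimes>\<^sub>M S \<rightarrow>\<^sub>M S" by measurable
  have "(\<integral>\<^sup>+w. \<phi> (w ` {0..<Suc n}, w (Suc n)) \<partial>lazy_walk x) = (\<integral>\<^sup>+\<xi>. \<phi> (?f x \<xi> ` {0..<Suc n}, ?f x \<xi> (Suc n)) \<partial>distr (?M \<Otimes>\<^sub>M S) S (\<lambda>(e, \<xi>). case_nat e \<xi>))"
    unfolding walk PiM_iter ..
  also have "\<dots> = (\<integral>\<^sup>+p. \<phi> (insert x (?f (x + fst p) (snd p) ` {0..<n}), ?f (x + fst p) (snd p) n) \<partial>(?M \<Otimes>\<^sub>M S))"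
    by (subst nn_integral_distr[OF meas]) (simp_all only: measurable_distr_eq1 mf, simp only: case_prod_unfold im fs)
  also have "\<dots> = (\<integral>\<^sup>+e. \<integral>\<^sup>+\<xi>. \<phi> (insert x (?f (x + e) \<xi> ` {0..<n}), ?f (x + e) \<xi> n) \<partial>S \<partial>?M)"
  proof (subst P.nn_integral_fst[symmetric])
    have "(\<lambda>p. \<phi> (?f x (case_nat (fst p) (snd p)) ` {0..<Suc n}, ?f x (case_nat (fst p) (snd p)) (Suc n))) \<in> borel_measurable (?M \<Otimes>\<^sub>M S)"
      using measurable_compose[OF meas mf[of \<phi> x "Suc n"]] by (simp add: case_prod_unfold)
    then show "(\<lambda>p. \<phi> (insert x (?f (x + fst p) (snd p) ` {0..<n}), ?f (x + fst p) (snd p) n)) \<in> borel_measurable (?M \<Otimes>\<^sub>M S)"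
      by (simp only: im fs)
  qed simp
  also have "\<dots> = (\<integral>\<^sup>+e. \<integral>\<^sup>+w. \<phi> (insert x (w ` {0..<n}), w n) \<partial>lazy_walk (x + e) \<partial>?M)"
    using walk[of _ "\<lambda>z. \<phi> (insert x (fst z), snd z)" n] by simp
  also have "\<dots> = (\<integral>\<^sup>+z. \<phi> z \<partial>walk_trace (Suc n) x)"
    using Suc.IH[where \<phi> = "\<lambda>z. \<phi> (insert x (fst z), snd z)"] by simp
  finally show ?case .
qed

lemma distr_lazy_walk: "distr (lazy_walk x) (count_space UNIV) (\<lambda>w. w n) = measure_pmf (map_pmf ((+) x) (walk_pos n))"
  for x :: "int ^ 'd::finite"
proof (rule measure_eqI)
  have m: "(\<lambda>w. w n) \<in> lazy_walk x \<rightarrow>\<^sub>M count_space UNIV"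
    using measurable_trajectory_prefix[of "\<lambda>A y. y" n] by (subst measurable_cong_sets[OF sets_lazy_walk refl])
  fix A :: "(int ^ 'd) set"
  have "emeasure (distr (lazy_walk x) (count_space UNIV) (\<lambda>w. w n)) A = (\<integral>\<^sup>+y. indicator A y \<partial>distr (lazy_walk x) (count_space UNIV) (\<lambda>w. w n))"
    by simp
  also have "\<dots> = (\<integral>\<^sup>+w. indicator A (w n) \<partial>lazy_walk x)"
    by (rule nn_integral_distr[OF m]) simp
  also have "\<dots> = (\<integral>\<^sup>+y. indicator A y \<partial>map_pmf snd (walk_trace n x))"
    using nn_integral_lazy_walk[where \<phi> = "\<lambda>z. indicator A (snd z)" and n = n and x = x] by simp
  also have "\<dots> = emeasure (map_pmf ((+) x) (walk_pos n)) A"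
    unfolding map_snd_walk_trace by (rule nn_integral_indicator) simp
  finally show "emeasure (distr (lazy_walk x) (count_space UNIV) (\<lambda>w. w n)) A = emeasure (map_pmf ((+) x) (walk_pos n)) A" .
qed simp

lemma walk_op_pmf: "walk_op n f x = (\<integral>y. f (x + y) \<partial>walk_pos n)" for x :: "int ^ 'd::finite"
proof -
  have m: "(\<lambda>w. w n) \<in> lazy_walk x \<rightarrow>\<^sub>M count_space UNIV"
    using measurable_trajectory_prefix[of "\<lambda>A y. y" n] by (subst measurable_cong_sets[OF sets_lazy_walk refl])
  have "walk_op n f x = (\<integral>y. f y \<partial>distr (lazy_walk x) (count_space UNIV) (\<lambda>w. w n))"
    unfolding walk_op_def by (rule integral_distr[OF m, symmetric]) simp
  then show ?thesis by (simp add: distr_lazy_walk)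
qed

lemma walk_op_nonneg: "(\<And>x. 0 \<le> f x) \<Longrightarrow> 0 \<le> walk_op n f x"
  by (simp add: walk_op_pmf)

text \<open>By symmetry of the kernel the operator also evolves densities forward: the right side is
  the density at \<open>y\<close> of walkers released with density \<open>f\<close> after
  \<open>n\<close> steps.\<close>

lemma ennreal_walk_op:
  fixes y :: "int ^ 'd::finite"
  assumes "\<And>x. 0 \<le> f x"
  shows "ennreal (walk_op n f y) = (\<integral>\<^sup>+x. ennreal (f x) * ennreal (hk n (y - x)) \<partial>count_space UNIV)"
proof -
  have "ennreal (walk_op n f y) = (\<integral>\<^sup>+x. ennreal (f (y + x)) \<partial>walk_pos n)"
    unfolding walk_op_pmf using assms
    by (intro nn_integral_eq_integral[symmetric] integrable_measure_pmf_finite finite_set_walk_pos) auto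
  also have "\<dots> = (\<integral>\<^sup>+x. ennreal (hk n x) * ennreal (f (y + x)) \<partial>count_space UNIV)"
    by (rule nn_integral_measure_pmf)
  also have "\<dots> = (\<integral>\<^sup>+x. ennreal (hk n (x - y)) * ennreal (f x) \<partial>count_space UNIV)"
    by (subst nn_integral_bij_count_space[of "\<lambda>z. z - y" UNIV UNIV, symmetric])
      (auto intro!: bij_betwI[where g = "\<lambda>z. z + y"])
  also have "\<dots> = (\<integral>\<^sup>+x. ennreal (f x) * ennreal (hk n (y - x)) \<partial>count_space UNIV)"
  proof -
    have "hk n (x - y) = hk n (y - x)" for x using hk_minus[of n "x - y"] by simp
    then show ?thesis by (simp add: mult.commute)
  qed
  finally show ?thesis .
qed

section \<open>Poisson point processes\<close>

definition poisson_prob :: "real \<Rightarrow> nat \<Rightarrow> real" where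
  "poisson_prob p k = p ^ k / fact k * exp (- p)"

text \<open>The multinomial probability that of \<open>r\<close> independent points exactly
  \<open>k j\<close> fall into the \<open>j\<close>-th of several disjoint sets with masses
  \<open>p j\<close>, the others falling outside.\<close>

definition hit_prob :: "('j \<Rightarrow> real) \<Rightarrow> 'j set \<Rightarrow> nat \<Rightarrow> ('j \<Rightarrow> nat) \<Rightarrow> real" where
  "hit_prob p J r k = (if sum k J \<le> r then fact r / fact (r - sum k J) * (1 - sum p J) ^ (r - sum k J) *
     (\<Prod>j\<in>J. p j ^ k j / fact (k j)) else 0)"

text \<open>Conditioning on where the first point falls: outside all sets, or in set
  \<open>i\<close>, which then has one count less to reach.\<close>

lemma hit_prob_Suc:
  assumes J: "finite J"
  shows "hit_prob p J (Suc r) k = (1 - sum p J) * hit_prob p J r k +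
    (\<Sum>i\<in>J. p i * (if k i = 0 then 0 else hit_prob p J r (k(i := k i - 1))))"
proof -
  define K where "K = sum k J"
  define A where "A = (\<Prod>j\<in>J. p j ^ k j / fact (k j))"
  define P where "P = 1 - sum p J"
  have tm: "p i * (if k i = 0 then 0 else hit_prob p J r (k(i := k i - 1))) =
      (if K \<le> Suc r then real (k i) * (fact r / fact (Suc r - K) * P ^ (Suc r - K) * A) else 0)" if i: "i \<in> J" for i
  proof (cases "k i = 0")
    case False
    have "sum (k(i := k i - 1)) J = (k i - 1) + sum (k(i := k i - 1)) (J - {i})" using sum.remove[OF J i, of "k(i := k i - 1)"] by simp
    also have "sum (k(i := k i - 1)) (J - {i}) = sum k (J - {i})" by (intro sum.cong) auto
    finally have K: "sum (k(i := k i - 1)) J = K - 1" "K \<ge> 1" using False sum.remove[OF J i, of k] by (auto simp: K_def)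
    let ?k = "k(i := k i - 1)"
    have "(\<Prod>j\<in>J. p j ^ ?k j / fact (?k j)) = p i ^ (k i - 1) / fact (k i - 1) * (\<Prod>j\<in>J - {i}. p j ^ ?k j / fact (?k j))"
      using prod.remove[OF J i, of "\<lambda>j. p j ^ ?k j / fact (?k j)"] by simp
    also have "(\<Prod>j\<in>J - {i}. p j ^ ?k j / fact (?k j)) = (\<Prod>j\<in>J - {i}. p j ^ k j / fact (k j))"
      by (intro prod.cong) auto
    finally have "p i * (\<Prod>j\<in>J. p j ^ ?k j / fact (?k j)) = p i ^ Suc (k i - 1) / fact (k i - 1) * (\<Prod>j\<in>J - {i}. p j ^ k j / fact (k j))"
      by simp
    also have "p i ^ Suc (k i - 1) / fact (k i - 1) = real (k i) * (p i ^ k i / fact (k i))"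
      using False by (simp add: fact_reduce[of "k i"])
    also have "real (k i) * (p i ^ k i / fact (k i)) * (\<Prod>j\<in>J - {i}. p j ^ k j / fact (k j)) = real (k i) * A"
      unfolding A_def by (subst prod.remove[OF J i]) simp
    finally have A: "p i * (\<Prod>j\<in>J. p j ^ ?k j / fact (?k j)) = real (k i) * A" .
    have "r - (K - 1) = Suc r - K" "K - 1 \<le> r \<longleftrightarrow> K \<le> Suc r" using K by auto
    then have "p i * hit_prob p J r ?k = (if K \<le> Suc r then fact r / fact (Suc r - K) * P ^ (Suc r - K) *
        (p i * (\<Prod>j\<in>J. p j ^ ?k j / fact (?k j))) else 0)"
      unfolding hit_prob_def K P_def by simp
    then show ?thesis using False unfolding A by simp
  qed auto
  have "(\<Sum>i\<in>J. p i * (if k i = 0 then 0 else hit_prob p J r (k(i := k i - 1)))) =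
     (\<Sum>i\<in>J. if K \<le> Suc r then real (k i) * (fact r / fact (Suc r - K) * P ^ (Suc r - K) * A) else 0)"
    by (intro sum.cong tm refl)
  also have "\<dots> = (if K \<le> Suc r then real K * (fact r / fact (Suc r - K) * P ^ (Suc r - K) * A) else 0)"
  proof -
    have "(\<Sum>i\<in>J. real (k i) * c) = real K * c" for c by (simp add: K_def sum_distrib_right)
    then show ?thesis by (cases "K \<le> Suc r") (simp_all only: if_True if_False sum.neutral_const)
  qed
  finally have S: "(\<Sum>i\<in>J. p i * (if k i = 0 then 0 else hit_prob p J r (k(i := k i - 1)))) =
      (if K \<le> Suc r then real K * (fact r / fact (Suc r - K) * P ^ (Suc r - K) * A) else 0)" .
  have h: "hit_prob p J n k = (if K \<le> n then fact n / fact (n - K) * P ^ (n - K) * A else 0)" for n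
    by (simp add: hit_prob_def K_def P_def A_def)
  consider "K \<le> r" | "K = Suc r" | "Suc r < K" by linarith
  then show ?thesis
  proof cases
    case 1
    then obtain s where r: "r = K + s" using le_Suc_ex by blast
    have "P * (fact r / fact s * P ^ s * A) + real K * (fact r / fact (Suc s) * P ^ Suc s * A)
       = (fact r / fact (Suc s) * P ^ Suc s * A) * (real (Suc s) + real K)"
      by (simp add: field_simps del: of_nat_Suc)
    also have "real (Suc s) + real K = real (Suc r)" by (simp add: r)
    finally show ?thesis unfolding S h P_def[symmetric] using 1 by (simp add: r)
  next
    case 2
    then show ?thesis unfolding S h P_def[symmetric] by simp
  next
    case 3
    then show ?thesis unfolding S h P_def[symmetric] by simp
  qed
qed

lemma hit_prob_nonneg:
  "(\<And>j. j \<in> J \<Longrightarrow> 0 \<le> p j) \<Longrightarrow> sum p J \<le> 1 \<Longrightarrow> 0 \<le> hit_prob p J r k"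
  by (auto simp: hit_prob_def intro!: divide_nonneg_nonneg mult_nonneg_nonneg prod_nonneg zero_le_power)

definition hits :: "'a set \<Rightarrow> nat \<Rightarrow> (nat \<Rightarrow> 'a) \<Rightarrow> nat" where
  "hits A r e = (\<Sum>i<r. of_bool (e i \<in> A))"

context sequence_space
begin

lemma measurable_hits[measurable]: "A \<in> sets M \<Longrightarrow> hits A r \<in> S \<rightarrow>\<^sub>M count_space UNIV"
proof -
  assume [measurable]: "A \<in> sets M"
  show "hits A r \<in> S \<rightarrow>\<^sub>M count_space UNIV" unfolding hits_def by measurable
qed

lemma sum_measure_le_1:
  assumes J: "finite J" "\<And>j. j \<in> J \<Longrightarrow> D j \<in> sets M" "disjoint_family_on D J"
  shows "(\<Sum>j\<in>J. measure M (D j)) \<le> 1" "measure M (space M - (\<Union>j\<in>J. D j)) = 1 - (\<Sum>j\<in>J. measure M (D j))"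
proof -
  have "(\<Sum>j\<in>J. measure M (D j)) = measure M (\<Union>j\<in>J. D j)"
    using J by (intro M.finite_measure_finite_Union[symmetric]) auto
  moreover have "measure M (space M - (\<Union>j\<in>J. D j)) = 1 - measure M (\<Union>j\<in>J. D j)"
    using J by (intro M.prob_compl) auto
  ultimately show "(\<Sum>j\<in>J. measure M (D j)) \<le> 1" "measure M (space M - (\<Union>j\<in>J. D j)) = 1 - (\<Sum>j\<in>J. measure M (D j))"
    by auto
qed

lemma emeasure_hits:
  assumes J: "finite J" "\<And>j. j \<in> J \<Longrightarrow> D j \<in> sets M" "disjoint_family_on D J"
  shows "emeasure S {e\<in>space S. \<forall>j\<in>J. hits (D j) r e = k j} = ennreal (hit_prob (\<lambda>j. measure M (D j)) J r k)"
proof (induction r arbitrary: k)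
  case 0
  have S: "sum k J = 0 \<longleftrightarrow> (\<forall>j\<in>J. k j = 0)" using J by simp
  show ?case
  proof (cases "\<forall>j\<in>J. k j = 0")
    case True
    then have "{e\<in>space S. \<forall>j\<in>J. hits (D j) 0 e = k j} = space S" by (auto simp: hits_def)
    moreover have "hit_prob (\<lambda>j. measure M (D j)) J 0 k = 1" using True S by (simp add: hit_prob_def)
    ultimately show ?thesis by (simp add: P.emeasure_space_1)
  next
    case False
    then have *: "{e\<in>space S. \<forall>j\<in>J. hits (D j) 0 e = k j} = {}" by (auto simp: hits_def)
    show ?thesis unfolding * using False S by (simp add: hit_prob_def)
  qed
next
  case (Suc r)
  let ?p = "\<lambda>j. measure M (D j)" and ?X = "\<lambda>r k. {e\<in>space S. \<forall>j\<in>J. hits (D j) r e = k j}"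
  have [measurable]: "?X r k \<in> sets S" for r k
    using J by (intro sets.sets_Collect_finite_All) (auto intro!: measurable_sets_Collect[OF measurable_hits])
  let ?C = "space M - (\<Union>j\<in>J. D j)" and ?q = "\<lambda>i. if k i = 0 then 0 else hit_prob ?p J r (k(i := k i - 1))"
  have hS: "hits A (Suc r) (case_nat a e) = of_bool (a \<in> A) + hits A r e" for A :: "'a set" and a e
    unfolding hits_def sum.lessThan_Suc_shift by simp
  have sp: "case_nat a e \<in> space S \<longleftrightarrow> a \<in> space M \<and> e \<in> space S" for a e
    by (auto simp: space_PiM PiE_def Pi_iff extensional_def split: nat.splits dest: spec[of _ "Suc _"] spec[of _ 0])
  have sec: "emeasure S {e\<in>space S. case_nat a e \<in> ?X (Suc r) k} =
     ennreal (hit_prob ?p J r k) * indicator ?C a + (\<Sum>i\<in>J. ennreal (?q i) * indicator (D i) a)" if a: "a \<in> space M" for a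
  proof (cases "\<exists>i\<in>J. a \<in> D i")
    case False
    then have "{e\<in>space S. case_nat a e \<in> ?X (Suc r) k} = ?X r k"
      using a by (auto simp: hS sp)
    then show ?thesis using False a by (simp add: Suc.IH)
  next
    case True
    then obtain i where i: "i \<in> J" "a \<in> D i" by auto
    have other: "a \<notin> D j" if "j \<in> J" "j \<noteq> i" for j using J(3) i that by (auto simp: disjoint_family_on_def)
    have "(\<Sum>j\<in>J. ennreal (?q j) * indicator (D j) a) = (\<Sum>j\<in>{i}. ennreal (?q j) * indicator (D j) a)"
      using i other J(1) by (intro sum.mono_neutral_right) auto
    also have "\<dots> = ennreal (?q i) * indicator (D i) a" by (subst sum.insert) (simp_all only: finite.emptyI empty_iff not_False_eq_True sum.empty add_0_right)
    finally have s1: "(\<Sum>j\<in>J. ennreal (?q j) * indicator (D j) a) = ennreal (?q i) * indicator (D i) a" .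
    have ic: "indicator ?C a = (0::ennreal)" "indicator (D i) a = (1::ennreal)" using i by (auto simp: indicator_def)
    have rhs: "ennreal (hit_prob ?p J r k) * indicator ?C a + (\<Sum>i\<in>J. ennreal (?q i) * indicator (D i) a) = ennreal (?q i)"
      unfolding s1 ic by (simp only: mult_zero_right mult_1_right add_0_left)
    have e1: "{e\<in>space S. case_nat a e \<in> ?X (Suc r) k} = (if k i = 0 then {} else ?X r (k(i := k i - 1)))"
    proof (cases "k i = 0")
      case True
      then show ?thesis using i by (auto simp: hS sp intro!: bexI[of _ i])
    next
      case False
      have "of_bool (a \<in> D j) + hits (D j) r e = k j \<longleftrightarrow> hits (D j) r e = (k(i := k i - 1)) j" if "j \<in> J" for j e
        using other[OF that] i False by (cases "j = i") auto
      then show ?thesis using False a by (auto simp: hS sp)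
    qed
    show ?thesis unfolding rhs unfolding e1 if_distrib[of "emeasure S"] if_distrib[of ennreal] Suc.IH emeasure_empty ennreal_0 ..
  qed
  have meas: "(\<lambda>(s, \<omega>). case_nat s \<omega>) \<in> M \<Otimes>\<^sub>M S \<rightarrow>\<^sub>M S" by measurable
  have "emeasure S (?X (Suc r) k) = emeasure (distr (M \<Otimes>\<^sub>M S) S (\<lambda>(s, \<omega>). case_nat s \<omega>)) (?X (Suc r) k)"
    unfolding PiM_iter ..
  also have "\<dots> = emeasure (M \<Otimes>\<^sub>M S) ((\<lambda>(s, \<omega>). case_nat s \<omega>) -` ?X (Suc r) k \<inter> space (M \<Otimes>\<^sub>M S))"
    by (rule emeasure_distr[OF meas]) measurable
  also have "\<dots> = (\<integral>\<^sup>+a. emeasure S (Pair a -` ((\<lambda>(s, \<omega>). case_nat s \<omega>) -` ?X (Suc r) k \<inter> space (M \<Otimes>\<^sub>M S))) \<partial>M)"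
    by (rule P.emeasure_pair_measure_alt, rule measurable_sets[OF meas]) measurable
  also have "\<dots> = (\<integral>\<^sup>+a. ennreal (hit_prob ?p J r k) * indicator ?C a + (\<Sum>i\<in>J. ennreal (?q i) * indicator (D i) a) \<partial>M)"
  proof (intro nn_integral_cong)
    fix a assume a: "a \<in> space M"
    have "Pair a -` ((\<lambda>(s, \<omega>). case_nat s \<omega>) -` ?X (Suc r) k \<inter> space (M \<Otimes>\<^sub>M S)) = {e\<in>space S. case_nat a e \<in> ?X (Suc r) k}"
      using a by (auto simp: space_pair_measure)
    then show "emeasure S (Pair a -` ((\<lambda>(s, \<omega>). case_nat s \<omega>) -` ?X (Suc r) k \<inter> space (M \<Otimes>\<^sub>M S))) =
       ennreal (hit_prob ?p J r k) * indicator ?C a + (\<Sum>i\<in>J. ennreal (?q i) * indicator (D i) a)"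
      using sec[OF a] by simp
  qed
  also have "\<dots> = ennreal (hit_prob ?p J r k) * emeasure M ?C + (\<Sum>i\<in>J. ennreal (?q i) * emeasure M (D i))"
  proof -
    have C: "?C \<in> sets M" using J by auto
    have "(\<integral>\<^sup>+a. c * indicator ?C a + (\<Sum>i\<in>J. b i * indicator (D i) a) \<partial>M) = c * emeasure M ?C + (\<Sum>i\<in>J. b i * emeasure M (D i))" for c b
    proof -
      have "(\<integral>\<^sup>+a. c * indicator ?C a + (\<Sum>i\<in>J. b i * indicator (D i) a) \<partial>M) =
        (\<integral>\<^sup>+a. c * indicator ?C a \<partial>M) + (\<integral>\<^sup>+a. (\<Sum>i\<in>J. b i * indicator (D i) a) \<partial>M)"
        using J(2) C by (intro nn_integral_add borel_measurable_sum borel_measurable_times_ennreal borel_measurable_const borel_measurable_indicator)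
      also have "(\<integral>\<^sup>+a. (\<Sum>i\<in>J. b i * indicator (D i) a) \<partial>M) = (\<Sum>i\<in>J. \<integral>\<^sup>+a. b i * indicator (D i) a \<partial>M)"
        using J(2) by (intro nn_integral_sum borel_measurable_times_ennreal borel_measurable_const borel_measurable_indicator)
      also have "\<dots> = (\<Sum>i\<in>J. b i * emeasure M (D i))"
        using J(2) by (intro sum.cong refl nn_integral_cmult_indicator)
      also have "(\<integral>\<^sup>+a. c * indicator ?C a \<partial>M) = c * emeasure M ?C" by (rule nn_integral_cmult_indicator[OF C])
      finally show ?thesis .
    qed
    then show ?thesis .
  qed
  also have "\<dots> = ennreal (hit_prob ?p J r k) * ennreal (1 - sum ?p J) + (\<Sum>i\<in>J. ennreal (?q i) * ennreal (?p i))"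
    using sum_measure_le_1[OF J] by (simp add: M.emeasure_eq_measure)
  also have "\<dots> = ennreal (hit_prob ?p J r k * (1 - sum ?p J) + (\<Sum>i\<in>J. ?q i * ?p i))"
    using sum_measure_le_1[OF J] hit_prob_nonneg[of J ?p]
    by (subst ennreal_plus) (auto simp: ennreal_mult sum_ennreal[symmetric] intro!: sum_nonneg mult_nonneg_nonneg)
  also have "hit_prob ?p J r k * (1 - sum ?p J) + (\<Sum>i\<in>J. ?q i * ?p i) = hit_prob ?p J (Suc r) k"
    unfolding hit_prob_Suc[OF J(1)] by (simp add: mult.commute)
  finally show ?case .
qed

text \<open>With a Poisson number of points the multinomial counts become independent: the power of
  the outside mass sums to an exponential that splits over the sets.\<close>

lemma emeasure_poisson_hits:
  assumes J: "finite J" "\<And>j. j \<in> J \<Longrightarrow> D j \<in> sets M" "disjoint_family_on D J"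
  shows "emeasure (measure_pmf (poisson_pmf 1) \<Otimes>\<^sub>M S) {z\<in>space (measure_pmf (poisson_pmf 1) \<Otimes>\<^sub>M S). \<forall>j\<in>J. hits (D j) (fst z) (snd z) = k j}
     = ennreal (\<Prod>j\<in>J. poisson_prob (measure M (D j)) (k j))"
proof -
  let ?p = "\<lambda>j. measure M (D j)" and ?N = "measure_pmf (poisson_pmf 1)"
  have [measurable]: "(\<lambda>z. hits A (fst z) (snd z)) \<in> ?N \<Otimes>\<^sub>M S \<rightarrow>\<^sub>M count_space UNIV" if [measurable]: "A \<in> sets M" for A
    by (rule measurable_compose_countable[where f = "\<lambda>r z. hits A r (snd z)" and g = fst]) measurable
  let ?Y = "{z\<in>space (?N \<Otimes>\<^sub>M S). \<forall>j\<in>J. hits (D j) (fst z) (snd z) = k j}"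
  have Y: "?Y \<in> sets (?N \<Otimes>\<^sub>M S)"
    using J by (intro sets.sets_Collect_finite_All) (auto intro!: measurable_sets_Collect)
  have "emeasure (?N \<Otimes>\<^sub>M S) ?Y = (\<integral>\<^sup>+r. emeasure S (Pair r -` ?Y) \<partial>?N)"
    by (rule P.emeasure_pair_measure_alt[OF Y])
  also have "\<dots> = (\<integral>\<^sup>+r. ennreal (hit_prob ?p J r k) \<partial>?N)"
  proof (intro nn_integral_cong)
    fix r
    have "Pair r -` ?Y = {e\<in>space S. \<forall>j\<in>J. hits (D j) r e = k j}" by (auto simp: space_pair_measure)
    then show "emeasure S (Pair r -` ?Y) = ennreal (hit_prob ?p J r k)" using emeasure_hits[OF J] by simp
  qed
  also have "\<dots> = (\<Sum>r. ennreal (1 / fact r * exp (-1) * hit_prob ?p J r k))"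
    using sum_measure_le_1[OF J] hit_prob_nonneg[of J ?p]
    by (simp add: nn_integral_measure_pmf nn_integral_count_space_nat ennreal_mult[symmetric])
  also have "\<dots> = ennreal (\<Prod>j\<in>J. poisson_prob (?p j) (k j))"
  proof (rule suminf_ennreal_eq)
    show "0 \<le> 1 / fact r * exp (-1) * hit_prob ?p J r k" for r
      using sum_measure_le_1[OF J] hit_prob_nonneg[of J ?p] by simp
    let ?K = "sum k J" and ?P = "1 - sum ?p J" and ?A = "\<Prod>j\<in>J. ?p j ^ k j / fact (k j)"
    have "(\<lambda>s. ?P ^ s /\<^sub>R fact s * (exp (-1) * ?A)) sums (exp ?P * (exp (-1) * ?A))"
      by (intro sums_mult2 exp_converges)
    moreover have "?P ^ s /\<^sub>R fact s * (exp (-1) * ?A) = 1 / fact (s + ?K) * exp (-1) * hit_prob ?p J (s + ?K) k" for s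
      by (simp add: hit_prob_def scaleR_conv_of_real field_simps)
    ultimately have "(\<lambda>s. 1 / fact (s + ?K) * exp (-1) * hit_prob ?p J (s + ?K) k) sums (exp ?P * (exp (-1) * ?A))" by simp
    then have "(\<lambda>r. 1 / fact r * exp (-1) * hit_prob ?p J r k) sums (exp ?P * (exp (-1) * ?A))"
      by (subst (asm) sums_zero_iff_shift) (auto simp: hit_prob_def)
    moreover have "exp ?P * (exp (-1) * ?A) = (\<Prod>j\<in>J. poisson_prob (?p j) (k j))"
    proof -
      have "(\<Prod>j\<in>J. poisson_prob (?p j) (k j)) = ?A * exp (\<Sum>j\<in>J. - ?p j)"
        by (simp only: poisson_prob_def prod.distrib exp_sum[OF J(1)])
      moreover have "exp ?P * exp (-1) = exp (\<Sum>j\<in>J. - ?p j)" by (simp add: mult_exp_exp sum_negf)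
      ultimately show ?thesis by (simp add: mult_ac)
    qed
    ultimately show "(\<lambda>r. 1 / fact r * exp (-1) * hit_prob ?p J r k) sums (\<Prod>j\<in>J. poisson_prob (?p j) (k j))" by simp
  qed
  finally show ?thesis .
qed

end

lemma poisson_prob_nonneg: "0 \<le> p \<Longrightarrow> 0 \<le> poisson_prob p k"
  by (simp add: poisson_prob_def)

lemma poisson_prob_convolution:
  "(\<Sum>i\<le>k. poisson_prob p i * poisson_prob q (k - i)) = poisson_prob (p + q) k"
proof -
  have "(\<Sum>i\<le>k. poisson_prob p i * poisson_prob q (k - i)) = (\<Sum>i\<le>k. real (k choose i) * p ^ i * q ^ (k - i)) / fact k * exp (- (p + q))"
    unfolding sum_divide_distrib sum_distrib_right
    by (intro sum.cong refl) (simp add: poisson_prob_def binomial_fact exp_add exp_diff exp_minus field_simps)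
  then show ?thesis by (simp only: poisson_prob_def binomial_ring)
qed

text \<open>Distribution functions are preferred to point probabilities because the events decrease
  when points are added. The value 0 at an infinite mean says that there are almost surely
  infinitely many points.\<close>

definition poisson_cdf :: "ennreal \<Rightarrow> nat \<Rightarrow> real" where
  "poisson_cdf x k = (if x = \<infinity> then 0 else (\<Sum>i\<le>k. poisson_prob (enn2real x) i))"

lemma poisson_cdf_tendsto:
  assumes a: "\<And>n. 0 \<le> a n"
  shows "(\<lambda>m. \<Sum>i\<le>k. poisson_prob (\<Sum>n<m. a n) i) \<longlonglongrightarrow> poisson_cdf (\<Sum>n. ennreal (a n)) k"
proof (cases "(\<Sum>n. ennreal (a n)) = \<infinity>")
  case False
  then have sm: "summable a" using a by (intro summable_suminf_not_top) auto
  then have e: "enn2real (\<Sum>n. ennreal (a n)) = suminf a"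
    using a by (simp add: suminf_ennreal2 suminf_nonneg)
  have "(\<lambda>m. \<Sum>n<m. a n) \<longlonglongrightarrow> suminf a" using summable_LIMSEQ[OF sm] .
  then have "(\<lambda>m. \<Sum>i\<le>k. poisson_prob (\<Sum>n<m. a n) i) \<longlonglongrightarrow> (\<Sum>i\<le>k. poisson_prob (suminf a) i)"
    unfolding poisson_prob_def by (intro tendsto_intros) auto
  then show ?thesis using False e by (simp add: poisson_cdf_def)
next
  case True
  have "\<not> summable a"
    using True suminf_ennreal_eq[of a] a by (metis ennreal_neq_top infinity_ennreal_def summable_sums)
  have fl: "filterlim (\<lambda>m. \<Sum>n<m. a n) at_top sequentially"
  proof (rule ccontr)
    assume n: "\<not> filterlim (\<lambda>m. \<Sum>n<m. a n) at_top sequentially"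
    have mono: "incseq (\<lambda>m. \<Sum>n<m. a n)" using a by (intro incseq_SucI) simp
    from n obtain Z where Z: "\<not> eventually (\<lambda>m. Z \<le> (\<Sum>n<m. a n)) sequentially" by (auto simp: filterlim_at_top)
    have "(\<Sum>n<m. a n) \<le> Z" for m
    proof (rule ccontr)
      assume "\<not> (\<Sum>n<m. a n) \<le> Z"
      then have "\<forall>m'\<ge>m. Z \<le> (\<Sum>n<m'. a n)" using mono by (meson incseqD linorder_le_cases order_trans)
      then show False using Z by (auto simp: eventually_sequentially)
    qed
    then have "summable a" using a by (intro summableI_nonneg_bounded) auto
    then show False using \<open>\<not> summable a\<close> by simp
  qed
  have pz: "((\<lambda>y. poisson_prob y i) \<longlongrightarrow> 0) at_top" for i
  proof -
    have "((\<lambda>y::real. y ^ i / exp y) \<longlongrightarrow> 0) at_top" by (rule tendsto_power_div_exp_0)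
    from tendsto_mult[OF tendsto_const this]
    have "((\<lambda>y::real. (1 / fact i) * (y ^ i / exp y)) \<longlongrightarrow> (1 / fact i) * 0) at_top" .
    moreover have "(\<lambda>y. (1 / fact i) * (y ^ i / exp y)) = (\<lambda>y::real. poisson_prob y i)"
      by (auto simp: poisson_prob_def exp_minus field_simps)
    ultimately show ?thesis by simp
  qed
  have "((\<lambda>y. \<Sum>i\<le>k. poisson_prob y i) \<longlongrightarrow> (\<Sum>i\<le>k. 0)) at_top"
    by (intro tendsto_sum pz)
  from filterlim_compose[OF this fl] show ?thesis using True by (simp add: poisson_cdf_def)
qed

text \<open>The intensity is a sum of countably many probability measures; each of them contributes a piece,
  namely a Poisson number of independent points, and the pieces are strung together into one sequence.\<close>

context sequence_space
begin

abbreviation "piece \<equiv> measure_pmf (poisson_pmf 1) \<Otimes>\<^sub>M S"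

definition tot :: "(nat \<Rightarrow> 'a set) \<Rightarrow> nat \<Rightarrow> (nat \<Rightarrow> nat \<times> (nat \<Rightarrow> 'a)) \<Rightarrow> nat" where
  "tot D m \<omega> = (\<Sum>n<m. hits (D n) (fst (\<omega> n)) (snd (\<omega> n)))"

lemma measurable_piece_hits[measurable]:
  assumes [measurable]: "A \<in> sets M"
  shows "(\<lambda>z. hits A (fst z) (snd z)) \<in> piece \<rightarrow>\<^sub>M count_space UNIV"
  by (rule measurable_compose_countable[where f = "\<lambda>r z. hits A r (snd z)" and g = fst]) measurable

lemma prob_space_piece: "prob_space piece"
  by (rule prob_space_pair) (auto intro: measure_pmf.prob_space_axioms P.prob_space_axioms)

interpretation Pc: sequence_space piece
  by (intro sequence_space.intro product_prob_spaceI prob_space_piece)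

lemma measurable_tot[measurable]:
  assumes D: "\<And>n. D n \<in> sets M"
  shows "tot D m \<in> Pc.S \<rightarrow>\<^sub>M count_space UNIV"
proof -
  have comp: "(\<lambda>\<omega>. hits (D n) (fst (\<omega> n)) (snd (\<omega> n))) \<in> Pc.S \<rightarrow>\<^sub>M count_space UNIV" for n
    by (rule measurable_compose[OF measurable_component_singleton[of n] measurable_piece_hits[OF D[of n]]]) simp
  have "(\<lambda>\<omega>. \<Sum>n\<in>N. hits (D n) (fst (\<omega> n)) (snd (\<omega> n))) \<in> Pc.S \<rightarrow>\<^sub>M count_space UNIV" if "finite N" for N
    using that
  proof (induction N rule: finite_induct)
    case (insert n N)
    then show ?case
      using comp[of n] measurable_compose_countable[OF _ insert.IH, of "\<lambda>a \<omega>. hits (D n) (fst (\<omega> n)) (snd (\<omega> n)) + a"] by simp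
  qed simp
  then show ?thesis unfolding tot_def by simp
qed

text \<open>The first piece is split off and the counts are summed over all ways to divide
  \<open>k\<close> between it and the rest; the convolution identity for Poisson laws closes the
  induction.\<close>

lemma emeasure_tot:
  assumes J: "finite J" "\<And>n j. j \<in> J \<Longrightarrow> D j n \<in> sets M" "\<And>n. disjoint_family_on (\<lambda>j. D j n) J"
  shows "emeasure Pc.S {\<omega>\<in>space Pc.S. \<forall>j\<in>J. tot (D j) m \<omega> = k j} = ennreal (\<Prod>j\<in>J. poisson_prob (\<Sum>n<m. measure M (D j n)) (k j))"
  using J
proof (induction m arbitrary: D k)
  case 0
  show ?case
  proof (cases "\<forall>j\<in>J. k j = 0")
    case True
    then have "{\<omega>\<in>space Pc.S. \<forall>j\<in>J. tot (D j) 0 \<omega> = k j} = space Pc.S" by (auto simp: tot_def)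
    then show ?thesis using True by (simp add: Pc.P.emeasure_space_1 poisson_prob_def)
  next
    case False
    then obtain j where j: "j \<in> J" "k j \<noteq> 0" by auto
    have "(\<Prod>j\<in>J. poisson_prob (\<Sum>n<0. measure M (D j n)) (k j)) = 0"
      using j J(1) by (intro prod_zero bexI[of _ j]) (auto simp: poisson_prob_def)
    moreover have *: "{\<omega>\<in>space Pc.S. \<forall>j\<in>J. tot (D j) 0 \<omega> = k j} = {}" using j by (auto simp: tot_def)
    ultimately show ?thesis unfolding * by simp
  qed
next
  case (Suc m)
  note J = Suc.prems
  let ?h = "\<lambda>j z. hits (D j 0) (fst z) (snd z)" and ?D = "\<lambda>j n. D j (Suc n)" and ?q = "\<lambda>j. \<Sum>n<m. measure M (D j (Suc n))"
  let ?X = "{\<omega>\<in>space Pc.S. \<forall>j\<in>J. tot (D j) (Suc m) \<omega> = k j}"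
  let ?I = "PiE J (\<lambda>j. {..k j})"
  have fI: "finite ?I" using J by (intro finite_PiE) auto
  have [measurable]: "?X \<in> sets Pc.S"
    using J by (intro sets.sets_Collect_finite_All) (auto intro!: measurable_sets_Collect[OF measurable_tot])
  have hS: "tot (D j) (Suc m) (case_nat z \<omega>) = ?h j z + tot (?D j) m \<omega>" for j z \<omega>
    unfolding tot_def sum.lessThan_Suc_shift by simp
  have sp: "case_nat z \<omega> \<in> space Pc.S \<longleftrightarrow> z \<in> space piece \<and> \<omega> \<in> space Pc.S" for z \<omega>
    by (auto simp: space_PiM PiE_def Pi_iff extensional_def split: nat.splits dest: spec[of _ "Suc _"] spec[of _ 0])
  let ?H = "\<lambda>k'. {z\<in>space piece. \<forall>j\<in>J. ?h j z = k' j}"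
  have H[measurable]: "?H k' \<in> sets piece" for k'
    using J by (intro sets.sets_Collect_finite_All) (auto intro!: measurable_sets_Collect[OF measurable_piece_hits])
  let ?q' = "\<lambda>k'. \<Prod>j\<in>J. poisson_prob (?q j) (k j - k' j)"
  have sec: "emeasure Pc.S {\<omega>\<in>space Pc.S. case_nat z \<omega> \<in> ?X} = (\<Sum>k'\<in>?I. ennreal (?q' k') * indicator (?H k') z)" if z: "z \<in> space piece" for z
  proof (cases "\<forall>j\<in>J. ?h j z \<le> k j")
    case True
    let ?k = "restrict (\<lambda>j. ?h j z) J"
    have kI: "?k \<in> ?I" using True by auto
    have "k' = ?k" if "k' \<in> ?I" "z \<in> ?H k'" for k' using that by (intro PiE_ext[OF that(1) kI]) auto
    then have "(\<Sum>k'\<in>?I. ennreal (?q' k') * indicator (?H k') z) = (\<Sum>k'\<in>{?k}. ennreal (?q' k') * indicator (?H k') z)"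
      using kI fI by (intro sum.mono_neutral_right) (auto simp: indicator_def)
    also have "\<dots> = ennreal (?q' ?k)" using z by (auto simp: indicator_def)
    also have "?q' ?k = (\<Prod>j\<in>J. poisson_prob (?q j) (k j - ?h j z))" by (intro prod.cong) auto
    also have "ennreal \<dots> = emeasure Pc.S {\<omega>\<in>space Pc.S. \<forall>j\<in>J. tot (?D j) m \<omega> = k j - ?h j z}"
      using Suc.IH[of ?D "\<lambda>j. k j - ?h j z"] J by simp
    also have "{\<omega>\<in>space Pc.S. \<forall>j\<in>J. tot (?D j) m \<omega> = k j - ?h j z} = {\<omega>\<in>space Pc.S. case_nat z \<omega> \<in> ?X}"
    proof -
      have "tot (?D j) m \<omega> = k j - ?h j z \<longleftrightarrow> ?h j z + tot (?D j) m \<omega> = k j" if "j \<in> J" for j \<omega>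
        using True that by auto
      then show ?thesis using z by (auto simp: hS sp)
    qed
    finally show ?thesis ..
  next
    case False
    then obtain j where j: "j \<in> J" "\<not> ?h j z \<le> k j" by auto
    have "(\<Sum>k'\<in>?I. ennreal (?q' k') * indicator (?H k') z) = 0"
      using j by (intro sum.neutral) (force simp: indicator_def PiE_iff)
    moreover have *: "{\<omega>\<in>space Pc.S. case_nat z \<omega> \<in> ?X} = {}" using j by (force simp: hS sp)
    ultimately show ?thesis unfolding * by simp
  qed
  have meas: "(\<lambda>(s, \<omega>). case_nat s \<omega>) \<in> piece \<Otimes>\<^sub>M Pc.S \<rightarrow>\<^sub>M Pc.S" by measurable
  have "emeasure Pc.S ?X = emeasure (distr (piece \<Otimes>\<^sub>M Pc.S) Pc.S (\<lambda>(s, \<omega>). case_nat s \<omega>)) ?X"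
    unfolding Pc.PiM_iter ..
  also have "\<dots> = emeasure (piece \<Otimes>\<^sub>M Pc.S) ((\<lambda>(s, \<omega>). case_nat s \<omega>) -` ?X \<inter> space (piece \<Otimes>\<^sub>M Pc.S))"
    by (rule emeasure_distr[OF meas]) measurable
  also have "\<dots> = (\<integral>\<^sup>+a. emeasure Pc.S (Pair a -` ((\<lambda>(s, \<omega>). case_nat s \<omega>) -` ?X \<inter> space (piece \<Otimes>\<^sub>M Pc.S))) \<partial>piece)"
    by (rule Pc.P.emeasure_pair_measure_alt, rule measurable_sets[OF meas]) measurable
  also have "\<dots> = (\<integral>\<^sup>+z. (\<Sum>k'\<in>?I. ennreal (?q' k') * indicator (?H k') z) \<partial>piece)"
  proof (intro nn_integral_cong)
    fix a assume a: "a \<in> space piece"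
    have "Pair a -` ((\<lambda>(s, \<omega>). case_nat s \<omega>) -` ?X \<inter> space (piece \<Otimes>\<^sub>M Pc.S)) = {e\<in>space Pc.S. case_nat a e \<in> ?X}"
      using a by (auto simp: space_pair_measure)
    then show "emeasure Pc.S (Pair a -` ((\<lambda>(s, \<omega>). case_nat s \<omega>) -` ?X \<inter> space (piece \<Otimes>\<^sub>M Pc.S))) =
       (\<Sum>k'\<in>?I. ennreal (?q' k') * indicator (?H k') a)"
      using sec[OF a] by simp
  qed
  also have "\<dots> = (\<Sum>k'\<in>?I. ennreal (?q' k') * emeasure piece (?H k'))"
    by (subst nn_integral_sum) (auto simp: nn_integral_cmult)
  also have "\<dots> = (\<Sum>k'\<in>?I. ennreal (?q' k' * (\<Prod>j\<in>J. poisson_prob (measure M (D j 0)) (k' j))))"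
  proof (intro sum.cong refl)
    fix k' assume "k' \<in> ?I"
    have "emeasure piece (?H k') = ennreal (\<Prod>j\<in>J. poisson_prob (measure M (D j 0)) (k' j))"
      by (rule emeasure_poisson_hits) (use J in auto)
    then show "ennreal (?q' k') * emeasure piece (?H k') = ennreal (?q' k' * (\<Prod>j\<in>J. poisson_prob (measure M (D j 0)) (k' j)))"
      by (simp add: ennreal_mult prod_nonneg poisson_prob_nonneg sum_nonneg)
  qed
  also have "\<dots> = ennreal (\<Sum>k'\<in>?I. \<Prod>j\<in>J. poisson_prob (measure M (D j 0)) (k' j) * poisson_prob (?q j) (k j - k' j))"
    by (subst sum_ennreal) (auto simp: prod.distrib mult.commute intro!: mult_nonneg_nonneg prod_nonneg poisson_prob_nonneg sum_nonneg)
  also have "(\<Sum>k'\<in>?I. \<Prod>j\<in>J. poisson_prob (measure M (D j 0)) (k' j) * poisson_prob (?q j) (k j - k' j))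
     = (\<Prod>j\<in>J. \<Sum>i\<le>k j. poisson_prob (measure M (D j 0)) i * poisson_prob (?q j) (k j - i))"
    using J by (subst prod_sum_PiE[of J "\<lambda>j. {..k j}"]) auto
  also have "\<dots> = (\<Prod>j\<in>J. poisson_prob (\<Sum>n<Suc m. measure M (D j n)) (k j))"
    unfolding poisson_prob_convolution sum.lessThan_Suc_shift ..
  finally show ?case .
qed

lemma measure_tot_le:
  assumes J: "finite J" "\<And>n j. j \<in> J \<Longrightarrow> D j n \<in> sets M" "\<And>n. disjoint_family_on (\<lambda>j. D j n) J"
  shows "measure Pc.S {\<omega>\<in>space Pc.S. \<forall>j\<in>J. tot (D j) m \<omega> \<le> k j} = (\<Prod>j\<in>J. \<Sum>i\<le>k j. poisson_prob (\<Sum>n<m. measure M (D j n)) i)"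
proof -
  let ?I = "PiE J (\<lambda>j. {..k j})" and ?X = "\<lambda>k'. {\<omega>\<in>space Pc.S. \<forall>j\<in>J. tot (D j) m \<omega> = k' j}"
  have fI: "finite ?I" using J by (intro finite_PiE) auto
  have X[measurable]: "?X k' \<in> sets Pc.S" for k'
    using J by (intro sets.sets_Collect_finite_All) (auto intro!: measurable_sets_Collect[OF measurable_tot])
  have eq: "measure Pc.S (?X k') = (\<Prod>j\<in>J. poisson_prob (\<Sum>n<m. measure M (D j n)) (k' j))" for k'
    using emeasure_tot[OF J, where m = m and k = k'] by (simp add: measure_def prod_nonneg poisson_prob_nonneg sum_nonneg)
  have "{\<omega>\<in>space Pc.S. \<forall>j\<in>J. tot (D j) m \<omega> \<le> k j} = (\<Union>k'\<in>?I. ?X k')"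
  proof (intro set_eqI iffI)
    fix \<omega> assume "\<omega> \<in> {\<omega>\<in>space Pc.S. \<forall>j\<in>J. tot (D j) m \<omega> \<le> k j}"
    then show "\<omega> \<in> (\<Union>k'\<in>?I. ?X k')" by (intro UN_I[of "restrict (\<lambda>j. tot (D j) m \<omega>) J"]) auto
  qed (auto simp: PiE_iff)
  moreover have "disjoint_family_on ?X ?I"
    unfolding disjoint_family_on_def
  proof (intro ballI impI)
    fix a b assume ab: "a \<in> ?I" "b \<in> ?I" "a \<noteq> b"
    have "a = b" if "\<forall>j\<in>J. a j = b j" using that by (intro PiE_ext[OF ab(1,2)]) auto
    then show "?X a \<inter> ?X b = {}" using ab by auto
  qed
  ultimately have "measure Pc.S {\<omega>\<in>space Pc.S. \<forall>j\<in>J. tot (D j) m \<omega> \<le> k j} = (\<Sum>k'\<in>?I. measure Pc.S (?X k'))"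
    using fI by (simp only:) (intro Pc.P.finite_measure_finite_Union, auto)
  also have "\<dots> = (\<Prod>j\<in>J. \<Sum>i\<le>k j. poisson_prob (\<Sum>n<m. measure M (D j n)) i)"
    unfolding eq using J by (subst prod_sum_PiE[of J "\<lambda>j. {..k j}"]) auto
  finally show ?thesis .
qed

text \<open>The events decrease in \<open>m\<close>, so both sides pass to the limit, including sets
  of infinite total mass; the product form is the independence of the final counts.\<close>

lemma measure_tot_le_limit:
  assumes J: "finite J" "\<And>n j. j \<in> J \<Longrightarrow> D j n \<in> sets M" "\<And>n. disjoint_family_on (\<lambda>j. D j n) J"
  shows "measure Pc.S {\<omega>\<in>space Pc.S. \<forall>j\<in>J. \<forall>m. tot (D j) m \<omega> \<le> k j} = (\<Prod>j\<in>J. poisson_cdf (\<Sum>n. emeasure M (D j n)) (k j))"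
proof -
  let ?X = "\<lambda>m. {\<omega>\<in>space Pc.S. \<forall>j\<in>J. tot (D j) m \<omega> \<le> k j}"
  have X: "range ?X \<subseteq> sets Pc.S"
    using J by (auto intro!: sets.sets_Collect_finite_All measurable_sets_Collect[OF measurable_tot])
  have "decseq ?X"
    by (intro decseq_SucI) (auto simp: tot_def)
  from Pc.P.finite_Lim_measure_decseq[OF X this]
  have "(\<lambda>m. \<Prod>j\<in>J. \<Sum>i\<le>k j. poisson_prob (\<Sum>n<m. measure M (D j n)) i) \<longlonglongrightarrow> measure Pc.S (\<Inter>m. ?X m)"
    by (simp only: measure_tot_le[OF J])
  moreover have "(\<lambda>m. \<Prod>j\<in>J. \<Sum>i\<le>k j. poisson_prob (\<Sum>n<m. measure M (D j n)) i) \<longlonglongrightarrow>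
      (\<Prod>j\<in>J. poisson_cdf (\<Sum>n. ennreal (measure M (D j n))) (k j))"
    by (intro tendsto_prod poisson_cdf_tendsto) auto
  ultimately have "measure Pc.S (\<Inter>m. ?X m) = (\<Prod>j\<in>J. poisson_cdf (\<Sum>n. ennreal (measure M (D j n))) (k j))"
    by (rule LIMSEQ_unique)
  moreover have "(\<Inter>m. ?X m) = {\<omega>\<in>space Pc.S. \<forall>j\<in>J. \<forall>m. tot (D j) m \<omega> \<le> k j}" by auto
  ultimately show ?thesis by (simp add: M.emeasure_eq_measure)
qed

end

section \<open>Poisson point processes from joint distribution functions of counts\<close>

lemma point_count_card: "point_count X A \<omega> = emeasure (count_space UNIV) {i. X i \<omega> \<in> A}"
proof -
  have "point_count X A \<omega> = (\<integral>\<^sup>+i. indicator {i. X i \<omega> \<in> A} i \<partial>count_space UNIV)"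
    unfolding point_count_def by (subst nn_integral_count_space_nat, rule arg_cong[where f = suminf], auto simp: indicator_def fun_eq_iff)
  then show ?thesis by simp
qed

lemma point_count_cases: "point_count X A \<omega> = \<infinity> \<or> (\<exists>n. point_count X A \<omega> = of_nat n)"
  by (cases "finite {i. X i \<omega> \<in> A}") (auto simp: point_count_card)

lemma measurable_point_count:
  assumes "\<And>i. X i \<in> N \<rightarrow>\<^sub>M \<nu>" "A \<in> sets \<nu>"
  shows "point_count X A \<in> borel_measurable N"
proof -
  have [measurable]: "X i \<in> N \<rightarrow>\<^sub>M \<nu>" "A \<in> sets \<nu>" for i using assms by auto
  show ?thesis unfolding point_count_def[abs_def] by measurable
qed

lemma ennreal_borel_atMost: "sets (borel :: ennreal measure) = sigma_sets UNIV (range atMost)"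
proof -
  have "(borel :: ennreal measure) = sigma UNIV (range atMost)"
  proof (rule borel_eq_sigmaI1[OF borel_Ioi])
    fix X :: "ennreal set" assume "X \<in> range greaterThan"
    then obtain a where X: "X = {a<..}" by auto
    have "UNIV - {..a} \<in> sigma_sets UNIV (range atMost)" by (intro sigma_sets.Compl sigma_sets.Basic) auto
    moreover have "UNIV - {..a} = X" using X by auto
    ultimately show "X \<in> sets (sigma UNIV (range atMost))" by simp
  qed auto
  then have "sets (borel :: ennreal measure) = sets (sigma UNIV (range atMost))" by (rule arg_cong)
  also have "\<dots> = sigma_sets UNIV (range atMost)" by (rule sets_measure_of) auto
  finally show ?thesis .
qed

text \<open>Point probabilities are differences of values of the distribution function, infinite
  counts come from the vanishing of all these values, and independence need only be tested on lower
  half-lines, which are stable under intersection and generate the Borel sets.\<close>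

lemma poisson_point_processI:
  fixes \<nu> :: "'a measure"
  assumes N: "prob_space N" and X: "\<And>i. X i \<in> N \<rightarrow>\<^sub>M \<nu>"
    and cdf: "\<And>(J :: nat set) A k. finite J \<Longrightarrow> (\<And>j. j \<in> J \<Longrightarrow> A j \<in> sets \<nu>) \<Longrightarrow> disjoint_family_on A J \<Longrightarrow>
      measure N {x\<in>space N. \<forall>j\<in>J. point_count X (A j) x \<le> of_nat (k j)} = (\<Prod>j\<in>J. poisson_cdf (emeasure \<nu> (A j)) (k j))"
  shows "poisson_point_process N \<nu> X"
proof -
  interpret prob_space N by fact
  have pm: "point_count X A \<in> borel_measurable N" if "A \<in> sets \<nu>" for A
    by (rule measurable_point_count[OF X that])
  have le_sets: "{x\<in>space N. point_count X A x \<le> a} \<in> sets N" if "A \<in> sets \<nu>" for A a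
    using pm[OF that] by measurable
  have single: "measure N {x\<in>space N. point_count X A x \<le> of_nat k} = poisson_cdf (emeasure \<nu> A) k" if "A \<in> sets \<nu>" for A k
    using cdf[of "{0}" "\<lambda>_. A" "\<lambda>_. k"] that by (simp add: disjoint_family_on_def)
  have exact: "measure N {x\<in>space N. point_count X A x = of_nat k} = measure \<nu> A ^ k / fact k * exp (- measure \<nu> A)"
    if A: "A \<in> sets \<nu>" "emeasure \<nu> A < \<infinity>" for A k
  proof (cases k)
    case 0
    then show ?thesis using single[OF A(1), of 0] A(2) by (simp add: poisson_cdf_def poisson_prob_def measure_def less_top)
  next
    case (Suc l)
    have "{x\<in>space N. point_count X A x = of_nat k} = {x\<in>space N. point_count X A x \<le> of_nat k} - {x\<in>space N. point_count X A x \<le> of_nat l}"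
    proof -
      have "point_count X A x = of_nat k \<longleftrightarrow> point_count X A x \<le> of_nat k \<and> \<not> point_count X A x \<le> of_nat l" for x
        using point_count_cases[of X A x] Suc by (auto simp: top_unique simp del: of_nat_Suc)
      then show ?thesis by auto
    qed
    also have "measure N \<dots> = poisson_cdf (emeasure \<nu> A) k - poisson_cdf (emeasure \<nu> A) l"
      using le_sets[OF A(1)] Suc by (subst finite_measure_Diff) (auto simp: single[OF A(1)] intro: order_trans simp del: of_nat_Suc)
    also have "\<dots> = poisson_prob (measure \<nu> A) k"
      using A Suc by (simp add: poisson_cdf_def measure_def)
    finally show ?thesis by (simp add: poisson_prob_def)
  qed
  have inf: "AE x in N. point_count X A x = \<infinity>" if A: "A \<in> sets \<nu>" "emeasure \<nu> A = \<infinity>" for A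
  proof -
    have "AE x in N. \<not> point_count X A x \<le> of_nat k" for k
    proof (rule AE_I[where N = "{x\<in>space N. point_count X A x \<le> of_nat k}"])
      show "emeasure N {x\<in>space N. point_count X A x \<le> of_nat k} = 0"
        using single[OF A(1), of k] A(2) by (simp add: poisson_cdf_def emeasure_eq_measure)
    qed (auto simp: le_sets[OF A(1)])
    then have "AE x in N. \<forall>k. \<not> point_count X A x \<le> of_nat k" by (simp add: AE_all_countable)
    then show ?thesis
    proof (rule AE_mp, intro AE_I2 impI)
      fix x assume "\<forall>k. \<not> point_count X A x \<le> of_nat k"
      then show "point_count X A x = \<infinity>" using point_count_cases[of X A x] by auto
    qed
  qed
  have indep: "indep_vars (\<lambda>_. borel) (\<lambda>j. point_count X (A j)) UNIV"
    if A: "range A \<subseteq> sets \<nu>" "disjoint_family A" for A :: "nat \<Rightarrow> 'a set"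
  proof -
    have prod: "prob (\<Inter>j\<in>J. point_count X (A j) -` B j \<inter> space N) = (\<Prod>j\<in>J. prob (point_count X (A j) -` B j \<inter> space N))"
      if J: "finite J" "J \<noteq> {}" and B: "B \<in> (\<Pi> j\<in>J. range atMost)" for J :: "nat set" and B :: "nat \<Rightarrow> ennreal set"
    proof -
      have "\<forall>j\<in>J. \<exists>b. B j = {..b}" using B by auto
      then obtain b where b: "\<And>j. j \<in> J \<Longrightarrow> B j = {..b j}" by metis
      \<comment> \<open>Counts are natural numbers or infinite, so a finite real threshold can be
        replaced by its floor; indices with an infinite threshold impose no condition and are
        dropped in \<open>J'\<close>.\<close>
      define k where "k j = nat \<lfloor>enn2real (b j)\<rfloor>" for j
      define J' where "J' = {j\<in>J. b j \<noteq> \<infinity>}"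
      have J': "finite J'" "J' \<subseteq> J" using J by (auto simp: J'_def)
      have eq: "point_count X (A j) x \<le> b j \<longleftrightarrow> point_count X (A j) x \<le> of_nat (k j)" if j: "j \<in> J'" for j x
      proof -
        obtain r where r: "b j = ennreal r" "0 \<le> r" using j by (cases "b j") (auto simp: J'_def)
        have nr: "of_nat n \<le> ennreal r \<longleftrightarrow> n \<le> nat \<lfloor>r\<rfloor>" for n
          using r by (simp add: ennreal_of_nat_eq_real_of_nat le_nat_floor le_nat_iff le_floor_iff)
        show ?thesis
          using point_count_cases[of X "A j" x] r by (auto simp: k_def nr top_unique)
      qed
      have all: "point_count X (A j) -` B j \<inter> space N = space N" if "j \<in> J - J'" for j
        using that b by (auto simp: J'_def)
      have some: "point_count X (A j) -` B j \<inter> space N = {x\<in>space N. point_count X (A j) x \<le> of_nat (k j)}" if "j \<in> J'" for j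
        using that b[of j] eq[OF that] J' by auto
      have "(\<Inter>j\<in>J. point_count X (A j) -` B j \<inter> space N) = {x\<in>space N. \<forall>j\<in>J'. point_count X (A j) x \<le> of_nat (k j)}"
      proof (intro set_eqI iffI)
        fix x assume x: "x \<in> (\<Inter>j\<in>J. point_count X (A j) -` B j \<inter> space N)"
        then have "x \<in> space N" using J by auto
        moreover have "point_count X (A j) x \<le> of_nat (k j)" if "j \<in> J'" for j
          using x that J' some[OF that] by blast
        ultimately show "x \<in> {x\<in>space N. \<forall>j\<in>J'. point_count X (A j) x \<le> of_nat (k j)}" by auto
      next
        fix x assume x: "x \<in> {x\<in>space N. \<forall>j\<in>J'. point_count X (A j) x \<le> of_nat (k j)}"
        show "x \<in> (\<Inter>j\<in>J. point_count X (A j) -` B j \<inter> space N)"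
        proof (intro INT_I)
          fix j assume "j \<in> J"
          then show "x \<in> point_count X (A j) -` B j \<inter> space N"
            using x some[of j] all[of j] by (cases "j \<in> J'") blast+
        qed
      qed
      then have "prob (\<Inter>j\<in>J. point_count X (A j) -` B j \<inter> space N) = (\<Prod>j\<in>J'. poisson_cdf (emeasure \<nu> (A j)) (k j))"
        using cdf[of J' A k] J' A by (auto simp: disjoint_family_on_def)
      also have "\<dots> = (\<Prod>j\<in>J'. prob (point_count X (A j) -` B j \<inter> space N))"
        using A by (intro prod.cong refl) (auto simp: some single)
      also have "\<dots> = (\<Prod>j\<in>J. prob (point_count X (A j) -` B j \<inter> space N))"
        using J J' by (intro prod.mono_neutral_left) (auto simp: all prob_space)
      finally show ?thesis .
    qed
    have fin: "indep_vars (\<lambda>_. borel) (\<lambda>j. point_count X (A j)) J" if J: "finite J" "J \<noteq> {}" for J :: "nat set"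
    proof (subst indep_vars_finite[OF J(2,1), where E = "\<lambda>_. range atMost"])
      show "Int_stable (range (atMost :: ennreal \<Rightarrow> _))"
        by (auto simp: Int_stable_def intro!: image_eqI[where x = "min _ _"])
      show "\<forall>B\<in>(\<Pi> j\<in>J. range atMost). prob (\<Inter>j\<in>J. point_count X (A j) -` B j \<inter> space N) = (\<Prod>j\<in>J. prob (point_count X (A j) -` B j \<inter> space N))"
        using prod[OF J] by blast
      show "space borel \<in> range (atMost :: ennreal \<Rightarrow> _)" by (auto intro!: image_eqI[of _ _ top])
    qed (use pm A in \<open>auto simp: ennreal_borel_atMost\<close>)
    show ?thesis
      unfolding indep_vars_def2
    proof (intro conjI ballI)
      show "random_variable borel (point_count X (A j))" for j using pm A by auto
      show "indep_sets (\<lambda>j. {point_count X (A j) -` B \<inter> space N |B. B \<in> sets borel}) UNIV"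
        using fin by (subst indep_sets_finite_index_sets) (auto simp: indep_vars_def2)
    qed
  qed
  show ?thesis
    unfolding poisson_point_process_def using N X exact inf indep by auto
qed

context sequence_space
begin

interpretation Pc: sequence_space piece
  by (intro sequence_space.intro product_prob_spaceI prob_space_piece)

lemma sum_lessThan_add: "(\<Sum>i<a + b. f i) = (\<Sum>i<a. f i) + (\<Sum>i<b. f (a + i))" for f :: "nat \<Rightarrow> 'c::comm_monoid_add"
  by (induction b) (auto simp: add.assoc)

text \<open>\<open>T n\<close> is the number of points in the first \<open>n\<close> pieces and
  \<open>idx i\<close> the piece that contains point number \<open>i\<close>, so \<open>X\<close>
  lists the pieces one after the other. The hypothesis \<open>dec\<close> says that the intensity is
  the sum of the images of the probability measure under the maps.\<close>

lemma poisson_point_process_exists: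
  fixes \<phi> :: "nat \<Rightarrow> 'a \<Rightarrow> 'b" and \<nu> :: "'b measure"
  assumes \<phi>: "\<And>n. \<phi> n \<in> M \<rightarrow>\<^sub>M \<nu>"
    and dec: "\<And>A. A \<in> sets \<nu> \<Longrightarrow> emeasure \<nu> A = (\<Sum>n. emeasure M (\<phi> n -` A \<inter> space M))"
  shows "\<exists>(N :: (nat \<Rightarrow> 'b) measure) X. poisson_point_process N \<nu> X"
proof -
  define T where "T n \<omega> = (\<Sum>m<n. fst (\<omega> m))" for n and \<omega> :: "nat \<Rightarrow> nat \<times> (nat \<Rightarrow> 'a)"
  define idx where "idx i \<omega> = (LEAST n. i < T (Suc n) \<omega>)" for i \<omega>
  define X where "X i \<omega> = \<phi> (idx i \<omega>) (snd (\<omega> (idx i \<omega>)) (i - T (idx i \<omega>) \<omega>))" for i \<omega>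
  define D where "D A n = \<phi> n -` A \<inter> space M" for A n
  have D: "D A n \<in> sets M" if "A \<in> sets \<nu>" for A n using that \<phi> unfolding D_def by (rule measurable_sets[rotated])
  have [measurable]: "(\<lambda>\<omega>. \<omega> n) \<in> Pc.S \<rightarrow>\<^sub>M piece" for n by measurable
  have fst_m: "(\<lambda>\<omega>. fst (\<omega> n)) \<in> Pc.S \<rightarrow>\<^sub>M count_space UNIV" for n
  proof -
    have "fst \<in> piece \<rightarrow>\<^sub>M count_space UNIV"
      using measurable_fst[of "measure_pmf (poisson_pmf 1)" S] by (simp cong: measurable_cong_sets)
    then show ?thesis by measurable
  qed
  have T_m[measurable]: "T n \<in> Pc.S \<rightarrow>\<^sub>M count_space UNIV" for n
  proof -
    have "(\<lambda>\<omega>. \<Sum>m<n. fst (\<omega> m)) \<in> Pc.S \<rightarrow>\<^sub>M count_space UNIV"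
    proof (induction n)
      case (Suc n)
      then show ?case
        using fst_m[of n] measurable_compose_countable[OF _ Suc.IH, of "\<lambda>a \<omega>. a + fst (\<omega> n)"] by simp
    qed simp
    then show ?thesis unfolding T_def .
  qed
  have idx_m[measurable]: "idx i \<in> Pc.S \<rightarrow>\<^sub>M count_space UNIV" for i
    unfolding idx_def[abs_def] by measurable
  have pt_m: "(\<lambda>\<omega>. \<phi> n (snd (\<omega> n) r)) \<in> Pc.S \<rightarrow>\<^sub>M \<nu>" for n r
    by (rule measurable_compose[OF _ \<phi>]) measurable
  have X_m: "X i \<in> Pc.S \<rightarrow>\<^sub>M \<nu>" for i
    unfolding X_def[abs_def]
  proof (rule measurable_compose_countable[where f = "\<lambda>n \<omega>. \<phi> n (snd (\<omega> n) (i - T n \<omega>))" and g = "idx i"])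
    show "(\<lambda>\<omega>. \<phi> n (snd (\<omega> n) (i - T n \<omega>))) \<in> Pc.S \<rightarrow>\<^sub>M \<nu>" for n
      by (rule measurable_compose_countable[where f = "\<lambda>r \<omega>. \<phi> n (snd (\<omega> n) r)" and g = "\<lambda>\<omega>. i - T n \<omega>"])
        (auto intro: pt_m)
  qed measurable
  have sp: "snd (\<omega> n) r \<in> space M" if "\<omega> \<in> space Pc.S" for \<omega> n r
    using that by (auto simp: space_PiM space_pair_measure PiE_def Pi_iff mem_Times_iff)
  have mono_T: "T m \<omega> \<le> T n \<omega>" if "m \<le> n" for m n \<omega>
    unfolding T_def using that by (intro sum_mono2) auto
  have idx_eq: "idx (T n \<omega> + r) \<omega> = n" if "r < fst (\<omega> n)" for n r \<omega>
    unfolding idx_def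
  proof (rule Least_equality)
    show "T n \<omega> + r < T (Suc n) \<omega>" using that by (simp add: T_def)
    fix y assume "T n \<omega> + r < T (Suc y) \<omega>"
    then show "n \<le> y" using mono_T[of "Suc y" n \<omega>] by (cases "n \<le> y") auto
  qed
  have partial: "(\<Sum>i<T n \<omega>. of_bool (X i \<omega> \<in> A)) = tot (D A) n \<omega>" if "\<omega> \<in> space Pc.S" for n \<omega> A
  proof (induction n)
    case (Suc n)
    have "(\<Sum>r<fst (\<omega> n). of_bool (X (T n \<omega> + r) \<omega> \<in> A)) = hits (D A n) (fst (\<omega> n)) (snd (\<omega> n))"
      unfolding hits_def using sp[OF that] by (intro sum.cong) (auto simp: X_def idx_eq D_def)
    moreover have "T (Suc n) \<omega> = T n \<omega> + fst (\<omega> n)" by (simp add: T_def)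
    ultimately show ?case using Suc by (simp only: sum_lessThan_add) (simp add: tot_def)
  qed (simp add: T_def tot_def)
  \<comment> \<open>The pieces contain infinitely many points in total, so that \<open>idx\<close>
    is attained for every \<open>i\<close> and every point of every piece is listed.\<close>
  have good: "AE \<omega> in Pc.S. \<forall>k. \<exists>n. k < T n \<omega>"
    unfolding AE_all_countable
  proof
    fix k
    have tT: "tot (\<lambda>_. space M) n \<omega> = T n \<omega>" if "\<omega> \<in> space Pc.S" for n \<omega>
      using sp[OF that] by (simp add: tot_def T_def hits_def)
    have "measure Pc.S {\<omega>\<in>space Pc.S. \<forall>m. tot (\<lambda>_. space M) m \<omega> \<le> k} = poisson_cdf (\<Sum>n. emeasure M (space M)) k"
      using measure_tot_le_limit[of "{()}" "\<lambda>_ _. space M" "\<lambda>_. k"] by (simp add: disjoint_family_on_def)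
    also have "(\<Sum>n::nat. emeasure M (space M)) = (\<integral>\<^sup>+n. 1 \<partial>count_space (UNIV :: nat set))"
      unfolding M.emeasure_space_1 by (subst nn_integral_count_space_nat) (rule refl)
    also have "\<dots> = \<infinity>" by simp
    finally have "measure Pc.S {\<omega>\<in>space Pc.S. \<forall>m. tot (\<lambda>_. space M) m \<omega> \<le> k} = 0" by (simp add: poisson_cdf_def)
    moreover have "{\<omega>\<in>space Pc.S. \<forall>m. tot (\<lambda>_. space M) m \<omega> \<le> k} = {\<omega>\<in>space Pc.S. \<forall>m. T m \<omega> \<le> k}" using tT by auto
    ultimately have z: "measure Pc.S {\<omega>\<in>space Pc.S. \<forall>m. T m \<omega> \<le> k} = 0" by simp
    show "AE \<omega> in Pc.S. \<exists>n. k < T n \<omega>"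
    proof (rule AE_I[where N = "{\<omega>\<in>space Pc.S. \<forall>m. T m \<omega> \<le> k}"])
      show "emeasure Pc.S {\<omega>\<in>space Pc.S. \<forall>m. T m \<omega> \<le> k} = 0" using z by (simp add: Pc.P.emeasure_eq_measure)
    qed (auto simp: not_less)
  qed
  have count_le: "point_count X A \<omega> \<le> of_nat k \<longleftrightarrow> (\<forall>n. tot (D A) n \<omega> \<le> k)"
    if g: "\<forall>k. \<exists>n. k < T n \<omega>" and w: "\<omega> \<in> space Pc.S" for \<omega> A k
  proof -
    have ps: "(\<Sum>i<m. indicator A (X i \<omega>)) = (of_nat (\<Sum>i<m. of_bool (X i \<omega> \<in> A)) :: ennreal)" for m
      by (auto simp: indicator_def intro!: sum.cong)
    have "point_count X A \<omega> \<le> of_nat k \<longleftrightarrow> (\<forall>m. (\<Sum>i<m. of_bool (X i \<omega> \<in> A)) \<le> k)"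
      unfolding point_count_def suminf_eq_SUP SUP_le_iff ps by (simp only: of_nat_le_iff UNIV_I ball_simps simp_thms) simp
    also have "\<dots> \<longleftrightarrow> (\<forall>n. tot (D A) n \<omega> \<le> k)"
    proof safe
      fix n assume "\<forall>m. (\<Sum>i<m. of_bool (X i \<omega> \<in> A)) \<le> k"
      then show "tot (D A) n \<omega> \<le> k" unfolding partial[OF w, symmetric] by blast
    next
      fix m assume a: "\<forall>n. tot (D A) n \<omega> \<le> k"
      obtain n where "m < T n \<omega>" using g by blast
      then have "(\<Sum>i<m. of_bool (X i \<omega> \<in> A)) \<le> (\<Sum>i<T n \<omega>. of_bool (X i \<omega> \<in> A) :: nat)" by (intro sum_mono2) auto
      also have "\<dots> \<le> k" unfolding partial[OF w] using a by blast
      finally show "(\<Sum>i<m. of_bool (X i \<omega> \<in> A)) \<le> k" .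
    qed
    finally show ?thesis .
  qed
  have law: "measure Pc.S {\<omega>\<in>space Pc.S. \<forall>j\<in>J. point_count X (A j) \<omega> \<le> of_nat (k j)} = (\<Prod>j\<in>J. poisson_cdf (emeasure \<nu> (A j)) (k j))"
    if J: "finite J" "\<And>j. j \<in> J \<Longrightarrow> A j \<in> sets \<nu>" "disjoint_family_on A J" for J :: "nat set" and A k
  proof -
    have s1: "{\<omega>\<in>space Pc.S. \<forall>j\<in>J. point_count X (A j) \<omega> \<le> of_nat (k j)} \<in> sets Pc.S"
      using J measurable_point_count[OF X_m] by (intro sets.sets_Collect_finite_All) auto
    have s2: "{\<omega>\<in>space Pc.S. \<forall>j\<in>J. \<forall>m. tot (D (A j)) m \<omega> \<le> k j} \<in> sets Pc.S"
      using J D by (intro sets.sets_Collect_finite_All sets.sets_Collect_countable_All) (auto intro!: measurable_sets_Collect[OF measurable_tot])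
    have "measure Pc.S {\<omega>\<in>space Pc.S. \<forall>j\<in>J. point_count X (A j) \<omega> \<le> of_nat (k j)} = measure Pc.S {\<omega>\<in>space Pc.S. \<forall>j\<in>J. \<forall>m. tot (D (A j)) m \<omega> \<le> k j}"
      by (rule Pc.P.finite_measure_eq_AE[OF _ s1 s2]) (use good in \<open>eventually_elim; auto simp: count_le\<close>)
    also have "\<dots> = (\<Prod>j\<in>J. poisson_cdf (\<Sum>n. emeasure M (D (A j) n)) (k j))"
    proof (rule measure_tot_le_limit)
      show "disjoint_family_on (\<lambda>j. D (A j) n) J" for n
        using J(3) by (auto simp: disjoint_family_on_def D_def)
    qed (use J D in auto)
    also have "\<dots> = (\<Prod>j\<in>J. poisson_cdf (emeasure \<nu> (A j)) (k j))"
      using J by (intro prod.cong refl) (simp add: dec D_def)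
    finally show ?thesis .
  qed
  \<comment> \<open>The process is transported to the sequence space itself, the type that
    \<open>interlacement_law\<close> prescribes.\<close>
  let ?Y = "\<lambda>\<omega> i. X i \<omega>" let ?N = "distr Pc.S (PiM UNIV (\<lambda>_::nat. \<nu>)) ?Y"
  have Y: "?Y \<in> Pc.S \<rightarrow>\<^sub>M PiM UNIV (\<lambda>_. \<nu>)"
    using X_m by (intro measurable_PiM_single') (auto dest: measurable_space simp: Pi_iff)
  have comp: "(\<lambda>x. x i) \<in> ?N \<rightarrow>\<^sub>M \<nu>" for i by simp
  have "poisson_point_process ?N \<nu> (\<lambda>i x. x i)"
  proof (rule poisson_point_processI)
    show "prob_space ?N" by (rule Pc.P.prob_space_distr[OF Y])
    show "(\<lambda>x. x i) \<in> ?N \<rightarrow>\<^sub>M \<nu>" for i by (rule comp)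
    fix J :: "nat set" and A :: "nat \<Rightarrow> 'b set" and k :: "nat \<Rightarrow> nat"
    assume J: "finite J" "\<And>j. j \<in> J \<Longrightarrow> A j \<in> sets \<nu>" "disjoint_family_on A J"
    have s: "{x\<in>space ?N. \<forall>j\<in>J. point_count (\<lambda>i x. x i) (A j) x \<le> of_nat (k j)} \<in> sets ?N"
      using J measurable_point_count[OF comp] by (intro sets.sets_Collect_finite_All) auto
    have "measure ?N {x\<in>space ?N. \<forall>j\<in>J. point_count (\<lambda>i x. x i) (A j) x \<le> of_nat (k j)} =
       measure Pc.S (?Y -` {x\<in>space ?N. \<forall>j\<in>J. point_count (\<lambda>i x. x i) (A j) x \<le> of_nat (k j)} \<inter> space Pc.S)"
      using s by (intro measure_distr[OF Y]) simp
    also have "?Y -` {x\<in>space ?N. \<forall>j\<in>J. point_count (\<lambda>i x. x i) (A j) x \<le> of_nat (k j)} \<inter> space Pc.S =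
       {\<omega>\<in>space Pc.S. \<forall>j\<in>J. point_count X (A j) \<omega> \<le> of_nat (k j)}"
      using measurable_space[OF Y] by (auto simp: point_count_def)
    finally show "measure ?N {x\<in>space ?N. \<forall>j\<in>J. point_count (\<lambda>i x. x i) (A j) x \<le> of_nat (k j)} = (\<Prod>j\<in>J. poisson_cdf (emeasure \<nu> (A j)) (k j))"
      using law[OF J] by simp
  qed
  then show ?thesis by blast
qed

end

section \<open>Existence of the process with the intensity of the interlacements\<close>

lemma nn_integral_unit_intervals:
  assumes f: "f \<in> borel_measurable lborel"
  shows "(\<integral>\<^sup>+u. f u * indicator {0..} u \<partial>lborel) = (\<Sum>j. \<integral>\<^sup>+u. f (real j + u) * indicator {0..<1} u \<partial>lborel)"
proof -
  have [measurable]: "f \<in> borel_measurable borel" using f by simp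
  have one: "(\<Sum>j. indicator {real j..<real j + 1} u) = (indicator {0..} u :: ennreal)" for u :: real
  proof (cases "0 \<le> u")
    case True
    have "indicator {real j..<real j + 1} u = (if j = nat \<lfloor>u\<rfloor> then 1 else (0::ennreal))" for j
      using True by (auto simp: indicator_def) linarith+
    then have "(\<Sum>j. indicator {real j..<real j + 1} u) = (\<Sum>j. if j = nat \<lfloor>u\<rfloor> then 1 else (0::ennreal))" by simp
    also have "\<dots> = (\<Sum>j\<in>{nat \<lfloor>u\<rfloor>}. if j = nat \<lfloor>u\<rfloor> then 1 else 0)" by (rule suminf_finite) auto
    finally show ?thesis using True by simp
  next
    case False
    then have "indicator {real j..<real j + 1} u = (0::ennreal)" for j by (auto simp: indicator_def)
    then show ?thesis using False by simp
  qed
  have "(\<integral>\<^sup>+u. f u * indicator {0..} u \<partial>lborel) = (\<integral>\<^sup>+u. (\<Sum>j. f u * indicator {real j..<real j + 1} u) \<partial>lborel)"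
    by (simp add: one)
  also have "\<dots> = (\<Sum>j. \<integral>\<^sup>+u. f u * indicator {real j..<real j + 1} u \<partial>lborel)"
    by (rule nn_integral_suminf) measurable
  also have "\<dots> = (\<Sum>j. \<integral>\<^sup>+u. f (real j + u) * indicator {0..<1} u \<partial>lborel)"
  proof (intro arg_cong[where f = suminf] ext)
    fix j
    have "(\<integral>\<^sup>+u. f u * indicator {real j..<real j + 1} u \<partial>lborel) =
       ennreal \<bar>1\<bar> * (\<integral>\<^sup>+u. f (real j + 1 * u) * indicator {real j..<real j + 1} (real j + 1 * u) \<partial>lborel)"
      by (rule nn_integral_real_affine) (auto intro!: borel_measurable_times_ennreal borel_measurable_indicator)
    also have "\<dots> = (\<integral>\<^sup>+u. f (real j + u) * indicator {0..<1} u \<partial>lborel)"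
      by (auto intro!: nn_integral_cong simp: indicator_def)
    finally show "(\<integral>\<^sup>+u. f u * indicator {real j..<real j + 1} u \<partial>lborel) = (\<integral>\<^sup>+u. f (real j + u) * indicator {0..<1} u \<partial>lborel)" .
  qed
  finally show ?thesis .
qed

lemma sets_walk_bind: "sets (count_space UNIV \<bind> lazy_walk) = sets (trajectories :: 'd::finite trajectory measure)"
  by (rule sets_bind) (auto simp: sets_lazy_walk)

lemma sets_intensity: "sets (intensity :: ('d::finite trajectory \<times> real) measure) = sets (trajectories \<Otimes>\<^sub>M restrict_space lborel {0..})"
  unfolding intensity_def by (rule sets_pair_measure_cong[OF sets_walk_bind refl])

lemma space_intensity: "space (intensity :: ('d::finite trajectory \<times> real) measure) = UNIV \<times> {0..}"
  using sets_eq_imp_space_eq[OF sets_intensity]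
  by (simp add: space_pair_measure trajectories_def space_PiM space_restrict_space PiE_def extensional_def)

text \<open>The label axis is cut into unit intervals; together with the starting points this writes
  the infinite intensity as a countable sum of probability measures.\<close>

lemma emeasure_intensity_sum:
  assumes A: "A \<in> sets (intensity :: ('d::finite trajectory \<times> real) measure)"
  shows "emeasure intensity A = (\<integral>\<^sup>+x. \<integral>\<^sup>+j. \<integral>\<^sup>+w. \<integral>\<^sup>+u. indicator A (w, real j + u) * indicator {0..<1} u \<partial>lborel
     \<partial>lazy_walk x \<partial>count_space UNIV \<partial>count_space (UNIV :: (int ^ 'd) set))"
proof -
  let ?R = "restrict_space lborel {0::real..}" and ?B = "count_space UNIV \<bind> (lazy_walk :: int ^ 'd \<Rightarrow> _)"
  interpret R: sigma_finite_measure ?R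
    by (rule sigma_finite_measure_restrict_space) (auto intro: lborel.sigma_finite_measure_axioms)
  have k: "lazy_walk \<in> count_space UNIV \<rightarrow>\<^sub>M subprob_algebra (trajectories :: 'd trajectory measure)"
    by (auto simp: space_subprob_algebra sets_lazy_walk prob_space_imp_subprob_space prob_space_lazy_walk)
  have A': "A \<in> sets (?B \<Otimes>\<^sub>M ?R)" using A by (simp add: intensity_def)
  have A2: "A \<in> sets (trajectories \<Otimes>\<^sub>M ?R)" using A by (simp add: sets_intensity)
  have m: "(\<lambda>w. emeasure ?R (Pair w -` A)) \<in> borel_measurable trajectories"
    using R.measurable_emeasure_Pair[OF A2] .
  have sec: "emeasure ?R (Pair w -` A) = (\<Sum>j. \<integral>\<^sup>+u. indicator A (w, real j + u) * indicator {0..<1} u \<partial>lborel)" for w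
  proof -
    have "Pair w -` A \<in> sets ?R" using sets_Pair1[OF A2] .
    then have s: "Pair w -` A \<in> sets lborel" "Pair w -` A \<subseteq> {0..}" by (auto simp: sets_restrict_space_iff sets_restrict_space)
    then have "emeasure ?R (Pair w -` A) = (\<integral>\<^sup>+u. indicator (Pair w -` A) u * indicator {0..} u \<partial>lborel)"
      by (subst emeasure_restrict_space) (auto simp: indicator_inter_arith[symmetric] Int_absorb2)
    also have "\<dots> = (\<Sum>j. \<integral>\<^sup>+u. indicator (Pair w -` A) (real j + u) * indicator {0..<1} u \<partial>lborel)"
      using s by (intro nn_integral_unit_intervals) auto
    finally show ?thesis by (simp add: indicator_def)
  qed
  have mj: "(\<lambda>w. \<integral>\<^sup>+u. indicator A (w, real j + u) * indicator {0..<1} u \<partial>lborel) \<in> borel_measurable trajectories" for j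
  proof -
    interpret r: sigma_finite_measure "restrict_space lborel {0::real..<1}"
      by (rule sigma_finite_measure_restrict_space) (auto intro: lborel.sigma_finite_measure_axioms)
    have "(\<lambda>p. (fst p, real j + snd p)) \<in> trajectories \<Otimes>\<^sub>M restrict_space lborel {0..<1} \<rightarrow>\<^sub>M trajectories \<Otimes>\<^sub>M ?R"
      by (intro measurable_Pair measurable_restrict_space2) (auto simp: space_pair_measure space_restrict_space intro!: borel_measurable_add measurable_compose[OF measurable_snd] measurable_restrict_space1)
    from measurable_compose[OF this borel_measurable_indicator[OF A2]]
    have "(\<lambda>p. indicator A (fst p, real j + snd p)) \<in> borel_measurable (trajectories \<Otimes>\<^sub>M restrict_space lborel {0..<1}) " .
    then have "(\<lambda>w. \<integral>\<^sup>+u. indicator A (w, real j + u) \<partial>restrict_space lborel {0..<1}) \<in> borel_measurable trajectories"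
      by (intro r.borel_measurable_nn_integral) (simp add: case_prod_unfold)
    then show ?thesis by (subst (asm) nn_integral_restrict_space) auto
  qed
  have "emeasure intensity A = (\<integral>\<^sup>+w. emeasure ?R (Pair w -` A) \<partial>?B)"
    unfolding intensity_def by (rule R.emeasure_pair_measure_alt[OF A'])
  also have "\<dots> = (\<integral>\<^sup>+x. \<integral>\<^sup>+w. emeasure ?R (Pair w -` A) \<partial>lazy_walk x \<partial>count_space UNIV)"
    by (rule nn_integral_bind[OF m k])
  also have "\<dots> = (\<integral>\<^sup>+x. \<integral>\<^sup>+j. \<integral>\<^sup>+w. \<integral>\<^sup>+u. indicator A (w, real j + u) * indicator {0..<1} u \<partial>lborel \<partial>lazy_walk x \<partial>count_space UNIV \<partial>count_space UNIV)"
    unfolding sec using mj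
    by (subst nn_integral_suminf) (auto simp: nn_integral_count_space_nat measurable_cong_sets[OF sets_lazy_walk refl])
  finally show ?thesis .
qed

text \<open>One piece for every pair of a starting point and an integer: the walk from that point,
  with a label uniform in the unit interval beginning at that integer.\<close>

lemma intensity_point_process: "\<exists>(N :: (nat \<Rightarrow> 'd::finite trajectory \<times> real) measure) X.
    poisson_point_process N (intensity :: ('d trajectory \<times> real) measure) X"
proof -
  let ?Sq = "PiM UNIV (\<lambda>_::nat. measure_pmf (lazy_step :: (int ^ 'd) pmf))" and ?U = "uniform_measure lborel {0::real..<1}"
  let ?E = "?Sq \<Otimes>\<^sub>M ?U" and ?b = "from_nat_into (UNIV :: ((int ^ 'd) \<times> nat) set)"
  let ?path = "\<lambda>x \<xi> n. x + (\<Sum>k<n. \<xi> k) :: int ^ 'd"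
  interpret Sq: product_prob_space "\<lambda>_::nat. measure_pmf (lazy_step :: (int ^ 'd) pmf)" UNIV by unfold_locales
  interpret U: prob_space ?U by (rule prob_space_uniform_measure) auto
  have E: "prob_space ?E" by (rule prob_space_pair) (auto intro: Sq.prob_space_axioms U.prob_space_axioms)
  interpret E: sequence_space ?E by (intro sequence_space.intro product_prob_spaceI E)
  have bij: "bij ?b"
    by (rule bij_betw_from_nat_into) (auto simp: finite_prod)
  \<comment> \<open>The absolute value makes the label nonnegative on the whole space, as membership
    in the space of \<open>intensity\<close> requires; on the support of the uniform law it changes
    nothing.\<close>
  define \<phi> where "\<phi> n e = (?path (fst (?b n)) (fst e), real (snd (?b n)) + \<bar>snd e\<bar>)" for n and e :: "(nat \<Rightarrow> int ^ 'd) \<times> real"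
  have \<phi>: "\<phi> n \<in> ?E \<rightarrow>\<^sub>M intensity" for n
    unfolding measurable_cong_sets[OF refl sets_intensity] \<phi>_def[abs_def]
  proof (intro measurable_Pair measurable_restrict_space2)
    show "(\<lambda>e. ?path (fst (?b n)) (fst e)) \<in> ?E \<rightarrow>\<^sub>M trajectories"
      by (rule measurable_compose[OF measurable_fst measurable_path])
    have "snd \<in> ?E \<rightarrow>\<^sub>M borel" using measurable_snd[of ?Sq ?U] by (simp cong: measurable_cong_sets)
    then show "(\<lambda>e. real (snd (?b n)) + \<bar>snd e\<bar>) \<in> ?E \<rightarrow>\<^sub>M lborel" by simp
  qed auto
  show ?thesis
  proof (rule E.poisson_point_process_exists[where \<phi> = \<phi>, OF \<phi>])
    fix A :: "('d trajectory \<times> real) set" assume A: "A \<in> sets intensity"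
    let ?g = "\<lambda>p. \<integral>\<^sup>+w. \<integral>\<^sup>+u. indicator A (w, real (snd p) + u) * indicator {0..<1} u \<partial>lborel \<partial>lazy_walk (fst p)"
    have one: "emeasure ?E (\<phi> n -` A \<inter> space ?E) = ?g (?b n)" for n
    proof -
      let ?x = "fst (?b n)" and ?j = "real (snd (?b n))"
      have mA: "(\<lambda>e. indicator A (\<phi> n e) :: ennreal) \<in> borel_measurable ?E"
        by (rule measurable_compose[OF \<phi> borel_measurable_indicator[OF A]])
      have "emeasure ?E (\<phi> n -` A \<inter> space ?E) = (\<integral>\<^sup>+e. indicator (\<phi> n -` A \<inter> space ?E) e \<partial>?E)"
        using measurable_sets[OF \<phi> A] by simp
      also have "\<dots> = (\<integral>\<^sup>+e. indicator A (\<phi> n e) \<partial>?E)"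
        by (intro nn_integral_cong) (auto simp: indicator_def)
      also have "\<dots> = (\<integral>\<^sup>+\<xi>. \<integral>\<^sup>+u. indicator A (?path ?x \<xi>, ?j + \<bar>u\<bar>) \<partial>?U \<partial>?Sq)"
        by (subst U.nn_integral_fst[symmetric]) (use mA in \<open>auto simp: \<phi>_def\<close>)
      also have "\<dots> = (\<integral>\<^sup>+\<xi>. \<integral>\<^sup>+u. indicator A (?path ?x \<xi>, ?j + u) * indicator {0..<1} u \<partial>lborel \<partial>?Sq)"
      proof (intro nn_integral_cong)
        fix \<xi>
        have A2: "A \<in> sets (trajectories \<Otimes>\<^sub>M restrict_space lborel {0..})" using A by (simp add: sets_intensity)
        have "Pair (?path ?x \<xi>) -` A \<in> sets (restrict_space lborel {0::real..})" by (rule sets_Pair1[OF A2])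
        then have s: "Pair (?path ?x \<xi>) -` A \<in> sets borel" by (auto simp: sets_restrict_space_iff sets_restrict_space)
        have "(\<lambda>u. ?j + \<bar>u\<bar>) \<in> borel \<rightarrow>\<^sub>M borel" by simp
        from measurable_compose[OF this borel_measurable_indicator[OF s]]
        have "(\<lambda>u. indicator A (?path ?x \<xi>, ?j + \<bar>u\<bar>) :: ennreal) \<in> borel_measurable lborel" by (simp add: indicator_def)
        then have "(\<integral>\<^sup>+u. indicator A (?path ?x \<xi>, ?j + \<bar>u\<bar>) \<partial>?U) = (\<integral>\<^sup>+u. indicator A (?path ?x \<xi>, ?j + \<bar>u\<bar>) * indicator {0..<1} u \<partial>lborel)"
          by (subst nn_integral_uniform_measure) (auto simp: divide_ennreal_def)
        also have "\<dots> = (\<integral>\<^sup>+u. indicator A (?path ?x \<xi>, ?j + u) * indicator {0..<1} u \<partial>lborel)"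
          by (intro nn_integral_cong) (auto simp: indicator_def)
        finally show "(\<integral>\<^sup>+u. indicator A (?path ?x \<xi>, ?j + \<bar>u\<bar>) \<partial>?U) = (\<integral>\<^sup>+u. indicator A (?path ?x \<xi>, ?j + u) * indicator {0..<1} u \<partial>lborel)" .
      qed
      also have "\<dots> = ?g (?b n)"
      proof -
        interpret r: sigma_finite_measure "restrict_space lborel {0::real..<1}"
          by (rule sigma_finite_measure_restrict_space) (auto intro: lborel.sigma_finite_measure_axioms)
        have "(\<lambda>p. (fst p, ?j + snd p)) \<in> trajectories \<Otimes>\<^sub>M restrict_space lborel {0..<1} \<rightarrow>\<^sub>M trajectories \<Otimes>\<^sub>M restrict_space lborel {0..}"
          by (intro measurable_Pair measurable_restrict_space2) (auto simp: space_pair_measure space_restrict_space intro!: borel_measurable_add measurable_compose[OF measurable_snd] measurable_restrict_space1)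
        from measurable_compose[OF this borel_measurable_indicator] A
        have "(\<lambda>p. indicator A (fst p, ?j + snd p)) \<in> borel_measurable (trajectories \<Otimes>\<^sub>M restrict_space lborel {0..<1}) " by (simp add: sets_intensity)
        then have "(\<lambda>w. \<integral>\<^sup>+u. indicator A (w, ?j + u) \<partial>restrict_space lborel {0..<1}) \<in> borel_measurable trajectories"
          by (intro r.borel_measurable_nn_integral) (simp add: case_prod_unfold)
        then have m: "(\<lambda>w. \<integral>\<^sup>+u. indicator A (w, ?j + u) * indicator {0..<1} u \<partial>lborel) \<in> borel_measurable trajectories"
          by (subst (asm) nn_integral_restrict_space) auto
        show ?thesis
          unfolding lazy_walk_def by (subst nn_integral_distr[OF measurable_path]) (simp_all add: m)
      qed
      finally show ?thesis .
    qed
    have "(\<Sum>n. emeasure ?E (\<phi> n -` A \<inter> space ?E)) = (\<integral>\<^sup>+n. ?g (?b n) \<partial>count_space UNIV)"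
      by (simp only: one nn_integral_count_space_nat)
    also have "\<dots> = (\<integral>\<^sup>+p. ?g p \<partial>count_space UNIV)" by (rule nn_integral_bij_count_space[OF bij])
    also have "\<dots> = (\<integral>\<^sup>+x. \<integral>\<^sup>+j. ?g (x, j) \<partial>count_space UNIV \<partial>count_space UNIV)"
      by (rule nn_integral_fst_count_space[symmetric])
    also have "\<dots> = emeasure intensity A" by (simp add: emeasure_intensity_sum[OF A])
    finally show "emeasure intensity A = (\<Sum>n. emeasure ?E (\<phi> n -` A \<inter> space ?E))" ..
  qed
qed

section \<open>Void probabilities\<close>

text \<open>The value 0 at infinity is the void probability when the mean number of hitting
  trajectories is infinite.\<close>

definition exp_neg :: "ennreal \<Rightarrow> ennreal" where
  "exp_neg x = (if x = \<infinity> then 0 else ennreal (exp (- enn2real x)))"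

lemma exp_neg_add: "exp_neg (x + y) = exp_neg x * exp_neg y"
  by (cases x; cases y) (auto simp: exp_neg_def ennreal_mult[symmetric] exp_add[symmetric] ennreal_plus[symmetric] simp del: ennreal_plus)

lemma exp_neg_ennreal: "0 \<le> r \<Longrightarrow> exp_neg (ennreal r) = ennreal (exp (- r))"
  by (simp add: exp_neg_def)

definition hit :: "nat \<Rightarrow> (int ^ 'd::finite) set \<Rightarrow> int ^ 'd \<Rightarrow> ennreal" where
  "hit n F x = emeasure (walk_trace n x) {z. fst z \<inter> F \<noteq> {}}"

text \<open>The mean number of trajectories that meet \<open>F\<close>. Negative densities are
  mapped to 0 by \<open>ennreal\<close>, which agrees with \<open>interlacement_set\<close>, as
  labels are nonnegative.\<close>

definition hit_mass :: "(int ^ 'd::finite \<Rightarrow> real) \<Rightarrow> nat \<Rightarrow> (int ^ 'd) set \<Rightarrow> ennreal" where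
  "hit_mass f L F = (\<integral>\<^sup>+x. ennreal (4 * real CARD('d) / real L * f x) * hit L F x \<partial>count_space UNIV)"

lemma sets_random_sets: "{A :: 'a::countable set. A \<inter> F = {}} \<in> sets random_sets"
proof -
  have x: "{A. x \<in> A} \<in> sets random_sets" for x :: 'a
    unfolding random_sets_def by (subst sets_measure_of) (auto intro: sigma_sets.Basic)
  have "(\<Union>x\<in>F. {A. x \<in> A}) \<in> sets random_sets"
    by (intro sets.countable_UN' ) (auto intro: x)
  then have "space random_sets - (\<Union>x\<in>F. {A. x \<in> A}) \<in> sets random_sets" by (rule sets.compl_sets)
  moreover have "space random_sets - (\<Union>x\<in>F. {A. x \<in> A}) = {A. A \<inter> F = {}}"
    by (auto simp: random_sets_def space_measure_of_conv)
  ultimately show ?thesis by simp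
qed

lemma space_random_sets: "space random_sets = UNIV"
  by (simp add: random_sets_def space_measure_of_conv)

lemma measurable_random_sets:
  fixes f :: "'b \<Rightarrow> 'a set"
  assumes "\<And>x. {\<omega>\<in>space M. x \<in> f \<omega>} \<in> sets M"
  shows "f \<in> M \<rightarrow>\<^sub>M random_sets"
  unfolding random_sets_def
proof (rule measurable_measure_of)
  fix A assume "A \<in> range (\<lambda>x :: 'a. {A. x \<in> A})"
  then obtain x :: 'a where "A = {A. x \<in> A}" by auto
  then have "f -` A \<inter> space M = {\<omega>\<in>space M. x \<in> f \<omega>}" by auto
  then show "f -` A \<inter> space M \<in> sets M" using assms by simp
qed auto

text \<open>Avoiding a finite set \<open>F\<close> and avoiding \<open>G\<close> is avoiding their
  union, so these events are stable under intersection; they also generate the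
  sigma-algebra.\<close>

lemma random_set_law_eqI:
  fixes \<mu> \<mu>' :: "'a::countable set measure"
  assumes "prob_space \<mu>" "prob_space \<mu>'" and s: "sets \<mu> = sets random_sets" "sets \<mu>' = sets random_sets"
    and eq: "\<And>F. finite F \<Longrightarrow> emeasure \<mu> {A. A \<inter> F = {}} = emeasure \<mu>' {A. A \<inter> F = {}}"
  shows "\<mu> = \<mu>'"
proof -
  interpret a: prob_space \<mu> by fact
  interpret b: prob_space \<mu>' by fact
  let ?E = "(\<lambda>F. {A. A \<inter> F = {}}) ` {F :: 'a set. finite F}"
  have sig: "sets random_sets = sigma_sets UNIV ?E"
  proof -
    have "sets random_sets = sigma_sets UNIV (range (\<lambda>x :: 'a. {A. x \<in> A}))"
      unfolding random_sets_def by (rule sets_measure_of) auto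
    also have "\<dots> = sigma_sets UNIV ?E"
    proof (rule sigma_sets_eqI)
      fix a assume "a \<in> range (\<lambda>x :: 'a. {A. x \<in> A})"
      then obtain x where a: "a = {A. x \<in> A}" by auto
      have "UNIV - {A. A \<inter> {x} = {}} \<in> sigma_sets UNIV ?E" by (intro sigma_sets.Compl sigma_sets.Basic) auto
      moreover have "UNIV - {A. A \<inter> {x} = {}} = a" using a by auto
      ultimately show "a \<in> sigma_sets UNIV ?E" by simp
    next
      fix b assume "b \<in> ?E"
      then obtain F where "b = {A. A \<inter> F = {}}" by auto
      then have "b \<in> sets random_sets" using sets_random_sets by simp
      then show "b \<in> sigma_sets UNIV (range (\<lambda>x :: 'a. {A. x \<in> A}))"
        unfolding random_sets_def by (subst (asm) sets_measure_of) auto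
    qed
    finally show ?thesis .
  qed
  show ?thesis
  proof (rule measure_eqI_generator_eq[where E = ?E and \<Omega> = UNIV and A = "\<lambda>_. UNIV"])
    show "Int_stable ?E"
    proof (rule Int_stableI)
      fix a b assume "a \<in> ?E" "b \<in> ?E"
      then obtain F G where "finite F" "finite G" "a = {A. A \<inter> F = {}}" "b = {A. A \<inter> G = {}}" by auto
      then have "a \<inter> b = {A. A \<inter> (F \<union> G) = {}}" "finite (F \<union> G)" by auto
      then show "a \<inter> b \<in> ?E" by blast
    qed
    show "range (\<lambda>_. UNIV) \<subseteq> ?E" by (auto intro!: image_eqI[of _ _ "{}"])
  qed (use s sig eq in auto)
qed

text \<open>Some trajectory meets \<open>F\<close> exactly when the process has a point in
  \<open>A F\<close>, a disjoint union over the starting points \<open>x\<close> of paths from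
  \<open>x\<close> that meet \<open>F\<close> times an interval of labels. The intensity of this set
  is \<open>hit_mass\<close>, and the void event is a count equal to 0.\<close>

lemma interlacement_point_process_law:
  fixes f :: "int ^ 'd::finite \<Rightarrow> real"
  assumes P: "poisson_point_process N intensity X" and L: "1 \<le> L"
  defines "I \<equiv> (\<lambda>\<omega>. interlacement_set f L (\<lambda>i. X i \<omega>))"
  shows "I \<in> N \<rightarrow>\<^sub>M random_sets" "emeasure (distr N random_sets I) {A. A \<inter> F = {}} = exp_neg (hit_mass f L F)"
proof -
  let ?c = "\<lambda>x. 4 * real CARD('d) / real L * f x"
  have N: "prob_space N" and X: "\<And>i. X i \<in> N \<rightarrow>\<^sub>M intensity" using P by (auto simp: poisson_point_process_def)
  interpret prob_space N by fact
  define H where "H F x = {w :: 'd trajectory. w 0 = x \<and> w ` {0..<L} \<inter> F \<noteq> {}}" for F x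
  have [measurable]: "(\<lambda>w :: 'd trajectory. w k) \<in> trajectories \<rightarrow>\<^sub>M count_space UNIV" for k
    unfolding trajectories_def by simp
  have sp_t: "space (trajectories :: 'd trajectory measure) = UNIV" by (simp add: trajectories_def space_PiM)
  have H: "H F x \<in> sets trajectories" for F x
  proof -
    have "Measurable.pred trajectories (\<lambda>w :: 'd trajectory. w 0 = x \<and> w ` {0..<L} \<inter> F \<noteq> {})"
      using measurable_trajectory_prefix[of "\<lambda>A y. A \<inter> F \<noteq> {}" L] by measurable
    then show ?thesis unfolding H_def pred_def by (simp add: sp_t)
  qed
  define A where "A F = (\<Union>x. H F x \<times> {0..?c x})" for F
  have ae: "AE w in lazy_walk y. w 0 = y" for y :: "int ^ 'd"
  proof -
    have "(\<integral>\<^sup>+w. indicator {w. w 0 \<noteq> y} w \<partial>lazy_walk y) = 0"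
      using nn_integral_lazy_walk[where \<phi> = "\<lambda>p. indicator {z. z \<noteq> y} (snd p)" and n = 0 and x = y] by (simp add: indicator_def)
    moreover have "{w. w 0 \<noteq> y} \<in> sets (lazy_walk y)"
    proof -
      have "Measurable.pred trajectories (\<lambda>w :: 'd trajectory. w 0 \<noteq> y)" by measurable
      then show ?thesis by (simp add: pred_def sp_t sets_lazy_walk)
    qed
    ultimately have "emeasure (lazy_walk y) {w. w 0 \<noteq> y} = 0" by simp
    then show ?thesis
      using \<open>{w. w 0 \<noteq> y} \<in> sets (lazy_walk y)\<close> by (intro AE_I[where N = "{w. w 0 \<noteq> y}"]) auto
  qed
  have walkH: "emeasure (lazy_walk y) (H F x) = hit L F x * indicator {x} y" for x y :: "int ^ 'd" and F
  proof (cases "x = y")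
    case True
    have m: "{w :: 'd trajectory. w ` {0..<L} \<inter> F \<noteq> {}} \<in> sets (lazy_walk y)"
      using measurable_trajectory_prefix[of "\<lambda>A y. A \<inter> F \<noteq> {}" L] by (simp add: pred_def sp_t sets_lazy_walk)
    have "emeasure (lazy_walk y) (H F x) = emeasure (lazy_walk y) {w. w ` {0..<L} \<inter> F \<noteq> {}}"
      using ae[of y] True H m by (intro emeasure_eq_AE) (auto simp: H_def sets_lazy_walk)
    also have "\<dots> = (\<integral>\<^sup>+w. indicator {z. fst z \<inter> F \<noteq> {}} (w ` {0..<L}, w L) \<partial>lazy_walk y)"
    proof -
      have "emeasure (lazy_walk y) {w. w ` {0..<L} \<inter> F \<noteq> {}} = (\<integral>\<^sup>+w. indicator {w. w ` {0..<L} \<inter> F \<noteq> {}} w \<partial>lazy_walk y)"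
        using m by (rule nn_integral_indicator[symmetric])
      also have "\<dots> = (\<integral>\<^sup>+w. indicator {z. fst z \<inter> F \<noteq> {}} (w ` {0..<L}, w L) \<partial>lazy_walk y)"
        by (intro nn_integral_cong) (simp add: indicator_def)
      finally show ?thesis .
    qed
    also have "\<dots> = hit L F y"
      unfolding nn_integral_lazy_walk hit_def by simp
    finally show ?thesis using True by simp
  next
    case False
    have "emeasure (lazy_walk y) (H F x) = emeasure (lazy_walk y) {}"
      using ae[of y] False H by (intro emeasure_eq_AE) (auto simp: H_def sets_lazy_walk)
    then show ?thesis using False by simp
  qed
  have rect: "emeasure intensity (H F x \<times> {0..?c x}) = ennreal (?c x) * hit L F x" for x F
  proof (cases "0 \<le> ?c x")
    case True
    have "(\<integral>\<^sup>+y. emeasure (lazy_walk y) (H F x) \<partial>count_space UNIV) = hit L F x"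
      unfolding walkH by (simp add: nn_integral_cmult)
    then show ?thesis using emeasure_intensity[OF H True] by simp
  next
    case False
    then have *: "H F x \<times> {0..?c x} = {}" and "ennreal (?c x) = 0" by (auto simp: ennreal_neg)
    show ?thesis unfolding * \<open>ennreal (?c x) = 0\<close> by simp
  qed
  have rs: "H F x \<times> {0..?c x} \<in> sets intensity" for F x
    unfolding sets_intensity by (intro pair_measureI H) (auto simp: sets_restrict_space_iff)
  have As: "A F \<in> sets intensity" for F unfolding A_def by (rule sets.countable_UN', simp, rule image_subsetI, rule rs)
  have Am: "emeasure intensity (A F) = hit_mass f L F" for F
    unfolding A_def hit_mass_def rect[symmetric]
    by (rule emeasure_UN_countable, rule rs, simp) (auto simp: disjoint_family_on_def H_def)
  have avoid: "I \<omega> \<inter> F = {} \<longleftrightarrow> point_count X (A F) \<omega> = 0" if "\<omega> \<in> space N" for \<omega> F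
  proof -
    have u: "0 \<le> snd (X i \<omega>)" for i
      using measurable_space[OF X that, of i] by (simp add: space_intensity mem_Times_iff)
    have "X i \<omega> \<in> A F \<longleftrightarrow> snd (X i \<omega>) \<le> ?c (fst (X i \<omega>) 0) \<and> fst (X i \<omega>) ` {0..<L} \<inter> F \<noteq> {}" for i
      using u[of i] by (cases "X i \<omega>") (auto simp: A_def H_def)
    then have "I \<omega> \<inter> F = {} \<longleftrightarrow> (\<forall>i. X i \<omega> \<notin> A F)"
      unfolding I_def interlacement_set_def by blast
    then show ?thesis by (auto simp: point_count_card emeasure_count_space_eq_0)
  qed
  show meas: "I \<in> N \<rightarrow>\<^sub>M random_sets"
  proof (rule measurable_random_sets)
    fix x
    have "{\<omega>\<in>space N. x \<in> I \<omega>} = {\<omega>\<in>space N. point_count X (A {x}) \<omega> \<noteq> 0}"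
      using avoid[of _ "{x}"] by auto
    also have "\<dots> \<in> sets N" using measurable_point_count[OF X As] by measurable
    finally show "{\<omega>\<in>space N. x \<in> I \<omega>} \<in> sets N" .
  qed
  have "emeasure (distr N random_sets I) {A. A \<inter> F = {}} = emeasure N {\<omega>\<in>space N. point_count X (A F) \<omega> = 0}"
    using sets_random_sets avoid by (subst emeasure_distr[OF meas]) (auto intro!: arg_cong[where f = "emeasure N"])
  also have "\<dots> = exp_neg (hit_mass f L F)"
  proof (cases "emeasure intensity (A F) = \<infinity>")
    case True
    then have "AE \<omega> in N. point_count X (A F) \<omega> = \<infinity>" using P As by (auto simp: poisson_point_process_def)
    then have "emeasure N {\<omega>\<in>space N. point_count X (A F) \<omega> = 0} = emeasure N {}"
      using measurable_point_count[OF X As] by (intro emeasure_eq_AE) auto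
    then show ?thesis using True by (simp add: exp_neg_def Am[symmetric])
  next
    case False
    then have "\<forall>k::nat. measure N {\<omega>\<in>space N. point_count X (A F) \<omega> = of_nat k} = measure intensity (A F) ^ k / fact k * exp (- measure intensity (A F))"
      using P As[of F] by (auto simp: poisson_point_process_def less_top)
    from spec[OF this, of 0] show ?thesis
      using False by (simp add: exp_neg_def Am[symmetric] emeasure_eq_measure measure_def[of intensity])
  qed
  finally show "emeasure (distr N random_sets I) {A. A \<inter> F = {}} = exp_neg (hit_mass f L F)" .
qed

lemma interlacement_law_exists:
  fixes f :: "int ^ 'd::finite \<Rightarrow> real"
  assumes "1 \<le> L"
  obtains \<mu> where "interlacement_law f L \<mu>" "prob_space \<mu>" "sets \<mu> = sets random_sets"
    "\<And>F. emeasure \<mu> {A. A \<inter> F = {}} = exp_neg (hit_mass f L F)"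
proof -
  obtain N :: "(nat \<Rightarrow> 'd trajectory \<times> real) measure" and X
    where P: "poisson_point_process N (intensity :: ('d trajectory \<times> real) measure) X"
    using intensity_point_process by blast
  note * = interlacement_point_process_law[OF P assms, of f]
  interpret prob_space N using P by (simp add: poisson_point_process_def)
  show thesis
    by (rule that[of "distr N random_sets (\<lambda>\<omega>. interlacement_set f L (\<lambda>i. X i \<omega>))"])
      (use P * in \<open>auto simp: interlacement_law_def intro: prob_space_distr\<close>)
qed

lemma measurable_random_sets_Un:
  fixes f g :: "'b \<Rightarrow> 'a::countable set"
  assumes f: "f \<in> M \<rightarrow>\<^sub>M random_sets" and g: "g \<in> M \<rightarrow>\<^sub>M random_sets"
  shows "(\<lambda>\<omega>. f \<omega> \<union> g \<omega>) \<in> M \<rightarrow>\<^sub>M random_sets"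
proof (rule measurable_random_sets)
  fix x :: 'a
  have x: "{A. x \<in> A} \<in> sets random_sets"
    unfolding random_sets_def by (subst sets_measure_of) (auto intro: sigma_sets.Basic)
  have "{\<omega>\<in>space M. x \<in> f \<omega> \<union> g \<omega>} = (f -` {A. x \<in> A} \<inter> space M) \<union> (g -` {A. x \<in> A} \<inter> space M)" by auto
  then show "{\<omega>\<in>space M. x \<in> f \<omega> \<union> g \<omega>} \<in> sets M"
    using measurable_sets[OF f x] measurable_sets[OF g x] by simp
qed

section \<open>Void probabilities of unions, and couplings built from them\<close>

definition void :: "'a set measure \<Rightarrow> 'a set \<Rightarrow> ennreal" where
  "void \<mu> F = emeasure \<mu> {A. A \<inter> F = {}}"

definition random_set_law :: "'a set measure \<Rightarrow> bool" where
  "random_set_law \<mu> \<longleftrightarrow> prob_space \<mu> \<and> sets \<mu> = sets random_sets"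

lemma void_nn_integral:
  fixes \<mu> :: "'a::countable set measure"
  assumes "random_set_law \<mu>"
  shows "void \<mu> F = (\<integral>\<^sup>+A. avoid F A \<partial>\<mu>)"
proof -
  have "{A. A \<inter> F = {}} \<in> sets \<mu>" using assms sets_random_sets[of F] by (simp add: random_set_law_def)
  then show ?thesis unfolding void_def avoid_def[abs_def]
    by (subst nn_integral_indicator[symmetric]) (auto intro!: nn_integral_cong simp: indicator_def)
qed

lemma borel_measurable_avoid: "(avoid F :: 'a::countable set \<Rightarrow> ennreal) \<in> borel_measurable random_sets"
proof -
  have "avoid F = (indicator {A. A \<inter> F = {}} :: 'a set \<Rightarrow> ennreal)" by (auto simp: avoid_def indicator_def)
  then show ?thesis using sets_random_sets[of F] by simp
qed

lemma void_distr:
  fixes f :: "'b \<Rightarrow> 'a::countable set"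
  assumes "prob_space M" "f \<in> M \<rightarrow>\<^sub>M random_sets"
  shows "random_set_law (distr M random_sets f)" "void (distr M random_sets f) F = (\<integral>\<^sup>+\<omega>. avoid F (f \<omega>) \<partial>M)"
proof -
  show r: "random_set_law (distr M random_sets f)" using prob_space.prob_space_distr[OF assms] by (simp add: random_set_law_def)
  show "void (distr M random_sets f) F = (\<integral>\<^sup>+\<omega>. avoid F (f \<omega>) \<partial>M)"
    unfolding void_nn_integral[OF r] by (rule nn_integral_distr[OF assms(2)]) (simp add: borel_measurable_avoid)
qed

lemma random_set_law_measurable: "random_set_law \<mu> \<Longrightarrow> measurable M \<mu> = measurable M random_sets"
  "random_set_law \<mu> \<Longrightarrow> measurable \<mu> M = measurable random_sets M"
  by (auto intro!: measurable_cong_sets simp: random_set_law_def)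

lemma independent_union_law:
  fixes \<mu> \<mu>' :: "'a::countable set measure"
  assumes m: "random_set_law \<mu>" "random_set_law \<mu>'"
  shows "random_set_law (independent_union \<mu> \<mu>')" "void (independent_union \<mu> \<mu>') F = void \<mu> F * void \<mu>' F"
proof -
  interpret a: prob_space \<mu> using m by (simp add: random_set_law_def)
  interpret b: prob_space \<mu>' using m by (simp add: random_set_law_def)
  have P: "prob_space (\<mu> \<Otimes>\<^sub>M \<mu>')" by (rule prob_space_pair) unfold_locales
  have f: "fst \<in> \<mu> \<Otimes>\<^sub>M \<mu>' \<rightarrow>\<^sub>M random_sets" "snd \<in> \<mu> \<Otimes>\<^sub>M \<mu>' \<rightarrow>\<^sub>M random_sets"
    using measurable_fst[of \<mu> \<mu>'] measurable_snd[of \<mu> \<mu>'] by (simp_all add: random_set_law_measurable(1)[OF m(1)] random_set_law_measurable(1)[OF m(2)])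
  have e: "(\<lambda>(A, B). A \<union> B) = (\<lambda>p. fst p \<union> snd p)" by (auto simp: fun_eq_iff)
  note u = measurable_random_sets_Un[OF f]
  show "random_set_law (independent_union \<mu> \<mu>')" unfolding independent_union_def e by (rule void_distr(1)[OF P u])
  have av: "avoid F \<in> borel_measurable \<mu>" "avoid F \<in> borel_measurable \<mu>'"
    using borel_measurable_avoid by (simp_all add: random_set_law_measurable(2)[OF m(1)] random_set_law_measurable(2)[OF m(2)])
  have "void (independent_union \<mu> \<mu>') F = (\<integral>\<^sup>+p. avoid F (fst p \<union> snd p) \<partial>(\<mu> \<Otimes>\<^sub>M \<mu>'))"
    unfolding independent_union_def e by (rule void_distr(2)[OF P u])
  also have "\<dots> = (\<integral>\<^sup>+A. \<integral>\<^sup>+B. avoid F A * avoid F B \<partial>\<mu>' \<partial>\<mu>)"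
    using av by (subst b.nn_integral_fst[symmetric]) (auto simp: avoid_Un intro!: borel_measurable_times_ennreal measurable_compose[OF measurable_fst] measurable_compose[OF measurable_snd])
  also have "\<dots> = void \<mu> F * void \<mu>' F"
    using av by (simp add: nn_integral_cmult nn_integral_multc void_nn_integral[OF m(1)] void_nn_integral[OF m(2)])
  finally show "void (independent_union \<mu> \<mu>') F = void \<mu> F * void \<mu>' F" .
qed

lemma random_set_law_eq:
  fixes \<mu> \<mu>' :: "'a::countable set measure"
  assumes "random_set_law \<mu>" "random_set_law \<mu>'" "\<And>F. void \<mu> F = void \<mu>' F"
  shows "\<mu> = \<mu>'"
  using assms by (intro random_set_law_eqI) (auto simp: random_set_law_def void_def)

text \<open>\<open>Z\<close> carries the two dependent parts; an independent set with law
  \<open>\<mu>r\<close> is added to the first and one with law \<open>\<mu>m\<close> to the second.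
  The marginals are recognized by their void probabilities, and inclusion fails only if it fails in
  \<open>Z\<close> or the set added to the second component is nonempty.\<close>

lemma coupling_of_pmf:
  fixes Z :: "('a::countable set \<times> 'a set) pmf"
  assumes r: "random_set_law \<mu>r" and m: "random_set_law \<mu>m" and l1: "random_set_law \<mu>1" and l2: "random_set_law \<mu>2"
    and v1: "\<And>F. void \<mu>1 F = (\<integral>\<^sup>+z. avoid F (fst z) \<partial>Z) * void \<mu>r F"
    and v2: "\<And>F. void \<mu>2 F = (\<integral>\<^sup>+z. avoid F (snd z) \<partial>Z) * void \<mu>m F"
  shows "\<exists>Q. coupling Q \<mu>1 \<mu>2 \<and>
    ennreal 1 \<le> emeasure Q {\<omega>\<in>space Q. fst \<omega> \<supseteq> snd \<omega>} + emeasure Z {z. \<not> snd z \<subseteq> fst z} + emeasure \<mu>m {S. S \<noteq> {}}"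
proof -
  interpret a: prob_space \<mu>r using r by (simp add: random_set_law_def)
  interpret b: prob_space \<mu>m using m by (simp add: random_set_law_def)
  let ?rm = "\<mu>r \<Otimes>\<^sub>M \<mu>m" let ?P = "measure_pmf Z \<Otimes>\<^sub>M ?rm" let ?RR = "random_sets \<Otimes>\<^sub>M random_sets :: ('a set \<times> 'a set) measure"
  have Prm: "prob_space ?rm" by (rule prob_space_pair) unfold_locales
  then interpret rm: prob_space ?rm .
  have P: "prob_space ?P" by (rule prob_space_pair[OF measure_pmf.prob_space_axioms Prm])
  then interpret P: prob_space ?P .
  define f1 where "f1 p = fst (fst p) \<union> fst (snd p)" for p :: "('a set \<times> 'a set) \<times> 'a set \<times> 'a set"
  define f2 where "f2 p = snd (fst p) \<union> snd (snd p)" for p :: "('a set \<times> 'a set) \<times> 'a set \<times> 'a set"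
  have c: "(\<lambda>p. h (fst p)) \<in> ?P \<rightarrow>\<^sub>M random_sets" for h :: "_ \<Rightarrow> 'a set"
    by (rule measurable_compose[OF measurable_fst]) (simp add: space_random_sets)
  have mr: "(\<lambda>p. fst (snd p)) \<in> ?P \<rightarrow>\<^sub>M random_sets" "(\<lambda>p. snd (snd p)) \<in> ?P \<rightarrow>\<^sub>M random_sets"
    using measurable_compose[OF measurable_snd measurable_fst, of "measure_pmf Z" \<mu>r \<mu>m] measurable_compose[OF measurable_snd measurable_snd, of "measure_pmf Z" \<mu>r \<mu>m]
    by (simp_all add: random_set_law_measurable(1)[OF r] random_set_law_measurable(1)[OF m])
  have f1: "f1 \<in> ?P \<rightarrow>\<^sub>M random_sets" unfolding f1_def[abs_def] by (rule measurable_random_sets_Un[OF c mr(1)])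
  have f2: "f2 \<in> ?P \<rightarrow>\<^sub>M random_sets" unfolding f2_def[abs_def] by (rule measurable_random_sets_Un[OF c mr(2)])
  have ff: "(\<lambda>p. (f1 p, f2 p)) \<in> ?P \<rightarrow>\<^sub>M ?RR" using f1 f2 by (rule measurable_Pair)
  define Q where "Q = distr ?P ?RR (\<lambda>p. (f1 p, f2 p))"
  have sQ: "sets Q = sets (\<mu>1 \<Otimes>\<^sub>M \<mu>2)" using l1 l2 by (auto simp: Q_def random_set_law_def intro!: sets_pair_measure_cong)
  have PQ: "prob_space Q" unfolding Q_def by (rule P.prob_space_distr[OF ff])
  have av: "avoid F \<in> borel_measurable \<mu>r" "avoid F \<in> borel_measurable \<mu>m" for F
    using borel_measurable_avoid by (simp_all add: random_set_law_measurable(2)[OF r] random_set_law_measurable(2)[OF m])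
  have cong: "distr Q \<mu> h = distr Q random_sets h" if "random_set_law \<mu>" for \<mu> :: "'a set measure" and h
    using that by (intro distr_cong) (auto simp: random_set_law_def)
  have d1: "distr Q random_sets fst = distr ?P random_sets f1" "distr Q random_sets snd = distr ?P random_sets f2"
    unfolding Q_def by (subst distr_distr[OF _ ff]; simp add: o_def)+
  have i1: "(\<integral>\<^sup>+p. avoid F (f1 p) \<partial>?P) = (\<integral>\<^sup>+z. avoid F (fst z) \<partial>Z) * void \<mu>r F" for F
  proof -
    have "(\<integral>\<^sup>+p. avoid F (f1 p) \<partial>?P) = (\<integral>\<^sup>+z. \<integral>\<^sup>+w. avoid F (fst z) * avoid F (fst w) \<partial>?rm \<partial>Z)"
      by (subst rm.nn_integral_fst[symmetric]) (auto simp: f1_def avoid_Un intro!: measurable_compose[OF f1 borel_measurable_avoid, unfolded f1_def avoid_Un])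
    also have "\<dots> = (\<integral>\<^sup>+z. avoid F (fst z) * (\<integral>\<^sup>+w. avoid F (fst w) \<partial>?rm) \<partial>Z)"
      using av by (intro nn_integral_cong nn_integral_cmult) (auto intro: measurable_compose[OF measurable_fst])
    also have "(\<integral>\<^sup>+w. avoid F (fst w) \<partial>?rm) = void \<mu>r F"
      using av by (subst b.nn_integral_fst[symmetric]) (auto intro: measurable_compose[OF measurable_fst] simp: void_nn_integral[OF r] b.emeasure_space_1)
    finally show ?thesis by (simp add: nn_integral_multc)
  qed
  have i2: "(\<integral>\<^sup>+p. avoid F (f2 p) \<partial>?P) = (\<integral>\<^sup>+z. avoid F (snd z) \<partial>Z) * void \<mu>m F" for F
  proof -
    have "(\<integral>\<^sup>+p. avoid F (f2 p) \<partial>?P) = (\<integral>\<^sup>+z. \<integral>\<^sup>+w. avoid F (snd z) * avoid F (snd w) \<partial>?rm \<partial>Z)"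
      by (subst rm.nn_integral_fst[symmetric]) (auto simp: f2_def avoid_Un intro!: measurable_compose[OF f2 borel_measurable_avoid, unfolded f2_def avoid_Un])
    also have "\<dots> = (\<integral>\<^sup>+z. avoid F (snd z) * (\<integral>\<^sup>+w. avoid F (snd w) \<partial>?rm) \<partial>Z)"
      using av by (intro nn_integral_cong nn_integral_cmult) (auto intro: measurable_compose[OF measurable_snd])
    also have "(\<integral>\<^sup>+w. avoid F (snd w) \<partial>?rm) = void \<mu>m F"
      using av by (subst b.nn_integral_fst[symmetric]) (auto intro: measurable_compose[OF measurable_snd] simp: void_nn_integral[OF m] a.emeasure_space_1)
    finally show ?thesis by (simp add: nn_integral_multc)
  qed
  have "coupling Q \<mu>1 \<mu>2"
    unfolding coupling_def
  proof (intro conjI PQ sQ)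
    show "distr Q \<mu>1 fst = \<mu>1" unfolding cong[OF l1] d1
      by (rule random_set_law_eq[OF void_distr(1)[OF P f1] l1]) (simp add: void_distr(2)[OF P f1] i1 v1)
    show "distr Q \<mu>2 snd = \<mu>2" unfolding cong[OF l2] d1
      by (rule random_set_law_eq[OF void_distr(1)[OF P f2] l2]) (simp add: void_distr(2)[OF P f2] i2 v2)
  qed
  moreover have "ennreal 1 \<le> emeasure Q {\<omega>\<in>space Q. fst \<omega> \<supseteq> snd \<omega>} + emeasure Z {z. \<not> snd z \<subseteq> fst z} + emeasure \<mu>m {S. S \<noteq> {}}"
  proof -
    have x: "{A. x \<in> A} \<in> sets random_sets" for x :: 'a
      unfolding random_sets_def by (subst sets_measure_of) (auto intro: sigma_sets.Basic)
    have sub: "{\<omega>\<in>space ?RR. fst \<omega> \<supseteq> snd \<omega>} \<in> sets ?RR"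
    proof -
      have "{\<omega>\<in>space ?RR. fst \<omega> \<supseteq> snd \<omega>} = space ?RR - (\<Union>x. (snd -` {A. x \<in> A} \<inter> space ?RR) - (fst -` {A. x \<in> A} \<inter> space ?RR))" by auto
      also have "\<dots> \<in> sets ?RR"
        by (rule sets.compl_sets, rule sets.countable_UN', simp, rule image_subsetI)
          (intro sets.Diff measurable_sets[OF measurable_fst x] measurable_sets[OF measurable_snd x])
      finally show ?thesis .
    qed
    let ?G = "{\<omega>\<in>space ?RR. fst \<omega> \<supseteq> snd \<omega>}"
    let ?E1 = "{z. \<not> snd z \<subseteq> fst z} \<times> space ?rm" and ?E2 = "UNIV \<times> (space \<mu>r \<times> {S. S \<noteq> {}})"
    have nS: "{S :: 'a set. S \<noteq> {}} \<in> sets \<mu>m"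
    proof -
      have "space random_sets - {A :: 'a set. A \<inter> UNIV = {}} \<in> sets random_sets" using sets_random_sets by (rule sets.compl_sets)
      moreover have "space random_sets - {A :: 'a set. A \<inter> UNIV = {}} = {S. S \<noteq> {}}" by (auto simp: space_random_sets)
      ultimately show ?thesis using m by (simp add: random_set_law_def)
    qed
    have s1: "?E1 \<in> sets ?P" by (intro pair_measureI) auto
    have s2: "?E2 \<in> sets ?P" using nS by (intro pair_measureI) auto
    have sG: "(\<lambda>p. (f1 p, f2 p)) -` ?G \<inter> space ?P \<in> sets ?P" by (rule measurable_sets[OF ff sub])
    have "space ?P \<subseteq> ((\<lambda>p. (f1 p, f2 p)) -` ?G \<inter> space ?P) \<union> ?E1 \<union> ?E2"
      using measurable_space[OF ff] by (auto simp: space_pair_measure f1_def f2_def)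
    then have "emeasure ?P (space ?P) \<le> emeasure ?P (((\<lambda>p. (f1 p, f2 p)) -` ?G \<inter> space ?P) \<union> ?E1 \<union> ?E2)"
      using s1 s2 sG by (intro emeasure_mono) auto
    also have "\<dots> \<le> emeasure ?P ((\<lambda>p. (f1 p, f2 p)) -` ?G \<inter> space ?P) + emeasure ?P ?E1 + emeasure ?P ?E2"
      using s1 s2 sG by (intro order_trans[OF emeasure_subadditive] add_right_mono emeasure_subadditive) auto
    also have "emeasure ?P ?E1 = emeasure Z {z. \<not> snd z \<subseteq> fst z}"
      by (subst rm.emeasure_pair_measure_Times) (auto simp: rm.emeasure_space_1)
    also have "emeasure ?P ?E2 = emeasure \<mu>m {S. S \<noteq> {}}"
      using nS by (subst rm.emeasure_pair_measure_Times, simp, simp) (subst b.emeasure_pair_measure_Times, auto simp: a.emeasure_space_1)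
    also have "emeasure ?P ((\<lambda>p. (f1 p, f2 p)) -` ?G \<inter> space ?P) = emeasure Q ?G"
      unfolding Q_def by (rule emeasure_distr[OF ff sub, symmetric])
    also have "?G = {\<omega>\<in>space Q. fst \<omega> \<supseteq> snd \<omega>}" by (simp add: Q_def)
    finally show ?thesis by (simp add: P.emeasure_space_1)
  qed
  ultimately show ?thesis by blast
qed

text \<open>The other component is the normalized remainder \<open>(p - a * q) / (1 - a)\<close>.
  For \<open>a = 1\<close> it is undefined, but then equality of the total masses forces
  \<open>p = q\<close>.\<close>

lemma pmf_mixture:
  assumes a: "0 \<le> a" "a \<le> 1" and le: "\<And>y. a * pmf q y \<le> pmf p y"
  shows "\<exists>r. p = bind_pmf (bernoulli_pmf a) (\<lambda>b. if b then q else r)"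
proof (cases "a = 1")
  case True
  have "pmf q y = pmf p y" for y
  proof (rule ccontr)
    assume ne: "pmf q y \<noteq> pmf p y"
    have "(\<integral>\<^sup>+x. ennreal (pmf q x) \<partial>count_space UNIV) < (\<integral>\<^sup>+x. ennreal (pmf p x) \<partial>count_space UNIV)"
    proof -
      let ?\<delta> = "\<lambda>x. ennreal (pmf p x - pmf q x)"
      have "0 < pmf p y - pmf q y" using le[of y] ne True by auto
      then have "0 < ?\<delta> y" by simp
      also have "?\<delta> y \<le> (\<integral>\<^sup>+x. ?\<delta> x \<partial>count_space UNIV)"
      proof -
        have "?\<delta> y = (\<integral>\<^sup>+x. ?\<delta> y * indicator {y} x \<partial>count_space UNIV)" by (simp add: nn_integral_cmult)
        also have "\<dots> \<le> (\<integral>\<^sup>+x. ?\<delta> x \<partial>count_space UNIV)" by (intro nn_integral_mono) (auto simp: indicator_def)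
        finally show ?thesis .
      qed
      finally have d: "0 < (\<integral>\<^sup>+x. ?\<delta> x \<partial>count_space UNIV)" .
      have "(\<integral>\<^sup>+x. ennreal (pmf p x) \<partial>count_space UNIV) = (\<integral>\<^sup>+x. ennreal (pmf q x) + ?\<delta> x \<partial>count_space UNIV)"
        using le True by (intro nn_integral_cong) (simp add: ennreal_plus[symmetric] del: ennreal_plus)
      also have "\<dots> = (\<integral>\<^sup>+x. ennreal (pmf q x) \<partial>count_space UNIV) + (\<integral>\<^sup>+x. ?\<delta> x \<partial>count_space UNIV)"
        by (rule nn_integral_add) auto
      finally have "(\<integral>\<^sup>+x. ennreal (pmf p x) \<partial>count_space UNIV) = 1 + (\<integral>\<^sup>+x. ?\<delta> x \<partial>count_space UNIV)" by (simp add: nn_integral_pmf)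
      then show ?thesis using d by (simp add: nn_integral_pmf)
    qed
    then show False by (simp add: nn_integral_pmf)
  qed
  then have "p = q" by (intro pmf_eqI) simp
  moreover have "bernoulli_pmf a = return_pmf True"
  proof (rule pmf_eqI)
    show "pmf (bernoulli_pmf a) b = pmf (return_pmf True) b" for b using True by (cases b) auto
  qed
  ultimately show ?thesis by (auto simp: bind_return_pmf)
next
  case False
  then have a1: "a < 1" using a by simp
  let ?r = "\<lambda>y. (pmf p y - a * pmf q y) / (1 - a)"
  have nn: "0 \<le> ?r y" for y using le[of y] a1 by simp
  have "(\<integral>\<^sup>+y. ennreal (1 - a) * ennreal (?r y) + ennreal a * ennreal (pmf q y) \<partial>count_space UNIV) = (\<integral>\<^sup>+y. ennreal (pmf p y) \<partial>count_space UNIV)"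
    using a a1 nn le by (intro nn_integral_cong) (simp add: ennreal_mult[symmetric] ennreal_plus[symmetric] del: ennreal_plus)
  then have e: "ennreal (1 - a) * (\<integral>\<^sup>+y. ennreal (?r y) \<partial>count_space UNIV) + ennreal a = 1"
    by (simp add: nn_integral_add nn_integral_cmult nn_integral_pmf)
  have i1: "(\<integral>\<^sup>+y. ennreal (?r y) \<partial>count_space UNIV) = 1"
  proof -
    let ?I = "\<integral>\<^sup>+y. ennreal (?r y) \<partial>count_space UNIV"
    have "?I \<noteq> \<infinity>" using e a1 by (auto simp: ennreal_mult_top)
    then obtain i where i: "?I = ennreal i" "0 \<le> i" by (cases ?I) auto
    have "ennreal ((1 - a) * i + a) = ennreal 1" using e i a a1 by (simp add: ennreal_mult ennreal_plus)
    then have "(1 - a) * i + a = 1" using i a a1 by (subst (asm) ennreal_inj) auto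
    then have "(1 - a) * (i - 1) = 0" by (simp add: algebra_simps)
    then show ?thesis using i a1 by simp
  qed
  have pr: "pmf (embed_pmf ?r) y = ?r y" for y by (rule pmf_embed_pmf[OF nn i1])
  have "p = bind_pmf (bernoulli_pmf a) (\<lambda>b. if b then q else embed_pmf ?r)"
  proof (rule pmf_eqI)
    fix y
    show "pmf p y = pmf (bind_pmf (bernoulli_pmf a) (\<lambda>b. if b then q else embed_pmf ?r)) y"
      using a a1 by (simp add: pmf_bind pr field_simps)
  qed
  then show ?thesis by blast
qed

text \<open>Drawing the second component first and the first one conditionally on it; applied to
  \<open>walk_trace\<close>, this reveals the end point before the path.\<close>

lemma pmf_disintegrate:
  "p = bind_pmf (map_pmf snd p) (\<lambda>y. map_pmf (\<lambda>A. (A, y)) (map_pmf fst (cond_pmf p {w. snd w = y})))"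
proof -
  have "bind_pmf (map_pmf snd p) (\<lambda>y. cond_pmf p {w. snd w = y}) = p"
    by (rule bind_cond_pmf_cancel) (auto simp: vimage_def intro!: arg_cong[where f = "measure _"])
  moreover have "map_pmf (\<lambda>A. (A, y)) (map_pmf fst (cond_pmf p {w. snd w = y})) = cond_pmf p {w. snd w = y}"
    if "y \<in> set_pmf (map_pmf snd p)" for y
  proof -
    have "set_pmf p \<inter> {w. snd w = y} \<noteq> {}" using that by auto
    then have "map_pmf (\<lambda>w. (fst w, y)) (cond_pmf p {w. snd w = y}) = map_pmf id (cond_pmf p {w. snd w = y})"
      by (intro map_pmf_cong refl) (auto simp: set_cond_pmf)
    then show ?thesis by (simp add: pmf.map_comp o_def)
  qed
  then have "bind_pmf (map_pmf snd p) (\<lambda>y. map_pmf (\<lambda>A. (A, y)) (map_pmf fst (cond_pmf p {w. snd w = y}))) =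
    bind_pmf (map_pmf snd p) (\<lambda>y. cond_pmf p {w. snd w = y})"
    by (intro bind_pmf_cong refl)
  ultimately show ?thesis by simp
qed

section \<open>Coupling walkers with trajectories started from cells\<close>

text \<open>The Laplace functional of a Poisson process. The complement \<open>\<psi>\<close> of
  \<open>\<phi>\<close> is a separate argument so that no subtraction in \<open>ennreal\<close>
  occurs.\<close>

lemma poisson_list_complement:
  fixes q :: "'a pmf" and \<phi> \<psi> :: "'a \<Rightarrow> ennreal"
  assumes W: "0 < W" and c: "\<And>z. \<phi> z + \<psi> z = 1"
  shows "(\<integral>\<^sup>+xs. (\<Prod>x\<leftarrow>xs. \<phi> x) \<partial>poisson_list W q) = exp_neg (ennreal W * (\<integral>\<^sup>+z. \<psi> z \<partial>q))"
proof -
  have one: "(\<integral>\<^sup>+z. \<phi> z \<partial>q) + (\<integral>\<^sup>+z. \<psi> z \<partial>q) = 1"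
    by (subst nn_integral_add[symmetric]) (auto simp: c)
  then have "(\<integral>\<^sup>+z. \<phi> z \<partial>q) \<noteq> \<infinity>" "(\<integral>\<^sup>+z. \<psi> z \<partial>q) \<noteq> \<infinity>" by (auto simp: top_unique)
  then obtain s t where st: "(\<integral>\<^sup>+z. \<phi> z \<partial>q) = ennreal s" "0 \<le> s" "(\<integral>\<^sup>+z. \<psi> z \<partial>q) = ennreal t" "0 \<le> t"
    by (cases "\<integral>\<^sup>+z. \<phi> z \<partial>q"; cases "\<integral>\<^sup>+z. \<psi> z \<partial>q") auto
  have "ennreal (s + t) = ennreal 1" using one st by simp
  then have "s - 1 = - t" using st by (subst (asm) ennreal_inj) auto
  then show ?thesis
    using W st by (simp add: nn_integral_poisson_list[OF W st(1,2)] exp_neg_ennreal ennreal_mult[symmetric])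
qed

text \<open>\<open>Full\<close> walkers come from \<open>f\<^sub>2\<close>, \<open>Early\<close> ones from \<open>f\<^sub>1\<close>; \<open>Late\<close> walkers come from \<open>P\<^bsub>L/2\<^esub> f\<^sub>1\<close>
  and move during the second half only.\<close>

datatype kind = Full | Early | Late

lemma UNIV_kind: "(UNIV :: kind set) = {Full, Early, Late}"
  by (auto intro: kind.exhaust)

lemma nn_integral_kind:
  "(\<integral>\<^sup>+p. f p \<partial>count_space (UNIV :: (kind \<times> 'a) set)) =
    (\<integral>\<^sup>+x. f (Full, x) \<partial>count_space UNIV) + (\<integral>\<^sup>+x. f (Early, x) \<partial>count_space UNIV) + (\<integral>\<^sup>+x. f (Late, x) \<partial>count_space UNIV)"
  by (subst nn_integral_fst_count_space[symmetric])
    (simp add: nn_integral_count_space_finite UNIV_kind add.assoc)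

lemma nn_shift: "(\<integral>\<^sup>+y. f (y - z) \<partial>count_space UNIV) = (\<integral>\<^sup>+y. f y \<partial>count_space (UNIV :: (int ^ 'd::finite) set))" for f :: "_ \<Rightarrow> ennreal"
  by (rule nn_integral_bij_count_space) (auto intro!: bij_betwI[where g = "\<lambda>x. x + z"])

lemma hk_sum: "(\<integral>\<^sup>+y. ennreal (hk k (y - z)) \<partial>count_space UNIV) = 1" for z :: "int ^ 'd::finite"
  unfolding nn_shift[of "\<lambda>y. ennreal (hk k y)"] by (simp add: nn_integral_pmf)

lemma hk_sum': "(\<integral>\<^sup>+z. ennreal (hk k (y - z)) \<partial>count_space UNIV) = 1" for y :: "int ^ 'd::finite"
proof -
  have "hk k (y - z) = hk k (z - y)" for z using hk_minus[of k "z - y"] by simp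
  then show ?thesis using hk_sum[of k y] by simp
qed

lemma swap_count: "(\<integral>\<^sup>+x. \<integral>\<^sup>+y. f x y \<partial>count_space UNIV \<partial>count_space UNIV) = (\<integral>\<^sup>+y. \<integral>\<^sup>+x. f x y \<partial>count_space UNIV \<partial>count_space UNIV)"
  for f :: "int ^ 'd::finite \<Rightarrow> int ^ 'd \<Rightarrow> ennreal"
  by (rule nn_integral_count_space_nn_integral) auto

text \<open>Stage \<open>k\<close> lasts from \<open>s k\<close> to \<open>s (k + 1)\<close>: \<open>g\<close> steps in which a walker of cell \<open>c\<close> forgets its
  position within the cell, then \<open>L1\<close> steps that serve as a trajectory of the target. \<open>qm c\<close> is the
  part of the \<open>g\<close>-step kernel common to all points of the cell, and \<open>th\<close> the thinning probability.\<close>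

locale coupling_data =
  fixes a1 a2 :: "int ^ 'd::finite \<Rightarrow> real" and Hf L1 g m n :: nat and s :: "nat \<Rightarrow> nat"
    and cellof :: "int ^ 'd \<Rightarrow> 'c" and C :: "'c set" and qm :: "'c \<Rightarrow> int ^ 'd \<Rightarrow> real"
    and th :: "int ^ 'd \<Rightarrow> real" and eps :: real
  assumes a1: "\<And>x. 0 \<le> a1 x" and a2: "\<And>x. 0 \<le> a2 x"
    and fin: "(\<integral>\<^sup>+x. ennreal (a1 x + a2 x) \<partial>count_space UNIV) < \<infinity>"
    and pos: "0 < (\<integral>\<^sup>+x. ennreal (a1 x + a2 x) \<partial>count_space UNIV)"
    and s0: "s 0 = L1" "L1 \<le> Hf"
    and step: "\<And>k. k < n \<Longrightarrow> s k + g + L1 \<le> s (Suc k)"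
    and early: "\<And>k. k < n \<Longrightarrow> k < m \<Longrightarrow> s (Suc k) \<le> Hf"
    and late: "\<And>k. k < n \<Longrightarrow> m \<le> k \<Longrightarrow> Hf \<le> s k"
    and C: "finite C" "C \<subseteq> range cellof"
    and qm0: "\<And>c y. 0 \<le> qm c y"
    and qm: "\<And>c z y. c \<in> C \<Longrightarrow> cellof z = c \<Longrightarrow> qm c y \<le> hk g (y - z)"
    and qmpos: "\<And>c. c \<in> C \<Longrightarrow> 0 < (\<integral>\<^sup>+y. ennreal (qm c y) \<partial>count_space UNIV)"
    and th: "\<And>y. 0 \<le> th y" "\<And>y. th y \<le> 1"
    and eps: "0 \<le> eps" "eps < 1"
    and occpos: "\<And>k c. k < n \<Longrightarrow> c \<in> C \<Longrightarrow>
      0 < (\<integral>\<^sup>+z. indicator {z. cellof z = c} z * (\<integral>\<^sup>+x. ennreal (a1 x + a2 x) * ennreal (hk (s k) (z - x)) \<partial>count_space UNIV) \<partial>count_space UNIV)"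
begin

definition occ :: "nat \<Rightarrow> int ^ 'd \<Rightarrow> ennreal" where
  "occ k z = (\<integral>\<^sup>+x. ennreal (a1 x + a2 x) * ennreal (hk (s k) (z - x)) \<partial>count_space UNIV)"

definition cm :: "nat \<Rightarrow> 'c \<Rightarrow> ennreal" where
  "cm k c = (\<integral>\<^sup>+z. indicator {z. cellof z = c} z * occ k z \<partial>count_space UNIV)"

definition qa :: "'c \<Rightarrow> real" where
  "qa c = enn2real (\<integral>\<^sup>+y. ennreal (qm c y) \<partial>count_space UNIV)"

lemma qa: assumes "c \<in> C" shows "ennreal (qa c) = (\<integral>\<^sup>+y. ennreal (qm c y) \<partial>count_space UNIV)" "0 < qa c" "qa c \<le> 1"
proof -
  obtain z where z: "cellof z = c" using C assms by auto
  have "(\<integral>\<^sup>+y. ennreal (qm c y) \<partial>count_space UNIV) \<le> (\<integral>\<^sup>+y. ennreal (hk g (y - z)) \<partial>count_space UNIV)"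
    by (intro nn_integral_mono ennreal_leI qm assms z)
  then have le: "(\<integral>\<^sup>+y. ennreal (qm c y) \<partial>count_space UNIV) \<le> 1" by (simp add: hk_sum)
  then show e: "ennreal (qa c) = (\<integral>\<^sup>+y. ennreal (qm c y) \<partial>count_space UNIV)"
    unfolding qa_def by (subst ennreal_enn2real) (auto simp: less_top[symmetric] top_unique)
  show "0 < qa c" using qmpos[OF assms] unfolding e[symmetric] by simp
  show "qa c \<le> 1" using le unfolding e[symmetric] by simp
qed

definition qp :: "'c \<Rightarrow> (int ^ 'd) pmf" where "qp c = embed_pmf (\<lambda>y. qm c y / qa c)"

lemma pmf_qp: assumes "c \<in> C" shows "pmf (qp c) y = qm c y / qa c"
  unfolding qp_def
proof (rule pmf_embed_pmf)
  show "0 \<le> qm c y / qa c" for y using qm0 qa(2)[OF assms] by simp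
  have "(\<integral>\<^sup>+y. ennreal (qm c y / qa c) \<partial>count_space UNIV) = (\<integral>\<^sup>+y. ennreal (qm c y) * ennreal (1 / qa c) \<partial>count_space UNIV)"
    using qm0 qa(2)[OF assms] by (intro nn_integral_cong) (simp add: ennreal_mult[symmetric])
  also have "\<dots> = ennreal (qa c) * ennreal (1 / qa c)" by (simp add: nn_integral_multc qa(1)[OF assms])
  also have "\<dots> = ennreal (qa c * (1 / qa c))" using qa(2)[OF assms] by (intro ennreal_mult[symmetric]) auto
  also have "\<dots> = 1" using qa(2)[OF assms] by simp
  finally show "(\<integral>\<^sup>+y. ennreal (qm c y / qa c) \<partial>count_space UNIV) = 1" .
qed

definition ypos :: "int ^ 'd \<Rightarrow> (int ^ 'd) pmf" where "ypos z = map_pmf snd (walk_trace g z)"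

lemma pmf_ypos: "pmf (ypos z) y = hk g (y - z)"
  unfolding ypos_def map_snd_walk_trace
  using pmf_map_inj'[of "(+) z" "walk_pos g" "y - z"] by (simp add: inj_on_def)

definition rp :: "'c \<Rightarrow> int ^ 'd \<Rightarrow> (int ^ 'd) pmf" where
  "rp c z = (SOME r. ypos z = bind_pmf (bernoulli_pmf (qa c)) (\<lambda>b. if b then qp c else r))"

lemma ypos_mix:
  assumes c: "c \<in> C" and z: "cellof z = c"
  shows "ypos z = bind_pmf (bernoulli_pmf (qa c)) (\<lambda>b. if b then qp c else rp c z)"
  unfolding rp_def
  by (rule someI_ex, rule pmf_mixture) (use qa[OF c] qm[OF c z] in \<open>auto simp: pmf_qp[OF c] pmf_ypos\<close>)

definition bridge :: "int ^ 'd \<Rightarrow> int ^ 'd \<Rightarrow> (int ^ 'd) set pmf" where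
  "bridge z y = map_pmf fst (cond_pmf (walk_trace g z) {w. snd w = y})"

lemma walk_trace_bridge: "walk_trace g z = bind_pmf (ypos z) (\<lambda>y. map_pmf (\<lambda>A. (A, y)) (bridge z y))"
  unfolding ypos_def bridge_def by (rule pmf_disintegrate)

text \<open>The age of a walker when the clock shows \<open>s k\<close>. \<open>Early\<close>
  walkers stop at \<open>Hf\<close>, and for \<open>Late\<close> walkers the truncated subtraction
  keeps the age 0 until \<open>Hf\<close>.\<close>

definition el :: "kind \<Rightarrow> nat \<Rightarrow> nat" where
  "el \<kappa> k = (case \<kappa> of Full \<Rightarrow> s k | Early \<Rightarrow> min (s k) Hf | Late \<Rightarrow> s k - Hf)"

definition act :: "kind \<Rightarrow> nat \<Rightarrow> bool" where
  "act \<kappa> k = (case \<kappa> of Full \<Rightarrow> True | Early \<Rightarrow> k < m | Late \<Rightarrow> m \<le> k)"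

definition extra :: "nat \<Rightarrow> nat" where "extra k = s (Suc k) - s k - g - L1"

lemma el_mono: "k < n \<Longrightarrow> el \<kappa> k \<le> el \<kappa> (Suc k)"
  using step[of k] by (auto simp: el_def split: kind.splits)

lemma el_act: "k < n \<Longrightarrow> act \<kappa> k \<Longrightarrow> el \<kappa> (Suc k) - el \<kappa> k = g + (L1 + extra k)"
  using step[of k] early[of k] late[of k] by (auto simp: el_def act_def extra_def split: kind.splits)

definition Kern :: "nat \<Rightarrow> (int ^ 'd) set \<times> kind \<times> (int ^ 'd) \<Rightarrow> ((int ^ 'd) set \<times> kind \<times> (int ^ 'd)) pmf" where
  "Kern k = (\<lambda>(A, \<kappa>, z). map_pmf (\<lambda>w. (A \<union> fst w, \<kappa>, snd w)) (walk_trace (el \<kappa> (Suc k) - el \<kappa> k) z))"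

text \<open>The record keeps the start \<open>y\<close> and the whole path also when the coin
  discards the set: the walker that serves the request follows the path in either case.\<close>

definition thin :: "int ^ 'd \<Rightarrow> ((int ^ 'd) set \<times> (int ^ 'd) \<times> (int ^ 'd) set \<times> (int ^ 'd)) pmf" where
  "thin y = bind_pmf (walk_trace L1 y) (\<lambda>w. map_pmf (\<lambda>b. (if b then fst w else {}, y, w)) (bernoulli_pmf (th y)))"

definition Qk :: "'c \<Rightarrow> ((int ^ 'd) set \<times> (int ^ 'd) \<times> (int ^ 'd) set \<times> (int ^ 'd)) pmf" where
  "Qk c = bind_pmf (qp c) thin"

text \<open>How a walker realizes a given sample: a bridge of \<open>g\<close> steps to
  \<open>y\<close>, then the sampled path of \<open>L1\<close> steps, then \<open>extra k\<close>
  free steps until the stage ends. Its trace contains the sampled set, which is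
  \<open>covered\<close>.\<close>

definition Hk :: "nat \<Rightarrow> (int ^ 'd) set \<times> kind \<times> (int ^ 'd) \<Rightarrow> (int ^ 'd) \<times> (int ^ 'd) set \<times> (int ^ 'd) \<Rightarrow>
    ((int ^ 'd) set \<times> kind \<times> (int ^ 'd)) pmf" where
  "Hk k = (\<lambda>(A, \<kappa>, z) (y, w). bind_pmf (bridge z y) (\<lambda>A1. map_pmf (\<lambda>v. (A \<union> (A1 \<union> (fst w \<union> fst v)), \<kappa>, snd v)) (walk_trace (extra k) (snd w))))"

definition Rk :: "nat \<Rightarrow> (int ^ 'd) set \<times> kind \<times> (int ^ 'd) \<Rightarrow> ((int ^ 'd) set \<times> kind \<times> (int ^ 'd)) pmf" where
  "Rk k x = bind_pmf (rp (cellof (snd (snd x))) (snd (snd x))) (\<lambda>y. bind_pmf (thin y) (\<lambda>z. Hk k x (snd z)))"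

definition cellk :: "nat \<Rightarrow> (int ^ 'd) set \<times> kind \<times> (int ^ 'd) \<Rightarrow> 'c option" where
  "cellk k = (\<lambda>(A, \<kappa>, z). if act \<kappa> k then Some (cellof z) else None)"

definition Ck :: "nat \<Rightarrow> 'c set" where "Ck k = (if k < n then C else {})"

lemma bind_bool_if: "bind_pmf (bind_pmf p (\<lambda>b. if b then q else r)) f = bind_pmf p (\<lambda>b. if b then bind_pmf q f else bind_pmf r f)"
  by (auto simp: bind_assoc_pmf intro!: bind_pmf_cong)

text \<open>Given \<open>y\<close>, the bridge and the later path are independent, so the bridge may
  be drawn last. Then only the choice of \<open>y\<close> depends on the position \<open>z\<close>,
  and that dependence is removed by the mixture \<open>ypos_mix\<close>.\<close>

lemma Kern_thin:
  assumes k: "k < n" and act: "act \<kappa> k"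
  shows "Kern k (A, \<kappa>, z) = bind_pmf (ypos z) (\<lambda>y. bind_pmf (thin y) (\<lambda>w. Hk k (A, \<kappa>, z) (snd w)))"
proof -
  have "Kern k (A, \<kappa>, z) = bind_pmf (walk_trace g z) (\<lambda>u. bind_pmf (walk_trace L1 (snd u)) (\<lambda>w.
      map_pmf (\<lambda>v. (A \<union> (fst u \<union> (fst w \<union> fst v)), \<kappa>, snd v)) (walk_trace (extra k) (snd w))))"
    by (simp add: Kern_def el_act[OF k act] walk_trace_add map_bind_pmf bind_map_pmf pmf.map_comp o_def)
  also have "\<dots> = bind_pmf (ypos z) (\<lambda>y. bind_pmf (bridge z y) (\<lambda>A1. bind_pmf (walk_trace L1 y) (\<lambda>w.
      map_pmf (\<lambda>v. (A \<union> (A1 \<union> (fst w \<union> fst v)), \<kappa>, snd v)) (walk_trace (extra k) (snd w)))))"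
    by (subst walk_trace_bridge) (simp add: bind_assoc_pmf bind_map_pmf)
  also have "\<dots> = bind_pmf (ypos z) (\<lambda>y. bind_pmf (walk_trace L1 y) (\<lambda>w. bind_pmf (bridge z y) (\<lambda>A1.
      map_pmf (\<lambda>v. (A \<union> (A1 \<union> (fst w \<union> fst v)), \<kappa>, snd v)) (walk_trace (extra k) (snd w)))))"
    by (intro bind_pmf_cong refl bind_commute_pmf)
  also have "\<dots> = bind_pmf (ypos z) (\<lambda>y. bind_pmf (thin y) (\<lambda>w. Hk k (A, \<kappa>, z) (snd w)))"
    by (simp add: thin_def Hk_def bind_assoc_pmf bind_map_pmf)
  finally show ?thesis .
qed

lemma stage: "particle_stage (Kern k) fst (Ck k) (cellk k) qa Qk (Hk k) (Rk k)"
proof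
  show "finite (Ck k)" using C by (simp add: Ck_def)
  show "0 \<le> qa c \<and> qa c \<le> 1" if "c \<in> Ck k" for c using that qa[of c] by (auto simp: Ck_def split: if_splits)
  fix x c assume c: "c \<in> Ck k" and x: "cellk k x = Some c"
  obtain A \<kappa> z where xe: "x = (A, \<kappa>, z)" by (cases x)
  have k: "k < n" "c \<in> C" using c by (auto simp: Ck_def split: if_splits)
  have a: "act \<kappa> k" "cellof z = c" using x by (auto simp: cellk_def xe split: if_splits)
  have "Kern k x = bind_pmf (bind_pmf (bernoulli_pmf (qa c)) (\<lambda>b. if b then qp c else rp c z)) (\<lambda>y. bind_pmf (thin y) (\<lambda>w. Hk k x (snd w)))"
    unfolding xe Kern_thin[OF k(1) a(1)] ypos_mix[OF k(2) a(2)] ..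
  also have "\<dots> = bind_pmf (bernoulli_pmf (qa c)) (\<lambda>b. if b then bind_pmf (Qk c) (\<lambda>w. Hk k x (snd w)) else Rk k x)"
    unfolding bind_bool_if by (simp add: Qk_def Rk_def bind_assoc_pmf xe a(2) cong: if_cong)
  finally show "Kern k x = bind_pmf (bernoulli_pmf (qa c)) (\<lambda>b. if b then bind_pmf (Qk c) (\<lambda>w. Hk k x (snd w)) else Rk k x)" .
  fix w y assume "w \<in> set_pmf (Qk c)" "y \<in> set_pmf (Hk k x (snd w))"
  then show "fst w \<subseteq> fst y" by (auto simp: Qk_def thin_def Hk_def xe split: if_splits)
qed

section \<open>The Poisson intensity of the walkers and the void probabilities of both sets\<close>

definition wt :: "kind \<times> (int ^ 'd) \<Rightarrow> real" where
  "wt = (\<lambda>(\<kappa>, x). case \<kappa> of Full \<Rightarrow> a2 x | Early \<Rightarrow> a1 x | Late \<Rightarrow> enn2real (\<integral>\<^sup>+y. ennreal (a1 y) * ennreal (hk Hf (x - y)) \<partial>count_space UNIV))"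

lemma fin1: "(\<integral>\<^sup>+x. ennreal (a1 x) \<partial>count_space UNIV) < \<infinity>" and fin2: "(\<integral>\<^sup>+x. ennreal (a2 x) \<partial>count_space UNIV) < \<infinity>"
proof -
  have "(\<integral>\<^sup>+x. ennreal (a1 x) \<partial>count_space UNIV) \<le> (\<integral>\<^sup>+x. ennreal (a1 x + a2 x) \<partial>count_space UNIV)"
    using a2 by (intro nn_integral_mono ennreal_leI) simp
  then show "(\<integral>\<^sup>+x. ennreal (a1 x) \<partial>count_space UNIV) < \<infinity>" using fin by (rule le_less_trans)
  have "(\<integral>\<^sup>+x. ennreal (a2 x) \<partial>count_space UNIV) \<le> (\<integral>\<^sup>+x. ennreal (a1 x + a2 x) \<partial>count_space UNIV)"
    using a1 by (intro nn_integral_mono ennreal_leI) simp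
  then show "(\<integral>\<^sup>+x. ennreal (a2 x) \<partial>count_space UNIV) < \<infinity>" using fin by (rule le_less_trans)
qed

lemma wt_Late: "ennreal (wt (Late, x)) = (\<integral>\<^sup>+y. ennreal (a1 y) * ennreal (hk Hf (x - y)) \<partial>count_space UNIV)"
proof -
  have "(\<integral>\<^sup>+y. ennreal (a1 y) * ennreal (hk Hf (x - y)) \<partial>count_space UNIV) \<le> (\<integral>\<^sup>+y. ennreal (a1 y) * 1 \<partial>count_space UNIV)"
    by (intro nn_integral_mono mult_left_mono) (auto simp: pmf_le_1)
  then have "(\<integral>\<^sup>+y. ennreal (a1 y) * ennreal (hk Hf (x - y)) \<partial>count_space UNIV) < \<infinity>" using fin1 by (simp add: le_less_trans)
  then show ?thesis by (simp add: wt_def)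
qed

lemma wt_nonneg: "0 \<le> wt p"
  using a1 a2 by (auto simp: wt_def split: prod.splits kind.splits)

lemma wt_total: "(\<integral>\<^sup>+p. ennreal (wt p) \<partial>count_space UNIV) < \<infinity>" "0 < (\<integral>\<^sup>+p. ennreal (wt p) \<partial>count_space UNIV)"
proof -
  have L: "(\<integral>\<^sup>+x. ennreal (wt (Late, x)) \<partial>count_space UNIV) = (\<integral>\<^sup>+x. ennreal (a1 x) \<partial>count_space UNIV)"
    unfolding wt_Late by (subst swap_count) (simp add: nn_integral_cmult hk_sum)
  have e: "(\<integral>\<^sup>+p. ennreal (wt p) \<partial>count_space UNIV) = (\<integral>\<^sup>+x. ennreal (a2 x) \<partial>count_space UNIV) + (\<integral>\<^sup>+x. ennreal (a1 x) \<partial>count_space UNIV) + (\<integral>\<^sup>+x. ennreal (a1 x) \<partial>count_space UNIV)"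
    unfolding nn_integral_kind L by (simp add: wt_def)
  show "(\<integral>\<^sup>+p. ennreal (wt p) \<partial>count_space UNIV) < \<infinity>" unfolding e using fin1 fin2 by (simp add: ennreal_add_less_top)
  have "(\<integral>\<^sup>+x. ennreal (a1 x + a2 x) \<partial>count_space UNIV) = (\<integral>\<^sup>+x. ennreal (a1 x) + ennreal (a2 x) \<partial>count_space UNIV)"
    using a1 a2 by (intro nn_integral_cong) simp
  also have "\<dots> = (\<integral>\<^sup>+x. ennreal (a1 x) \<partial>count_space UNIV) + (\<integral>\<^sup>+x. ennreal (a2 x) \<partial>count_space UNIV)"
    by (rule nn_integral_add) auto
  also have "\<dots> \<le> (\<integral>\<^sup>+p. ennreal (wt p) \<partial>count_space UNIV)" unfolding e by (simp add: add.commute add_increasing2)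
  finally show "0 < (\<integral>\<^sup>+p. ennreal (wt p) \<partial>count_space UNIV)" using pos by (rule less_le_trans[rotated])
qed

definition W :: real where "W = enn2real (\<integral>\<^sup>+p. ennreal (wt p) \<partial>count_space UNIV)"

lemma W: "ennreal W = (\<integral>\<^sup>+p. ennreal (wt p) \<partial>count_space UNIV)" "0 < W"
proof -
  show e: "ennreal W = (\<integral>\<^sup>+p. ennreal (wt p) \<partial>count_space UNIV)" unfolding W_def using wt_total(1) by simp
  show "0 < W" using wt_total(2) unfolding e[symmetric] by simp
qed

definition start :: "(kind \<times> (int ^ 'd)) pmf" where "start = embed_pmf (\<lambda>p. wt p / W)"

lemma nn_integral_start: "ennreal W * (\<integral>\<^sup>+p. f p \<partial>start) = (\<integral>\<^sup>+p. ennreal (wt p) * f p \<partial>count_space UNIV)"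
proof -
  have "(\<integral>\<^sup>+p. ennreal (wt p / W) \<partial>count_space UNIV) = (\<integral>\<^sup>+p. ennreal (wt p) * ennreal (1 / W) \<partial>count_space UNIV)"
    using wt_nonneg W(2) by (intro nn_integral_cong) (simp add: ennreal_mult[symmetric])
  also have "\<dots> = ennreal W * ennreal (1 / W)" by (simp add: nn_integral_multc W(1))
  also have "\<dots> = ennreal (W * (1 / W))" using W(2) by (intro ennreal_mult[symmetric]) auto
  finally have 1: "(\<integral>\<^sup>+p. ennreal (wt p / W) \<partial>count_space UNIV) = 1" using W(2) by simp
  have pm: "pmf start p = wt p / W" for p
    unfolding start_def by (rule pmf_embed_pmf[OF _ 1]) (use wt_nonneg W(2) in simp)
  have "ennreal W * (\<integral>\<^sup>+p. f p \<partial>start) = (\<integral>\<^sup>+p. ennreal W * (ennreal (wt p / W) * f p) \<partial>count_space UNIV)"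
    by (simp add: nn_integral_measure_pmf pm nn_integral_cmult)
  also have "\<dots> = (\<integral>\<^sup>+p. ennreal (wt p) * f p \<partial>count_space UNIV)"
  proof (intro nn_integral_cong)
    fix p
    have "ennreal W * ennreal (wt p / W) = ennreal (wt p)"
      using wt_nonneg[of p] W(2) by (subst ennreal_mult[symmetric]) auto
    then show "ennreal W * (ennreal (wt p / W) * f p) = ennreal (wt p) * f p" by (simp add: mult.assoc[symmetric])
  qed
  finally show ?thesis .
qed

text \<open>The first \<open>L1\<close> steps of a \<open>Full\<close> or \<open>Early\<close>
  walker form its trajectory for the time-0 term of the target, thinned according to the starting
  point. This is why stage 0 begins at \<open>s 0 = L1\<close>.\<close>

definition J :: "kind \<times> (int ^ 'd) \<Rightarrow> (((int ^ 'd) set \<times> kind \<times> (int ^ 'd)) \<times> (int ^ 'd) set) pmf" where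
  "J = (\<lambda>(\<kappa>, x). if \<kappa> = Late then return_pmf (({}, Late, x), {}) else
     bind_pmf (walk_trace L1 x) (\<lambda>w. map_pmf (\<lambda>b. ((fst w, \<kappa>, snd w), if b then fst w else {})) (bernoulli_pmf (th x))))"

definition init :: "(((int ^ 'd) set \<times> kind \<times> (int ^ 'd)) list \<times> (int ^ 'd) set) pmf" where
  "init = map_pmf (\<lambda>l. (map fst l, \<Union>(set (map snd l)))) (poisson_list W (bind_pmf start J))"

text \<open>The mean number of successful coins in the cell is \<open>cm k c * qa c\<close>; asking
  for a fraction \<open>eps\<close> less leaves the gap that Chernoff's bound exploits.\<close>

definition lam :: "nat \<Rightarrow> 'c \<Rightarrow> real" where
  "lam k c = (1 - eps) * enn2real (cm k c) * qa c"

lemma cm_le: "cm k c < \<infinity>"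
proof -
  have "cm k c \<le> (\<integral>\<^sup>+z. occ k z \<partial>count_space UNIV)"
    unfolding cm_def by (intro nn_integral_mono) (auto simp: indicator_def)
  also have "\<dots> = (\<integral>\<^sup>+x. ennreal (a1 x + a2 x) \<partial>count_space UNIV)"
    unfolding occ_def by (subst swap_count) (simp add: nn_integral_cmult hk_sum)
  finally show ?thesis using fin by (rule le_less_trans)
qed

lemma lam_pos: "k < n \<Longrightarrow> c \<in> C \<Longrightarrow> 0 < lam k c"
  using occpos[of k c] qa[of c] cm_le[of k c] eps unfolding lam_def cm_def[symmetric] occ_def[symmetric]
  by (auto simp: enn2real_positive_iff intro!: mult_pos_pos)

lemma J_cover: "z \<in> set_pmf (J p) \<Longrightarrow> snd z \<subseteq> fst (fst z)"
  by (auto simp: J_def split: prod.splits if_splits)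

lemma set_poisson_list: "l \<in> set_pmf (poisson_list r q) \<Longrightarrow> z \<in> set l \<Longrightarrow> z \<in> set_pmf q"
  by (auto simp: poisson_list_def set_replicate_pmf)

sublocale sys: particle_system Kern fst Ck cellk "\<lambda>_. qa" "\<lambda>_. Qk" Hk Rk lam init
proof (rule particle_system.intro)
  show "particle_stage (Kern k) fst (Ck k) (cellk k) qa Qk (Hk k) (Rk k)" for k by (rule stage)
  show "fst x \<subseteq> fst y" if "y \<in> set_pmf (Kern k x)" for k x y
    using that by (auto simp: Kern_def split: prod.splits)
  show "0 < lam k c" if "c \<in> Ck k" for k c using that lam_pos by (auto simp: Ck_def split: if_splits)
  show "snd z \<subseteq> (\<Union>x\<in>set (fst z). fst x)" if z: "z \<in> set_pmf init" for z
  proof -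
    obtain l where l: "l \<in> set_pmf (poisson_list W (bind_pmf start J))" "z = (map fst l, \<Union>(set (map snd l)))"
      using z by (auto simp: init_def)
    have cov: "snd w \<subseteq> fst (fst w)" if w: "w \<in> set l" for w
    proof -
      have "w \<in> set_pmf (bind_pmf start J)" by (rule set_poisson_list[OF l(1) w])
      then have "w \<in> (\<Union>p\<in>set_pmf start. set_pmf (J p))" by (simp only: set_bind_pmf)
      then obtain p where "p \<in> set_pmf start" "w \<in> set_pmf (J p)" by (rule UN_E)
      from this(2) show ?thesis by (rule J_cover)
    qed
    show ?thesis
    proof
      fix x assume "x \<in> snd z"
      then have "x \<in> \<Union>(set (map snd l))" by (simp only: l(2) snd_conv)
      then obtain B where B: "B \<in> set (map snd l)" "x \<in> B" by (rule UnionE)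
      from B(1) have "B \<in> snd ` set l" by (simp only: list.set_map)
      then obtain w where w': "B = snd w" "w \<in> set l" by (rule imageE)
      with B have w: "w \<in> set l" "x \<in> snd w" by simp_all
      then have "x \<in> fst (fst w)" using cov by blast
      then show "x \<in> (\<Union>x\<in>set (fst z). fst x)" using w(1) unfolding l(2) by (intro UN_I[of "fst w"]) simp_all
    qed
  qed
qed

definition Psi :: "nat \<Rightarrow> kind \<times> (int ^ 'd) \<Rightarrow> ((int ^ 'd) set \<times> kind \<times> (int ^ 'd)) pmf" where
  "Psi k = (\<lambda>(\<kappa>, x). map_pmf (\<lambda>w. (fst w, \<kappa>, snd w)) (walk_trace (el \<kappa> k) x))"

lemma run_Psi: "k \<le> n \<Longrightarrow> bind_pmf (map_pmf fst (J p)) (sys.run k) = Psi k p"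
proof (induction k)
  case 0
  obtain \<kappa> x where p: "p = (\<kappa>, x)" by (cases p)
  have "map_pmf fst (J p) = Psi 0 p"
    using s0 by (cases \<kappa>) (simp_all add: p J_def Psi_def el_def map_bind_pmf pmf.map_comp o_def map_pmf_const map_pmf_def[symmetric])
  then show ?case by (simp add: bind_return_pmf')
next
  case (Suc k)
  obtain \<kappa> x where p: "p = (\<kappa>, x)" by (cases p)
  have "bind_pmf (map_pmf fst (J p)) (sys.run (Suc k)) = bind_pmf (Psi k p) (Kern k)"
  proof -
    have "sys.run (Suc k) = (\<lambda>x. bind_pmf (sys.run k x) (Kern k))" by (simp add: fun_eq_iff)
    then have "bind_pmf (map_pmf fst (J p)) (sys.run (Suc k)) = bind_pmf (bind_pmf (map_pmf fst (J p)) (sys.run k)) (Kern k)"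
      by (simp only: bind_assoc_pmf)
    then show ?thesis using Suc.IH Suc.prems by (simp only: Suc_leD)
  qed
  also have "\<dots> = Psi (Suc k) p"
  proof -
    have "el \<kappa> (Suc k) = el \<kappa> k + (el \<kappa> (Suc k) - el \<kappa> k)" using el_mono[of k \<kappa>] Suc.prems by simp
    then have "walk_trace (el \<kappa> (Suc k)) x = walk_trace (el \<kappa> k + (el \<kappa> (Suc k) - el \<kappa> k)) x" by simp
    then show ?thesis
      by (simp add: p Psi_def Kern_def bind_map_pmf map_bind_pmf pmf.map_comp o_def walk_trace_add)
  qed
  finally show ?case .
qed

definition bad :: "(int ^ 'd) set \<Rightarrow> (int ^ 'd) set \<Rightarrow> ennreal" where
  "bad F A = indicator {A. A \<inter> F \<noteq> {}} A"

lemma avoid_bad: "avoid F A + bad F A = 1"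
  by (auto simp: avoid_def bad_def indicator_def)

lemma nn_integral_bad: "(\<integral>\<^sup>+w. bad F (fst w) \<partial>walk_trace k x) = hit k F x"
proof -
  have "(\<integral>\<^sup>+w. bad F (fst w) \<partial>walk_trace k x) = (\<integral>\<^sup>+w. indicator {z. fst z \<inter> F \<noteq> {}} w \<partial>walk_trace k x)"
    by (intro nn_integral_cong) (simp add: bad_def indicator_def)
  then show ?thesis by (simp add: hit_def)
qed

lemma pmf_complement: "(\<integral>\<^sup>+z. \<phi> z \<partial>q) + (\<integral>\<^sup>+z. \<psi> z \<partial>q) = 1" if "\<And>z. \<phi> z + \<psi> z = (1::ennreal)" for q :: "'x pmf"
  by (subst nn_integral_add[symmetric]) (auto simp: that)

lemma init_functional:
  assumes c: "\<And>z. \<phi> z + \<psi> z = (1::ennreal)"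
  shows "(\<integral>\<^sup>+l. (\<Prod>z\<leftarrow>l. \<phi> z) \<partial>poisson_list W (bind_pmf start J)) = exp_neg (\<integral>\<^sup>+p. ennreal (wt p) * (\<integral>\<^sup>+z. \<psi> z \<partial>J p) \<partial>count_space UNIV)"
  unfolding poisson_list_complement[OF W(2) c] nn_integral_bind_pmf nn_integral_start ..

text \<open>Independent moves of Poisson points give Poisson points again, and only their mean
  measure evolves, here through the law \<open>Psi k p\<close> of one walker.\<close>

lemma run_functional:
  assumes c: "\<And>z. \<phi> z + \<psi> z = (1::ennreal)" and k: "k \<le> n"
  shows "(\<integral>\<^sup>+z. (\<Prod>x\<leftarrow>fst z. \<integral>\<^sup>+y. \<phi> y \<partial>sys.run k x) \<partial>init) = exp_neg (\<integral>\<^sup>+p. ennreal (wt p) * (\<integral>\<^sup>+y. \<psi> y \<partial>Psi k p) \<partial>count_space UNIV)"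
proof -
  have "(\<integral>\<^sup>+z. (\<Prod>x\<leftarrow>fst z. \<integral>\<^sup>+y. \<phi> y \<partial>sys.run k x) \<partial>init) = (\<integral>\<^sup>+l. (\<Prod>z\<leftarrow>l. \<integral>\<^sup>+y. \<phi> y \<partial>sys.run k (fst z)) \<partial>poisson_list W (bind_pmf start J))"
    by (simp add: init_def o_def)
  also have "\<dots> = exp_neg (\<integral>\<^sup>+p. ennreal (wt p) * (\<integral>\<^sup>+z. (\<integral>\<^sup>+y. \<psi> y \<partial>sys.run k (fst z)) \<partial>J p) \<partial>count_space UNIV)"
    by (rule init_functional) (rule pmf_complement[OF c])
  also have "\<dots> = exp_neg (\<integral>\<^sup>+p. ennreal (wt p) * (\<integral>\<^sup>+y. \<psi> y \<partial>Psi k p) \<partial>count_space UNIV)"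
    unfolding run_Psi[OF k, symmetric] by simp
  finally show ?thesis .
qed

lemma source_void:
  "(\<integral>\<^sup>+z. avoid F (\<Union>x\<in>set (fst z). fst x) \<partial>sys.system n) = exp_neg ((\<integral>\<^sup>+x. ennreal (a2 x) * hit (el Full n) F x \<partial>count_space UNIV) +
     (\<integral>\<^sup>+x. ennreal (a1 x) * hit (el Early n) F x \<partial>count_space UNIV) + (\<integral>\<^sup>+x. ennreal (wt (Late, x)) * hit (el Late n) F x \<partial>count_space UNIV))"
proof -
  have "avoid F (\<Union>x\<in>set xs. fst x) = (\<Prod>x\<leftarrow>xs. avoid F (fst x))" for xs :: "((int ^ 'd) set \<times> kind \<times> (int ^ 'd)) list"
    using avoid_Union_list[of F "map fst xs"] by (simp add: o_def)
  then have "(\<integral>\<^sup>+z. avoid F (\<Union>x\<in>set (fst z). fst x) \<partial>sys.system n) = (\<integral>\<^sup>+z. (\<Prod>x\<leftarrow>fst z. \<integral>\<^sup>+y. avoid F (fst y) \<partial>sys.run n x) \<partial>init)"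
    by (simp only: sys.particles_system)
  also have "\<dots> = exp_neg (\<integral>\<^sup>+p. ennreal (wt p) * (\<integral>\<^sup>+y. bad F (fst y) \<partial>Psi n p) \<partial>count_space UNIV)"
    by (rule run_functional) (rule avoid_bad, simp)
  finally show ?thesis
    by (simp add: nn_integral_kind Psi_def nn_integral_bad) (simp add: wt_def)
qed

text \<open>The density of starting points of the available trajectories before thinning: the
  walkers at time 0 and the samples of all stages.\<close>

definition total :: "int ^ 'd \<Rightarrow> ennreal" where
  "total y = ennreal (a1 y + a2 y) + (\<Sum>k<n. \<Sum>c\<in>C. ennreal (1 - eps) * cm k c * ennreal (qm c y))"

lemma exp_neg_sum: "finite A \<Longrightarrow> exp_neg (\<Sum>x\<in>A. f x) = (\<Prod>x\<in>A. exp_neg (f x))"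
  by (induction rule: finite_induct) (auto simp: exp_neg_add, simp add: exp_neg_def)

lemma bad_if: "(\<integral>\<^sup>+b. bad F (if b then A else {}) \<partial>bernoulli_pmf r) = ennreal r * bad F A" if "0 \<le> r" "r \<le> 1"
  using that by (subst nn_integral_bernoulli_pmf) (auto simp: bad_def mult.commute)

lemma init_void: "(\<integral>\<^sup>+z. avoid F (snd z) \<partial>init) = exp_neg (\<integral>\<^sup>+y. ennreal (a1 y + a2 y) * (ennreal (th y) * hit L1 F y) \<partial>count_space UNIV)"
proof -
  have "(\<integral>\<^sup>+z. avoid F (snd z) \<partial>init) = (\<integral>\<^sup>+l. (\<Prod>z\<leftarrow>l. avoid F (snd z)) \<partial>poisson_list W (bind_pmf start J))"
  proof -
    have "avoid F (\<Union>(snd ` set l)) = (\<Prod>z\<leftarrow>l. avoid F (snd z))" for l :: "(((int ^ 'd) set \<times> kind \<times> (int ^ 'd)) \<times> (int ^ 'd) set) list"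
      using avoid_Union_list[of F "map snd l"] by (simp add: o_def)
    then show ?thesis by (simp add: init_def)
  qed
  also have "\<dots> = exp_neg (\<integral>\<^sup>+p. ennreal (wt p) * (\<integral>\<^sup>+z. bad F (snd z) \<partial>J p) \<partial>count_space UNIV)"
    by (rule init_functional) (rule avoid_bad)
  also have "(\<integral>\<^sup>+p. ennreal (wt p) * (\<integral>\<^sup>+z. bad F (snd z) \<partial>J p) \<partial>count_space UNIV) =
     (\<integral>\<^sup>+y. ennreal (a2 y) * (ennreal (th y) * hit L1 F y) \<partial>count_space UNIV) + (\<integral>\<^sup>+y. ennreal (a1 y) * (ennreal (th y) * hit L1 F y) \<partial>count_space UNIV)"
  proof -
    have Jf: "(\<integral>\<^sup>+z. bad F (snd z) \<partial>J (\<kappa>, x)) = ennreal (th x) * hit L1 F x" if "\<kappa> \<noteq> Late" for \<kappa> x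
      using that th[of x] by (simp add: J_def bad_if nn_integral_cmult nn_integral_bad del: nn_integral_bernoulli_pmf)
    have Jl: "(\<integral>\<^sup>+z. bad F (snd z) \<partial>J (Late, x)) = 0" for x by (simp add: J_def bad_def)
    show ?thesis by (simp add: nn_integral_kind Jf Jl) (simp add: wt_def)
  qed
  also have "\<dots> = (\<integral>\<^sup>+y. ennreal (a1 y + a2 y) * (ennreal (th y) * hit L1 F y) \<partial>count_space UNIV)"
    using a1 a2 by (subst nn_integral_add[symmetric]) (auto simp: distrib_right add.commute intro!: nn_integral_cong)
  finally show ?thesis .
qed

text \<open>A Poisson number of independent samples avoids \<open>F\<close> with probability exp of
  minus its mean times the hitting probability. The normalization \<open>qa c\<close> of the sampled
  law cancels against the factor in \<open>lam\<close>.\<close>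

lemma stage_void:
  assumes k: "k < n" and c: "c \<in> C"
  shows "ennreal (exp (lam k c * (enn2real (sys.st.avoid_prob F c) - 1))) =
    exp_neg (\<integral>\<^sup>+y. (ennreal (1 - eps) * cm k c * ennreal (qm c y)) * (ennreal (th y) * hit L1 F y) \<partial>count_space UNIV)"
proof -
  let ?b = "\<integral>\<^sup>+z. bad F (fst z) \<partial>Qk c"
  have one: "sys.st.avoid_prob F c + ?b = 1"
    unfolding sys.st.avoid_prob_def by (rule pmf_complement[OF avoid_bad])
  then have "sys.st.avoid_prob F c \<noteq> \<infinity>" "?b \<noteq> \<infinity>" by (auto simp: top_unique)
  then obtain u v where uv: "sys.st.avoid_prob F c = ennreal u" "0 \<le> u" "?b = ennreal v" "0 \<le> v"
    by (cases "sys.st.avoid_prob F c"; cases ?b) auto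
  have "ennreal (u + v) = ennreal 1" using one uv by simp
  then have "u - 1 = - v" using uv by (subst (asm) ennreal_inj) auto
  then have "ennreal (exp (lam k c * (enn2real (sys.st.avoid_prob F c) - 1))) = exp_neg (ennreal (lam k c) * ?b)"
    using uv lam_pos[OF k c] by (simp add: exp_neg_ennreal ennreal_mult[symmetric])
  also have "?b = (\<integral>\<^sup>+y. ennreal (qm c y / qa c) * (ennreal (th y) * hit L1 F y) \<partial>count_space UNIV)"
    using th by (simp add: Qk_def thin_def bad_if nn_integral_cmult nn_integral_bad nn_integral_measure_pmf[of "qp c"] pmf_qp[OF c] del: nn_integral_bernoulli_pmf)
  also have "ennreal (lam k c) * \<dots> = (\<integral>\<^sup>+y. ennreal (lam k c) * (ennreal (qm c y / qa c) * (ennreal (th y) * hit L1 F y)) \<partial>count_space UNIV)"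
    by (rule nn_integral_cmult[symmetric]) simp
  also have "\<dots> = (\<integral>\<^sup>+y. (ennreal (1 - eps) * cm k c * ennreal (qm c y)) * (ennreal (th y) * hit L1 F y) \<partial>count_space UNIV)"
  proof (intro nn_integral_cong)
    fix y
    have e: "cm k c = ennreal (enn2real (cm k c))" using cm_le[of k c] by simp
    have "ennreal (lam k c) * ennreal (qm c y / qa c) = ennreal (lam k c * (qm c y / qa c))"
      using lam_pos[OF k c] qm0 qa(2)[OF c] by (intro ennreal_mult[symmetric]) auto
    also have "lam k c * (qm c y / qa c) = (1 - eps) * enn2real (cm k c) * qm c y"
      using qa(2)[OF c] by (simp add: lam_def)
    also have "ennreal \<dots> = ennreal (1 - eps) * cm k c * ennreal (qm c y)"
      using eps qm0 by (subst (2) e) (simp add: ennreal_mult)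
    finally have f: "ennreal (lam k c) * ennreal (qm c y / qa c) = ennreal (1 - eps) * cm k c * ennreal (qm c y)" .
    show "ennreal (lam k c) * (ennreal (qm c y / qa c) * (ennreal (th y) * hit L1 F y)) = (ennreal (1 - eps) * cm k c * ennreal (qm c y)) * (ennreal (th y) * hit L1 F y)"
      by (simp only: mult.assoc[symmetric] f)
  qed
  finally show ?thesis .
qed

lemma target_void: "(\<integral>\<^sup>+z. avoid F (snd z) \<partial>sys.system n) = exp_neg (\<integral>\<^sup>+y. total y * (ennreal (th y) * hit L1 F y) \<partial>count_space UNIV)"
proof -
  let ?h = "\<lambda>y. ennreal (th y) * hit L1 F y" let ?I = "\<lambda>k c. \<integral>\<^sup>+y. (ennreal (1 - eps) * cm k c * ennreal (qm c y)) * ?h y \<partial>count_space UNIV"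
  have "(\<integral>\<^sup>+z. avoid F (snd z) \<partial>sys.system n) = exp_neg (\<integral>\<^sup>+y. ennreal (a1 y + a2 y) * ?h y \<partial>count_space UNIV) *
     (\<Prod>k<n. \<Prod>c\<in>C. exp_neg (?I k c))"
    unfolding sys.avoid_system init_void
    by (intro arg_cong2[where f = "(*)"] refl prod.cong) (auto simp: Ck_def stage_void)
  also have "\<dots> = exp_neg ((\<integral>\<^sup>+y. ennreal (a1 y + a2 y) * ?h y \<partial>count_space UNIV) + (\<Sum>k<n. \<Sum>c\<in>C. ?I k c))"
    using C(1) by (simp add: exp_neg_add exp_neg_sum)
  also have "(\<integral>\<^sup>+y. ennreal (a1 y + a2 y) * ?h y \<partial>count_space UNIV) + (\<Sum>k<n. \<Sum>c\<in>C. ?I k c) = (\<integral>\<^sup>+y. total y * ?h y \<partial>count_space UNIV)"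
    unfolding total_def distrib_right sum_distrib_right by (subst nn_integral_add, simp, simp) (simp add: nn_integral_sum)
  finally show ?thesis .
qed

text \<open>In the first half the contribution of \<open>a1\<close> comes from \<open>Early\<close>
  walkers, in the second half from \<open>Late\<close> ones, whose starting density already contains
  \<open>Hf\<close> steps. By the Chapman-Kolmogorov equation both give the kernel at time
  \<open>s k\<close>.\<close>

lemma cell_mass:
  assumes k: "k < n"
  shows "(\<integral>\<^sup>+p. ennreal (wt p) * (\<integral>\<^sup>+y. indicator {y. cellk k y = Some c} y \<partial>Psi k p) \<partial>count_space UNIV) = cm k c"
proof -
  let ?i = "\<lambda>z. indicator {z. cellof z = c} z :: ennreal"
  have P: "(\<integral>\<^sup>+y. indicator {y. cellk k y = Some c} y \<partial>Psi k (\<kappa>, x)) = (if act \<kappa> k then (\<integral>\<^sup>+z. ennreal (hk (el \<kappa> k) (z - x)) * ?i z \<partial>count_space UNIV) else 0)" for \<kappa> x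
  proof -
    have "(\<integral>\<^sup>+y. indicator {y. cellk k y = Some c} y \<partial>Psi k (\<kappa>, x)) = (\<integral>\<^sup>+w. (if act \<kappa> k then ?i (snd w) else 0) \<partial>walk_trace (el \<kappa> k) x)"
      unfolding Psi_def by (auto simp: cellk_def indicator_def intro!: nn_integral_cong simp del: nn_integral_indicator)
    also have "\<dots> = (\<integral>\<^sup>+z. (if act \<kappa> k then ?i z else 0) \<partial>map_pmf snd (walk_trace (el \<kappa> k) x))" by simp
    also have "\<dots> = (if act \<kappa> k then (\<integral>\<^sup>+z. ?i (x + z) \<partial>walk_pos (el \<kappa> k)) else 0)"
      unfolding map_snd_walk_trace by simp
    also have "(\<integral>\<^sup>+z. ?i (x + z) \<partial>walk_pos (el \<kappa> k)) = (\<integral>\<^sup>+z. ennreal (hk (el \<kappa> k) z) * ?i (x + z) \<partial>count_space UNIV)"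
      by (rule nn_integral_measure_pmf)
    also have "\<dots> = (\<integral>\<^sup>+z. ennreal (hk (el \<kappa> k) (z - x)) * ?i z \<partial>count_space UNIV)"
      using nn_shift[of "\<lambda>z. ennreal (hk (el \<kappa> k) z) * ?i (x + z)" x] by simp
    finally show ?thesis .
  qed
  have sw: "(\<integral>\<^sup>+x. ennreal (b x) * (\<integral>\<^sup>+z. ennreal (hk j (z - x)) * ?i z \<partial>count_space UNIV) \<partial>count_space UNIV) =
    (\<integral>\<^sup>+z. ?i z * (\<integral>\<^sup>+x. ennreal (b x) * ennreal (hk j (z - x)) \<partial>count_space UNIV) \<partial>count_space UNIV)" for b j
    unfolding nn_integral_cmult[OF borel_measurable_count_space, symmetric]
    by (subst swap_count) (intro nn_integral_cong, simp add: mult_ac)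
  have add: "(\<integral>\<^sup>+z. ?i z * (\<integral>\<^sup>+x. ennreal (a2 x) * ennreal (hk (s k) (z - x)) \<partial>count_space UNIV) \<partial>count_space UNIV) +
     (\<integral>\<^sup>+z. ?i z * (\<integral>\<^sup>+x. ennreal (a1 x) * ennreal (hk (s k) (z - x)) \<partial>count_space UNIV) \<partial>count_space UNIV) = cm k c"
    unfolding cm_def occ_def using a1 a2
    by (subst nn_integral_add[symmetric], simp, simp)
      (intro nn_integral_cong, simp add: distrib_left[symmetric] nn_integral_add[symmetric] distrib_right[symmetric] add.commute)
  have wF: "wt (Full, x) = a2 x" "wt (Early, x) = a1 x" for x by (simp_all add: wt_def)
  show ?thesis
  proof (cases "k < m")
    case True
    then have "s k \<le> Hf" using step[OF k] early[OF k True] by simp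
    then show ?thesis
      using True add unfolding nn_integral_kind P wF sw by (simp add: act_def el_def sw)
  next
    case False
    then have h: "Hf \<le> s k" using late[OF k] by simp
    have "(\<integral>\<^sup>+x. ennreal (wt (Late, x)) * ennreal (hk (s k - Hf) (z - x)) \<partial>count_space UNIV) = (\<integral>\<^sup>+x. ennreal (a1 x) * ennreal (hk (s k) (z - x)) \<partial>count_space UNIV)" for z
    proof -
      have "(\<integral>\<^sup>+x. ennreal (wt (Late, x)) * ennreal (hk (s k - Hf) (z - x)) \<partial>count_space UNIV) =
        (\<integral>\<^sup>+x. \<integral>\<^sup>+y. ennreal (a1 y) * (ennreal (hk Hf (x - y)) * ennreal (hk (s k - Hf) (z - x))) \<partial>count_space UNIV \<partial>count_space UNIV)"
        unfolding wt_Late nn_integral_multc[OF borel_measurable_count_space, symmetric] by (simp add: mult.assoc)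
      also have "\<dots> = (\<integral>\<^sup>+y. ennreal (a1 y) * ennreal (hk (Hf + (s k - Hf)) (z - y)) \<partial>count_space UNIV)"
        by (subst swap_count) (simp add: nn_integral_cmult hk_chapman)
      finally show ?thesis using h by simp
    qed
    then show ?thesis
      using False add unfolding nn_integral_kind P wF sw by (simp add: act_def el_def sw)
  qed
qed

text \<open>The walkers in a cell form a Poisson number with mean \<open>cm k c\<close>, so the
  product of the factors \<open>tilt\<close> has an explicit expectation.\<close>

lemma miss_bound:
  assumes t: "0 < t"
  shows "(\<integral>\<^sup>+z. indicator {z. \<not> snd z \<subseteq> (\<Union>x\<in>set (fst z). fst x)} z \<partial>sys.system n) \<le>
    (\<Sum>k<n. \<Sum>c\<in>C. ennreal (exp (lam k c * (exp t - 1))) * exp_neg (cm k c * ennreal (qa c * (1 - exp (- t)))))"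
proof -
  have "(\<integral>\<^sup>+z. indicator {z. \<not> snd z \<subseteq> (\<Union>x\<in>set (fst z). fst x)} z \<partial>sys.system n) = (\<integral>\<^sup>+z. sys.st.miss z \<partial>sys.system n)"
    by (intro nn_integral_cong) (simp add: sys.st.miss_def[abs_def])
  also have "\<dots> \<le> (\<Sum>k<n. \<Sum>c\<in>Ck k. ennreal (exp (lam k c * (exp t - 1))) *
       (\<integral>\<^sup>+z. (\<Prod>x\<leftarrow>fst z. \<integral>\<^sup>+y. ennreal (sys.st.tilt k t c y) \<partial>sys.run k x) \<partial>init))"
    by (rule sys.miss_system[OF t])
  also have "\<dots> = (\<Sum>k<n. \<Sum>c\<in>C. ennreal (exp (lam k c * (exp t - 1))) * exp_neg (cm k c * ennreal (qa c * (1 - exp (- t)))))"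
  proof (intro sum.cong refl)
    fix k assume k: "k \<in> {..<n}"
    then show "Ck k = C" by (simp add: Ck_def)
    fix c assume c: "c \<in> C"
    let ?r = "qa c * (1 - exp (- t))" let ?\<psi> = "\<lambda>y. ennreal ?r * indicator {y. cellk k y = Some c} y"
    have r: "0 \<le> ?r" "?r \<le> 1" using qa[OF c] t mult_le_one[of "qa c" "1 - exp (- t)"] by auto
    have "ennreal (sys.st.tilt k t c y) + ?\<psi> y = 1" for y
      using r by (auto simp: sys.st.tilt_def indicator_def ennreal_plus[symmetric] simp del: ennreal_plus)
    from run_functional[OF this, of k] k
    have "(\<integral>\<^sup>+z. (\<Prod>x\<leftarrow>fst z. \<integral>\<^sup>+y. ennreal (sys.st.tilt k t c y) \<partial>sys.run k x) \<partial>init) =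
      exp_neg (\<integral>\<^sup>+p. ennreal (wt p) * (\<integral>\<^sup>+y. ?\<psi> y \<partial>Psi k p) \<partial>count_space UNIV)" by simp
    also have "(\<integral>\<^sup>+p. ennreal (wt p) * (\<integral>\<^sup>+y. ?\<psi> y \<partial>Psi k p) \<partial>count_space UNIV) =
       ennreal ?r * (\<integral>\<^sup>+p. ennreal (wt p) * (\<integral>\<^sup>+y. indicator {y. cellk k y = Some c} y \<partial>Psi k p) \<partial>count_space UNIV)"
    proof -
      have "(\<integral>\<^sup>+p. ennreal (wt p) * (\<integral>\<^sup>+y. ?\<psi> y \<partial>Psi k p) \<partial>count_space UNIV) =
         (\<integral>\<^sup>+p. ennreal ?r * (ennreal (wt p) * (\<integral>\<^sup>+y. indicator {y. cellk k y = Some c} y \<partial>Psi k p)) \<partial>count_space UNIV)"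
        by (intro nn_integral_cong, subst nn_integral_cmult, simp, rule mult.left_commute)
      also have "\<dots> = ennreal ?r * (\<integral>\<^sup>+p. ennreal (wt p) * (\<integral>\<^sup>+y. indicator {y. cellk k y = Some c} y \<partial>Psi k p) \<partial>count_space UNIV)"
        by (rule nn_integral_cmult) simp
      finally show ?thesis .
    qed
    also have "\<dots> = cm k c * ennreal ?r" using k cell_mass[of k c] by (simp add: mult.commute)
    finally show "ennreal (exp (lam k c * (exp t - 1))) * (\<integral>\<^sup>+z. (\<Prod>x\<leftarrow>fst z. \<integral>\<^sup>+y. ennreal (sys.st.tilt k t c y) \<partial>sys.run k x) \<partial>init)
       = ennreal (exp (lam k c * (exp t - 1))) * exp_neg (cm k c * ennreal ?r)" by simp
  qed
  finally show ?thesis .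
qed

end

section \<open>Cells and the time schedule\<close>

lemma mem_lattice_ball: "y \<in> lattice_ball 0 r \<longleftrightarrow> (\<forall>i. \<bar>y $ i\<bar> \<le> int r)" for y :: "int ^ 'd::finite"
  by (auto simp: lattice_ball_def linf_def)

lemma bij_betw_box:
  fixes lo hi :: "'d::finite \<Rightarrow> int"
  shows "bij_betw vec_lambda (PiE UNIV (\<lambda>i. {lo i..hi i})) {y :: int ^ 'd. \<forall>i. lo i \<le> y $ i \<and> y $ i \<le> hi i}"
  by (rule bij_betwI[where g = vec_nth]) (auto simp: PiE_iff)

lemma finite_box: "finite {y :: int ^ 'd::finite. \<forall>i. lo i \<le> y $ i \<and> y $ i \<le> hi i}"
  using bij_betw_finite[OF bij_betw_box[of lo hi]] by (simp add: finite_PiE)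

lemma card_box: "card {y :: int ^ 'd::finite. \<forall>i. lo i \<le> y $ i \<and> y $ i \<le> hi i} = (\<Prod>i\<in>UNIV. nat (hi i - lo i + 1))"
  using bij_betw_same_card[OF bij_betw_box[of lo hi]] by (simp add: card_PiE)

lemma lattice_ball_box: "lattice_ball 0 r = {y :: int ^ 'd::finite. \<forall>i. - int r \<le> y $ i \<and> y $ i \<le> int r}"
proof -
  have "\<bar>x\<bar> \<le> int r \<longleftrightarrow> - int r \<le> x \<and> x \<le> int r" for x by linarith
  then show ?thesis by (simp add: set_eq_iff mem_lattice_ball)
qed

lemma finite_lattice_ball: "finite (lattice_ball 0 r :: (int ^ 'd::finite) set)"
  unfolding lattice_ball_box by (rule finite_box)

lemma card_lattice_ball: "card (lattice_ball 0 r :: (int ^ 'd::finite) set) = (2 * r + 1) ^ CARD('d)"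
proof -
  have "nat (int r - - int r + 1) = 2 * r + 1" by linarith
  then show ?thesis unfolding lattice_ball_box by (subst card_box) (simp only: prod_constant)
qed

text \<open>Here \<open>L1\<close> is the range called \<open>L'\<close> in the theorem, and \<open>L = 2 * M * L1\<close>.\<close>

locale schedule =
  fixes f1 f2 :: "int ^ 'd::finite \<Rightarrow> real" and u d :: real and K M L1 :: nat
  assumes d_eq: "d = real CARD('d)" and d3: "3 \<le> CARD('d)"
    and f1: "\<And>x. 0 \<le> f1 x" and f2: "\<And>x. 0 \<le> f2 x" and u: "0 < u" and L1: "1 \<le> L1"
    and fb: "\<And>x. x \<in> lattice_ball 0 (K + 2 * M * L1) \<Longrightarrow> f1 x + f2 x \<le> u \<and> real (2 * M * L1) powr (- 1/4) \<le> f1 x + f2 x"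
    and N0: "10000 * CARD('d) ^ 2 \<le> 2 * M"
    and big: "(2 * M) ^ (20 * CARD('d) + 20) \<le> 2 * M * L1"
begin

definition N :: nat where "N = 2 * M"
definition L :: nat where "L = 2 * M * L1"
definition Hf :: nat where "Hf = M * L1"
text \<open>The surplus time of a stage. Added up over at most \<open>N\<close> stages it does not
  exceed \<open>L1\<close>, the length of one slot, yet it is at least \<open>N ^ 20\<close>, which
  leaves room for large cells.\<close>

definition g :: nat where "g = L1 div N"
text \<open>The side of a cell, smaller than the diffusive distance \<open>sqrt g\<close> by the
  factor \<open>N ^ 2\<close>. A shift by \<open>l\<close> at distances up to \<open>R\<close> then
  changes the kernel by a relative amount of order \<open>l * R / g\<close>, that is
  \<open>N powr (-3/2)\<close>.\<close>

definition l :: nat where "l = nat \<lfloor>sqrt (real g) / (real N)\<^sup>2\<rfloor>"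
text \<open>The distance that a walk of \<open>g\<close> steps exceeds with probability of order
  \<open>exp (- N / 2)\<close> only.\<close>

definition R :: real where "R = sqrt (real g * real N)"
definition cellof :: "int ^ 'd \<Rightarrow> int ^ 'd" where "cellof z = (\<chi> i. (z $ i) div int l)"
text \<open>The radius is a compromise: walkers released within distance \<open>K\<close> rarely
  leave this region before time \<open>L\<close>, and it is still so far inside the ball of radius
  \<open>K + L\<close> that walkers of that ball populate all its cells.\<close>

definition C :: "(int ^ 'd) set" where "C = cellof ` lattice_ball 0 (K + L div 4)"
definition qm :: "int ^ 'd \<Rightarrow> int ^ 'd \<Rightarrow> real" where
  "qm c y = max 0 (INF z\<in>{z. cellof z = c}. hk g (y - z))"

lemma d: "3 \<le> d" using d3 by (simp add: d_eq)

lemma N_bounds: "10000 * d\<^sup>2 \<le> real N" "90000 \<le> real N" "0 < N"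
proof -
  have "real (10000 * CARD('d) ^ 2) \<le> real (2 * M)" using N0 by (simp only: of_nat_le_iff)
  then show a: "10000 * d\<^sup>2 \<le> real N" by (simp add: N_def d_eq)
  have "(3::real)\<^sup>2 \<le> d\<^sup>2" using d by (intro power_mono) auto
  then show "90000 \<le> real N" using a by simp
  then show "0 < N" by simp
qed

lemma L_eq: "real L = real N * real L1" "real Hf = real L / 2" "L = N * L1" "L = 2 * Hf"
  by (simp_all add: L_def N_def Hf_def)

lemma L1_big: "N ^ (20 * CARD('d) + 19) \<le> L1"
proof -
  have e: "20 * CARD('d) + 20 = Suc (20 * CARD('d) + 19)" by simp
  have "N * N ^ (20 * CARD('d) + 19) \<le> N * L1"
    using big unfolding e power_Suc N_def .
  then show ?thesis using N_bounds(3) by simp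
qed

lemma N_pow_le: "k \<le> 20 * CARD('d) + 19 \<Longrightarrow> N ^ k \<le> L1"
  using L1_big power_increasing[of k "20 * CARD('d) + 19" N] N_bounds(3) by simp

lemma g_bounds: "g * N \<le> L1" "N ^ 20 \<le> g" "real L \<le> 2 * (real N)\<^sup>2 * real g"
proof -
  show "g * N \<le> L1" by (simp add: g_def)
  have "N ^ 20 * N \<le> L1" using N_pow_le[of 21] d3 by (simp add: power_Suc2[symmetric] del: power_Suc2)
  then show g20: "N ^ 20 \<le> g" unfolding g_def using N_bounds(3) by (subst less_eq_div_iff_mult_less_eq) auto
  have g1: "1 \<le> g" using g20 one_le_power[of N 20] N_bounds(3) by linarith
  have "N * g + L1 mod N = L1" unfolding g_def by simp
  moreover have "L1 mod N < N" using N_bounds(3) by simp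
  ultimately have "L1 \<le> N * g + N" by linarith
  also have "\<dots> \<le> 2 * (N * g)" using g1 by (cases g) auto
  finally have "N * L1 \<le> N * (2 * (N * g))" by simp
  then have "real (N * L1) \<le> real (N * (2 * (N * g)))" by (simp only: of_nat_le_iff)
  then show "real L \<le> 2 * (real N)\<^sup>2 * real g" by (simp add: L_eq power2_eq_square algebra_simps)
qed

lemma g_real: "(real N) ^ 20 \<le> real g" "0 < g" "real N \<le> real g" "real N ^ 10 \<le> sqrt (real g)"
proof -
  show a: "(real N) ^ 20 \<le> real g" using g_bounds(2) by (simp flip: of_nat_power)
  show "0 < g" using g_bounds(2) one_le_power[of N 20] N_bounds(3) by linarith
  have "real N ^ 1 \<le> real N ^ 20" using N_bounds by (intro power_increasing) auto
  then show "real N \<le> real g" using a by simp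
  have "(real N ^ 10)\<^sup>2 \<le> real g" using a by (simp add: power_mult[symmetric])
  then show "real N ^ 10 \<le> sqrt (real g)" by (rule real_le_rsqrt)
qed

lemma l_bounds: "1 \<le> l" "real l \<le> sqrt (real g) / (real N)\<^sup>2" "sqrt (real g) / (2 * (real N)\<^sup>2) \<le> real l"
proof -
  let ?x = "sqrt (real g) / (real N)\<^sup>2"
  have n2: "0 < (real N)\<^sup>2" using N_bounds by simp
  have "(real N)\<^sup>2 \<le> real N ^ 10" using N_bounds by (intro power_increasing) auto
  then have x1: "1 \<le> ?x" using g_real(4) n2 by (simp add: le_divide_eq)
  then show "1 \<le> l" unfolding l_def by (simp add: le_nat_iff)
  have r: "real l = real_of_int \<lfloor>?x\<rfloor>" using x1 unfolding l_def by simp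
  show "real l \<le> ?x" unfolding r by simp
  have "?x - 1 < real l" unfolding r by linarith
  moreover have "y / 2 \<le> k" if "y - 1 < k" "1 \<le> k" for y k :: real using that by simp
  ultimately have "?x / 2 \<le> real l" using \<open>1 \<le> l\<close> by simp
  moreover have "sqrt (real g) / (2 * (real N)\<^sup>2) = ?x / 2" by simp
  ultimately show "sqrt (real g) / (2 * (real N)\<^sup>2) \<le> real l" by (simp only:)
qed

lemma L_big: "real g \<le> real L" "real N \<le> real L1" "real L1 \<le> real L" "4 * real l \<le> real L - 8" "real N \<le> real L"
proof -
  have "g \<le> L1" by (simp add: g_def)
  then have a: "real g \<le> real L1" by simp
  show b: "real L1 \<le> real L" unfolding L_eq using N_bounds(2) mult_right_mono[of 1 "real N" "real L1"] by simp
  then show "real g \<le> real L" using a by simp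
  show c: "real N \<le> real L1" using N_pow_le[of 1] by simp
  then show "real N \<le> real L" using b by simp
  have "real l \<le> sqrt (real g) / (real N)\<^sup>2" by (rule l_bounds)
  also have "\<dots> \<le> sqrt (real g) / 1" using N_bounds(2) one_le_power[of "real N" 2] by (intro divide_left_mono) auto
  also have "\<dots> \<le> real g" using g_real(2) self_le_power[of "real g" 2] by (simp add: real_le_lsqrt)
  also have "\<dots> \<le> real L1" by (rule a)
  finally have l: "real l \<le> real L1" .
  have L1r: "1 \<le> real L1" using L1 by simp
  have "real N * real L1 \<ge> 90000 * real L1" using N_bounds(2) by (intro mult_right_mono) auto
  then show "4 * real l \<le> real L - 8" unfolding L_eq(1) using l L1r by linarith
qed

lemma cell_same: "cellof z = cellof z' \<Longrightarrow> \<bar>z $ i - z' $ i\<bar> \<le> int l"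
proof -
  assume "cellof z = cellof z'"
  then have e: "z $ i div int l = z' $ i div int l" by (simp add: cellof_def vec_eq_iff)
  have l0: "0 < int l" using l_bounds(1) by simp
  have "z $ i - z' $ i = z $ i mod int l - z' $ i mod int l"
  proof -
    have "int l * (z $ i div int l) + z $ i mod int l = z $ i" "int l * (z' $ i div int l) + z' $ i mod int l = z' $ i" by simp_all
    then show ?thesis unfolding e by linarith
  qed
  moreover have "0 \<le> z $ i mod int l" "z $ i mod int l < int l" "0 \<le> z' $ i mod int l" "z' $ i mod int l < int l" using l0 by auto
  ultimately show ?thesis by linarith
qed

lemma cell_box: "{z. cellof z = c} = {z. \<forall>i. int l * (c $ i) \<le> z $ i \<and> z $ i \<le> int l * (c $ i) + int l - 1}"
proof -
  have l0: "0 < int l" using l_bounds(1) by simp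
  have "x div int l = k \<longleftrightarrow> int l * k \<le> x \<and> x \<le> int l * k + int l - 1" for x k
  proof
    assume "x div int l = k"
    then have "x = int l * k + x mod int l" using mult_div_mod_eq[of "int l" x] by simp
    moreover have "0 \<le> x mod int l" "x mod int l < int l" using l0 by auto
    ultimately show "int l * k \<le> x \<and> x \<le> int l * k + int l - 1" by linarith
  next
    assume a: "int l * k \<le> x \<and> x \<le> int l * k + int l - 1"
    then have "(x - int l * k) div int l = 0" by (intro div_pos_pos_trivial) auto
    moreover have "x div int l = k + (x - int l * k) div int l"
      using l0 div_mult_self2[of "int l" "x - int l * k" k] by simp
    ultimately show "x div int l = k" by simp
  qed
  then show ?thesis by (auto simp: cellof_def vec_eq_iff)
qed

lemma card_cell: "card {z. cellof z = c} = l ^ CARD('d)"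
  unfolding cell_box by (subst card_box) simp

lemma finite_cell: "finite {z. cellof z = c}"
  unfolding cell_box by (rule finite_box)

lemma cell_nonempty: "{z. cellof z = c} \<noteq> {}"
proof
  assume *: "{z. cellof z = c} = {}"
  have "l ^ CARD('d) = 0" using card_cell[of c] unfolding * by simp
  then show False using l_bounds(1) by simp
qed

lemma qm_le: "cellof z = c \<Longrightarrow> qm c y \<le> hk g (y - z)"
  unfolding qm_def by (auto intro!: cINF_lower bdd_belowI[of _ 0])

lemma qm_nonneg: "0 \<le> qm c y" by (simp add: qm_def)

lemma qm_ge: "(\<And>z. cellof z = c \<Longrightarrow> b \<le> hk g (y - z)) \<Longrightarrow> b \<le> qm c y"
  unfolding qm_def using cell_nonempty by (intro max.coboundedI2 cINF_greatest) auto

definition rS :: "int ^ 'd \<Rightarrow> ennreal" where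
  "rS x = low g 0 (hk_th TYPE('d) g) x + hk_far g R x"

definition shift_factor :: real where "shift_factor = (1 - 1 / (sqrt (real N))) ^ CARD('d)"

lemma d_le_N: "20 * d \<le> real N"
proof -
  have "d \<le> d * d" using d mult_left_mono[of 1 d d] by simp
  then show ?thesis using N_bounds(1) d unfolding power2_eq_square by linarith
qed

lemma sqrtN: "300 \<le> sqrt (real N)" "1 / sqrt (real N) \<le> 1/300" "0 < sqrt (real N)" "100 * d \<le> sqrt (real N)"
proof -
  have "(300::real)\<^sup>2 \<le> real N" using N_bounds(2) by simp
  then show a: "300 \<le> sqrt (real N)" by (rule real_le_rsqrt)
  then show "1 / sqrt (real N) \<le> 1/300" using N_bounds(3) by (intro divide_left_mono) auto
  show "0 < sqrt (real N)" using N_bounds(3) by simp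
  have "(100 * d)\<^sup>2 \<le> real N" using N_bounds(1) by (simp add: power_mult_distrib)
  then show "100 * d \<le> sqrt (real N)" by (rule real_le_rsqrt)
qed

lemma R_bounds: "0 \<le> R" "R \<le> real g" "1 \<le> R" "real l \<le> R" "5 * R \<le> real g / (4 * d)"
proof -
  show "0 \<le> R" by (simp add: R_def)
  have gN: "1 \<le> real g" using g_real(2) by simp
  have "R \<le> sqrt (real g * real g)" unfolding R_def using g_real(3) by (intro real_sqrt_le_mono mult_left_mono) auto
  then show "R \<le> real g" by simp
  have "1 * 1 \<le> real g * real N" using gN N_bounds by (intro mult_mono) auto
  then show "1 \<le> R" unfolding R_def by (intro real_le_rsqrt) simp
  have "real l \<le> sqrt (real g) / (real N)\<^sup>2" by (rule l_bounds)
  also have "\<dots> \<le> sqrt (real g) / 1" using N_bounds(2) one_le_power[of "real N" 2] by (intro divide_left_mono) auto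
  also have "\<dots> \<le> R" unfolding R_def using N_bounds(3) mult_left_mono[of 1 "sqrt (real N)" "sqrt (real g)"] by (simp add: real_sqrt_mult)
  finally show "real l \<le> R" .
  have "20 * d * sqrt (real N) \<le> real N * real N"
  proof -
    have "sqrt (real N) \<le> real N" using N_bounds by (simp add: real_le_lsqrt self_le_power)
    then show ?thesis using d d_le_N by (intro mult_mono) simp_all
  qed
  also have "\<dots> = real N ^ 2" by (simp add: power2_eq_square)
  also have "\<dots> \<le> real N ^ 10" using N_bounds by (intro power_increasing) auto
  also have "\<dots> \<le> sqrt (real g)" by (rule g_real)
  finally have "sqrt (real g) * (20 * d * sqrt (real N)) \<le> sqrt (real g) * sqrt (real g)" by (intro mult_left_mono) auto
  then have "20 * d * R \<le> real g" unfolding R_def by (simp add: real_sqrt_mult mult_ac)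
  then show "5 * R \<le> real g / (4 * d)" using d by (simp add: field_simps)
qed

text \<open>The choices of \<open>l\<close> and \<open>R\<close> were made for this estimate: moving
  the starting point within a cell costs a factor close to 1, apart from the error
  \<open>rS\<close>.\<close>

lemma shift_kernel:
  assumes h: "\<And>i. \<bar>h $ i\<bar> \<le> int l"
  shows "ennreal shift_factor * ennreal (hk g x) \<le> ennreal (hk g (x + h)) + rS x"
proof -
  let ?q = "4 * d * (real l * (2 * (R + real l) + 1)) / real g"
  have lin: "2 * (R + real l) + 1 \<le> 5 * R" using R_bounds(3,4) by simp
  \<comment> \<open>The left side is of order \<open>20 * d / (N * sqrt N)\<close>; one factor
    \<open>N\<close> absorbs \<open>20 * d\<close>.\<close>
  have q: "?q \<le> 1 / sqrt (real N)"
  proof -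
    have "real l * (2 * (R + real l) + 1) \<le> sqrt (real g) / (real N)\<^sup>2 * (5 * R)"
      using lin l_bounds(2) R_bounds by (intro mult_mono) auto
    also have "\<dots> = 5 * real g * sqrt (real N) / (real N)\<^sup>2" by (simp add: R_def real_sqrt_mult)
    finally have "?q \<le> 4 * d * (5 * real g * sqrt (real N) / (real N)\<^sup>2) / real g"
      using d by (intro divide_right_mono mult_left_mono) auto
    also have "\<dots> = (20 * d / real N) * (sqrt (real N) / real N)" using g_real(2) by (simp add: power2_eq_square)
    also have "\<dots> \<le> 1 * (sqrt (real N) / real N)"
    proof (intro mult_right_mono)
      show "20 * d / real N \<le> 1" using N_bounds(3) d_le_N by (simp add: divide_le_eq)
    qed auto
    also have "\<dots> = 1 / sqrt (real N)" using N_bounds by (simp add: field_simps)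
    finally show ?thesis .
  qed
  have q1: "?q \<le> 1" using q sqrtN by linarith
  have keep: "0 \<le> ?q" using R_bounds d by (intro divide_nonneg_nonneg mult_nonneg_nonneg) auto
  have "ennreal ((1 - ?q) ^ CARD('d)) * ennreal (hk g x) \<le> ennreal (hk g (x + h)) + rS x"
    unfolding rS_def d_eq by (rule hk_shift[OF g_real(2) R_bounds(1) _ q1[unfolded d_eq] h]) (use lin R_bounds(5) in \<open>simp add: d_eq\<close>)
  moreover have "shift_factor \<le> (1 - ?q) ^ CARD('d)" unfolding shift_factor_def using q sqrtN by (intro power_mono) auto
  then have "ennreal shift_factor * ennreal (hk g x) \<le> ennreal ((1 - ?q) ^ CARD('d)) * ennreal (hk g x)"
    by (intro mult_right_mono ennreal_leI) auto
  ultimately show ?thesis by (rule order_trans[rotated])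
qed

text \<open>Any other point of the cell is a shift of \<open>z\<close> by at most \<open>l\<close>
  in each coordinate, so the bound of \<open>shift_kernel\<close> holds for all of them and hence
  for the infimum.\<close>

lemma qm_lower:
  "ennreal shift_factor * ennreal (hk g (y - z)) \<le> ennreal (qm (cellof z) y) + rS (y - z)"
proof (cases "rS (y - z) = \<infinity>")
  case False
  then obtain r where r: "rS (y - z) = ennreal r" "0 \<le> r" by (cases "rS (y - z)") auto
  have k0: "0 \<le> shift_factor" unfolding shift_factor_def using sqrtN by simp
  have "shift_factor * hk g (y - z) - r \<le> qm (cellof z) y"
  proof (rule qm_ge)
    fix z' assume "cellof z' = cellof z"
    then have "\<bar>(z - z') $ i\<bar> \<le> int l" for i using cell_same[of z z' i] by simp
    from shift_kernel[of "z - z'", OF this, of "y - z"]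
    have "ennreal (shift_factor * hk g (y - z)) \<le> ennreal (hk g (y - z') + r)"
      using k0 r by (simp add: ennreal_mult ennreal_plus)
    then show "shift_factor * hk g (y - z) - r \<le> hk g (y - z')" using r by (subst (asm) ennreal_le_iff) auto
  qed
  then have "ennreal (shift_factor * hk g (y - z)) \<le> ennreal (qm (cellof z) y + r)" by (intro ennreal_leI) simp
  then show ?thesis using k0 r qm_nonneg by (simp add: ennreal_mult ennreal_plus)
qed simp

section \<open>Evolving densities, error kernels and the timetable\<close>

definition kap :: real where "kap = 4 * d / real L"
definition A :: "int ^ 'd \<Rightarrow> real" where
  "A x = kap * (f1 x + f2 x) * indicator (lattice_ball 0 (K + L)) x"
definition F :: "int ^ 'd \<Rightarrow> real" where
  "F x = kap * (f1 x + f2 x) * indicator (lattice_ball 0 K) x"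

text \<open>Convolution with \<open>F\<close>, used for heat kernels, where it is the density
  \<open>T n\<close> of the walkers at time \<open>n\<close>, and for error kernels as well. So
  \<open>er_mono\<close> carries an inequality between kernels over to densities, and
  \<open>er_mass\<close> computes the mass of the error.\<close>

definition er :: "(int ^ 'd \<Rightarrow> ennreal) \<Rightarrow> int ^ 'd \<Rightarrow> ennreal" where
  "er r y = (\<integral>\<^sup>+x. ennreal (F x) * r (y - x) \<partial>count_space UNIV)"

abbreviation T :: "nat \<Rightarrow> int ^ 'd \<Rightarrow> ennreal" where
  "T n \<equiv> er (\<lambda>x. ennreal (hk n x))"

definition mass :: ennreal where "mass = (\<integral>\<^sup>+x. ennreal (F x) \<partial>count_space UNIV)"

text \<open>The \<open>M - 2\<close> stages before \<open>L/2\<close> and the \<open>M - 1\<close> stages after it supply the terms \<open>ix k\<close> of the target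
  density; the terms \<open>M - 1\<close> and \<open>2 * M - 1\<close> are left over.\<close>

definition s :: "nat \<Rightarrow> nat" where
  "s k = (if k < M - 2 then L1 + k * (L1 + g) else if k < 2 * M - 3 then Hf + (k - (M - 2)) * (L1 + g) else L)"

definition ix :: "nat \<Rightarrow> nat" where
  "ix k = (if k < M - 2 then k + 1 else k + 2)"

text \<open>The weakest of all error bounds, coming from the Gaussian tail beyond the distance
  \<open>R3\<close>; the other errors are estimated by it too.\<close>

definition tau :: real where "tau = exp (- (sqrt (real N) / (256 * d\<^sup>2)))"

lemma M_big: "45000 \<le> M" using N_bounds(2) by (simp add: N_def)

lemma M_mid: "M - 2 < 2 * M - 3" using M_big by linarith

lemma L_pos: "0 < L" "0 < real L" using L_eq(3) N_bounds(3) L1 by auto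

lemma kap_pos: "0 < kap" using d L_pos by (simp add: kap_def)

lemma ball_mono: "r \<le> r' \<Longrightarrow> lattice_ball 0 r \<subseteq> (lattice_ball 0 r' :: (int ^ 'd) set)"
  unfolding lattice_ball_def by auto

lemma A_nonneg: "0 \<le> A x"
  using kap_pos f1 f2 by (simp add: A_def indicator_def)

lemma F_le_A: "F x \<le> A x"
proof -
  have "lattice_ball 0 K \<subseteq> (lattice_ball 0 (K + L) :: (int ^ 'd) set)"
    by (rule ball_mono) simp
  then show ?thesis using kap_pos f1[of x] f2[of x] by (auto simp: F_def A_def indicator_def)
qed

lemma er_mono:
  assumes "\<And>x. ennreal \<alpha> * h x \<le> h' x + r x"
  shows "ennreal \<alpha> * er h y \<le> er h' y + er r y"
proof -
  have "ennreal \<alpha> * er h y = (\<integral>\<^sup>+x. ennreal (F x) * (ennreal \<alpha> * h (y - x)) \<partial>count_space UNIV)"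
    unfolding er_def by (subst nn_integral_cmult[symmetric]) (auto simp: mult_ac)
  also have "\<dots> \<le> (\<integral>\<^sup>+x. ennreal (F x) * (h' (y - x) + r (y - x)) \<partial>count_space UNIV)"
    by (intro nn_integral_mono mult_left_mono assms) auto
  also have "\<dots> = er h' y + er r y"
    unfolding er_def by (subst nn_integral_add[symmetric]) (auto simp: distrib_left)
  finally show ?thesis .
qed

lemma er_mass: "(\<integral>\<^sup>+y. er r y \<partial>count_space UNIV) = mass * (\<integral>\<^sup>+y. r y \<partial>count_space UNIV)"
proof -
  have "(\<integral>\<^sup>+y. er r y \<partial>count_space UNIV) = (\<integral>\<^sup>+x. ennreal (F x) * (\<integral>\<^sup>+y. r (y - x) \<partial>count_space UNIV) \<partial>count_space UNIV)"
    unfolding er_def by (subst swap_count) (simp add: nn_integral_cmult)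
  then show ?thesis by (simp add: nn_shift nn_integral_multc mass_def)
qed

lemma mass_le: "mass \<le> ennreal (kap * u * (2 * real K + 1) ^ CARD('d))"
proof -
  have "mass \<le> (\<integral>\<^sup>+x. ennreal (kap * u) * indicator (lattice_ball 0 K) x \<partial>count_space (UNIV :: (int ^ 'd) set))"
    unfolding mass_def
  proof (rule nn_integral_mono)
    fix x :: "int ^ 'd"
    show "ennreal (F x) \<le> ennreal (kap * u) * indicator (lattice_ball 0 K) x"
    proof (cases "x \<in> lattice_ball 0 K")
      case True
      then have "x \<in> lattice_ball 0 (K + 2 * M * L1)" using ball_mono[of K "K + 2 * M * L1"] by auto
      then have "f1 x + f2 x \<le> u" using fb by blast
      then show ?thesis using True kap_pos by (auto simp: F_def intro!: ennreal_leI)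
    qed (simp add: F_def)
  qed
  also have "\<dots> = ennreal (kap * u) * of_nat ((2 * K + 1) ^ CARD('d))"
    by (simp only: nn_integral_cmult_indicator sets_count_space Pow_UNIV UNIV_I emeasure_count_space_finite[OF subset_UNIV finite_lattice_ball] card_lattice_ball)
  also have "of_nat ((2 * K + 1) ^ CARD('d)) = ennreal ((2 * real K + 1) ^ CARD('d))"
    by (simp flip: ennreal_of_nat_eq_real_of_nat add: ennreal_power[symmetric] ennreal_plus ennreal_mult add.commute)
  finally show ?thesis using kap_pos u by (simp add: ennreal_mult[symmetric])
qed

lemma mass_fin: "mass < \<infinity>"
  using mass_le by (rule le_less_trans) simp

text \<open>After the initial slot, \<open>M - 2\<close> stages have to end by \<open>Hf\<close>,
  and \<open>M - 1\<close> stages have to fit into the second half. In each half one slot of length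
  \<open>L1\<close> is left free, and it pays for all surplus times because
  \<open>g * N \<le> L1\<close>.\<close>

lemma step: "k < 2 * M - 3 \<Longrightarrow> s k + g + L1 \<le> s (Suc k)"
proof -
  assume k: "k < 2 * M - 3"
  have gN: "g * (2 * M) \<le> L1" using g_bounds(1) by (simp add: N_def)
  have aux: "a * (L1 + g) + b \<le> M * L1" if "a + c = M" "1 \<le> c" "b \<le> (c - 1) * L1" for a b c
  proof -
    have "a * g \<le> (2 * M) * g" using that by simp
    also have "\<dots> \<le> L1" using gN by (simp add: mult.commute)
    finally have "a * g \<le> L1" .
    moreover have "M * L1 = a * L1 + (c - 1) * L1 + L1" unfolding that(1)[symmetric] using that(2) by (cases c) (auto simp: algebra_simps)
    ultimately show ?thesis using that(3) by (simp add: algebra_simps)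
  qed
  consider "Suc k < M - 2" | "Suc k = M - 2" | "M - 2 \<le> k" "Suc k < 2 * M - 3" | "Suc k = 2 * M - 3" using k by linarith
  then show ?thesis
  proof cases
    case 1 then show ?thesis by (simp add: s_def)
  next
    case 2
    have e: "(M - 2) + 2 = M" using M_big by simp
    have "(M - 2) * (L1 + g) + L1 \<le> M * L1" by (rule aux[OF e]) auto
    moreover have "s k + g + L1 = (M - 2) * (L1 + g) + L1" using 2[symmetric] by (simp add: s_def)
    moreover have "s (Suc k) = M * L1" using 2 M_mid by (simp add: s_def Hf_def)
    ultimately show ?thesis by simp
  next
    case 3
    then have "Suc k - (M - 2) = Suc (k - (M - 2))" by simp
    then show ?thesis using 3 by (simp add: s_def)
  next
    case 4
    have e: "(M - 1) + 1 = M" using M_big by simp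
    have "(M - 1) * (L1 + g) + 0 \<le> M * L1" by (rule aux[OF e]) auto
    moreover have "k - (M - 2) = M - 2" "M - 1 = Suc (M - 2)" "\<not> k < M - 2" using 4 M_big by simp_all
    then have "s k + g + L1 = Hf + (M - 1) * (L1 + g)" using k by (simp add: s_def)
    moreover have "s (Suc k) = Hf + Hf" using 4 M_mid by (simp add: s_def L_eq(4))
    ultimately show ?thesis by (simp add: Hf_def)
  qed
qed

lemma s0: "s 0 = L1" "L1 \<le> Hf"
  using M_big by (simp_all add: s_def Hf_def)

lemma s_mono: "k \<le> j \<Longrightarrow> j \<le> 2 * M - 3 \<Longrightarrow> s k \<le> s j"
proof (induction j)
  case (Suc j)
  show ?case
  proof (cases "k = Suc j")
    case False
    then have "s k \<le> s j" using Suc by simp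
    also have "\<dots> \<le> s (Suc j)" using step[of j] Suc by simp
    finally show ?thesis .
  qed simp
qed simp

lemma s_end: "s (2 * M - 3) = L" and s_mid: "s (M - 2) = Hf"
  using M_big M_mid by (simp_all add: s_def)

lemma early: "k < 2 * M - 3 \<Longrightarrow> k < M - 2 \<Longrightarrow> s (Suc k) \<le> Hf"
  using s_mono[of "Suc k" "M - 2"] s_mid by simp

lemma late: "k < 2 * M - 3 \<Longrightarrow> M - 2 \<le> k \<Longrightarrow> Hf \<le> s k"
  using s_mono[of "M - 2" k] s_mid by simp

lemma s_le_L: "k < 2 * M - 3 \<Longrightarrow> s k \<le> L"
  using s_mono[of k "2 * M - 3"] s_end by simp

lemma ix_bounds: "k < 2 * M - 3 \<Longrightarrow> 1 \<le> ix k \<and> ix k < N"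
  by (auto simp: ix_def N_def)

text \<open>The sampled path of stage \<open>k\<close> starts at \<open>s k + g\<close>, whereas the
  term of the target it replaces belongs to time \<open>ix k * L1\<close>. The delay is at most
  \<open>g\<close> per slot, a fraction \<open>1 / N\<close> of the elapsed time.\<close>

lemma s_ix: assumes "k < 2 * M - 3" obtains J where "s k + g = ix k * L1 + J" "J \<le> ix k * g"
proof (cases "k < M - 2")
  case True
  show ?thesis by (rule that[of "(k + 1) * g"]) (use True in \<open>simp_all add: s_def ix_def algebra_simps\<close>)
next
  case False
  define j where "j = k - (M - 2)"
  have k: "k + 2 = M + j" using False M_big by (simp add: j_def)
  show ?thesis
  proof (rule that[of "(j + 1) * g"])
    show "s k + g = ix k * L1 + (j + 1) * g"
      using False assms k by (simp add: s_def ix_def Hf_def j_def[symmetric] algebra_simps)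
    show "(j + 1) * g \<le> ix k * g" using False k M_big by (intro mult_right_mono) (auto simp: ix_def)
  qed
qed

lemma tau_bounds: "exp (- (real N / (4 * d))) \<le> tau" "exp (- (real N / 2)) \<le> tau" "exp (- (real N / 128)) \<le> tau" "0 < tau"
proof -
  have sq: "sqrt (real N) \<le> real N" using N_bounds by (simp add: real_le_lsqrt self_le_power)
  have dd: "d \<le> d * d" using d mult_left_mono[of 1 d d] by simp
  have *: "sqrt (real N) / (256 * d\<^sup>2) \<le> real N / k" if "k \<le> 256 * d\<^sup>2" "0 < k" for k
    using that sq by (intro frac_le) auto
  have k: "4 * d \<le> 256 * d\<^sup>2" "2 \<le> 256 * d\<^sup>2" "128 \<le> 256 * d\<^sup>2" using d dd unfolding power2_eq_square by linarith+
  show "exp (- (real N / (4 * d))) \<le> tau" "exp (- (real N / 2)) \<le> tau" "exp (- (real N / 128)) \<le> tau" "0 < tau"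
    using *[OF k(1)] *[OF k(2)] *[OF k(3)] d unfolding tau_def by auto
qed

lemma low_mass_le: "N \<le> n \<Longrightarrow> hk_low_mass TYPE('d) n \<le> d * tau"
proof -
  assume n: "N \<le> n"
  then have "real N / (4 * d) \<le> real n / (4 * d)" using d by (intro divide_right_mono) auto
  then have "exp (- (real n / (4 * d))) \<le> tau" using tau_bounds(1) by (smt (verit) exp_le_cancel_iff)
  then show ?thesis using d unfolding hk_low_mass_def by (simp add: d_eq[symmetric])
qed

lemma rS_mass: "(\<integral>\<^sup>+x. rS x \<partial>count_space UNIV) \<le> ennreal (3 * d * tau)"
proof -
  have "(\<integral>\<^sup>+x. rS x \<partial>count_space UNIV) \<le> ennreal (hk_low_mass TYPE('d) g) + ennreal (hk_far_mass TYPE('d) R g)"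
    unfolding rS_def by (subst nn_integral_add) (auto intro!: add_mono nn_integral_low_le nn_integral_hk_far R_bounds g_real)
  also have "\<dots> \<le> ennreal (d * tau) + ennreal (2 * d * tau)"
  proof (intro add_mono ennreal_leI)
    show "hk_low_mass TYPE('d) g \<le> d * tau" using g_real(3) by (intro low_mass_le) simp
    have "R\<^sup>2 / (2 * real g) = real N / 2" using g_real(2) by (simp add: R_def)
    then have "exp (- (R\<^sup>2 / (2 * real g))) \<le> tau" using tau_bounds(2) by (simp only:)
    then show "hk_far_mass TYPE('d) R g \<le> 2 * d * tau" using d unfolding hk_far_mass_def d_eq[symmetric] by simp
  qed
  also have "\<dots> = ennreal (3 * d * tau)" using d tau_bounds(4) by (subst ennreal_plus[symmetric]) auto
  finally show ?thesis .
qed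

text \<open>Such a walker has moved farther than \<open>L div 4\<close> in time at most
  \<open>L\<close>. The Gaussian tail gives \<open>exp (- L / 128)\<close>, and \<open>L\<close> is
  at least \<open>N\<close>.\<close>

lemma exit_mass:
  assumes "k < 2 * M - 3" "x \<in> lattice_ball 0 K"
  shows "(\<integral>\<^sup>+z. ennreal (hk (s k) (z - x)) * indicator {z. cellof z \<notin> C} z \<partial>count_space UNIV) \<le> ennreal (2 * d * tau)"
proof -
  let ?R = "real (L div 4)"
  let ?S = "{w :: int ^ 'd. \<exists>i. ?R < \<bar>real_of_int (w $ i)\<bar>}"
  have "(\<integral>\<^sup>+z. ennreal (hk (s k) (z - x)) * indicator {z. cellof z \<notin> C} z \<partial>count_space UNIV)
      \<le> (\<integral>\<^sup>+z. ennreal (hk (s k) (z - x)) * indicator ?S (z - x) \<partial>count_space UNIV)"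
  proof (intro nn_integral_mono mult_left_mono)
    fix z
    have "z - x \<in> ?S" if "cellof z \<notin> C"
    proof -
      have "z \<notin> lattice_ball 0 (K + L div 4)" using that by (auto simp: C_def)
      then obtain i where "int (K + L div 4) < \<bar>z $ i\<bar>" by (auto simp: mem_lattice_ball not_le)
      moreover have "\<bar>x $ i\<bar> \<le> int K" using assms(2) by (auto simp: mem_lattice_ball)
      ultimately have "int (L div 4) < \<bar>(z - x) $ i\<bar>" by simp
      then have "?R < \<bar>real_of_int ((z - x) $ i)\<bar>" by linarith
      then show ?thesis by blast
    qed
    then show "indicator {z. cellof z \<notin> C} z \<le> (indicator ?S (z - x) :: ennreal)" by (auto simp: indicator_def)
  qed simp
  also have "\<dots> = (\<integral>\<^sup>+z. ennreal (hk (s k) z) * indicator ?S z \<partial>count_space UNIV)"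
    by (rule nn_shift[of "\<lambda>w. ennreal (hk (s k) w) * indicator ?S w"])
  also have "\<dots> = emeasure (walk_pos (s k)) ?S"
    by (subst nn_integral_measure_pmf[symmetric]) simp
  also have "\<dots> \<le> ennreal (2 * real CARD('d) * exp (- (?R\<^sup>2 / (2 * real L))))"
    by (rule walk_pos_tail) (use L_pos s_le_L[OF assms(1)] in auto)
  also have "\<dots> \<le> ennreal (2 * d * tau)"
  proof -
    have "8 \<le> real L" using L_big(5) N_bounds(2) by linarith
    then have "real L / 8 \<le> ?R" by linarith
    then have "(real L / 8)\<^sup>2 / (2 * real L) \<le> ?R\<^sup>2 / (2 * real L)" by (intro divide_right_mono power_mono) auto
    moreover have "(real L / 8)\<^sup>2 / (2 * real L) = real L / 128" using L_pos by (simp add: power2_eq_square)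
    ultimately have "real N / 128 \<le> ?R\<^sup>2 / (2 * real L)" using L_big(5) by linarith
    then have "exp (- (?R\<^sup>2 / (2 * real L))) \<le> exp (- (real N / 128))" by simp
    then have "exp (- (?R\<^sup>2 / (2 * real L))) \<le> tau" using tau_bounds(3) by (rule order_trans)
    then show ?thesis using d by (auto simp: d_eq[symmetric] intro!: ennreal_leI)
  qed
  finally show ?thesis .
qed

section \<open>The density supplied by one stage\<close>

definition cmass :: "nat \<Rightarrow> int ^ 'd \<Rightarrow> ennreal" where
  "cmass k c = (\<integral>\<^sup>+z. indicator {z. cellof z = c} z *
     (\<integral>\<^sup>+x. ennreal (A x) * ennreal (hk (s k) (z - x)) \<partial>count_space UNIV) \<partial>count_space UNIV)"

definition stage :: "nat \<Rightarrow> int ^ 'd \<Rightarrow> ennreal" where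
  "stage k y = (\<Sum>c\<in>C. cmass k c * ennreal (qm c y))"

text \<open>Two losses: kernels that are not comparable across the cell, and walkers that have left
  the cells in \<open>C\<close>.\<close>

definition stage_error :: "nat \<Rightarrow> int ^ 'd \<Rightarrow> ennreal" where
  "stage_error k y = (\<integral>\<^sup>+z. T (s k) z * (rS (y - z) + indicator {z. cellof z \<notin> C} z * ennreal (hk g (y - z))) \<partial>count_space UNIV)"

lemma finite_C: "finite C" by (simp add: C_def finite_lattice_ball)

lemma chapman_T: "T (i + j) y = (\<integral>\<^sup>+z. T i z * ennreal (hk j (y - z)) \<partial>count_space UNIV)"
proof -
  have "T (i + j) y = (\<integral>\<^sup>+x. \<integral>\<^sup>+z. ennreal (F x) * (ennreal (hk i (z - x)) * ennreal (hk j (y - z))) \<partial>count_space UNIV \<partial>count_space UNIV)"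
    unfolding er_def hk_chapman[symmetric] by (simp add: nn_integral_cmult)
  also have "\<dots> = (\<integral>\<^sup>+z. T i z * ennreal (hk j (y - z)) \<partial>count_space UNIV)"
    unfolding er_def by (subst swap_count) (simp add: nn_integral_multc[symmetric] mult.assoc)
  finally show ?thesis .
qed

text \<open>The evolution over \<open>g\<close> steps is split at time \<open>s k\<close>, and the
  kernel from \<open>z\<close> is replaced by the common part \<open>qm\<close> of its cell. Only
  the walkers of \<open>F\<close> have to be reproduced, but all those of \<open>A\<close>, which is
  larger, take part.\<close>

lemma stage_lower: "ennreal shift_factor * T (s k + g) y \<le> stage k y + stage_error k y"
proof -
  let ?O = "\<lambda>z. \<integral>\<^sup>+x. ennreal (A x) * ennreal (hk (s k) (z - x)) \<partial>count_space UNIV"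
  have O: "T (s k) z \<le> ?O z" for z
    unfolding er_def by (intro nn_integral_mono mult_right_mono ennreal_leI F_le_A) auto
  have st: "stage k y = (\<integral>\<^sup>+z. ?O z * (indicator {z. cellof z \<in> C} z * ennreal (qm (cellof z) y)) \<partial>count_space UNIV)"
  proof -
    have "stage k y = (\<integral>\<^sup>+z. (\<Sum>c\<in>C. indicator {z. cellof z = c} z * ?O z * ennreal (qm c y)) \<partial>count_space UNIV)"
      unfolding stage_def cmass_def by (subst nn_integral_sum) (auto simp: nn_integral_multc)
    also have "\<dots> = (\<integral>\<^sup>+z. ?O z * (indicator {z. cellof z \<in> C} z * ennreal (qm (cellof z) y)) \<partial>count_space UNIV)"
    proof (rule nn_integral_cong)
      fix z
      have "(\<Sum>c\<in>C. indicator {z. cellof z = c} z * ?O z * ennreal (qm c y)) = (\<Sum>c\<in>C. if c = cellof z then ?O z * ennreal (qm c y) else 0)"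
        by (intro sum.cong) (auto simp: indicator_def)
      then show "(\<Sum>c\<in>C. indicator {z. cellof z = c} z * ?O z * ennreal (qm c y)) = ?O z * (indicator {z. cellof z \<in> C} z * ennreal (qm (cellof z) y))"
        using finite_C by (simp add: sum.delta indicator_def)
    qed
    finally show ?thesis .
  qed
  have pt: "ennreal shift_factor * ennreal (hk g (y - z)) \<le> indicator {z. cellof z \<in> C} z * ennreal (qm (cellof z) y)
     + (rS (y - z) + indicator {z. cellof z \<notin> C} z * ennreal (hk g (y - z)))" for z
  proof (cases "cellof z \<in> C")
    case True then show ?thesis using qm_lower[of y z] by simp
  next
    case False
    have "ennreal shift_factor * ennreal (hk g (y - z)) \<le> ennreal (qm (cellof z) y) + rS (y - z)" by (rule qm_lower)
    also have "\<dots> \<le> ennreal (hk g (y - z)) + rS (y - z)" by (intro add_mono ennreal_leI qm_le) auto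
    finally show ?thesis using False by (simp add: add.commute)
  qed
  have "ennreal shift_factor * T (s k + g) y = (\<integral>\<^sup>+z. T (s k) z * (ennreal shift_factor * ennreal (hk g (y - z))) \<partial>count_space UNIV)"
    unfolding chapman_T by (subst nn_integral_cmult[symmetric]) (auto simp: mult_ac)
  also have "\<dots> \<le> (\<integral>\<^sup>+z. T (s k) z * (indicator {z. cellof z \<in> C} z * ennreal (qm (cellof z) y)
     + (rS (y - z) + indicator {z. cellof z \<notin> C} z * ennreal (hk g (y - z)))) \<partial>count_space UNIV)"
    by (intro nn_integral_mono mult_left_mono pt) auto
  also have "\<dots> = (\<integral>\<^sup>+z. T (s k) z * (indicator {z. cellof z \<in> C} z * ennreal (qm (cellof z) y)) \<partial>count_space UNIV) + stage_error k y"
    unfolding stage_error_def by (subst nn_integral_add[symmetric]) (auto simp: distrib_left)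
  also have "\<dots> \<le> stage k y + stage_error k y"
    unfolding st by (intro add_mono nn_integral_mono mult_right_mono O) auto
  finally show ?thesis .
qed

lemma stage_error_mass: assumes "k < 2 * M - 3"
  shows "(\<integral>\<^sup>+y. stage_error k y \<partial>count_space UNIV) \<le> mass * ennreal (5 * d * tau)"
proof -
  have "(\<integral>\<^sup>+y. stage_error k y \<partial>count_space UNIV) = (\<integral>\<^sup>+z. T (s k) z * ((\<integral>\<^sup>+y. rS (y - z) \<partial>count_space UNIV) + indicator {z. cellof z \<notin> C} z * (\<integral>\<^sup>+y. ennreal (hk g (y - z)) \<partial>count_space UNIV)) \<partial>count_space UNIV)"
    unfolding stage_error_def by (subst swap_count) (simp add: nn_integral_cmult nn_integral_add)
  also have "\<dots> \<le> (\<integral>\<^sup>+z. T (s k) z * (ennreal (3 * d * tau) + indicator {z. cellof z \<notin> C} z) \<partial>count_space UNIV)"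
    using rS_mass by (intro nn_integral_mono mult_left_mono) (simp_all add: hk_sum nn_shift)
  also have "\<dots> = (\<integral>\<^sup>+z. T (s k) z \<partial>count_space UNIV) * ennreal (3 * d * tau)
     + (\<integral>\<^sup>+z. T (s k) z * indicator {z. cellof z \<notin> C} z \<partial>count_space UNIV)"
    by (simp add: distrib_left nn_integral_add nn_integral_multc)
  also have "(\<integral>\<^sup>+z. T (s k) z \<partial>count_space UNIV) = mass"
    unfolding er_mass by (simp add: nn_integral_pmf)
  also have "(\<integral>\<^sup>+z. T (s k) z * indicator {z. cellof z \<notin> C} z \<partial>count_space UNIV)
     = (\<integral>\<^sup>+x. ennreal (F x) * (\<integral>\<^sup>+z. ennreal (hk (s k) (z - x)) * indicator {z. cellof z \<notin> C} z \<partial>count_space UNIV) \<partial>count_space UNIV)"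
    unfolding er_def by (subst nn_integral_multc[symmetric], simp, subst swap_count) (simp add: nn_integral_cmult[symmetric] mult.assoc)
  also have "\<dots> \<le> (\<integral>\<^sup>+x. ennreal (F x) * ennreal (2 * d * tau) \<partial>count_space UNIV)"
  proof (rule nn_integral_mono)
    fix x :: "int ^ 'd"
    show "ennreal (F x) * (\<integral>\<^sup>+z. ennreal (hk (s k) (z - x)) * indicator {z. cellof z \<notin> C} z \<partial>count_space UNIV) \<le> ennreal (F x) * ennreal (2 * d * tau)"
      using exit_mass[OF assms, of x] by (cases "x \<in> lattice_ball 0 K") (auto intro!: mult_left_mono simp: F_def)
  qed
  also have "\<dots> = mass * ennreal (2 * d * tau)" by (simp add: nn_integral_multc mass_def)
  finally have "(\<integral>\<^sup>+y. stage_error k y \<partial>count_space UNIV) \<le> mass * ennreal (3 * d * tau) + mass * ennreal (2 * d * tau)"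
    by (simp add: add_left_mono)
  also have "\<dots> = mass * ennreal (5 * d * tau)"
    using d tau_bounds(4) by (subst distrib_left[symmetric], subst ennreal_plus[symmetric]) (auto simp: algebra_simps)
  finally show ?thesis .
qed

definition time_factor :: real where "time_factor = (1 / (1 + 4 * d / real N)) ^ CARD('d)"

definition slot_error :: "nat \<Rightarrow> int ^ 'd \<Rightarrow> ennreal" where
  "slot_error k y = stage_error k y + er (low (ix k * L1) 0 (hk_th TYPE('d) (ix k * L1))) y"

lemma factor_bounds: "0 \<le> shift_factor" "shift_factor \<le> 1" "0 \<le> time_factor" "time_factor \<le> 1"
proof -
  have "0 \<le> 4 * d / real N" using d by simp
  then have "0 \<le> 1 / (1 + 4 * d / real N)" "1 / (1 + 4 * d / real N) \<le> 1" by (simp_all add: divide_le_eq)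
  then show "0 \<le> time_factor" "time_factor \<le> 1" unfolding time_factor_def by (auto intro!: power_le_one simp del: divide_le_eq_1)
  show "0 \<le> shift_factor" "shift_factor \<le> 1" using sqrtN unfolding shift_factor_def by (auto intro!: power_le_one)
qed

lemma er_later:
  assumes "1 \<le> i" "real J \<le> b * real (i * L1)" "0 \<le> b"
  shows "ennreal ((1 / (1 + 4 * d * b)) ^ CARD('d)) * T (i * L1) y \<le> T (i * L1 + J) y + er (low (i * L1) 0 (hk_th TYPE('d) (i * L1))) y"
proof (rule er_mono)
  fix x :: "int ^ 'd"
  have n0: "0 < i * L1" using assms(1) L1 by simp
  have "4 * d * real J / real (i * L1) \<le> 4 * d * b"
  proof -
    have "real J / real (i * L1) \<le> b" using n0 assms(2) by (simp only: divide_le_eq) simp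
    then have "4 * d * (real J / real (i * L1)) \<le> 4 * d * b" using d by (intro mult_left_mono) auto
    then show ?thesis by simp
  qed
  then have "(1 / (1 + 4 * d * b)) ^ CARD('d) \<le> (1 / (1 + 4 * d * real J / real (i * L1))) ^ CARD('d)"
    using d assms(3) by (intro power_mono divide_left_mono mult_pos_pos add_pos_nonneg add_left_mono) auto
  then have "ennreal ((1 / (1 + 4 * d * b)) ^ CARD('d)) * ennreal (hk (i * L1) x)
     \<le> ennreal ((1 / (1 + 4 * d * real J / real (i * L1))) ^ CARD('d)) * ennreal (hk (i * L1) x)"
    by (intro mult_right_mono ennreal_leI) auto
  also have "\<dots> \<le> ennreal (hk (i * L1 + J) x) + low (i * L1) 0 (hk_th TYPE('d) (i * L1)) x"
    unfolding d_eq by (rule hk_later[OF n0])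
  finally show "ennreal ((1 / (1 + 4 * d * b)) ^ CARD('d)) * ennreal (hk (i * L1) x)
     \<le> ennreal (hk (i * L1 + J) x) + low (i * L1) 0 (hk_th TYPE('d) (i * L1)) x" .
qed

lemma er_low_mass: "N \<le> n \<Longrightarrow> (\<integral>\<^sup>+y. er (low n J (hk_th TYPE('d) n)) y \<partial>count_space UNIV) \<le> mass * ennreal (d * tau)"
  unfolding er_mass using low_mass_le[of n] by (intro mult_left_mono order_trans[OF nn_integral_low_le] ennreal_leI) auto

lemma N_le_iL1: "1 \<le> i \<Longrightarrow> N \<le> i * L1"
  using L_big(2) mult_le_mono1[of 1 i L1] by linarith

text \<open>\<open>stage_lower\<close> yields the density at the actual starting time;
  \<open>er_later\<close> moves it to the nominal time \<open>ix k * L1\<close>, with a relative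
  delay of at most \<open>1 / N\<close>.\<close>

lemma main_term:
  assumes k: "k < 2 * M - 3"
  shows "ennreal (shift_factor * time_factor) * T (ix k * L1) y \<le> stage k y + slot_error k y"
proof -
  obtain J where J: "s k + g = ix k * L1 + J" "J \<le> ix k * g" using s_ix[OF k] by blast
  have i: "1 \<le> ix k" using ix_bounds[OF k] by simp
  have "N * J \<le> N * (ix k * g)" using J(2) by simp
  also have "\<dots> = ix k * (g * N)" by simp
  also have "\<dots> \<le> ix k * L1" using g_bounds(1) by simp
  finally have "real (N * J) \<le> real (ix k * L1)" by (simp only: of_nat_le_iff)
  then have b: "real J \<le> 1 / real N * real (ix k * L1)" using N_bounds(3) by (simp add: field_simps)
  have "ennreal time_factor * T (ix k * L1) y \<le> T (s k + g) y + er (low (ix k * L1) 0 (hk_th TYPE('d) (ix k * L1))) y"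
    using er_later[OF i b, of y] unfolding J(1) time_factor_def by simp
  then have "ennreal shift_factor * (ennreal time_factor * T (ix k * L1) y) \<le> ennreal shift_factor * (T (s k + g) y + er (low (ix k * L1) 0 (hk_th TYPE('d) (ix k * L1))) y)"
    by (rule mult_left_mono) simp
  also have "\<dots> \<le> ennreal shift_factor * T (s k + g) y + 1 * er (low (ix k * L1) 0 (hk_th TYPE('d) (ix k * L1))) y"
    using factor_bounds unfolding distrib_left by (intro add_left_mono mult_right_mono) auto
  also have "\<dots> \<le> stage k y + stage_error k y + er (low (ix k * L1) 0 (hk_th TYPE('d) (ix k * L1))) y"
    using stage_lower by (simp add: add_right_mono)
  finally show ?thesis using factor_bounds by (simp add: slot_error_def ennreal_mult mult.assoc add.assoc)
qed

lemma slot_error_mass: assumes "k < 2 * M - 3"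
  shows "(\<integral>\<^sup>+y. slot_error k y \<partial>count_space UNIV) \<le> mass * ennreal (6 * d * tau)"
proof -
  have "(\<integral>\<^sup>+y. slot_error k y \<partial>count_space UNIV) \<le> mass * ennreal (5 * d * tau) + mass * ennreal (d * tau)"
    unfolding slot_error_def
    by (subst nn_integral_add, simp, simp) (rule add_mono[OF stage_error_mass[OF assms] er_low_mass[OF N_le_iL1[OF conjunct1[OF ix_bounds[OF assms]]]]])
  also have "\<dots> = mass * ennreal (6 * d * tau)"
    using d tau_bounds(4) by (subst distrib_left[symmetric], subst ennreal_plus[symmetric]) (auto simp: algebra_simps)
  finally show ?thesis .
qed

section \<open>The two terms of the target without a stage of their own\<close>

definition R3 :: real where "R3 = sqrt (real L * sqrt (real N) / (128 * d\<^sup>2))"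

definition window_error :: "nat \<Rightarrow> int ^ 'd \<Rightarrow> ennreal" where
  "window_error i y = er (\<lambda>x. low (i * L1) ((N - 1 - i) * L1) (hk_th TYPE('d) (i * L1)) x + hk_far ((N - 1) * L1) R3 x) y"

text \<open>The two leftover terms are charged to the \<open>w\<close> terms of index just below \<open>2 * M - 1\<close>.\<close>

definition w :: nat where "w = nat \<lfloor>sqrt (real N)\<rfloor>"

lemma w_bounds: "real w \<le> sqrt (real N)" "sqrt (real N) / 2 \<le> real w" "1 \<le> w" "w \<le> M - 2"
proof -
  have a: "300 \<le> sqrt (real N)" by (rule sqrtN)
  have r: "real w = real_of_int \<lfloor>sqrt (real N)\<rfloor>" using a unfolding w_def by simp
  show b: "real w \<le> sqrt (real N)" unfolding r by simp
  show c: "sqrt (real N) / 2 \<le> real w" unfolding r using a by linarith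
  then show "1 \<le> w" using a by linarith
  have "300 * sqrt (real N) \<le> sqrt (real N) * sqrt (real N)" using a by (intro mult_right_mono) auto
  then have "300 * real w \<le> 2 * real M" using b by (simp add: N_def)
  then show "w \<le> M - 2" using M_big by linarith
qed

text \<open>The last term lies after all stages, so it can only be compared with earlier times. A
  window of \<open>sqrt N\<close> slots is short enough for a constant factor and long enough to
  spread the term thinly.\<close>

lemma er_earlier:
  assumes i: "i + r + 1 = N" "r \<le> w" "1 \<le> r"
  shows "ennreal ((1/2) ^ CARD('d)) * T ((N - 1) * L1) y \<le> T (i * L1) y + window_error i y"
  unfolding window_error_def
proof (rule er_mono)
  fix x :: "int ^ 'd"
  have iM: "M \<le> i" using i w_bounds(4) M_big by (simp add: N_def)
  have nJ: "(N - 1) * L1 = i * L1 + r * L1" "N - 1 - i = r" using i(1) by (auto simp: add_mult_distrib[symmetric])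
  have n0: "0 < i * L1" using iM M_big L1 by simp
  have nL: "real L / 2 \<le> real (i * L1)"
  proof -
    have "M * L1 \<le> i * L1" using iM by simp
    then have "real (M * L1) \<le> real (i * L1)" by (simp only: of_nat_le_iff)
    then show ?thesis by (simp add: L_def)
  qed
  have R3s: "R3\<^sup>2 = real L * sqrt (real N) / (128 * d\<^sup>2)" unfolding R3_def using d by simp
  have R30: "0 \<le> R3" unfolding R3_def by simp
  have R3n: "R3 \<le> real (i * L1) / (4 * real CARD('d))"
  proof -
    have "R3\<^sup>2 \<le> (real L / (8 * d))\<^sup>2"
    proof -
      have "sqrt (real N) \<le> real N" using N_bounds by (simp add: real_le_lsqrt self_le_power)
      then have "sqrt (real N) \<le> real L" using L_big(5) by linarith
      then have "real L * sqrt (real N) \<le> real L * (2 * real L)" by (intro mult_left_mono) auto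
      then have "real L * sqrt (real N) / (128 * d\<^sup>2) \<le> real L * (2 * real L) / (128 * d\<^sup>2)" by (intro divide_right_mono) auto
      also have "\<dots> = (real L / (8 * d))\<^sup>2" by (simp add: power2_eq_square)
      finally show ?thesis unfolding R3s .
    qed
    then have "R3 \<le> real L / (8 * d)" by (rule power2_le_imp_le) (use d in simp)
    also have "\<dots> = (real L / 2) / (4 * d)" by simp
    also have "\<dots> \<le> real (i * L1) / (4 * d)" using nL d by (intro divide_right_mono) auto
    finally show ?thesis by (simp only: d_eq)
  qed
  \<comment> \<open>With \<open>r \<le> sqrt N\<close>, \<open>L / 2 \<le> i * L1\<close> and the
    definition of \<open>R3\<close> this quantity is at most exactly 1/2; the constant 128 in
    \<open>R3\<close> is chosen for that.\<close>
  let ?q = "(4 * real CARD('d))\<^sup>2 * (real (r * L1) * R3\<^sup>2) / (real (i * L1))\<^sup>2"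
  have q: "?q \<le> 1/2"
  proof -
    have "real r \<le> sqrt (real N)" using i(2) w_bounds(1) by linarith
    then have "real (r * L1) \<le> sqrt (real N) * real L1" by (simp add: mult_right_mono)
    then have "(4 * d)\<^sup>2 * (real (r * L1) * R3\<^sup>2) \<le> (4 * d)\<^sup>2 * (sqrt (real N) * real L1 * R3\<^sup>2)"
      by (intro mult_left_mono mult_right_mono) auto
    also have "\<dots> = (sqrt (real N) * sqrt (real N)) * real L1 * real L / 8"
      unfolding R3s using d by (simp add: power2_eq_square)
    also have "\<dots> = 1/2 * (real L / 2)\<^sup>2" by (simp add: L_eq power2_eq_square)
    finally have "(4 * d)\<^sup>2 * (real (r * L1) * R3\<^sup>2) \<le> 1/2 * (real L / 2)\<^sup>2" .
    moreover have "(real L / 2)\<^sup>2 \<le> (real (i * L1))\<^sup>2" using nL by (intro power_mono) auto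
    ultimately have "(4 * d)\<^sup>2 * (real (r * L1) * R3\<^sup>2) \<le> 1/2 * (real (i * L1))\<^sup>2" by linarith
    then show ?thesis using n0 unfolding d_eq[symmetric] by (subst divide_le_eq) (simp del: of_nat_mult)
  qed
  have "ennreal ((1/2) ^ CARD('d)) * ennreal (hk (i * L1 + r * L1) x) \<le> ennreal ((1 - ?q) ^ CARD('d)) * ennreal (hk (i * L1 + r * L1) x)"
    using q by (intro mult_right_mono ennreal_leI power_mono) auto
  also have "\<dots> \<le> ennreal (hk (i * L1) x) + (low (i * L1) (r * L1) (hk_th TYPE('d) (i * L1)) x + hk_far (i * L1 + r * L1) R3 x)"
    by (rule hk_earlier[OF n0 R30 R3n]) (use q in simp)
  finally show "ennreal ((1/2) ^ CARD('d)) * ennreal (hk ((N - 1) * L1) x)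
     \<le> ennreal (hk (i * L1) x) + (low (i * L1) ((N - 1 - i) * L1) (hk_th TYPE('d) (i * L1)) x + hk_far ((N - 1) * L1) R3 x)"
    unfolding nJ .
qed

lemma window_error_mass:
  assumes i: "i + r + 1 = N" "r \<le> w"
  shows "(\<integral>\<^sup>+y. window_error i y \<partial>count_space UNIV) \<le> mass * ennreal (3 * d * tau)"
proof -
  have i1: "1 \<le> i" using i w_bounds(4) M_big by (simp add: N_def)
  have LN: "(N - 1) * L1 + L1 = L" using N_bounds(3) by (cases N) (auto simp: L_eq(3))
  have R3s: "R3\<^sup>2 = real L * sqrt (real N) / (128 * d\<^sup>2)" unfolding R3_def using d by simp
  have n1: "0 < (N - 1) * L1" using N_bounds(2) L1 by simp
  have "(N - 1) * L1 \<le> L" using LN by linarith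
  then have nL: "real ((N - 1) * L1) \<le> real L" by (simp only: of_nat_le_iff)
  have nL2: "real L / 2 \<le> real ((N - 1) * L1)"
  proof -
    have "90000 \<le> N" using N_bounds(2) by simp
    then have "1 \<le> N - 1" by linarith
    from mult_le_mono1[OF this, of L1] have "L \<le> 2 * ((N - 1) * L1)" using LN by linarith
    then show ?thesis by linarith
  qed
  have R30: "0 \<le> R3" unfolding R3_def by simp
  have R3n: "R3 \<le> real ((N - 1) * L1)"
  proof -
    have "R3\<^sup>2 \<le> (real L / 2)\<^sup>2"
    proof -
      have "sqrt (real N) \<le> real N" using N_bounds by (simp add: real_le_lsqrt self_le_power)
      then have "sqrt (real N) \<le> real L" using L_big(5) by linarith
      moreover have "1 \<le> d\<^sup>2" using d by simp
      ultimately have "real L * sqrt (real N) / (128 * d\<^sup>2) \<le> real L * real L / 4"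
        by (intro frac_le mult_left_mono) auto
      then show ?thesis unfolding R3s by (simp add: power2_eq_square)
    qed
    then have "R3 \<le> real L / 2" by (rule power2_le_imp_le) simp
    then show ?thesis using nL2 by linarith
  qed
  have far: "hk_far_mass TYPE('d) R3 ((N - 1) * L1) \<le> 2 * d * tau"
  proof -
    have "R3\<^sup>2 / (2 * real L) \<le> R3\<^sup>2 / (2 * real ((N - 1) * L1))" using nL n1 L_pos by (intro divide_left_mono) auto
    moreover have "R3\<^sup>2 / (2 * real L) = sqrt (real N) / (256 * d\<^sup>2)" unfolding R3s using L_pos by simp
    ultimately have "exp (- (R3\<^sup>2 / (2 * real ((N - 1) * L1)))) \<le> tau" unfolding tau_def by simp
    then show ?thesis using d unfolding hk_far_mass_def d_eq[symmetric] by simp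
  qed
  have "(\<integral>\<^sup>+x. low (i * L1) ((N - 1 - i) * L1) (hk_th TYPE('d) (i * L1)) x + hk_far ((N - 1) * L1) R3 x \<partial>count_space (UNIV :: (int ^ 'd) set))
     \<le> ennreal (hk_low_mass TYPE('d) (i * L1)) + ennreal (hk_far_mass TYPE('d) R3 ((N - 1) * L1))"
    by (subst nn_integral_add, simp, simp) (rule add_mono[OF nn_integral_low_le nn_integral_hk_far[OF R30 R3n n1]])
  also have "\<dots> \<le> ennreal (d * tau) + ennreal (2 * d * tau)"
    by (intro add_mono ennreal_leI far low_mass_le N_le_iL1 i1)
  also have "\<dots> = ennreal (3 * d * tau)" using d tau_bounds(4) by (subst ennreal_plus[symmetric]) auto
  finally show ?thesis unfolding window_error_def er_mass by (intro mult_left_mono) auto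
qed

text \<open>The window lies after time \<open>(M - 1) * L1\<close>, at a delay of at most twice that
  time. So a later kernel suffices here, at the price of a constant depending on the
  dimension.\<close>

lemma er_middle:
  assumes i: "i + r + 1 = N" "r \<le> w"
  shows "ennreal ((1 / (1 + 8 * d)) ^ CARD('d)) * T ((M - 1) * L1) y \<le> T (i * L1) y + er (low ((M - 1) * L1) 0 (hk_th TYPE('d) ((M - 1) * L1))) y"
proof -
  have e: "i * L1 = (M - 1) * L1 + (i - (M - 1)) * L1"
    using i w_bounds(4) M_big by (simp add: N_def add_mult_distrib[symmetric])
  have "i - (M - 1) \<le> 2 * (M - 1)" using i M_big by (simp add: N_def)
  then have "(i - (M - 1)) * L1 \<le> 2 * ((M - 1) * L1)" using mult_le_mono1 by fastforce
  then have "real ((i - (M - 1)) * L1) \<le> real (2 * ((M - 1) * L1))" by (simp only: of_nat_le_iff)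
  then have b: "real ((i - (M - 1)) * L1) \<le> 2 * real ((M - 1) * L1)" by (simp del: of_nat_diff)
  have m1: "1 \<le> M - 1" using M_big by simp
  show ?thesis using er_later[OF m1 b, of y] unfolding e[symmetric] by simp
qed

end

section \<open>Domination of the target density\<close>

text \<open>The reciprocals of the factors in \<open>er_earlier\<close> and
  \<open>er_middle\<close>: what the two leftover terms cost together when they are charged to the
  window.\<close>

definition win_const :: "'d::finite itself \<Rightarrow> real" where
  "win_const _ = 2 ^ CARD('d) + (1 + 8 * real CARD('d)) ^ CARD('d)"

text \<open>\<open>1 + 2 * d + 2 * win_const\<close> is the actual loss in units of
  \<open>eta\<close>, see \<open>keep_le\<close>. The additional \<open>100 * d\<close> guarantees
  that \<open>N\<close> is at least \<open>10000 * d ^ 2\<close> whenever the target density is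
  positive.\<close>

definition loss_const :: "'d::finite itself \<Rightarrow> real" where
  "loss_const _ = 1 + 102 * real CARD('d) + 2 * win_const TYPE('d)"

lemma ennreal_le_divI: "0 < h \<Longrightarrow> ennreal h * a \<le> b \<Longrightarrow> a \<le> ennreal (1 / h) * b"
proof -
  assume h: "0 < h" "ennreal h * a \<le> b"
  have "a = ennreal (1 / h) * (ennreal h * a)" using h(1) by (simp add: mult.assoc[symmetric] ennreal_mult[symmetric])
  also have "\<dots> \<le> ennreal (1 / h) * b" using h(2) by (rule mult_left_mono) simp
  finally show ?thesis .
qed

lemma le_average:
  fixes a :: ennreal
  assumes "finite S" "S \<noteq> {}" "0 < h" "\<And>r. r \<in> S \<Longrightarrow> ennreal h * a \<le> b r + e r"
  shows "a \<le> ennreal (1 / (h * real (card S))) * (sum b S + sum e S)"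
proof (rule ennreal_le_divI)
  show "0 < h * real (card S)" using assms by (simp add: card_gt_0_iff)
  have "ennreal (h * real (card S)) * a = (\<Sum>r\<in>S. ennreal h * a)"
    using assms(3) by (simp add: ennreal_mult ennreal_of_nat_eq_real_of_nat mult_ac)
  also have "\<dots> \<le> (\<Sum>r\<in>S. b r + e r)" by (intro sum_mono assms)
  finally show "ennreal (h * real (card S)) * a \<le> sum b S + sum e S" by (simp add: sum.distrib)
qed

lemma nn_integral_sum_le:
  assumes "finite S" "\<And>i. i \<in> S \<Longrightarrow> (\<integral>\<^sup>+y. f i y \<partial>count_space UNIV) \<le> b"
  shows "(\<integral>\<^sup>+y. (\<Sum>i\<in>S. f i y) \<partial>count_space UNIV) \<le> of_nat (card S) * b"
  using sum_mono[OF assms(2), of S "\<lambda>i. i"] by (subst nn_integral_sum) auto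

text \<open>The arithmetic of \<open>cmass_ge\<close>, with \<open>a = L powr (1/4)\<close> and
  \<open>b = N\<close>: density times the cube of the lower bound for the side of a cell.\<close>

lemma cube_identity:
  fixes a b :: real
  assumes a: "0 < a" and b: "0 < b"
  shows "2 * a / (27 * b ^ 9) = (4 / a ^ 4) / a / 2 * (a ^ 2 / (3 * b ^ 3)) ^ 3"
proof -
  have "b ^ 9 = b ^ 3 * b ^ 3 * b ^ 3" "a ^ 4 = a * a * (a * a)" by (simp_all flip: power_add add: numeral_eq_Suc)
  then show ?thesis using a b unfolding power3_eq_cube power2_eq_square by (simp add: field_simps)
qed

lemma four_div: "4 * int (n div 4) \<le> int n"
  by presburger

lemma far_apart:
  fixes l' p q r :: int
  shows "4 * l' \<le> int L' \<Longrightarrow> 4 * int m \<le> int L' \<Longrightarrow> int (K' + L') < q \<Longrightarrow> p \<le> int (K' + m) + l' \<Longrightarrow>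
    q - p \<le> r \<Longrightarrow> int L' \<le> 2 * r - 1"
  unfolding of_nat_add by linarith

context schedule
begin

text \<open>The fraction by which the requests are reduced. It is of the same order as the other
  losses, and with cells of mean at least of order \<open>N ^ 2\<close> the Chernoff exponent is
  still linear in \<open>N\<close>.\<close>

definition eta :: real where "eta = 1 / sqrt (real N)"
definition keep :: real where "keep = 1 - loss_const TYPE('d) * eta"

definition E :: "int ^ 'd \<Rightarrow> ennreal" where
  "E y = (\<Sum>k<2 * M - 3. slot_error k y) + (ennreal (2 ^ CARD('d) / real w) * (\<Sum>r=1..w. window_error (N - 1 - r) y)
     + ennreal ((1 + 8 * d) ^ CARD('d) / real w) * (\<Sum>r=1..w. er (low ((M - 1) * L1) 0 (hk_th TYPE('d) ((M - 1) * L1))) y))"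

lemma T_0: "T 0 y = ennreal (F y)"
proof -
  have "T 0 y = (\<integral>\<^sup>+x. ennreal (F y) * indicator {y} x \<partial>count_space UNIV)"
    unfolding er_def by (intro nn_integral_cong) (auto simp: indicator_def)
  then show ?thesis by (simp add: nn_integral_cmult_indicator one_ennreal_def[symmetric])
qed

lemma eta_bounds: "0 < eta" "eta \<le> 1/300" "eta * sqrt (real N) = 1" "eta\<^sup>2 = 1 / real N" "100 * d * eta \<le> 1"
proof -
  show "0 < eta" "eta \<le> 1/300" "eta * sqrt (real N) = 1" "eta\<^sup>2 = 1 / real N"
    using sqrtN by (auto simp: eta_def power_divide)
  show "100 * d * eta \<le> 1" using sqrtN by (simp add: eta_def divide_le_eq)
qed

text \<open>Each of the two factors is the power of a number at least \<open>1 - eta\<close>, so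
  Bernoulli's inequality costs \<open>d * eta\<close> for each.\<close>

lemma factor_ge: "1 - 2 * d * eta \<le> shift_factor * time_factor"
proof -
  have b: "1 - d * x \<le> (1 - x) ^ CARD('d)" if "x \<le> 1" for x :: real
    using Bernoulli_inequality[of "- x" "CARD('d)"] that by (simp add: d_eq)
  have 1: "1 - d * eta \<le> shift_factor" using b[of eta] eta_bounds(2) by (simp add: shift_factor_def eta_def)
  have x: "4 * d / real N \<le> eta"
  proof -
    have "4 * d / real N = (4 * d * eta) * eta" using eta_bounds(4) by (simp add: power2_eq_square mult.assoc)
    also have "\<dots> \<le> 1 * eta" using eta_bounds d by (intro mult_right_mono) linarith+
    finally show ?thesis by simp
  qed
  have "1 - eta \<le> 1 / (1 + 4 * d / real N)"
  proof -
    have "1 - 4 * d / real N \<le> 1 / (1 + 4 * d / real N)" using d N_bounds(3) by (simp add: field_simps)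
    then show ?thesis using x by linarith
  qed
  then have "(1 - eta) ^ CARD('d) \<le> time_factor" unfolding time_factor_def using eta_bounds(2) by (intro power_mono) auto
  then have 2: "1 - d * eta \<le> time_factor" using b[of eta] eta_bounds(2) by linarith
  have "0 \<le> (1 - shift_factor) * (1 - time_factor)" using factor_bounds by simp
  then have "shift_factor + time_factor - 1 \<le> shift_factor * time_factor" by (simp add: algebra_simps)
  then show ?thesis using 1 2 by linarith
qed

lemma win_const_pos: "2 \<le> win_const TYPE('d)"
proof -
  have "(1 + 8 * real CARD('d)) ^ CARD('d) \<ge> 1" "(2::real) ^ CARD('d) \<ge> 1" by (intro one_le_power; simp)+
  then show ?thesis unfolding win_const_def by linarith
qed

text \<open>A regular term carries at most the weight \<open>1 + win_const / w\<close> once its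
  share of the leftover terms is included. Here \<open>win_const / w\<close> is at most
  \<open>2 * win_const * eta\<close>, and the thinned, shifted and delayed supply is at least
  \<open>1 - eta - 2 * d * eta\<close>.\<close>

lemma keep_le: "keep \<le> 1" "keep * (1 + win_const TYPE('d) / real w) \<le> (1 - eta) * (shift_factor * time_factor)" if "0 \<le> keep"
proof -
  let ?x = "win_const TYPE('d) / real w"
  have lc: "0 \<le> loss_const TYPE('d)" using win_const_pos d unfolding loss_const_def by simp
  show "keep \<le> 1" unfolding keep_def using lc eta_bounds(1) by simp
  have x0: "0 \<le> ?x" using win_const_pos by simp
  have x: "?x \<le> 2 * win_const TYPE('d) * eta"
  proof -
    have "?x \<le> win_const TYPE('d) / (sqrt (real N) / 2)"
      using win_const_pos w_bounds sqrtN by (intro divide_left_mono mult_pos_pos) auto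
    then show ?thesis by (simp add: eta_def mult.commute)
  qed
  have "1 - eta - 2 * d * eta \<le> (1 - eta) * (1 - 2 * d * eta)" using eta_bounds(1) d by (simp add: algebra_simps)
  also have "\<dots> \<le> (1 - eta) * (shift_factor * time_factor)" using factor_ge eta_bounds(2) by (intro mult_left_mono) auto
  finally have p: "1 - eta - 2 * d * eta \<le> (1 - eta) * (shift_factor * time_factor)" .
  have "keep \<le> 1 - eta - 2 * d * eta - ?x"
  proof -
    have "loss_const TYPE('d) * eta = eta + 102 * (d * eta) + 2 * win_const TYPE('d) * eta"
      unfolding loss_const_def d_eq[symmetric] by (simp add: algebra_simps)
    moreover have "0 \<le> d * eta" using d eta_bounds(1) by (intro mult_nonneg_nonneg) auto
    ultimately show ?thesis using x unfolding keep_def by linarith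
  qed
  moreover have "keep * ?x \<le> 1 * ?x" using \<open>keep \<le> 1\<close> x0 by (rule mult_right_mono)
  ultimately show "keep * (1 + ?x) \<le> (1 - eta) * (shift_factor * time_factor)" using p by (simp add: algebra_simps)
qed

lemma ix_inj: "inj_on ix {..<2 * M - 3}" and ix_image: "ix ` {..<2 * M - 3} = {1..<N} - {M - 1, N - 1}"
proof -
  show "inj_on ix {..<2 * M - 3}" by (auto simp: inj_on_def ix_def split: if_splits)
  show "ix ` {..<2 * M - 3} = {1..<N} - {M - 1, N - 1}"
  proof (intro equalityI subsetI)
    fix i assume "i \<in> ix ` {..<2 * M - 3}"
    then show "i \<in> {1..<N} - {M - 1, N - 1}" using M_big by (auto simp: ix_def N_def split: if_splits)
  next
    fix i assume i: "i \<in> {1..<N} - {M - 1, N - 1}"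
    show "i \<in> ix ` {..<2 * M - 3}"
    proof (cases "i < M - 1")
      case True
      then have "i = ix (i - 1)" "i - 1 < 2 * M - 3" using i by (auto simp: ix_def)
      then show ?thesis by blast
    next
      case False
      then have "i = ix (i - 2)" "i - 2 < 2 * M - 3" using i M_big by (auto simp: ix_def N_def)
      then show ?thesis by blast
    qed
  qed
qed

lemma window_idx: "r \<in> {1..w} \<Longrightarrow> N - 1 - r + r + 1 = N"
  using w_bounds(4) M_big unfolding N_def atLeastAtMost_iff by linarith

text \<open>Regular terms are supplied by their stages through \<open>main_term\<close>, the term at
  time 0 by \<open>A\<close> itself, and the two leftover terms are averaged over the window, so
  that they become a small multiple of the regular sum \<open>S\<close>.\<close>

lemma target_domination:
  assumes q: "0 \<le> keep"
  shows "ennreal keep * (\<Sum>i<N. T (i * L1) y) \<le> ennreal (A y) + ennreal (1 - eta) * (\<Sum>k<2 * M - 3. stage k y) + E y"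
proof -
  let ?I = "{..<N} - {M - 1, N - 1}" and ?p = "(1 - eta) * (shift_factor * time_factor)"
  let ?x1 = "2 ^ CARD('d) / real w" and ?x2 = "(1 + 8 * d) ^ CARD('d) / real w"
  let ?e5 = "er (low ((M - 1) * L1) 0 (hk_th TYPE('d) ((M - 1) * L1))) y"
  define S where "S = (\<Sum>i\<in>?I. T (i * L1) y)"
  have p: "0 \<le> ?p" "?p \<le> 1" "?p = (1 - eta) * (shift_factor * time_factor)" using eta_bounds factor_bounds by (auto intro!: mult_le_one)
  have x: "0 \<le> ?x1" "0 \<le> ?x2" "win_const TYPE('d) / real w = ?x1 + ?x2"
    using d by (auto simp: win_const_def d_eq add_divide_distrib)
  have S: "S = T 0 y + (\<Sum>k<2 * M - 3. T (ix k * L1) y)"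
  proof -
    have "?I = insert 0 ({1..<N} - {M - 1, N - 1})" using M_big by (auto simp: N_def)
    then have "S = T 0 y + (\<Sum>i\<in>{1..<N} - {M - 1, N - 1}. T (i * L1) y)" unfolding S_def by simp
    then show ?thesis unfolding ix_image[symmetric] by (simp add: sum.reindex[OF ix_inj])
  qed
  have a: "ennreal ?p * S \<le> ennreal (A y) + ennreal (1 - eta) * (\<Sum>k<2 * M - 3. stage k y) + (\<Sum>k<2 * M - 3. slot_error k y)"
  proof -
    have "ennreal ?p * T 0 y \<le> 1 * ennreal (A y)"
      unfolding T_0 using p F_le_A by (intro mult_mono) (auto intro: ennreal_leI)
    moreover have "ennreal ?p * (\<Sum>k<2 * M - 3. T (ix k * L1) y) \<le> (\<Sum>k<2 * M - 3. ennreal (1 - eta) * stage k y + slot_error k y)"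
      unfolding sum_distrib_left
    proof (rule sum_mono)
      fix k assume "k \<in> {..<2 * M - 3}"
      then have "ennreal (shift_factor * time_factor) * T (ix k * L1) y \<le> stage k y + slot_error k y" by (intro main_term) simp
      then have "ennreal (1 - eta) * (ennreal (shift_factor * time_factor) * T (ix k * L1) y) \<le> ennreal (1 - eta) * (stage k y + slot_error k y)"
        by (rule mult_left_mono) simp
      also have "\<dots> \<le> ennreal (1 - eta) * stage k y + 1 * slot_error k y"
        using eta_bounds unfolding distrib_left by (intro add_left_mono mult_right_mono) auto
      finally show "ennreal ?p * T (ix k * L1) y \<le> ennreal (1 - eta) * stage k y + slot_error k y"
        using eta_bounds factor_bounds by (simp add: ennreal_mult mult.assoc)
    qed
    ultimately show ?thesis unfolding S distrib_left
      by (simp add: sum.distrib sum_distrib_left add_mono add.assoc)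
  qed
  \<comment> \<open>The window consists of regular terms: its indices lie strictly between
    \<open>M - 1\<close> and \<open>N - 1\<close>, since \<open>w \<le> M - 2\<close>.\<close>
  have win: "(\<Sum>r=1..w. T ((N - 1 - r) * L1) y) \<le> S"
  proof -
    have inj: "inj_on (\<lambda>r. N - 1 - r) {1..w}" using w_bounds(4) M_big by (auto simp: inj_on_def N_def)
    have "(\<lambda>r. N - 1 - r) ` {1..w} \<subseteq> ?I" using w_bounds(4) M_big by (auto simp: N_def)
    then have "(\<Sum>i\<in>(\<lambda>r. N - 1 - r) ` {1..w}. T (i * L1) y) \<le> S"
      unfolding S_def by (intro sum_mono2) auto
    then show ?thesis by (simp only: sum.reindex[OF inj] o_def)
  qed
  have ne: "finite {1..w}" "{1..w} \<noteq> {}" using w_bounds(3) by auto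
  have b: "T ((N - 1) * L1) y \<le> ennreal ?x1 * (S + (\<Sum>r=1..w. window_error (N - 1 - r) y))"
  proof -
    have "T ((N - 1) * L1) y \<le> ennreal (1 / ((1/2) ^ CARD('d) * real (card {1..w}))) * ((\<Sum>r=1..w. T ((N - 1 - r) * L1) y) + (\<Sum>r=1..w. window_error (N - 1 - r) y))"
      using er_earlier[OF window_idx] by (intro le_average ne) auto
    also have "1 / ((1/2) ^ CARD('d) * real (card {1..w})) = ?x1" by (simp add: power_divide)
    finally show ?thesis using win by (meson add_right_mono mult_left_mono order_trans zero_le)
  qed
  have c: "T ((M - 1) * L1) y \<le> ennreal ?x2 * (S + (\<Sum>r=1..w. ?e5))"
  proof -
    have "T ((M - 1) * L1) y \<le> ennreal (1 / ((1 / (1 + 8 * d)) ^ CARD('d) * real (card {1..w}))) * ((\<Sum>r=1..w. T ((N - 1 - r) * L1) y) + (\<Sum>r=1..w. ?e5))"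
      using er_middle[OF window_idx] d by (intro le_average ne) (auto intro!: zero_less_power divide_pos_pos)
    also have "1 / ((1 / (1 + 8 * d)) ^ CARD('d) * real (card {1..w})) = ?x2" by (simp add: power_divide)
    finally show ?thesis using win by (meson add_right_mono mult_left_mono order_trans zero_le)
  qed
  have "(\<Sum>i<N. T (i * L1) y) = S + (T ((N - 1) * L1) y + T ((M - 1) * L1) y)"
  proof -
    have "(\<Sum>i<N. T (i * L1) y) = S + (\<Sum>i\<in>{M - 1, N - 1}. T (i * L1) y)"
      unfolding S_def using M_big by (intro sum.subset_diff) (auto simp: N_def)
    moreover have "M - 1 \<noteq> N - 1" using M_big by (simp add: N_def)
    ultimately show ?thesis by (simp add: add.commute)
  qed
  also have "\<dots> \<le> S + (ennreal ?x1 * (S + (\<Sum>r=1..w. window_error (N - 1 - r) y)) + ennreal ?x2 * (S + (\<Sum>r=1..w. ?e5)))"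
    by (intro add_left_mono add_mono b c)
  also have "\<dots> = ennreal (1 + win_const TYPE('d) / real w) * S + (ennreal ?x1 * (\<Sum>r=1..w. window_error (N - 1 - r) y) + ennreal ?x2 * (\<Sum>r=1..w. ?e5))"
    unfolding x(3) using x(1,2) by (simp add: distrib_left distrib_right ac_simps)
  finally have "ennreal keep * (\<Sum>i<N. T (i * L1) y) \<le> ennreal keep * (ennreal (1 + win_const TYPE('d) / real w) * S)
      + ennreal keep * (ennreal ?x1 * (\<Sum>r=1..w. window_error (N - 1 - r) y) + ennreal ?x2 * (\<Sum>r=1..w. ?e5))"
    by (simp only: distrib_left[symmetric] mult_left_mono[OF _ zero_le])
  also have "\<dots> \<le> ennreal ?p * S + 1 * (ennreal ?x1 * (\<Sum>r=1..w. window_error (N - 1 - r) y) + ennreal ?x2 * (\<Sum>r=1..w. ?e5))"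
  proof (intro add_mono mult_right_mono)
    have "ennreal keep * ennreal (1 + win_const TYPE('d) / real w) \<le> ennreal ?p"
      using keep_le[OF q] q win_const_pos by (subst ennreal_mult[symmetric]) (auto intro!: ennreal_leI)
    then show "ennreal keep * (ennreal (1 + win_const TYPE('d) / real w) * S) \<le> ennreal ?p * S"
      unfolding mult.assoc[symmetric] by (rule mult_right_mono) simp
    show "ennreal keep \<le> 1" using keep_le(1)[OF q] by simp
  qed auto
  also have "\<dots> \<le> (ennreal (A y) + ennreal (1 - eta) * (\<Sum>k<2 * M - 3. stage k y) + (\<Sum>k<2 * M - 3. slot_error k y))
      + (ennreal ?x1 * (\<Sum>r=1..w. window_error (N - 1 - r) y) + ennreal ?x2 * (\<Sum>r=1..w. ?e5))"
    using a by (simp add: add_right_mono)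
  finally show ?thesis unfolding E_def by (simp add: add.assoc)
qed

lemma E_mass: "(\<integral>\<^sup>+y. E y \<partial>count_space UNIV) \<le> mass * ennreal ((6 * d * real N + 3 * d * win_const TYPE('d)) * tau)"
proof -
  have t: "0 < tau" "0 < d" "0 < real w" using tau_bounds d w_bounds by auto
  have 1: "(\<integral>\<^sup>+y. (\<Sum>k<2 * M - 3. slot_error k y) \<partial>count_space UNIV) \<le> mass * ennreal (6 * d * real N * tau)"
  proof -
    have "(\<integral>\<^sup>+y. (\<Sum>k<2 * M - 3. slot_error k y) \<partial>count_space UNIV) \<le> of_nat (card {..<2 * M - 3}) * (mass * ennreal (6 * d * tau))"
      by (rule nn_integral_sum_le) (auto intro: slot_error_mass)
    also have "\<dots> \<le> of_nat N * (mass * ennreal (6 * d * tau))"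
      by (intro mult_right_mono) (auto simp: N_def simp del: of_nat_mult)
    also have "\<dots> = mass * ennreal (6 * d * real N * tau)"
      using t by (simp add: ennreal_of_nat_eq_real_of_nat ennreal_mult ac_simps)
    finally show ?thesis .
  qed
  have 2: "(\<integral>\<^sup>+y. ennreal (2 ^ CARD('d) / real w) * (\<Sum>r=1..w. window_error (N - 1 - r) y) \<partial>count_space UNIV) \<le> mass * ennreal (2 ^ CARD('d) * (3 * d * tau))"
  proof -
    have "(\<integral>\<^sup>+y. (\<Sum>r=1..w. window_error (N - 1 - r) y) \<partial>count_space UNIV) \<le> of_nat (card {1..w}) * (mass * ennreal (3 * d * tau))"
      using window_error_mass[OF window_idx] by (intro nn_integral_sum_le) auto
    then have "ennreal (2 ^ CARD('d) / real w) * (\<integral>\<^sup>+y. (\<Sum>r=1..w. window_error (N - 1 - r) y) \<partial>count_space UNIV) \<le> ennreal (2 ^ CARD('d) / real w) * (of_nat w * (mass * ennreal (3 * d * tau)))"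
      by (intro mult_left_mono) auto
    also have "\<dots> = mass * (ennreal (2 ^ CARD('d) / real w) * (ennreal (real w) * ennreal (3 * d * tau)))"
      by (simp add: ennreal_of_nat_eq_real_of_nat ac_simps)
    also have "ennreal (2 ^ CARD('d) / real w) * (ennreal (real w) * ennreal (3 * d * tau)) = ennreal (2 ^ CARD('d) * (3 * d * tau))"
      using t by (simp add: ennreal_mult[symmetric])
    finally show ?thesis by (simp add: nn_integral_cmult)
  qed
  have 3: "(\<integral>\<^sup>+y. ennreal ((1 + 8 * d) ^ CARD('d) / real w) * (\<Sum>r=1..w. er (low ((M - 1) * L1) 0 (hk_th TYPE('d) ((M - 1) * L1))) y) \<partial>count_space UNIV)
    \<le> mass * ennreal ((1 + 8 * d) ^ CARD('d) * (3 * d * tau))"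
  proof -
    have "N \<le> (M - 1) * L1" using M_big by (intro N_le_iL1) simp
    from er_low_mass[OF this, of 0]
    have "(\<integral>\<^sup>+y. (\<Sum>r=1..w. er (low ((M - 1) * L1) 0 (hk_th TYPE('d) ((M - 1) * L1))) y) \<partial>count_space UNIV) \<le> of_nat (card {1..w}) * (mass * ennreal (d * tau))"
      by (intro nn_integral_sum_le) auto
    also have "\<dots> \<le> of_nat (card {1..w}) * (mass * ennreal (3 * d * tau))" using t by (intro mult_left_mono ennreal_leI) auto
    finally have "ennreal ((1 + 8 * d) ^ CARD('d) / real w) * (\<integral>\<^sup>+y. (\<Sum>r=1..w. er (low ((M - 1) * L1) 0 (hk_th TYPE('d) ((M - 1) * L1))) y) \<partial>count_space UNIV) \<le> ennreal ((1 + 8 * d) ^ CARD('d) / real w) * (of_nat w * (mass * ennreal (3 * d * tau)))"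
      by (intro mult_left_mono) auto
    also have "\<dots> = mass * (ennreal ((1 + 8 * d) ^ CARD('d) / real w) * (ennreal (real w) * ennreal (3 * d * tau)))"
      by (simp add: ennreal_of_nat_eq_real_of_nat ac_simps)
    also have "ennreal ((1 + 8 * d) ^ CARD('d) / real w) * (ennreal (real w) * ennreal (3 * d * tau)) = ennreal ((1 + 8 * d) ^ CARD('d) * (3 * d * tau))"
      using t by (simp add: ennreal_mult[symmetric])
    finally show ?thesis by (simp add: nn_integral_cmult)
  qed
  have "(\<integral>\<^sup>+y. E y \<partial>count_space UNIV) \<le> mass * ennreal (6 * d * real N * tau) + (mass * ennreal (2 ^ CARD('d) * (3 * d * tau)) + mass * ennreal ((1 + 8 * d) ^ CARD('d) * (3 * d * tau)))"
    unfolding E_def using 1 2 3 by (subst nn_integral_add, simp, simp, subst nn_integral_add, simp, simp) (intro add_mono)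
  also have "\<dots> = mass * ennreal (6 * d * real N * tau + (2 ^ CARD('d) * (3 * d * tau) + (1 + 8 * d) ^ CARD('d) * (3 * d * tau)))"
    using t by (simp add: distrib_left[symmetric] ennreal_plus[symmetric] del: ennreal_plus)
  also have "6 * d * real N * tau + (2 ^ CARD('d) * (3 * d * tau) + (1 + 8 * d) ^ CARD('d) * (3 * d * tau)) = (6 * d * real N + 3 * d * win_const TYPE('d)) * tau"
    by (simp add: win_const_def d_eq algebra_simps)
  finally show ?thesis .
qed

text \<open>The number of error terms is of order \<open>N\<close>; it is absorbed by the factor
  \<open>1 / L\<close> hidden in \<open>kap\<close>.\<close>

lemma E_mass_le: "(\<integral>\<^sup>+y. E y \<partial>count_space UNIV) \<le> ennreal (4 * d * (6 * d + 3 * d * win_const TYPE('d)) * u * (2 * real K + 1) ^ CARD('d) * tau)"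
proof -
  let ?W = "win_const TYPE('d)" and ?Q = "(2 * real K + 1) ^ CARD('d)"
  have W: "2 \<le> ?W" by (rule win_const_pos)
  have Q: "0 \<le> ?Q" by simp
  have "(\<integral>\<^sup>+y. E y \<partial>count_space UNIV) \<le> ennreal (kap * u * ?Q) * ennreal ((6 * d * real N + 3 * d * ?W) * tau)"
    by (rule order_trans[OF E_mass]) (intro mult_right_mono mass_le zero_le)
  also have "\<dots> = ennreal (kap * u * ?Q * ((6 * d * real N + 3 * d * ?W) * tau))"
    using kap_pos u Q W d tau_bounds(4) by (intro ennreal_mult[symmetric]) auto
  also have "\<dots> \<le> ennreal (4 * d * (6 * d + 3 * d * ?W) * u * ?Q * tau)"
  proof (rule ennreal_leI)
    have NL: "real N \<le> real L" "1 \<le> real N" using L_big(5) N_bounds(2) by auto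
    have "3 * d * ?W * 1 \<le> 3 * d * ?W * real N" using NL W d by (intro mult_left_mono) auto
    then have "6 * d * real N + 3 * d * ?W \<le> (6 * d + 3 * d * ?W) * real N" by (simp add: algebra_simps)
    also have "\<dots> \<le> (6 * d + 3 * d * ?W) * real L" using NL W d by (intro mult_left_mono) auto
    finally have "kap * (6 * d * real N + 3 * d * ?W) \<le> kap * ((6 * d + 3 * d * ?W) * real L)" using kap_pos by simp
    also have "\<dots> = 4 * d * (6 * d + 3 * d * ?W)" using L_pos by (simp add: kap_def)
    finally have "kap * (6 * d * real N + 3 * d * ?W) * (u * ?Q * tau) \<le> 4 * d * (6 * d + 3 * d * ?W) * (u * ?Q * tau)"
      using u Q tau_bounds(4) by (intro mult_right_mono) auto
    then show "kap * u * ?Q * ((6 * d * real N + 3 * d * ?W) * tau) \<le> 4 * d * (6 * d + 3 * d * ?W) * u * ?Q * tau"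
      by (simp only: ac_simps)
  qed
  finally show ?thesis .
qed

section \<open>Lower bounds for the number of walkers in a cell\<close>

lemma qm_mass: assumes "c \<in> C" shows "ennreal (1/2) \<le> (\<integral>\<^sup>+y. ennreal (qm c y) \<partial>count_space UNIV)"
proof -
  obtain z where z: "cellof z = c" using assms by (auto simp: C_def)
  \<comment> \<open>The common bound \<open>tau\<close> will not do here: only
    \<open>100 * d \<le> sqrt N\<close> is known, so \<open>tau\<close> may be close to 1. The
    errors of \<open>rS\<close> have the better exponents \<open>N / (4 * d)\<close> and
    \<open>N / 2\<close>.\<close>
  have small: "3 * d * exp (- (real N / (4 * d))) \<le> 1/4"
  proof -
    let ?v = "real N / (4 * d)"
    have v: "2500 * d \<le> ?v" using N_bounds(1) d by (simp add: le_divide_eq power2_eq_square)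
    have "1 + ?v \<le> exp ?v" by (rule exp_ge_add_one_self)
    then have "12 * d \<le> exp ?v" using v d by linarith
    then have "12 * d * exp (- ?v) \<le> exp ?v * exp (- ?v)" by (intro mult_right_mono) auto
    then show ?thesis by (simp add: exp_minus)
  qed
  have le: "exp (- (real N / 2)) \<le> exp (- (real N / (4 * d)))" 
  proof -
    have "real N / (4 * d) \<le> real N / 2" using d by (intro divide_left_mono) auto
    then show ?thesis by simp
  qed
  have "(\<integral>\<^sup>+x. rS x \<partial>count_space UNIV) \<le> ennreal (hk_low_mass TYPE('d) g) + ennreal (hk_far_mass TYPE('d) R g)"
    unfolding rS_def by (subst nn_integral_add) (auto intro!: add_mono nn_integral_low_le nn_integral_hk_far R_bounds g_real)
  also have "\<dots> \<le> ennreal (d * exp (- (real N / (4 * d)))) + ennreal (2 * d * exp (- (real N / (4 * d))))"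
  proof (intro add_mono ennreal_leI)
    have "real N / (4 * d) \<le> real g / (4 * d)" using g_real(3) d by (intro divide_right_mono) auto
    then show "hk_low_mass TYPE('d) g \<le> d * exp (- (real N / (4 * d)))" using d unfolding hk_low_mass_def d_eq[symmetric] by simp
    have "R\<^sup>2 / (2 * real g) = real N / 2" using g_real(2) by (simp add: R_def)
    then have "exp (- (R\<^sup>2 / (2 * real g))) \<le> exp (- (real N / (4 * d)))" using le by (simp only:)
    then show "hk_far_mass TYPE('d) R g \<le> 2 * d * exp (- (real N / (4 * d)))" using d unfolding hk_far_mass_def d_eq[symmetric] by simp
  qed
  also have "\<dots> = ennreal (3 * d * exp (- (real N / (4 * d))))" using d by (subst ennreal_plus[symmetric]) auto
  also have "\<dots> \<le> ennreal (1/4)" by (rule ennreal_leI[OF small])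
  finally have r: "(\<integral>\<^sup>+x. rS x \<partial>count_space UNIV) \<le> ennreal (1/4)" .
  have "3/4 \<le> shift_factor"
  proof -
    have "1 - 2 * d * eta \<le> shift_factor * time_factor" by (rule factor_ge)
    also have "\<dots> \<le> shift_factor * 1" using factor_bounds by (intro mult_left_mono) auto
    finally show ?thesis using eta_bounds(5) by linarith
  qed
  then have "ennreal (3/4) \<le> ennreal shift_factor * (\<integral>\<^sup>+y. ennreal (hk g (y - z)) \<partial>count_space UNIV)" by (simp add: hk_sum ennreal_leI)
  also have "\<dots> = (\<integral>\<^sup>+y. ennreal shift_factor * ennreal (hk g (y - z)) \<partial>count_space UNIV)" by (simp add: nn_integral_cmult)
  also have "\<dots> \<le> (\<integral>\<^sup>+y. ennreal (qm c y) + rS (y - z) \<partial>count_space UNIV)"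
    using qm_lower[of _ z] z by (intro nn_integral_mono) simp
  also have "\<dots> = (\<integral>\<^sup>+y. ennreal (qm c y) \<partial>count_space UNIV) + (\<integral>\<^sup>+x. rS x \<partial>count_space UNIV)"
    by (simp add: nn_integral_add nn_shift)
  also have "\<dots> \<le> (\<integral>\<^sup>+y. ennreal (qm c y) \<partial>count_space UNIV) + ennreal (1/4)" by (intro add_left_mono r)
  finally have "ennreal (3/4) \<le> (\<integral>\<^sup>+y. ennreal (qm c y) \<partial>count_space UNIV) + ennreal (1/4)" .
  moreover have "ennreal (1/2) + ennreal (1/4) = ennreal (3/4)" by (subst ennreal_plus[symmetric]) auto
  ultimately have "ennreal (1/2) + ennreal (1/4) \<le> (\<integral>\<^sup>+y. ennreal (qm c y) \<partial>count_space UNIV) + ennreal (1/4)" by (simp only:)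
  then show ?thesis by (simp only: ennreal_add_left_cancel_le add.commute[of _ "ennreal (1/4)"]) auto
qed

lemma cmass_finite: "cmass k c < \<infinity>"
proof -
  have "(\<integral>\<^sup>+x. ennreal (A x) \<partial>count_space UNIV) < \<infinity>"
  proof -
    have "(\<integral>\<^sup>+x. ennreal (A x) \<partial>count_space UNIV) = (\<integral>\<^sup>+x\<in>lattice_ball 0 (K + L). ennreal (A x) \<partial>count_space UNIV)"
      by (intro nn_integral_cong) (auto simp: A_def indicator_def)
    also have "\<dots> = (\<Sum>x\<in>lattice_ball 0 (K + L). ennreal (A x))"
      by (subst nn_integral_count_space_indicator[symmetric]) (auto simp: nn_integral_count_space_finite finite_lattice_ball)
    also have "\<dots> < \<infinity>" by (subst sum_ennreal) (auto simp: A_nonneg)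
    finally show ?thesis .
  qed
  moreover have "cmass k c \<le> (\<integral>\<^sup>+z. \<integral>\<^sup>+x. ennreal (A x) * ennreal (hk (s k) (z - x)) \<partial>count_space UNIV \<partial>count_space UNIV)"
    unfolding cmass_def by (intro nn_integral_mono) (auto simp: indicator_def)
  moreover have "\<dots> = (\<integral>\<^sup>+x. ennreal (A x) \<partial>count_space UNIV)"
    by (subst swap_count) (simp add: nn_integral_cmult hk_sum)
  ultimately show ?thesis by (simp add: order.strict_trans1)
qed

text \<open>Traced back in time from a point of the cell, a walker must move by more than
  \<open>L / 2\<close> to leave the ball of radius \<open>K + L\<close>; within time
  \<open>L\<close> this has probability at most 1/2.\<close>

lemma ball_mass:
  assumes k: "k < 2 * M - 3" and c: "c \<in> C" and z: "cellof z = c"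
  shows "ennreal (1/2) \<le> (\<integral>\<^sup>+x. indicator (lattice_ball 0 (K + L)) x * ennreal (hk (s k) (z - x)) \<partial>count_space UNIV)" (is "_ \<le> ?in")
proof -
  let ?R = "real L / 2"
  let ?S = "{v :: int ^ 'd. \<exists>i. ?R < \<bar>real_of_int (v $ i)\<bar>}"
  let ?out = "\<integral>\<^sup>+x. indicator (- lattice_ball 0 (K + L)) x * ennreal (hk (s k) (z - x)) \<partial>count_space UNIV"
  obtain z' where z': "cellof z' = c" "z' \<in> lattice_ball 0 (K + L div 4)" using c by (auto simp: C_def)
  have zi: "\<bar>z $ i\<bar> \<le> int (K + L div 4) + int l" for i
  proof -
    have "\<bar>z $ i - z' $ i\<bar> \<le> int l" using cell_same[of z z' i] z z'(1) by simp
    moreover have "\<bar>z' $ i\<bar> \<le> int (K + L div 4)" using z'(2) unfolding mem_lattice_ball by blast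
    ultimately show ?thesis by linarith
  qed
  have "?out \<le> (\<integral>\<^sup>+x. indicator ?S (z - x) * ennreal (hk (s k) (z - x)) \<partial>count_space UNIV)"
  proof (intro nn_integral_mono mult_right_mono)
    fix x
    have "z - x \<in> ?S" if x: "x \<notin> lattice_ball 0 (K + L)"
    proof -
      obtain i where i: "int (K + L) < \<bar>x $ i\<bar>" using x by (auto simp: mem_lattice_ball not_le)
      have "4 * l \<le> L" using L_big(4) by linarith
      then have "int (4 * l) \<le> int L" by (simp only: of_nat_le_iff)
      then have "4 * int l \<le> int L" by simp
      moreover have "4 * int (L div 4) \<le> int L" by (rule four_div)
      moreover have "int (K + L) < \<bar>x $ i\<bar>" by (rule i)
      ultimately have "int L \<le> 2 * \<bar>z $ i - x $ i\<bar> - 1"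
        using zi[of i] abs_triangle_ineq2_sym[of "x $ i" "z $ i"] by (rule far_apart)
      then have "int L \<le> 2 * \<bar>(z - x) $ i\<bar> - 1" by (simp only: vector_minus_component)
      then have "?R < \<bar>real_of_int ((z - x) $ i)\<bar>" by linarith
      then show ?thesis by blast
    qed
    then show "indicator (- lattice_ball 0 (K + L)) x \<le> (indicator ?S (z - x) :: ennreal)" by (auto simp: indicator_def)
  qed simp
  also have "\<dots> = (\<integral>\<^sup>+v. ennreal (hk (s k) v) * indicator ?S v \<partial>count_space UNIV)"
  proof -
    have "(\<integral>\<^sup>+x. indicator ?S (z - x) * ennreal (hk (s k) (z - x)) \<partial>count_space UNIV) = (\<integral>\<^sup>+v. indicator ?S v * ennreal (hk (s k) v) \<partial>count_space UNIV)"
      by (rule nn_integral_bij_count_space[of "\<lambda>x. z - x" UNIV UNIV]) (auto intro!: bij_betwI[where g = "\<lambda>x. z - x"])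
    then show ?thesis by (simp add: mult.commute)
  qed
  also have "\<dots> = emeasure (walk_pos (s k)) ?S" by (subst nn_integral_measure_pmf[symmetric]) simp
  also have "\<dots> \<le> ennreal (2 * real CARD('d) * exp (- (?R\<^sup>2 / (2 * real L))))"
    by (rule walk_pos_tail) (use L_pos s_le_L[OF k] in auto)
  also have "\<dots> \<le> ennreal (1/2)"
  proof (rule ennreal_leI)
    have e: "?R\<^sup>2 / (2 * real L) = real L / 8" using L_pos by (simp add: power2_eq_square)
    have "1 + real L / 8 \<le> exp (real L / 8)" by (rule exp_ge_add_one_self)
    moreover have "d \<le> d * d" using d mult_left_mono[of 1 d d] by simp
    then have "32 * d \<le> real L" using L_big(5) N_bounds(1) d unfolding power2_eq_square by linarith
    ultimately have "4 * d \<le> exp (real L / 8)" by linarith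
    then have "4 * d * exp (- (real L / 8)) \<le> exp (real L / 8) * exp (- (real L / 8))" by (intro mult_right_mono) auto
    then have "4 * d * exp (- (real L / 8)) \<le> 1" by (simp add: exp_minus)
    then show "2 * real CARD('d) * exp (- (?R\<^sup>2 / (2 * real L))) \<le> 1/2" unfolding e d_eq[symmetric] by simp
  qed
  finally have out: "?out \<le> ennreal (1/2)" .
  have "ennreal (1/2) + ennreal (1/2) = ennreal 1" by (subst ennreal_plus[symmetric]) auto
  also have "\<dots> = (\<integral>\<^sup>+x. ennreal (hk (s k) (z - x)) \<partial>count_space UNIV)" by (simp add: hk_sum')
  also have "\<dots> = ?in + ?out"
    by (subst nn_integral_add[symmetric]) (auto intro!: nn_integral_cong simp: indicator_def)
  also have "\<dots> \<le> ?in + ennreal (1/2)" by (intro add_left_mono out)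
  also have "\<dots> = ennreal (1/2) + ?in" by (rule add.commute)
  finally show ?thesis by (simp only: ennreal_add_left_cancel_le) auto
qed

text \<open>The density of walkers is of order \<open>L powr (-5/4)\<close> and a cell contains
  \<open>l ^ d\<close> points, at least \<open>l ^ 3\<close> of them. As \<open>l\<close> is at
  least \<open>sqrt L / (3 * N ^ 3)\<close>, the mean is of order
  \<open>L powr (1/4) / N ^ 9\<close>, and \<open>L powr (1/4)\<close> exceeds \<open>N ^ 20\<close>
  by the locale hypothesis \<open>big\<close>. Here three dimensions, the exponent 1/4 and the
  exponent \<open>20 * d + 20\<close> meet.\<close>

lemma cmass_ge:
  assumes k: "k < 2 * M - 3" and c: "c \<in> C"
  shows "ennreal (24 * (real N)\<^sup>2) \<le> cmass k c"
proof -
  let ?b = "kap * real L powr (- 1/4)"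
  have b0: "0 \<le> ?b" using kap_pos by simp
  have A_ge: "ennreal ?b * indicator (lattice_ball 0 (K + L)) x \<le> ennreal (A x)" for x
  proof (cases "x \<in> lattice_ball 0 (K + L)")
    case True
    then have "real L powr (- 1/4) \<le> f1 x + f2 x" using fb[of x] by (simp add: L_def mult.assoc)
    then show ?thesis using True kap_pos by (simp add: A_def ennreal_leI)
  qed simp
  have "ennreal (?b / 2) * indicator {z. cellof z = c} z \<le> indicator {z. cellof z = c} z *
     (\<integral>\<^sup>+x. ennreal (A x) * ennreal (hk (s k) (z - x)) \<partial>count_space UNIV)" for z
  proof (cases "cellof z = c")
    case True
    have "ennreal (?b / 2) = ennreal ?b * ennreal (1/2)" using b0 by (subst ennreal_mult[symmetric]) auto
    also have "\<dots> \<le> ennreal ?b * (\<integral>\<^sup>+x. indicator (lattice_ball 0 (K + L)) x * ennreal (hk (s k) (z - x)) \<partial>count_space UNIV)"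
      by (intro mult_left_mono ball_mass[OF k c True]) simp
    also have "\<dots> = (\<integral>\<^sup>+x. ennreal ?b * indicator (lattice_ball 0 (K + L)) x * ennreal (hk (s k) (z - x)) \<partial>count_space UNIV)"
      by (subst nn_integral_cmult[symmetric]) (auto simp: mult.assoc)
    also have "\<dots> \<le> (\<integral>\<^sup>+x. ennreal (A x) * ennreal (hk (s k) (z - x)) \<partial>count_space UNIV)"
      by (intro nn_integral_mono mult_right_mono A_ge) simp
    finally show ?thesis using True by simp
  qed simp
  then have lb: "(\<integral>\<^sup>+z. ennreal (?b / 2) * indicator {z. cellof z = c} z \<partial>count_space UNIV) \<le> cmass k c"
    unfolding cmass_def by (rule nn_integral_mono)
  have i1: "(\<integral>\<^sup>+z. ennreal (?b / 2) * indicator {z. cellof z = c} z \<partial>count_space UNIV) = ennreal (?b / 2) * of_nat (l ^ CARD('d))"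
    by (simp only: nn_integral_cmult_indicator sets_count_space Pow_UNIV UNIV_I emeasure_count_space_finite[OF subset_UNIV finite_cell] card_cell)
  have i2: "ennreal (?b / 2) * of_nat (l ^ CARD('d)) = ennreal (?b / 2 * real l ^ CARD('d))"
    unfolding ennreal_of_nat_eq_real_of_nat of_nat_power using b0 by (intro ennreal_mult[symmetric]) auto
  have "24 * (real N)\<^sup>2 \<le> ?b / 2 * real l ^ CARD('d)"
  proof -
    let ?r = "real L powr (1/4)"
    have N0: "0 < real N" using N_bounds(3) by simp
    have r0: "0 < ?r" using L_pos by simp
    have r4: "?r ^ 4 = real L" using L_pos by (simp add: powr_power)
    have rm: "real L powr (- 1/4) = 1 / ?r" by (simp add: powr_minus_divide[of _ "1/4", simplified])
    have Nr20: "real N ^ 20 \<le> ?r"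
    proof -
      have "real N ^ 80 \<le> real N ^ (20 * CARD('d) + 20)" using d3 N_bounds(3) by (intro power_increasing) auto
      also have "\<dots> \<le> real L"
      proof -
        have "N ^ (20 * CARD('d) + 20) \<le> L" using big unfolding L_eq(3) N_def .
        then have "real (N ^ (20 * CARD('d) + 20)) \<le> real L" by (simp only: of_nat_le_iff)
        then show ?thesis by simp
      qed
      finally have "(real N ^ 20) ^ 4 \<le> ?r ^ 4" unfolding r4 by (simp flip: power_mult)
      then show ?thesis by (rule power_mono_iff[THEN iffD1, rotated 3]) (use r0 in auto)
    qed
    have l: "?r ^ 2 / (3 * real N ^ 3) \<le> real l"
    proof -
      have "(?r ^ 2 / (3 * real N / 2))\<^sup>2 = ?r ^ 4 / (9/4 * (real N)\<^sup>2)" by (simp add: power_divide power_mult_distrib flip: power_mult)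
      also have "\<dots> \<le> real g" unfolding r4 using g_bounds(3) N0 mult_nonneg_nonneg[of "(real N)\<^sup>2" "real g"]
        by (subst divide_le_eq) (auto simp: algebra_simps)
      finally have "?r ^ 2 / (3 * real N / 2) \<le> sqrt (real g)" by (rule real_le_rsqrt)
      then have "?r ^ 2 / (3 * real N / 2) / (2 * (real N)\<^sup>2) \<le> sqrt (real g) / (2 * (real N)\<^sup>2)" by (intro divide_right_mono) auto
      also have "\<dots> \<le> real l" by (rule l_bounds)
      finally show ?thesis by (simp add: power2_eq_square power3_eq_cube mult.assoc)
    qed
    have "24 * (real N)\<^sup>2 * (27 * real N ^ 9) \<le> 2 * real N ^ 20"
    proof -
      have "324 \<le> real N ^ 9" using N_bounds(2) self_le_power[of "real N" 9] by linarith
      then have "324 * real N ^ 11 \<le> real N ^ 9 * real N ^ 11" using N0 by (intro mult_right_mono) auto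
      then show ?thesis by (simp flip: power_add)
    qed
    then have "24 * (real N)\<^sup>2 \<le> 2 * real N ^ 20 / (27 * real N ^ 9)" using N0 by (subst le_divide_eq) auto
    also have "\<dots> \<le> 2 * ?r / (27 * real N ^ 9)" using Nr20 by (intro divide_right_mono) auto
    also have "\<dots> = (4 / real L) / ?r / 2 * (?r ^ 2 / (3 * real N ^ 3)) ^ 3"
      by (rule cube_identity[OF r0 N0, unfolded r4])
    also have "\<dots> \<le> ?b / 2 * real l ^ CARD('d)"
    proof (rule mult_mono)
      have "4 / real L \<le> kap" using d L_pos by (simp add: kap_def divide_right_mono)
      then have "(4 / real L) / ?r / 2 \<le> kap / ?r / 2" using r0 by (intro divide_right_mono) auto
      moreover have "kap / ?r = ?b" unfolding rm by (rule times_divide_eq_right[of kap 1, simplified mult_1_right, symmetric])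
      ultimately show "(4 / real L) / ?r / 2 \<le> ?b / 2" by (simp only:)
      have "(?r ^ 2 / (3 * real N ^ 3)) ^ 3 \<le> real l ^ 3" using l r0 N0 by (intro power_mono) auto
      also have "\<dots> \<le> real l ^ CARD('d)" using l_bounds(1) d3 by (intro power_increasing) auto
      finally show "(?r ^ 2 / (3 * real N ^ 3)) ^ 3 \<le> real l ^ CARD('d)" .
    qed (use b0 r0 N0 in auto)
    finally show ?thesis .
  qed
  from order_trans[OF ennreal_leI[OF this] lb[unfolded i1 i2]] show ?thesis .
qed

lemma card_C: "real (card C) \<le> (3 * real (K + L)) ^ CARD('d)"
proof -
  have "card C \<le> (2 * (K + L div 4) + 1) ^ CARD('d)"
    unfolding C_def card_lattice_ball[where 'd='d, symmetric] by (rule card_image_le[OF finite_lattice_ball])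
  also have "\<dots> \<le> (3 * (K + L)) ^ CARD('d)" using L_pos by (intro power_mono) auto
  finally have "real (card C) \<le> real ((3 * (K + L)) ^ CARD('d))" by (simp only: of_nat_le_iff)
  then show ?thesis by simp
qed

end

lemma hit_le_1: "hit n S x \<le> 1"
  unfolding hit_def by (rule measure_pmf.emeasure_le_1)

lemma interlacement_void:
  fixes f :: "int ^ 'd::finite \<Rightarrow> real"
  assumes "1 \<le> L"
  shows "\<exists>\<mu>. interlacement_law f L \<mu> \<and> random_set_law \<mu> \<and> (\<forall>S. void \<mu> S = exp_neg (hit_mass f L S))"
  by (rule interlacement_law_exists[OF assms, of f]) (auto simp: random_set_law_def void_def)

text \<open>The probability is \<open>1 - exp (- x)\<close> with \<open>x\<close> the mean number of
  trajectories.\<close>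

lemma nonempty_le:
  fixes \<mu> :: "'a::countable set measure"
  assumes r: "random_set_law \<mu>" and v: "void \<mu> UNIV = exp_neg x"
  shows "emeasure \<mu> {S. S \<noteq> {}} \<le> x"
proof (cases "x = \<infinity>")
  case False
  then obtain t where t: "x = ennreal t" "0 \<le> t" by (cases x) auto
  interpret prob_space \<mu> using r by (simp add: random_set_law_def)
  have sp: "space \<mu> = UNIV" using r sets_eq_imp_space_eq[of \<mu> random_sets] by (simp add: random_set_law_def space_random_sets)
  have e: "{A. A \<inter> UNIV = {}} \<in> sets \<mu>" using r sets_random_sets[of "UNIV :: 'a set"] by (simp add: random_set_law_def)
  have "{S. S \<noteq> {}} = space \<mu> - {A. A \<inter> UNIV = {}}" unfolding sp by auto
  then have "emeasure \<mu> {S. S \<noteq> {}} = 1 - void \<mu> UNIV"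
    using emeasure_compl[OF e] emeasure_space_1 unfolding void_def by simp
  also have "\<dots> = ennreal 1 - ennreal (exp (- t))" using v t by (simp add: exp_neg_ennreal)
  also have "\<dots> = ennreal (1 - exp (- t))" by (rule ennreal_minus) simp
  also have "\<dots> \<le> ennreal t" using exp_ge_add_one_self[of "- t"] by (intro ennreal_leI) simp
  finally show ?thesis using t by simp
qed simp

lemma exp_quadratic: "exp t \<le> 1 + t + t\<^sup>2" "t - t\<^sup>2 / 2 \<le> 1 - exp (- t)" if "0 \<le> t" "t \<le> 1" for t :: real
proof -
  show "exp t \<le> 1 + t + t\<^sup>2" using that by (rule exp_bound)
  show "t - t\<^sup>2 / 2 \<le> 1 - exp (- t)"
  proof -
    have "(1 - t + t\<^sup>2 / 2) * exp t \<ge> (1 - t + t\<^sup>2 / 2) * (1 + t + t\<^sup>2 / 2)"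
      using exp_lower_Taylor_quadratic[OF that(1)] that by (intro mult_left_mono) (auto simp: power2_eq_square)
    moreover have "(1 - t + t\<^sup>2 / 2) * (1 + t + t\<^sup>2 / 2) = 1 + (t\<^sup>2 / 2)\<^sup>2" by (simp add: power2_eq_square field_simps)
    ultimately have "1 \<le> (1 - t + t\<^sup>2 / 2) * exp t" using zero_le_power2[of "t\<^sup>2 / 2"] by linarith
    then have "exp (- t) * 1 \<le> exp (- t) * ((1 - t + t\<^sup>2 / 2) * exp t)" by (intro mult_left_mono) auto
    also have "\<dots> = (1 - t + t\<^sup>2 / 2) * (exp (- t) * exp t)" by (simp only: ac_simps)
    also have "exp (- t) * exp t = 1" by (simp flip: exp_add)
    finally show ?thesis by simp
  qed
qed

text \<open>To second order the exponent at \<open>t\<close> is at most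
  \<open>- e * t + 3 * t ^ 2 / 2\<close>, which is minimal at \<open>t = e / 3\<close>.\<close>

lemma chernoff_exponent:
  fixes e :: real
  assumes e: "0 \<le> e" "e \<le> 1"
  shows "(1 - e) * (exp (e / 3) - 1) - (1 - exp (- (e / 3))) \<le> - (e\<^sup>2 / 6)"
proof -
  have t: "0 \<le> e / 3" "e / 3 \<le> 1" using e by auto
  have "(1 - e) * (exp (e / 3) - 1) \<le> (1 - e) * (e / 3 + (e / 3)\<^sup>2)"
    using exp_quadratic(1)[OF t] e by (intro mult_left_mono) auto
  also have "\<dots> = e / 3 + (e / 3)\<^sup>2 - e * (e / 3) - e * (e / 3)\<^sup>2" by (simp only: left_diff_distrib distrib_left mult_1_left)
  also have "\<dots> \<le> e / 3 + (e / 3)\<^sup>2 - e * (e / 3)" using e by simp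
  finally show ?thesis using exp_quadratic(2)[OF t] by (simp add: power2_eq_square)
qed

lemma sum_less_top_ennreal: "finite S \<Longrightarrow> (\<And>i. i \<in> S \<Longrightarrow> f i < (\<infinity> :: ennreal)) \<Longrightarrow> sum f S < \<infinity>"
  by (induction rule: finite_induct) auto

lemma times_divide_self_ennreal: "b \<noteq> 0 \<Longrightarrow> b < \<infinity> \<Longrightarrow> b * (a / b) = (a :: ennreal)"
  by (simp add: ennreal_times_divide mult.commute ennreal_mult_divide_eq)

section \<open>Source and target in terms of hitting masses\<close>

context schedule
begin

definition fK :: "int ^ 'd \<Rightarrow> real" where "fK x = (f1 x + f2 x) * indicator (lattice_ball 0 K) x"
definition inB :: "(int ^ 'd \<Rightarrow> real) \<Rightarrow> int ^ 'd \<Rightarrow> real" where "inB h x = h x * indicator (lattice_ball 0 (K + L)) x"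
text \<open>Walkers released outside the ball may have infinite total intensity; they do not enter
  the particle system and are added to the first set independently.\<close>

definition outB :: "(int ^ 'd \<Rightarrow> real) \<Rightarrow> int ^ 'd \<Rightarrow> real" where "outB h x = h x * indicator (- lattice_ball 0 (K + L)) x"

definition target :: "int ^ 'd \<Rightarrow> ennreal" where "target y = ennreal keep * (\<Sum>i<N. T (i * L1) y)"
definition covered :: "int ^ 'd \<Rightarrow> ennreal" where
  "covered y = ennreal (A y) + ennreal (1 - eta) * (\<Sum>k<2 * M - 3. stage k y)"
text \<open>Keeping an available trajectory with this probability gives the target density exactly
  wherever there is enough supply.\<close>

definition thinning :: "int ^ 'd \<Rightarrow> real" where "thinning y = enn2real (min 1 (target y / covered y))"
definition uncovered :: "int ^ 'd \<Rightarrow> ennreal" where "uncovered y = target y - covered y * ennreal (thinning y)"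

lemma T_fin: "T n y < \<infinity>"
proof -
  have "T n y \<le> mass" unfolding er_def mass_def
    by (intro nn_integral_mono mult_left_le) (auto simp: pmf_le_1)
  then show ?thesis using mass_fin by (rule le_less_trans)
qed

lemma target_fin: "target y < \<infinity>"
proof -
  have "(\<Sum>i<N. T (i * L1) y) < \<infinity>" by (rule sum_less_top_ennreal) (auto intro: T_fin simp del: infinity_ennreal_def)
  then show ?thesis unfolding target_def by (simp add: ennreal_mult_less_top)
qed

lemma covered_fin: "covered y < \<infinity>"
proof -
  have "stage k y < \<infinity>" for k
    unfolding stage_def using cmass_finite by (intro sum_less_top_ennreal finite_C) (simp add: ennreal_mult_less_top)
  then have "(\<Sum>k<2 * M - 3. stage k y) < \<infinity>" by (intro sum_less_top_ennreal) simp_all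
  then show ?thesis unfolding covered_def by (simp add: ennreal_mult_less_top)
qed

lemma thinning_bounds: "0 \<le> thinning y" "thinning y \<le> 1"
proof -
  show "0 \<le> thinning y" by (simp add: thinning_def)
  have "enn2real (min 1 (target y / covered y)) \<le> enn2real 1" by (rule enn2real_mono) auto
  then show "thinning y \<le> 1" by (simp add: thinning_def)
qed

text \<open>Where the supply suffices nothing is left uncovered. Elsewhere the thinning probability
  is 1, and \<open>target_domination\<close> bounds the deficit by \<open>E\<close>.\<close>

lemma split_target:
  assumes "0 \<le> keep"
  shows "covered y * ennreal (thinning y) + uncovered y = target y" "uncovered y \<le> E y"
proof -
  have e: "ennreal (thinning y) = min 1 (target y / covered y)"
    unfolding thinning_def by (subst ennreal_enn2real) (auto simp: min_less_iff_disj)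
  have c: "target y \<le> covered y + E y" using target_domination[OF assms, of y] by (simp add: target_def covered_def)
  have le: "covered y * ennreal (thinning y) \<le> target y"
  proof (cases "covered y = 0")
    case False
    have "covered y * ennreal (thinning y) \<le> covered y * (target y / covered y)" unfolding e by (intro mult_left_mono) auto
    also have "\<dots> = target y" by (rule times_divide_self_ennreal[OF False covered_fin])
    finally show ?thesis .
  qed simp
  then show "covered y * ennreal (thinning y) + uncovered y = target y" unfolding uncovered_def by (rule add_diff_inverse_ennreal)
  show "uncovered y \<le> E y"
  proof (cases "target y \<le> covered y")
    case True
    have "covered y * ennreal (thinning y) = target y"
    proof (cases "covered y = 0")
      case False
      have "target y / covered y \<le> 1" using True False by (simp add: divide_le_posI_ennreal zero_less_iff_neq_zero)
      then have "covered y * ennreal (thinning y) = covered y * (target y / covered y)" unfolding e by (simp add: min_absorb2)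
      also have "\<dots> = target y" by (rule times_divide_self_ennreal[OF False covered_fin])
      finally show ?thesis .
    qed (use True in simp)
    then show ?thesis using target_fin[of y] by (simp add: uncovered_def)
  next
    case False
    have "1 \<le> target y / covered y"
    proof (cases "covered y = 0")
      case True
      then show ?thesis using False by (auto simp: ennreal_divide_zero)
    next
      case nz: False
      show ?thesis
      proof (rule ccontr)
        assume "\<not> 1 \<le> target y / covered y"
        then have "covered y * (target y / covered y) \<le> covered y * 1" by (intro mult_left_mono) auto
        then show False using False times_divide_self_ennreal[OF nz covered_fin, of "target y"] by simp
      qed
    qed
    then have "ennreal (thinning y) = 1" unfolding e by (simp add: min_absorb1)
    then show ?thesis using c using covered_fin[of y] by (auto simp: uncovered_def ennreal_minus_le_iff)
  qed
qed

lemma kap_eq: "4 * real CARD('d) / real L = kap"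
  by (simp add: kap_def d_eq[symmetric])

lemma A_split: "A x = kap * inB f1 x + kap * inB f2 x"
  by (simp add: A_def inB_def algebra_simps)

lemma in_out: "ennreal (kap * h x) = ennreal (kap * inB h x) + ennreal (kap * outB h x)" if "0 \<le> h x"
  using that by (simp add: inB_def outB_def indicator_def)

lemma in_out_nonneg: "0 \<le> h x \<Longrightarrow> 0 \<le> inB h x" "0 \<le> h x \<Longrightarrow> 0 \<le> outB h x"
  by (auto simp: inB_def outB_def)

text \<open>The range \<open>L / 2\<close> doubles the factor in front of the density and the weight
  1/2 cancels this. So the law splits into walkers with density \<open>kap * h\<close>, the
  \<open>Early\<close> ones, and their positions after \<open>Hf\<close> steps, the
  \<open>Late\<close> ones.\<close>

lemma half_mass:
  fixes h :: "int ^ 'd \<Rightarrow> real"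
  assumes h: "\<And>x. 0 \<le> h x"
  shows "hit_mass (\<lambda>x. 1/2 * (h x + walk_op Hf h x)) Hf S =
    (\<integral>\<^sup>+x. ennreal (kap * h x) * hit Hf S x \<partial>count_space UNIV) +
    (\<integral>\<^sup>+x. (\<integral>\<^sup>+y. ennreal (kap * h y) * ennreal (hk Hf (x - y)) \<partial>count_space UNIV) * hit Hf S x \<partial>count_space UNIV)"
proof -
  have "ennreal (4 * real CARD('d) / real Hf * (1/2 * (h x + walk_op Hf h x)))
      = ennreal (kap * h x) + (\<integral>\<^sup>+y. ennreal (kap * h y) * ennreal (hk Hf (x - y)) \<partial>count_space UNIV)" for x
  proof -
    have "4 * real CARD('d) / real Hf * (1/2 * (h x + walk_op Hf h x)) = kap * h x + kap * walk_op Hf h x"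
      unfolding L_eq(2) kap_eq[symmetric] using L_pos by (simp add: field_simps)
    then have "ennreal (4 * real CARD('d) / real Hf * (1/2 * (h x + walk_op Hf h x))) = ennreal (kap * h x) + ennreal kap * ennreal (walk_op Hf h x)"
      using h kap_pos walk_op_nonneg[of h, OF h] by (simp add: ennreal_plus ennreal_mult)
    also have "ennreal kap * ennreal (walk_op Hf h x) = (\<integral>\<^sup>+y. ennreal (kap * h y) * ennreal (hk Hf (x - y)) \<partial>count_space UNIV)"
      unfolding ennreal_walk_op[of h, OF h] using h kap_pos
      by (subst nn_integral_cmult[symmetric]) (auto simp: ennreal_mult mult.assoc)
    finally show ?thesis .
  qed
  then show ?thesis unfolding hit_mass_def by (simp add: distrib_right nn_integral_add)
qed

lemma half_mass_split:
  fixes h :: "int ^ 'd \<Rightarrow> real"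
  assumes h: "\<And>x. 0 \<le> h x"
  shows "hit_mass (\<lambda>x. 1/2 * (h x + walk_op Hf h x)) Hf S =
    hit_mass (\<lambda>x. 1/2 * (inB h x + walk_op Hf (inB h) x)) Hf S + hit_mass (\<lambda>x. 1/2 * (outB h x + walk_op Hf (outB h) x)) Hf S"
  proof -
  let ?u = "\<lambda>h x. \<integral>\<^sup>+y. ennreal (kap * h y) * ennreal (hk Hf (x - y)) \<partial>count_space UNIV"
  have 1: "(\<integral>\<^sup>+x. ennreal (kap * h x) * hit Hf S x \<partial>count_space UNIV) =
     (\<integral>\<^sup>+x. ennreal (kap * inB h x) * hit Hf S x \<partial>count_space UNIV) + (\<integral>\<^sup>+x. ennreal (kap * outB h x) * hit Hf S x \<partial>count_space UNIV)"
    unfolding in_out[of h, OF h] by (simp add: distrib_right nn_integral_add)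
  have "?u h x = ?u (inB h) x + ?u (outB h) x" for x
    unfolding in_out[of h, OF h] by (simp add: distrib_right nn_integral_add)
  then have 2: "(\<integral>\<^sup>+x. ?u h x * hit Hf S x \<partial>count_space UNIV) =
     (\<integral>\<^sup>+x. ?u (inB h) x * hit Hf S x \<partial>count_space UNIV) + (\<integral>\<^sup>+x. ?u (outB h) x * hit Hf S x \<partial>count_space UNIV)"
    by (simp add: distrib_right nn_integral_add)
  show ?thesis
    unfolding half_mass[OF h] half_mass[of "inB h", OF in_out_nonneg(1)[of h, OF h]] half_mass[of "outB h", OF in_out_nonneg(2)[of h, OF h]] 1 2
    by (simp only: add_ac)
qed

lemma full_mass_split:
  fixes h :: "int ^ 'd \<Rightarrow> real"
  assumes h: "\<And>x. 0 \<le> h x"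
  shows "hit_mass h L S = hit_mass (inB h) L S + hit_mass (outB h) L S"
proof -
  show ?thesis unfolding hit_mass_def kap_eq by (simp add: in_out[of h, OF h] distrib_right nn_integral_add)
qed

text \<open>The prefactor of \<open>walk_avg\<close> turns \<open>4 * d / L1\<close> into
  \<open>kap\<close>, so the target is the sum of the densities \<open>T (i * L1)\<close>, one for
  each slot.\<close>

lemma target_mass: assumes q: "0 \<le> keep"
  shows "hit_mass (\<lambda>x. keep * walk_avg L L1 (\<lambda>y. (f1 y + f2 y) * indicator (lattice_ball 0 K) y) x) L1 S = (\<integral>\<^sup>+x. target x * hit L1 S x \<partial>count_space UNIV)"
proof -
  have fK: "0 \<le> fK x" for x using f1[of x] f2[of x] by (simp add: fK_def)
  have f: "(\<lambda>y. (f1 y + f2 y) * indicator (lattice_ball 0 K) y) = fK" by (simp add: fun_eq_iff fK_def)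
  have kw: "ennreal (kap * walk_op n fK x) = T n x" for n x
  proof -
    have "ennreal (kap * walk_op n fK x) = ennreal kap * ennreal (walk_op n fK x)"
      using kap_pos walk_op_nonneg[of fK, OF fK] by (intro ennreal_mult) auto
    also have "\<dots> = T n x"
      unfolding er_def ennreal_walk_op[of fK, OF fK] using fK kap_pos
      by (subst nn_integral_cmult[symmetric]) (auto intro!: nn_integral_cong simp: ennreal_mult mult.assoc F_def fK_def)
    finally show ?thesis .
  qed
  have "ennreal (4 * real CARD('d) / real L1 * (keep * walk_avg L L1 fK x)) = target x" for x
  proof -
    have LN: "L div L1 = N" unfolding L_eq(3) using L1 by simp
    have "(\<Sum>k=1..N. walk_op ((k - 1) * L1) fK x) = (\<Sum>i<N. walk_op (i * L1) fK x)"
      by (rule sum.reindex_bij_witness[where i = Suc and j = "\<lambda>k. k - 1"]) auto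
    then have "4 * real CARD('d) / real L1 * (keep * walk_avg L L1 fK x) = keep * (\<Sum>i<N. kap * walk_op (i * L1) fK x)"
      unfolding walk_avg_def LN sum_distrib_left[symmetric] kap_eq[symmetric] using L1 L_pos by simp
    also have "ennreal \<dots> = ennreal keep * (\<Sum>i<N. ennreal (kap * walk_op (i * L1) fK x))"
    proof -
      have nn: "0 \<le> kap * walk_op (i * L1) fK x" for i using kap_pos walk_op_nonneg[of fK, OF fK] by simp
      then have "(\<Sum>i<N. ennreal (kap * walk_op (i * L1) fK x)) = ennreal (\<Sum>i<N. kap * walk_op (i * L1) fK x)" by (intro sum_ennreal) auto
      then show ?thesis using q nn by (simp only: ennreal_mult sum_nonneg)
    qed
    finally show ?thesis unfolding kw target_def .
  qed
  then show ?thesis unfolding hit_mass_def f by simp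
qed

lemma A_int: "(\<integral>\<^sup>+x. ennreal (A x) \<partial>count_space UNIV) < \<infinity>" "0 < (\<integral>\<^sup>+x. ennreal (A x) \<partial>count_space UNIV)"
proof -
  have "(\<integral>\<^sup>+x. ennreal (A x) \<partial>count_space UNIV) = (\<integral>\<^sup>+x\<in>lattice_ball 0 (K + L). ennreal (A x) \<partial>count_space UNIV)"
    by (intro nn_integral_cong) (auto simp: A_def indicator_def)
  also have "\<dots> = (\<Sum>x\<in>lattice_ball 0 (K + L). ennreal (A x))"
    by (subst nn_integral_count_space_indicator[symmetric]) (auto simp: nn_integral_count_space_finite finite_lattice_ball)
  also have "\<dots> < \<infinity>" by (intro sum_less_top_ennreal finite_lattice_ball) simp
  finally show "(\<integral>\<^sup>+x. ennreal (A x) \<partial>count_space UNIV) < \<infinity>" .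
  have z: "(0 :: int ^ 'd) \<in> lattice_ball 0 (K + L)" "(0 :: int ^ 'd) \<in> lattice_ball 0 (K + 2 * M * L1)" by (simp_all add: mem_lattice_ball)
  have "0 < real (2 * M * L1) powr (- 1/4)" using L_pos by (simp only: L_def[symmetric]) simp
  then have "0 < f1 0 + f2 0" using fb[OF z(2)] by linarith
  then have "0 < A 0" using z(1) kap_pos by (simp add: A_def)
  then have "0 < (\<integral>\<^sup>+x. ennreal (A 0) * indicator {0} x \<partial>count_space (UNIV :: (int ^ 'd) set))"
    by (simp add: nn_integral_cmult_indicator)
  also have "\<dots> \<le> (\<integral>\<^sup>+x. ennreal (A x) \<partial>count_space UNIV)" by (intro nn_integral_mono) (auto simp: indicator_def)
  finally show "0 < (\<integral>\<^sup>+x. ennreal (A x) \<partial>count_space UNIV)" .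
qed

lemma coupling_data: "coupling_data (\<lambda>x. kap * inB f1 x) (\<lambda>x. kap * inB f2 x) Hf L1 g (M - 2) (2 * M - 3) s cellof C qm thinning eta"
proof
  show "0 \<le> kap * inB f1 x" "0 \<le> kap * inB f2 x" for x
    using kap_pos in_out_nonneg(1)[of f1 x] in_out_nonneg(1)[of f2 x] f1[of x] f2[of x] by simp_all
  show "(\<integral>\<^sup>+x. ennreal (kap * inB f1 x + kap * inB f2 x) \<partial>count_space UNIV) < \<infinity>"
    and "0 < (\<integral>\<^sup>+x. ennreal (kap * inB f1 x + kap * inB f2 x) \<partial>count_space UNIV)"
    using A_int unfolding A_split by simp_all
  show "s 0 = L1" "L1 \<le> Hf" by (rule s0)+
  show "s k + g + L1 \<le> s (Suc k)" if "k < 2 * M - 3" for k by (rule step[OF that])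
  show "s (Suc k) \<le> Hf" if "k < 2 * M - 3" "k < M - 2" for k by (rule early[OF that])
  show "Hf \<le> s k" if "k < 2 * M - 3" "M - 2 \<le> k" for k by (rule late[OF that])
  show "finite C" by (rule finite_C)
  show "C \<subseteq> range cellof" by (auto simp: C_def)
  show "0 \<le> qm c y" for c y by (rule qm_nonneg)
  show "qm c y \<le> hk g (y - z)" if "c \<in> C" "cellof z = c" for c z y by (rule qm_le[OF that(2)])
  show "0 < (\<integral>\<^sup>+y. ennreal (qm c y) \<partial>count_space UNIV)" if "c \<in> C" for c
    using qm_mass[OF that] by (rule less_le_trans[rotated]) (subst ennreal_less_zero_iff, simp)
  show "0 \<le> thinning y" "thinning y \<le> 1" for y by (rule thinning_bounds)+
  show "0 \<le> eta" "eta < 1" using eta_bounds by auto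
  show "0 < (\<integral>\<^sup>+z. indicator {z. cellof z = c} z * (\<integral>\<^sup>+x. ennreal (kap * inB f1 x + kap * inB f2 x) * ennreal (hk (s k) (z - x)) \<partial>count_space UNIV) \<partial>count_space UNIV)"
    if "k < 2 * M - 3" "c \<in> C" for k c
  proof -
    have "0 < ennreal (24 * (real N)\<^sup>2)" using N_bounds(3) by simp
    then have "0 < cmass k c" using cmass_ge[OF that] by (rule less_le_trans)
    then show ?thesis unfolding cmass_def A_split .
  qed
qed

sublocale walkers: coupling_data "\<lambda>x. kap * inB f1 x" "\<lambda>x. kap * inB f2 x" Hf L1 g "M - 2" "2 * M - 3" s cellof C qm thinning eta
  by (rule coupling_data)

lemma walkers_cm: "walkers.cm k c = cmass k c"
  unfolding walkers.cm_def walkers.occ_def cmass_def A_split ..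

lemma walkers_total: "walkers.total y = covered y"
  unfolding walkers.total_def covered_def stage_def walkers_cm A_split
  by (simp add: sum_distrib_left mult.assoc)

text \<open>The mean number of successful coins is at least \<open>24 * N ^ 2 / 2\<close>, and
  \<open>eta ^ 2 / 6\<close> is \<open>1 / (6 * N)\<close>, so the Chernoff exponent is at most
  \<open>- 2 * N\<close>.\<close>

lemma miss_term:
  assumes k: "k < 2 * M - 3" and c: "c \<in> C"
  shows "ennreal (exp (walkers.lam k c * (exp (eta / 3) - 1))) * exp_neg (walkers.cm k c * ennreal (walkers.qa c * (1 - exp (- (eta / 3))))) \<le> ennreal (exp (- (2 * real N)))"
proof -
  obtain r where r: "cmass k c = ennreal r" "0 \<le> r" using cmass_finite[of k c] by (cases "cmass k c") auto
  have r24: "24 * (real N)\<^sup>2 \<le> r" using cmass_ge[OF k c] r by simp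
  have "ennreal (1/2) \<le> ennreal (walkers.qa c)" using qm_mass[OF c] walkers.qa(1)[OF c] by simp
  then have qa: "1/2 \<le> walkers.qa c" using walkers.qa(2)[OF c] by (simp only: ennreal_le_iff less_imp_le)
  let ?p = "1 - exp (- (eta / 3))"
  have p0: "0 \<le> ?p" using eta_bounds(1) by simp
  have ch: "(1 - eta) * (exp (eta / 3) - 1) - ?p \<le> - (eta\<^sup>2 / 6)"
    using eta_bounds by (intro chernoff_exponent) auto
  have "12 * (real N)\<^sup>2 \<le> r * walkers.qa c"
  proof -
    have "24 * (real N)\<^sup>2 * (1/2) \<le> r * walkers.qa c" using r24 qa r by (intro mult_mono) auto
    then show ?thesis by simp
  qed
  then have "12 * (real N)\<^sup>2 * (eta\<^sup>2 / 6) \<le> r * walkers.qa c * (eta\<^sup>2 / 6)" by (intro mult_right_mono) auto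
  moreover have "12 * (real N)\<^sup>2 * (eta\<^sup>2 / 6) = 2 * real N" unfolding eta_bounds(4) using N_bounds(3) by (simp add: power2_eq_square)
  moreover have "r * walkers.qa c * ((1 - eta) * (exp (eta / 3) - 1) - ?p) \<le> r * walkers.qa c * (- (eta\<^sup>2 / 6))"
    using ch r qa by (intro mult_left_mono) auto
  ultimately have e: "r * walkers.qa c * ((1 - eta) * (exp (eta / 3) - 1) - ?p) \<le> - (2 * real N)" by simp
  have "walkers.cm k c * ennreal (walkers.qa c * ?p) = ennreal (r * (walkers.qa c * ?p))"
    unfolding walkers_cm r(1) using r(2) qa p0 by (subst ennreal_mult) auto
  then have "exp_neg (walkers.cm k c * ennreal (walkers.qa c * ?p)) = ennreal (exp (- (r * (walkers.qa c * ?p))))"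
    using r(2) qa p0 by (simp only:) (intro exp_neg_ennreal mult_nonneg_nonneg, auto)
  moreover have "walkers.lam k c = (1 - eta) * r * walkers.qa c" unfolding walkers.lam_def walkers_cm r(1) using r(2) by simp
  ultimately have "ennreal (exp (walkers.lam k c * (exp (eta / 3) - 1))) * exp_neg (walkers.cm k c * ennreal (walkers.qa c * ?p))
     = ennreal (exp ((1 - eta) * r * walkers.qa c * (exp (eta / 3) - 1))) * ennreal (exp (- (r * (walkers.qa c * ?p))))" by (simp only:)
  also have "\<dots> = ennreal (exp ((1 - eta) * r * walkers.qa c * (exp (eta / 3) - 1) + - (r * (walkers.qa c * ?p))))"
    by (simp add: ennreal_mult[symmetric] exp_add[symmetric])
  also have "(1 - eta) * r * walkers.qa c * (exp (eta / 3) - 1) + - (r * (walkers.qa c * ?p)) = r * walkers.qa c * ((1 - eta) * (exp (eta / 3) - 1) - ?p)"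
    by (simp add: algebra_simps)
  also have "ennreal (exp \<dots>) \<le> ennreal (exp (- (2 * real N)))" using e by (intro ennreal_leI) simp
  finally show ?thesis .
qed

text \<open>Half of the exponent \<open>2 * N\<close> absorbs the number of stages; the number of
  cells remains as the polynomial factor.\<close>

lemma miss_total:
  "(\<integral>\<^sup>+z. indicator {z. \<not> snd z \<subseteq> (\<Union>x\<in>set (fst z). fst x)} z \<partial>walkers.sys.system (2 * M - 3)) \<le> ennreal ((3 * real (K + L)) ^ CARD('d) * exp (- real N))"
proof -
  have "(\<integral>\<^sup>+z. indicator {z. \<not> snd z \<subseteq> (\<Union>x\<in>set (fst z). fst x)} z \<partial>walkers.sys.system (2 * M - 3))
     \<le> (\<Sum>k<2 * M - 3. \<Sum>c\<in>C. ennreal (exp (- (2 * real N))))"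
    using eta_bounds(1) by (intro order_trans[OF walkers.miss_bound[of "eta / 3"]] sum_mono miss_term) auto
  also have "\<dots> = ennreal (real (2 * M - 3) * (real (card C) * exp (- (2 * real N))))"
    by (simp add: ennreal_of_nat_eq_real_of_nat ennreal_mult)
  also have "\<dots> \<le> ennreal (real N * ((3 * real (K + L)) ^ CARD('d) * exp (- (2 * real N))))"
    using card_C by (intro ennreal_leI mult_mono mult_right_mono) (auto simp: N_def)
  also have "\<dots> \<le> ennreal ((3 * real (K + L)) ^ CARD('d) * exp (- real N))"
  proof (rule ennreal_leI)
    have "real N \<le> exp (real N)" using exp_ge_add_one_self[of "real N"] by linarith
    then have "real N * exp (- (2 * real N)) \<le> exp (real N) * exp (- (2 * real N))" by (intro mult_right_mono) auto
    also have "\<dots> = exp (- real N)" by (simp flip: exp_add)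
    finally have "(3 * real (K + L)) ^ CARD('d) * (real N * exp (- (2 * real N))) \<le> (3 * real (K + L)) ^ CARD('d) * exp (- real N)"
      by (intro mult_left_mono) auto
    then show "real N * ((3 * real (K + L)) ^ CARD('d) * exp (- (2 * real N))) \<le> (3 * real (K + L)) ^ CARD('d) * exp (- real N)"
      by (simp only: mult_ac)
  qed
  finally show ?thesis .
qed

end

section \<open>Assembling the coupling\<close>

lemma coupling_measure:
  assumes Q: "prob_space Q" and e: "ennreal 1 \<le> emeasure Q X + x + y" and x: "x \<le> ennreal a" "0 \<le> a" and y: "y \<le> ennreal b" "0 \<le> b"
  shows "1 - (a + b) \<le> measure Q X"
proof -
  interpret prob_space Q by fact
  have "ennreal 1 \<le> ennreal (measure Q X) + ennreal a + ennreal b"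
    using e x(1) y(1) by (simp only: emeasure_eq_measure) (meson add_mono order_refl order_trans)
  also have "\<dots> = ennreal (measure Q X + a + b)" using x(2) y(2) by (simp add: ennreal_plus)
  finally have "1 \<le> measure Q X + a + b" using x(2) y(2) by (subst (asm) ennreal_le_iff) auto
  then show ?thesis by linarith
qed

lemma emeasure_map_pmf_set: "emeasure (map_pmf f p) {z. P z} = (\<integral>\<^sup>+z. indicator {z. P (f z)} z \<partial>p)"
  by (simp add: vimage_def)

context schedule
begin

lemma remainder_mass: assumes q: "0 \<le> keep"
  shows "hit_mass (\<lambda>x. real L1 / (4 * real CARD('d)) * enn2real (uncovered x)) L1 S = (\<integral>\<^sup>+x. uncovered x * hit L1 S x \<partial>count_space UNIV)"
proof -
  have "ennreal (4 * real CARD('d) / real L1 * (real L1 / (4 * real CARD('d)) * enn2real (uncovered x))) = uncovered x" for x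
  proof -
    have "uncovered x \<le> target x" unfolding uncovered_def by (rule diff_le_self_ennreal)
    then have "uncovered x < \<infinity>" using target_fin[of x] by (rule le_less_trans)
    moreover have "4 * real CARD('d) / real L1 * (real L1 / (4 * real CARD('d)) * r) = r" for r using L1 by simp
    ultimately show ?thesis by simp
  qed
  then show ?thesis unfolding hit_mass_def by simp
qed

lemma schedule_coupling:
  assumes q: "0 \<le> keep"
  shows "\<exists>\<mu>1 \<mu>1' \<mu>2 Q. interlacement_law (\<lambda>x. 1/2 * (f1 x + walk_op Hf f1 x)) Hf \<mu>1 \<and> interlacement_law f2 L \<mu>1' \<and>
    interlacement_law (\<lambda>x. keep * walk_avg L L1 (\<lambda>y. (f1 y + f2 y) * indicator (lattice_ball 0 K) y) x) L1 \<mu>2 \<and>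
    coupling Q (independent_union \<mu>1 \<mu>1') \<mu>2 \<and>
    1 - ((3 * real (K + L)) ^ CARD('d) * exp (- real N) + 4 * d * (6 * d + 3 * d * win_const TYPE('d)) * u * (2 * real K + 1) ^ CARD('d) * tau)
      \<le> measure Q {\<omega>\<in>space Q. fst \<omega> \<supseteq> snd \<omega>}"
proof -
  let ?n = "2 * M - 3"
  have H1: "1 \<le> Hf" using s0(2) L1 by linarith
  have L1': "1 \<le> L" using L_pos by simp
  obtain \<mu>1 where m1: "interlacement_law (\<lambda>x. 1/2 * (f1 x + walk_op Hf f1 x)) Hf \<mu>1" "random_set_law \<mu>1"
    "\<And>S. void \<mu>1 S = exp_neg (hit_mass (\<lambda>x. 1/2 * (f1 x + walk_op Hf f1 x)) Hf S)"
    using interlacement_void[OF H1, of "\<lambda>x. 1/2 * (f1 x + walk_op Hf f1 x)"] by auto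
  obtain \<mu>1' where m1': "interlacement_law f2 L \<mu>1'" "random_set_law \<mu>1'" "\<And>S. void \<mu>1' S = exp_neg (hit_mass f2 L S)"
    using interlacement_void[OF L1', of f2] by auto
  let ?f = "\<lambda>x. keep * walk_avg L L1 (\<lambda>y. (f1 y + f2 y) * indicator (lattice_ball 0 K) y) x"
  obtain \<mu>2 where m2: "interlacement_law ?f L1 \<mu>2" "random_set_law \<mu>2" "\<And>S. void \<mu>2 S = exp_neg (hit_mass ?f L1 S)"
    using interlacement_void[OF L1, of ?f] by auto
  \<comment> \<open>The laws \<open>\<rho>1\<close> and \<open>\<rho>2\<close> belong to the walkers
    released outside the ball; they complete the first set.\<close>
  obtain \<rho>1 where r1: "random_set_law \<rho>1"
    "\<And>S. void \<rho>1 S = exp_neg (hit_mass (\<lambda>x. 1/2 * (outB f1 x + walk_op Hf (outB f1) x)) Hf S)"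
    using interlacement_void[OF H1, of "\<lambda>x. 1/2 * (outB f1 x + walk_op Hf (outB f1) x)"] by auto
  obtain \<rho>2 where r2: "random_set_law \<rho>2" "\<And>S. void \<rho>2 S = exp_neg (hit_mass (outB f2) L S)"
    using interlacement_void[OF L1', of "outB f2"] by auto
  let ?r = "\<lambda>x. real L1 / (4 * real CARD('d)) * enn2real (uncovered x)"
  \<comment> \<open>This independent set supplies the uncovered part of the target. Inclusion is
    claimed only when it is empty.\<close>
  obtain \<mu>m where mm: "random_set_law \<mu>m" "\<And>S. void \<mu>m S = exp_neg (hit_mass ?r L1 S)"
    using interlacement_void[OF L1, of ?r] by auto
  define Z where "Z = map_pmf (\<lambda>z. (\<Union>x\<in>set (fst z). fst x, snd z)) (walkers.sys.system ?n)"
  have el: "walkers.el Full ?n = L" "walkers.el Early ?n = Hf" "walkers.el Late ?n = Hf"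
    using L_eq(4) by (simp_all add: walkers.el_def s_end)
  have src: "(\<integral>\<^sup>+z. avoid S (fst z) \<partial>Z) = exp_neg (hit_mass (inB f2) L S + hit_mass (\<lambda>x. 1/2 * (inB f1 x + walk_op Hf (inB f1) x)) Hf S)" for S
  proof -
    have "(\<integral>\<^sup>+z. avoid S (fst z) \<partial>Z) = (\<integral>\<^sup>+z. avoid S (\<Union>x\<in>set (fst z). fst x) \<partial>walkers.sys.system ?n)"
      unfolding Z_def by simp
    also have "\<dots> = exp_neg ((\<integral>\<^sup>+x. ennreal (kap * inB f2 x) * hit L S x \<partial>count_space UNIV) +
      (\<integral>\<^sup>+x. ennreal (kap * inB f1 x) * hit Hf S x \<partial>count_space UNIV) +
      (\<integral>\<^sup>+x. (\<integral>\<^sup>+y. ennreal (kap * inB f1 y) * ennreal (hk Hf (x - y)) \<partial>count_space UNIV) * hit Hf S x \<partial>count_space UNIV))"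
      unfolding walkers.source_void el walkers.wt_Late ..
    also have "\<dots> = exp_neg (hit_mass (inB f2) L S + hit_mass (\<lambda>x. 1/2 * (inB f1 x + walk_op Hf (inB f1) x)) Hf S)"
      unfolding half_mass[of "inB f1", OF in_out_nonneg(1)[of f1, OF f1]] unfolding hit_mass_def kap_eq by (simp only: add.assoc)
    finally show ?thesis .
  qed
  have v1: "void (independent_union \<mu>1 \<mu>1') S = (\<integral>\<^sup>+z. avoid S (fst z) \<partial>Z) * void (independent_union \<rho>1 \<rho>2) S" for S
    unfolding src independent_union_law(2)[OF m1(2) m1'(2)] independent_union_law(2)[OF r1(1) r2(1)] m1(3) m1'(3) r1(2) r2(2)
      half_mass_split[of f1, OF f1] full_mass_split[of f2, OF f2] exp_neg_add
    by (simp only: mult_ac)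
  have v2: "void \<mu>2 S = (\<integral>\<^sup>+z. avoid S (snd z) \<partial>Z) * void \<mu>m S" for S
  proof -
    have "(\<integral>\<^sup>+z. avoid S (snd z) \<partial>Z) = (\<integral>\<^sup>+z. avoid S (snd z) \<partial>walkers.sys.system ?n)" unfolding Z_def by simp
    also have "\<dots> = exp_neg (\<integral>\<^sup>+y. covered y * (ennreal (thinning y) * hit L1 S y) \<partial>count_space UNIV)"
      unfolding walkers.target_void walkers_total ..
    finally have "(\<integral>\<^sup>+z. avoid S (snd z) \<partial>Z) * void \<mu>m S =
      exp_neg ((\<integral>\<^sup>+y. covered y * (ennreal (thinning y) * hit L1 S y) \<partial>count_space UNIV) + (\<integral>\<^sup>+y. uncovered y * hit L1 S y \<partial>count_space UNIV))"
      unfolding mm(2) remainder_mass[OF q] exp_neg_add by simp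
    also have "(\<integral>\<^sup>+y. covered y * (ennreal (thinning y) * hit L1 S y) \<partial>count_space UNIV) + (\<integral>\<^sup>+y. uncovered y * hit L1 S y \<partial>count_space UNIV)
      = (\<integral>\<^sup>+y. target y * hit L1 S y \<partial>count_space UNIV)"
      unfolding split_target(1)[OF q, symmetric] by (subst nn_integral_add[symmetric]) (auto simp: distrib_right mult.assoc)
    finally show ?thesis unfolding m2(3) target_mass[OF q] by simp
  qed
  obtain Q where Q: "coupling Q (independent_union \<mu>1 \<mu>1') \<mu>2"
    "ennreal 1 \<le> emeasure Q {\<omega>\<in>space Q. fst \<omega> \<supseteq> snd \<omega>} + emeasure Z {z. \<not> snd z \<subseteq> fst z} + emeasure \<mu>m {S. S \<noteq> {}}"
    using coupling_of_pmf[OF independent_union_law(1)[OF r1(1) r2(1)] mm(1) independent_union_law(1)[OF m1(2) m1'(2)] m2(2) v1 v2] by blast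
  have z: "emeasure Z {z. \<not> snd z \<subseteq> fst z} \<le> ennreal ((3 * real (K + L)) ^ CARD('d) * exp (- real N))"
    unfolding Z_def emeasure_map_pmf_set fst_conv snd_conv by (rule miss_total)
  have m: "emeasure \<mu>m {S. S \<noteq> {}} \<le> ennreal (4 * d * (6 * d + 3 * d * win_const TYPE('d)) * u * (2 * real K + 1) ^ CARD('d) * tau)"
  proof -
    have "emeasure \<mu>m {S. S \<noteq> {}} \<le> hit_mass ?r L1 UNIV" by (rule nonempty_le[OF mm(1) mm(2)])
    also have "\<dots> \<le> (\<integral>\<^sup>+x. E x \<partial>count_space UNIV)"
      unfolding remainder_mass[OF q]
    proof (rule nn_integral_mono)
      fix x
      have "uncovered x * hit L1 UNIV x \<le> uncovered x * 1" by (intro mult_left_mono hit_le_1) simp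
      then show "uncovered x * hit L1 UNIV x \<le> E x" using split_target(2)[OF q, of x] by simp
    qed
    also have "\<dots> \<le> ennreal (4 * d * (6 * d + 3 * d * win_const TYPE('d)) * u * (2 * real K + 1) ^ CARD('d) * tau)"
      by (rule E_mass_le)
    finally show ?thesis .
  qed
  have nn: "0 \<le> 4 * d * (6 * d + 3 * d * win_const TYPE('d)) * u * (2 * real K + 1) ^ CARD('d) * tau"
    using d u tau_bounds(4) win_const_pos by simp
  have "prob_space Q" using Q(1) by (simp add: coupling_def)
  from coupling_measure[OF this Q(2) z _ m nn] m1(1) m1'(1) m2(1) Q(1) show ?thesis
    by (intro exI[of _ \<mu>1] exI[of _ \<mu>1'] exI[of _ \<mu>2] exI[of _ Q]) auto
qed

end

lemma walk_avg_nonneg: "(\<And>x. 0 \<le> f x) \<Longrightarrow> 0 \<le> walk_avg L L' f x"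
  unfolding walk_avg_def by (intro mult_nonneg_nonneg sum_nonneg walk_op_nonneg) auto

text \<open>No trajectory meets the labels of a nonpositive density, so the second set is almost
  surely empty and any coupling contains it.\<close>

lemma trivial_coupling:
  fixes f1 f2 f :: "int ^ 'd::finite \<Rightarrow> real"
  assumes H: "1 \<le> H" and L: "1 \<le> L" and L': "1 \<le> L'" and f: "\<And>x. f x \<le> 0"
  shows "\<exists>\<mu>1 \<mu>1' \<mu>2 Q. interlacement_law f1 H \<mu>1 \<and> interlacement_law f2 L \<mu>1' \<and> interlacement_law f L' \<mu>2 \<and>
    coupling Q (independent_union \<mu>1 \<mu>1') \<mu>2 \<and> 1 \<le> measure Q {\<omega>\<in>space Q. fst \<omega> \<supseteq> snd \<omega>}"
proof -
  obtain \<mu>1 where m1: "interlacement_law f1 H \<mu>1" "random_set_law \<mu>1" using interlacement_void[OF H, of f1] by auto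
  obtain \<mu>1' where m1': "interlacement_law f2 L \<mu>1'" "random_set_law \<mu>1'" using interlacement_void[OF L, of f2] by auto
  obtain \<mu>2 where m2: "interlacement_law f L' \<mu>2" "random_set_law \<mu>2" "\<And>S. void \<mu>2 S = exp_neg (hit_mass f L' S)"
    using interlacement_void[OF L', of f] by auto
  have "ennreal (4 * real CARD('d) / real L' * f x) = 0" for x
    using f[of x] by (intro ennreal_neg mult_nonneg_nonpos) auto
  then have h: "hit_mass f L' S = 0" for S unfolding hit_mass_def by simp
  let ?Z = "return_pmf ({}, {}) :: ((int ^ 'd) set \<times> (int ^ 'd) set) pmf"
  have v: "void \<mu> S = (\<integral>\<^sup>+z. avoid S (fst z) \<partial>?Z) * void \<mu> S" "void \<mu> S = (\<integral>\<^sup>+z. avoid S (snd z) \<partial>?Z) * void \<mu> S"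
    for \<mu> :: "(int ^ 'd) set measure" and S by (simp_all add: avoid_def)
  note iu = independent_union_law(1)[OF m1(2) m1'(2)]
  obtain Q where Q: "coupling Q (independent_union \<mu>1 \<mu>1') \<mu>2"
    "ennreal 1 \<le> emeasure Q {\<omega>\<in>space Q. fst \<omega> \<supseteq> snd \<omega>} + emeasure ?Z {z. \<not> snd z \<subseteq> fst z} + emeasure \<mu>2 {S. S \<noteq> {}}"
    using coupling_of_pmf[OF iu m2(2) iu m2(2) v(1) v(2)] by blast
  have "emeasure \<mu>2 {S. S \<noteq> {}} \<le> 0" by (rule nonempty_le[OF m2(2)]) (simp add: m2(3) h)
  then have "emeasure \<mu>2 {S. S \<noteq> {}} \<le> ennreal 0" by simp
  moreover have "emeasure ?Z {z. \<not> snd z \<subseteq> fst z} \<le> ennreal 0" by simp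
  moreover have "prob_space Q" using Q(1) by (simp add: coupling_def)
  ultimately have "1 - (0 + 0) \<le> measure Q {\<omega>\<in>space Q. fst \<omega> \<supseteq> snd \<omega>}" using Q(2) by (intro coupling_measure) auto
  then show ?thesis using m1(1) m1'(1) m2(1) Q(1) by auto
qed

text \<open>The condition says that \<open>L / L1\<close> is at most the \<open>D\<close>-th root of
  \<open>L\<close>; so the constant \<open>c = 1 / D\<close> provides the power of \<open>N\<close>
  below \<open>L\<close> that the cells need.\<close>

lemma scale_bounds:
  fixes L L1 M D :: nat
  assumes L: "L = 2 * M * L1" "1 \<le> L" and D: "0 < D"
    and h: "real L powr (1 - 1 / real D) \<le> real L1"
  shows "(2 * M) ^ D \<le> L"
proof -
  have L_pos: "0 < real L" using L(2) by simp
  have "real L = real (2 * M) * real L1" using L(1) by simp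
  moreover have "real (2 * M) * real L powr (1 - 1 / real D) \<le> real (2 * M) * real L1" using h by (intro mult_left_mono) auto
  ultimately have "real (2 * M) * real L powr (1 - 1 / real D) \<le> real L" by simp
  also have "real L = real L powr (1 / real D) * real L powr (1 - 1 / real D)" using L_pos by (simp flip: powr_add)
  finally have "real (2 * M) \<le> real L powr (1 / real D)" using L_pos by simp
  then have "real (2 * M) ^ D \<le> (real L powr (1 / real D)) ^ D" by (intro power_mono) auto
  also have "\<dots> = real L" using L_pos D by (simp add: powr_power)
  finally have "real ((2 * M) ^ D) \<le> real L" by simp
  then show ?thesis by (simp only: of_nat_le_iff)
qed

theorem theorem4p1:
  assumes "CARD('d::finite) \<ge> 3"
  shows "\<exists>c c' c'' C C' :: real. c > 0 \<and> c' > 0 \<and> c'' > 0 \<and> C > 0 \<and> C' > 0 \<and>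
    (\<forall>(u::real) (K::nat) (L::nat) (L'::nat) (f\<^sub>1 :: int ^ 'd \<Rightarrow> real) (f\<^sub>2 :: int ^ 'd \<Rightarrow> real) f.
       u > 0 \<longrightarrow> L \<ge> 1 \<longrightarrow> L' \<ge> 1 \<longrightarrow>
       even L \<longrightarrow> L' dvd L div 2 \<longrightarrow> real L' \<ge> real L powr (1 - c) \<longrightarrow>
       (\<forall>x. f\<^sub>1 x \<ge> 0) \<longrightarrow> (\<forall>x. f\<^sub>2 x \<ge> 0) \<longrightarrow> f = (\<lambda>x. f\<^sub>1 x + f\<^sub>2 x) \<longrightarrow>
       (\<forall>x\<in>lattice_ball 0 (K + L). u \<ge> f x \<and> f x \<ge> C * real L powr (- c')) \<longrightarrow>
       (\<exists>\<mu>\<^sub>1 \<mu>\<^sub>1' \<mu>\<^sub>2 Q.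
          interlacement_law (\<lambda>x. 1/2 * (f\<^sub>1 x + walk_op (L div 2) f\<^sub>1 x)) (L div 2) \<mu>\<^sub>1 \<and>
          interlacement_law f\<^sub>2 L \<mu>\<^sub>1' \<and>
          interlacement_law
            (\<lambda>x. (1 - C' * (real L / real L') powr (- 1/2)) *
                 walk_avg L L' (\<lambda>y. f y * indicator (lattice_ball 0 K) y) x) L' \<mu>\<^sub>2 \<and>
          coupling Q (independent_union \<mu>\<^sub>1 \<mu>\<^sub>1') \<mu>\<^sub>2 \<and>
          measure Q {\<omega>\<in>space Q. fst \<omega> \<supseteq> snd \<omega>} \<ge>
            1 - C * max u 1 * real (K + L) ^ CARD('d) * exp (- c'' * (real L / real L') powr (1/4))))"
proof -
  define d where "d = real CARD('d)"
  define W where "W = win_const TYPE('d)"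
  define D where "D = 20 * CARD('d) + 20"
  define C' where "C' = loss_const TYPE('d)"
  \<comment> \<open>The constant in \<open>tau\<close>. The bound obtained is exponential in
    \<open>sqrt N\<close>, which is weakened to the power 1/4 below.\<close>
  define c'' where "c'' = 1 / (256 * d\<^sup>2)"
  define C where "C = 3 ^ CARD('d) + 4 * d * (6 * d + 3 * d * W) * 3 ^ CARD('d)"
  have d3: "3 \<le> d" using assms by (simp add: d_def)
  have W0: "0 \<le> W" unfolding W_def win_const_def by simp
  have C'd: "100 * d \<le> C'" unfolding C'_def loss_const_def d_def using W0 by (simp add: W_def)
  have C1: "1 \<le> C"
  proof -
    have "(1::real) \<le> 3 ^ CARD('d)" by simp
    moreover have "0 \<le> 4 * d * (6 * d + 3 * d * W) * 3 ^ CARD('d)" using d3 W0 by simp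
    ultimately show ?thesis unfolding C_def by linarith
  qed
  have main: "\<exists>\<mu>\<^sub>1 \<mu>\<^sub>1' \<mu>\<^sub>2 Q.
          interlacement_law (\<lambda>x. 1/2 * (f\<^sub>1 x + walk_op (L div 2) f\<^sub>1 x)) (L div 2) \<mu>\<^sub>1 \<and>
          interlacement_law f\<^sub>2 L \<mu>\<^sub>1' \<and>
          interlacement_law
            (\<lambda>x. (1 - C' * (real L / real L') powr (- 1/2)) *
                 walk_avg L L' (\<lambda>y. (f\<^sub>1 y + f\<^sub>2 y) * indicator (lattice_ball 0 K) y) x) L' \<mu>\<^sub>2 \<and>
          coupling Q (independent_union \<mu>\<^sub>1 \<mu>\<^sub>1') \<mu>\<^sub>2 \<and>
          measure Q {\<omega>\<in>space Q. fst \<omega> \<supseteq> snd \<omega>} \<ge>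
            1 - C * max u 1 * real (K + L) ^ CARD('d) * exp (- c'' * (real L / real L') powr (1/4))"
    if u: "u > 0" and L: "L \<ge> 1" and L': "L' \<ge> 1" and ev: "even L" and dv: "L' dvd L div 2"
      and big: "real L' \<ge> real L powr (1 - 1 / real D)" and f1: "\<And>x. f\<^sub>1 x \<ge> 0" and f2: "\<And>x. f\<^sub>2 x \<ge> 0"
      and fb: "\<And>x. x \<in> lattice_ball 0 (K + L) \<Longrightarrow> u \<ge> f\<^sub>1 x + f\<^sub>2 x \<and> f\<^sub>1 x + f\<^sub>2 x \<ge> C * real L powr (- 1/4)"
    for u :: real and K L L' :: nat and f\<^sub>1 f\<^sub>2 :: "int ^ 'd \<Rightarrow> real"
  proof -
    define M where "M = (L div 2) div L'"
    have H: "L div 2 = M * L'" using dv by (simp add: M_def)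
    then have LM: "L = 2 * M * L'" using ev by (metis dvd_mult_div_cancel mult.assoc)
    have H1: "1 \<le> L div 2" using L ev by presburger
    define N where "N = real (2 * M)"
    have N: "real L / real L' = N" using LM L' by (simp add: N_def)
    have N1: "1 \<le> N" using LM L by (cases M) (auto simp: N_def)
    have sq: "N powr (- 1/2) = 1 / sqrt N" "N powr (1/4) \<le> sqrt N" "sqrt N \<le> N"
    proof -
      show "N powr (- 1/2) = 1 / sqrt N" using N1 powr_minus_divide[of N "1/2"] by (simp add: powr_half_sqrt)
      have "N powr (1/4) \<le> N powr (1/2)" using N1 by (intro powr_mono) auto
      then show "N powr (1/4) \<le> sqrt N" using N1 by (simp add: powr_half_sqrt)
      show "sqrt N \<le> N" using N1 by (simp add: real_le_lsqrt self_le_power)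
    qed
    let ?err = "C * max u 1 * real (K + L) ^ CARD('d) * exp (- c'' * N powr (1/4))"
    have err0: "0 \<le> ?err" using C1 by simp
    show ?thesis
    proof (cases "C' < sqrt N")
      \<comment> \<open>The target factor \<open>1 - C' / sqrt N\<close> is not positive.\<close>
      case False
      have "(1 - C' * N powr (- 1/2)) * walk_avg L L' (\<lambda>y. (f\<^sub>1 y + f\<^sub>2 y) * indicator (lattice_ball 0 K) y) x \<le> 0" for x
      proof (rule mult_nonpos_nonneg)
        show "1 - C' * N powr (- 1/2) \<le> 0" unfolding sq(1) using False N1 by (simp add: le_divide_eq)
        show "0 \<le> walk_avg L L' (\<lambda>y. (f\<^sub>1 y + f\<^sub>2 y) * indicator (lattice_ball 0 K) y) x"
          using f1 f2 by (intro walk_avg_nonneg) (simp add: add_nonneg_nonneg)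
      qed
      from trivial_coupling[where f = "\<lambda>x. (1 - C' * N powr (- 1/2)) * walk_avg L L' (\<lambda>y. (f\<^sub>1 y + f\<^sub>2 y) * indicator (lattice_ball 0 K) y) x",
          OF H1 L L' this, of "\<lambda>x. 1/2 * (f\<^sub>1 x + walk_op (L div 2) f\<^sub>1 x)" "f\<^sub>2"]
      obtain \<mu>1 \<mu>1' \<mu>2 Q where t:
        "interlacement_law (\<lambda>x. 1/2 * (f\<^sub>1 x + walk_op (L div 2) f\<^sub>1 x)) (L div 2) \<mu>1" "interlacement_law f\<^sub>2 L \<mu>1'"
        "interlacement_law (\<lambda>x. (1 - C' * N powr (- 1/2)) * walk_avg L L' (\<lambda>y. (f\<^sub>1 y + f\<^sub>2 y) * indicator (lattice_ball 0 K) y) x) L' \<mu>2"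
        "coupling Q (independent_union \<mu>1 \<mu>1') \<mu>2" and m: "1 \<le> measure Q {\<omega>\<in>space Q. fst \<omega> \<supseteq> snd \<omega>}"
        by blast
      have "1 - ?err \<le> measure Q {\<omega>\<in>space Q. fst \<omega> \<supseteq> snd \<omega>}" using m err0 by linarith
      then show ?thesis unfolding N using t by blast
    next
      case True
      \<comment> \<open>This is what the summand \<open>100 * d\<close> in \<open>C'\<close> was
        reserved for: a positive target factor implies that \<open>N\<close> is as large as the
        locale \<open>schedule\<close> demands.\<close>
      have "100 * d < sqrt N" using True C'd by linarith
      then have "(100 * d)\<^sup>2 \<le> (sqrt N)\<^sup>2" using d3 by (intro power_mono) auto
      then have "10000 * d\<^sup>2 \<le> N" using N1 by (simp add: power_mult_distrib)
      then have "real (10000 * CARD('d) ^ 2) \<le> real (2 * M)" unfolding N_def d_def by simp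
      then have N0: "10000 * CARD('d) ^ 2 \<le> 2 * M" by (simp only: of_nat_le_iff)
      have "(2 * M) ^ (20 * CARD('d) + 20) \<le> L"
        using scale_bounds[OF LM L _ big] by (simp add: D_def)
      then have bg: "(2 * M) ^ (20 * CARD('d) + 20) \<le> 2 * M * L'" using LM by simp
      interpret sc: schedule "f\<^sub>1" "f\<^sub>2" u d K M L'
      proof
        show "f\<^sub>1 x + f\<^sub>2 x \<le> u \<and> real (2 * M * L') powr (- 1/4) \<le> f\<^sub>1 x + f\<^sub>2 x" if "x \<in> lattice_ball 0 (K + 2 * M * L')" for x
        proof -
          have "1 * real L powr (- 1/4) \<le> C * real L powr (- 1/4)" using C1 by (intro mult_right_mono) auto
          moreover have "x \<in> lattice_ball 0 (K + L)" using that unfolding LM by (simp add: mult.assoc)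
          ultimately show ?thesis using fb[of x] unfolding LM[symmetric] by (simp add: mult.assoc)
        qed
      qed (use assms u L' f1 f2 N0 bg in \<open>auto simp: d_def\<close>)
      have e: "sc.L = L" "sc.Hf = L div 2" "real sc.N = N"
        unfolding sc.L_def sc.Hf_def sc.N_def N_def using LM H by simp_all
      have q: "sc.keep = 1 - C' * N powr (- 1/2)" unfolding sc.keep_def sc.eta_def e sq(1) C'_def ..
      have keep: "0 \<le> sc.keep" unfolding q sq(1) using True N1 by (simp add: divide_le_eq)
      have tau: "sc.tau \<le> exp (- c'' * N powr (1/4))" "exp (- N) \<le> exp (- c'' * N powr (1/4))"
      proof -
        have d1: "1 \<le> d\<^sup>2" using d3 by simp
        then have c: "0 \<le> c''" "c'' \<le> 1" by (auto simp: c''_def divide_le_eq)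
        have "c'' * N powr (1/4) \<le> c'' * sqrt N" using c sq by (intro mult_left_mono) auto
        then show "sc.tau \<le> exp (- c'' * N powr (1/4))" unfolding sc.tau_def e by (simp add: c''_def)
        have "c'' * N powr (1/4) \<le> 1 * N" using c sq by (intro mult_mono) auto
        then show "exp (- N) \<le> exp (- c'' * N powr (1/4))" by simp
      qed
      let ?x = "exp (- c'' * N powr (1/4))" and ?Q = "real (K + L) ^ CARD('d)" and ?B = "4 * d * (6 * d + 3 * d * W)"
      have B0: "0 \<le> ?B" using d3 W0 by simp
      have bound: "(3 * real (K + L)) ^ CARD('d) * exp (- N) + ?B * u * (2 * real K + 1) ^ CARD('d) * sc.tau \<le> ?err"
      proof -
        have "(3 * real (K + L)) ^ CARD('d) * exp (- N) \<le> (3 * real (K + L)) ^ CARD('d) * ?x"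
          using tau by (intro mult_left_mono) auto
        also have "\<dots> = 3 ^ CARD('d) * 1 * (?Q * ?x)" by (simp only: power_mult_distrib mult.assoc mult_1_left)
        also have "\<dots> \<le> 3 ^ CARD('d) * max u 1 * (?Q * ?x)" by (intro mult_right_mono mult_left_mono) auto
        finally have 1: "(3 * real (K + L)) ^ CARD('d) * exp (- N) \<le> 3 ^ CARD('d) * max u 1 * (?Q * ?x)" .
        have "(2 * real K + 1) ^ CARD('d) \<le> (3 * real (K + L)) ^ CARD('d)" using L by (intro power_mono) auto
        then have 0: "(2 * real K + 1) ^ CARD('d) * sc.tau \<le> (3 * real (K + L)) ^ CARD('d) * ?x"
          using tau(1) sc.tau_bounds(4) by (intro mult_mono) auto
        have "?B * u * ((2 * real K + 1) ^ CARD('d) * sc.tau) \<le> ?B * max u 1 * ((3 * real (K + L)) ^ CARD('d) * ?x)"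
        proof (rule mult_mono)
          show "(2 * real K + 1) ^ CARD('d) * sc.tau \<le> (3 * real (K + L)) ^ CARD('d) * ?x" by (rule 0)
          show "?B * u \<le> ?B * max u 1" by (rule mult_left_mono[OF max.cobounded1 B0])
          show "0 \<le> ?B * max u 1" by (rule mult_nonneg_nonneg[OF B0]) simp
          show "0 \<le> (2 * real K + 1) ^ CARD('d) * sc.tau" using sc.tau_bounds(4) by simp
        qed
        also have "\<dots> = ?B * 3 ^ CARD('d) * max u 1 * (?Q * ?x)" by (simp only: power_mult_distrib mult_ac)
        finally have 2: "?B * u * (2 * real K + 1) ^ CARD('d) * sc.tau \<le> ?B * 3 ^ CARD('d) * max u 1 * (?Q * ?x)" by (simp only: mult.assoc)
        have "?err = 3 ^ CARD('d) * max u 1 * (?Q * ?x) + ?B * 3 ^ CARD('d) * max u 1 * (?Q * ?x)"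
          unfolding C_def by (simp only: distrib_right mult.assoc)
        then show ?thesis using 1 2 by linarith
      qed
      from sc.schedule_coupling[OF keep] obtain \<mu>1 \<mu>1' \<mu>2 Q where
        "interlacement_law (\<lambda>x. 1/2 * (f\<^sub>1 x + walk_op (L div 2) f\<^sub>1 x)) (L div 2) \<mu>1" "interlacement_law f\<^sub>2 L \<mu>1'"
        "interlacement_law (\<lambda>x. (1 - C' * N powr (- 1/2)) * walk_avg L L' (\<lambda>y. (f\<^sub>1 y + f\<^sub>2 y) * indicator (lattice_ball 0 K) y) x) L' \<mu>2"
        "coupling Q (independent_union \<mu>1 \<mu>1') \<mu>2"
        and m: "1 - ((3 * real (K + L)) ^ CARD('d) * exp (- N) + ?B * u * (2 * real K + 1) ^ CARD('d) * sc.tau)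
          \<le> measure Q {\<omega>\<in>space Q. fst \<omega> \<supseteq> snd \<omega>}"
        unfolding e q W_def by blast
      moreover have "1 - ?err \<le> measure Q {\<omega>\<in>space Q. fst \<omega> \<supseteq> snd \<omega>}" using m bound by linarith
      ultimately show ?thesis unfolding N by blast
    qed
  qed
  show ?thesis
  proof (rule exI[of _ "1 / real D"], rule exI[of _ "1/4"], rule exI[of _ c''], rule exI[of _ C], rule exI[of _ C'], intro conjI allI impI)
    show "0 < 1 / real D" by (simp add: D_def)
    show "0 < c''" using d3 by (simp add: c''_def)
    show "0 < C" using C1 by linarith
    show "0 < C'" using C'd d3 by linarith
  qed (simp, use main in simp)
qed

end
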